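(* Let $k$ be a field and let $A$ and $B$ be two finite-dimensional $k$-algebras which are singularly equivalent of Morita type with level. Then $A$ is syzygy-finite if and only if $B$ is syzygy-finite; and $A$ is Igusa-Todorov if and only if $B$ is Igusa-Todorov.
   Context: Algebras are finite-dimensional associative unital $k$-algebras, $k$ acts centrally on bimodules, and modules are finitely generated left modules unless stated otherwise. An algebra $A$ is syzygy-finite if there is an integer $s$ such that the class of all $n$-th syzygies of $A$-modules, where $n>s$, is representation finite, i.e. only finitely many pairwise nonisomorphic indecomposable modules occur (as direct summands of modules) in the class. An algebra $A$ is Igusa-Todorov if there are a fixed $A$-module $V$ and an integer $n$ such that every $n$-th syzygy module $M$ fits into an exact sequence $0\to V_1\to V_0\to M\to 0$, where $V_1,V_0$ are direct summands of finite direct sums of copies of $V$. Write $A^e=A\otimes_k A^{op}$, identify $A$-$A$-bimodules with left $A^e$-modules, let $\underline{\mathrm{mod}}\,A^e$ be the stable category of finitely generated $A^e$-modules modulo morphisms factoring through projectives, and let $\Omega_{A^e}$ be the syzygy functor on it. Two algebras $A$ and $B$ are singularly equivalent of Morita type with level if there exist an $A$-$B$-bimodule $M$, a $B$-$A$-bimodule $N$ and an integer $n\ge 0$ such that (1) the one-sided modules ${}_AM$, $M_B$, ${}_BN$, $N_A$ are all finitely generated projective; and (2) $M\otimes_B N\cong\Omega^n_{A^e}(A)$ in $\underline{\mathrm{mod}}\,A^e$ and $N\otimes_A M\cong\Omega^n_{B^e}(B)$ in $\underline{\mathrm{mod}}\,B^e$. *)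

theory Defs
  imports "HOL-Algebra.Module" "HOL-Algebra.QuotRing" "HOL-Algebra.Free_Abelian_Groups"
begin

hide_const (open) Wellorder_Constructions.zero

section \<open>Left modules over an arbitrary ring\<close>

text \<open>
  The library locale \<open>module\<close> covers commutative rings only, so left modules are introduced here on
  the library record \<open>module\<close>.  As there, a module is an additive group together with
  the scalar multiplication \<open>smult\<close>; the inherited ring fields \<open>mult\<close> and \<open>one\<close> play no role.
\<close>

locale left_module = R?: ring R + M?: abelian_group M
  for R :: "('r, 'c) ring_scheme" (structure) and M :: "('r, 'm, 'd) module_scheme" (structure) +
  assumes smult_closed:
      "\<lbrakk>a \<in> carrier R; x \<in> carrier M\<rbrakk> \<Longrightarrow> a \<odot>\<^bsub>M\<^esub> x \<in> carrier M"
    and smult_l_distr: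
      "\<lbrakk>a \<in> carrier R; b \<in> carrier R; x \<in> carrier M\<rbrakk> \<Longrightarrow>
        (a \<oplus>\<^bsub>R\<^esub> b) \<odot>\<^bsub>M\<^esub> x = a \<odot>\<^bsub>M\<^esub> x \<oplus>\<^bsub>M\<^esub> b \<odot>\<^bsub>M\<^esub> x"
    and smult_r_distr:
      "\<lbrakk>a \<in> carrier R; x \<in> carrier M; y \<in> carrier M\<rbrakk> \<Longrightarrow>
        a \<odot>\<^bsub>M\<^esub> (x \<oplus>\<^bsub>M\<^esub> y) = a \<odot>\<^bsub>M\<^esub> x \<oplus>\<^bsub>M\<^esub> a \<odot>\<^bsub>M\<^esub> y"
    and smult_assoc:
      "\<lbrakk>a \<in> carrier R; b \<in> carrier R; x \<in> carrier M\<rbrakk> \<Longrightarrow>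
        (a \<otimes>\<^bsub>R\<^esub> b) \<odot>\<^bsub>M\<^esub> x = a \<odot>\<^bsub>M\<^esub> (b \<odot>\<^bsub>M\<^esub> x)"
    and smult_one:
      "x \<in> carrier M \<Longrightarrow> \<one>\<^bsub>R\<^esub> \<odot>\<^bsub>M\<^esub> x = x"

definition finitely_generated ::
    "('r, 'c) ring_scheme \<Rightarrow> ('r, 'm, 'd) module_scheme \<Rightarrow> bool" where
  "finitely_generated R M \<longleftrightarrow>
    (\<exists>S. finite S \<and> S \<subseteq> carrier M \<and>
      (\<forall>x\<in>carrier M. \<exists>c\<in>S \<rightarrow> carrier R. x = (\<Oplus>\<^bsub>M\<^esub>s\<in>S. c s \<odot>\<^bsub>M\<^esub> s)))"

definition fg_module ::
    "('r, 'c) ring_scheme \<Rightarrow> ('r, 'm, 'd) module_scheme \<Rightarrow> bool" where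
  "fg_module R M \<longleftrightarrow> left_module R M \<and> finitely_generated R M"

definition module_homs ::
    "('r, 'c) ring_scheme \<Rightarrow> ('r, 'm, 'd) module_scheme \<Rightarrow> ('r, 'n, 'e) module_scheme
      \<Rightarrow> ('m \<Rightarrow> 'n) set" where
  "module_homs R M N = {f \<in> carrier M \<rightarrow> carrier N.
    (\<forall>x\<in>carrier M. \<forall>y\<in>carrier M. f (x \<oplus>\<^bsub>M\<^esub> y) = f x \<oplus>\<^bsub>N\<^esub> f y) \<and>
    (\<forall>a\<in>carrier R. \<forall>x\<in>carrier M. f (a \<odot>\<^bsub>M\<^esub> x) = a \<odot>\<^bsub>N\<^esub> f x)}"

definition module_iso ::
    "('r, 'c) ring_scheme \<Rightarrow> ('r, 'm, 'd) module_scheme \<Rightarrow> ('r, 'n, 'e) module_scheme \<Rightarrow> bool" where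
  "module_iso R M N \<longleftrightarrow> (\<exists>f\<in>module_homs R M N. bij_betw f (carrier M) (carrier N))"

definition short_exact ::
    "('r, 'c) ring_scheme \<Rightarrow> ('r, 'l, 'd) module_scheme \<Rightarrow> ('r, 'm, 'e) module_scheme
      \<Rightarrow> ('r, 'n, 'f) module_scheme \<Rightarrow> ('l \<Rightarrow> 'm) \<Rightarrow> ('m \<Rightarrow> 'n) \<Rightarrow> bool" where
  "short_exact R L M N f g \<longleftrightarrow>
    f \<in> module_homs R L M \<and> g \<in> module_homs R M N \<and> inj_on f (carrier L) \<and>
    f ` carrier L = a_kernel M N g \<and> g ` carrier M = carrier N"

definition regular_module :: "('r, 'c) ring_scheme \<Rightarrow> ('r, 'r) module" where
  "regular_module R = \<lparr>carrier = carrier R, mult = mult R, one = one R, zero = zero R, add = add R,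
    smult = mult R\<rparr>"

definition direct_sum ::
    "('r, 'm, 'd) module_scheme \<Rightarrow> ('r, 'n, 'e) module_scheme \<Rightarrow> ('r, 'm \<times> 'n) module" where
  "direct_sum M N = \<lparr>carrier = carrier M \<times> carrier N, mult = undefined, one = undefined,
    zero = (\<zero>\<^bsub>M\<^esub>, \<zero>\<^bsub>N\<^esub>),
    add = (\<lambda>(x, y) (x', y'). (x \<oplus>\<^bsub>M\<^esub> x', y \<oplus>\<^bsub>N\<^esub> y')),
    smult = (\<lambda>a (x, y). (a \<odot>\<^bsub>M\<^esub> x, a \<odot>\<^bsub>N\<^esub> y))\<rparr>"

definition direct_power :: "nat \<Rightarrow> ('r, 'm, 'd) module_scheme \<Rightarrow> ('r, nat \<Rightarrow> 'm) module" where
  "direct_power n M = \<lparr>carrier = {..<n} \<rightarrow>\<^sub>E carrier M, mult = undefined, one = undefined,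
    zero = (\<lambda>i\<in>{..<n}. \<zero>\<^bsub>M\<^esub>),
    add = (\<lambda>x y. \<lambda>i\<in>{..<n}. x i \<oplus>\<^bsub>M\<^esub> y i),
    smult = (\<lambda>a x. \<lambda>i\<in>{..<n}. a \<odot>\<^bsub>M\<^esub> x i)\<rparr>"


section \<open>Finite-dimensional algebras\<close>

text \<open>
  A \<open>k\<close>-algebra is kept in one library record of type \<open>('k, 'a) module\<close>: its ring fields are the
  multiplication of the algebra and \<open>smult\<close> is the action of \<open>k\<close>.  The zero algebra is allowed.
\<close>

locale fd_algebra = K?: field K + module K A + A?: ring A
  for K :: "'k ring" (structure) and A :: "('k, 'a) module" (structure) +
  assumes smult_mult_left:
      "\<lbrakk>c \<in> carrier K; x \<in> carrier A; y \<in> carrier A\<rbrakk> \<Longrightarrow>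
        (c \<odot>\<^bsub>A\<^esub> x) \<otimes>\<^bsub>A\<^esub> y = c \<odot>\<^bsub>A\<^esub> (x \<otimes>\<^bsub>A\<^esub> y)"
    and smult_mult_right:
      "\<lbrakk>c \<in> carrier K; x \<in> carrier A; y \<in> carrier A\<rbrakk> \<Longrightarrow>
        x \<otimes>\<^bsub>A\<^esub> (c \<odot>\<^bsub>A\<^esub> y) = c \<odot>\<^bsub>A\<^esub> (x \<otimes>\<^bsub>A\<^esub> y)"
    and finite_dim: "finitely_generated K A"

text \<open>
  All quantifiers over the finitely generated modules of a finite-dimensional algebra range over the
  modules whose carrier is a subset of the type \<open>nat \<Rightarrow> 'k\<close>.  Up to isomorphism these are all of
  them, see \<open>fg_module_in_universe\<close>; the same argument applies to bimodules.
\<close>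

type_synonym ('k, 'r) small_module = "('r, nat \<Rightarrow> 'k) module"

lemma module_iso_transport:
  fixes M :: "('r, 'm, 'd) module_scheme" and \<phi> :: "'m \<Rightarrow> 'n"
  assumes fg: "fg_module R M" and inj: "inj_on \<phi> (carrier M)"
  shows "\<exists>M' :: ('r, 'n) module. fg_module R M' \<and> module_iso R M M'"
proof -
  interpret left_module R M using fg by (simp add: fg_module_def)
  define \<psi> where "\<psi> = inv_into (carrier M) \<phi>"
  have \<psi>: "\<psi> (\<phi> x) = x" if "x \<in> carrier M" for x
    using that inj by (simp add: \<psi>_def)
  define M' :: "('r, 'n) module" where
    "M' = \<lparr>carrier = \<phi> ` carrier M, mult = undefined, one = undefined, zero = \<phi> \<zero>\<^bsub>M\<^esub>,
       add = (\<lambda>x y. \<phi> (\<psi> x \<oplus>\<^bsub>M\<^esub> \<psi> y)), smult = (\<lambda>a x. \<phi> (a \<odot>\<^bsub>M\<^esub> \<psi> x))\<rparr>"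
  have ag: "abelian_group M'"
  proof (rule abelian_groupI)
    fix x assume "x \<in> carrier M'"
    then obtain u where u: "u \<in> carrier M" "x = \<phi> u" by (auto simp: M'_def)
    show "\<exists>y\<in>carrier M'. y \<oplus>\<^bsub>M'\<^esub> x = \<zero>\<^bsub>M'\<^esub>"
      by (rule bexI[of _ "\<phi> (\<ominus>\<^bsub>M\<^esub> u)"]) (auto simp: M'_def \<psi> u M.l_neg)
  qed (auto simp: M'_def \<psi> M.a_ac)
  have lm: "left_module R M'"
    by (intro left_module.intro left_module_axioms.intro ag R.ring_axioms)
      (auto simp: M'_def \<psi> smult_closed smult_l_distr smult_r_distr smult_assoc smult_one)
  interpret M': left_module R M' by fact
  have hom: "\<phi> \<in> module_homs R M M'"
    by (auto simp: module_homs_def M'_def \<psi>)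
  have sum: "\<phi> (\<Oplus>\<^bsub>M\<^esub>s\<in>S. f s) = (\<Oplus>\<^bsub>M'\<^esub>s\<in>S. \<phi> (f s))"
    if "finite S" "f \<in> S \<rightarrow> carrier M" for f and S :: "'m set"
    using that
  proof (induction S rule: finite_induct)
    case empty
    have "\<zero>\<^bsub>M'\<^esub> = \<phi> \<zero>\<^bsub>M\<^esub>" by (simp add: M'_def)
    then show ?case by simp
  next
    case (insert s S)
    then have "f \<in> S \<rightarrow> carrier M" "f s \<in> carrier M" by auto
    moreover have "(\<lambda>s. \<phi> (f s)) \<in> S \<rightarrow> carrier M'" "\<phi> (f s) \<in> carrier M'"
      using calculation by (auto simp: M'_def)
    ultimately show ?case using insert hom
      by (auto simp: module_homs_def M.finsum_insert M'.M.finsum_insert M.finsum_closed)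
  qed
  obtain S where S: "finite S" "S \<subseteq> carrier M"
    "\<And>x. x \<in> carrier M \<Longrightarrow> \<exists>c\<in>S \<rightarrow> carrier R. x = (\<Oplus>\<^bsub>M\<^esub>s\<in>S. c s \<odot>\<^bsub>M\<^esub> s)"
    using fg unfolding fg_module_def finitely_generated_def by auto
  have "finitely_generated R M'"
    unfolding finitely_generated_def
  proof (intro exI[of _ "\<phi> ` S"] conjI ballI)
    show "finite (\<phi> ` S)" "\<phi> ` S \<subseteq> carrier M'" using S by (auto simp: M'_def)
    fix x assume "x \<in> carrier M'"
    then obtain u where u: "u \<in> carrier M" "x = \<phi> u" by (auto simp: M'_def)
    obtain c where c: "c \<in> S \<rightarrow> carrier R" "u = (\<Oplus>\<^bsub>M\<^esub>s\<in>S. c s \<odot>\<^bsub>M\<^esub> s)"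
      using S(3)[OF u(1)] by blast
    have injS: "inj_on \<phi> S" using inj S(2) inj_on_subset by blast
    have "x = (\<Oplus>\<^bsub>M'\<^esub>s\<in>S. \<phi> (c s \<odot>\<^bsub>M\<^esub> s))"
      unfolding u(2) c(2) using c S by (intro sum) (auto intro!: smult_closed)
    also have "\<dots> = (\<Oplus>\<^bsub>M'\<^esub>s\<in>S. c (\<psi> (\<phi> s)) \<odot>\<^bsub>M'\<^esub> \<phi> s)"
      using c S by (intro M'.M.finsum_cong') (auto simp: M'_def \<psi> subset_iff intro!: smult_closed)
    also have "\<dots> = (\<Oplus>\<^bsub>M'\<^esub>t\<in>\<phi> ` S. c (\<psi> t) \<odot>\<^bsub>M'\<^esub> t)"
      using c S injS by (intro M'.M.finsum_reindex[symmetric])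
        (auto simp: M'_def \<psi> subset_iff intro!: smult_closed)
    finally show "\<exists>c\<in>\<phi> ` S \<rightarrow> carrier R. x = (\<Oplus>\<^bsub>M'\<^esub>t\<in>\<phi> ` S. c t \<odot>\<^bsub>M'\<^esub> t)"
      using c S by (intro bexI[of _ "\<lambda>t. c (\<psi> t)"]) (auto simp: \<psi> subset_iff)
  qed
  moreover have "module_iso R M M'"
    unfolding module_iso_def using hom inj by (auto simp: bij_betw_def M'_def)
  ultimately show ?thesis using lm fg_module_def by blast
qed

lemma fg_module_in_universe:
  fixes K :: "'k ring" and A :: "('k, 'a) module" and M :: "('a, 'm, 'd) module_scheme"
  assumes A: "fd_algebra K A" and M: "fg_module A M"
  shows "\<exists>M' :: ('k, 'a) small_module. fg_module A M' \<and> module_iso A M M'"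
proof -
  interpret A: fd_algebra K A by fact
  interpret M: left_module A M using M by (simp add: fg_module_def)
  obtain S where S: "finite S" "S \<subseteq> carrier M"
    "\<And>x. x \<in> carrier M \<Longrightarrow> \<exists>c\<in>S \<rightarrow> carrier A. x = (\<Oplus>\<^bsub>M\<^esub>s\<in>S. c s \<odot>\<^bsub>M\<^esub> s)"
    using M unfolding fg_module_def finitely_generated_def by auto
  obtain T where T: "finite T" "T \<subseteq> carrier A"
    "\<And>x. x \<in> carrier A \<Longrightarrow> \<exists>c\<in>T \<rightarrow> carrier K. x = (\<Oplus>\<^bsub>A\<^esub>t\<in>T. c t \<odot>\<^bsub>A\<^esub> t)"
    using A.finite_dim unfolding finitely_generated_def by auto
  obtain h :: "'m \<times> 'a \<Rightarrow> nat" where h: "inj_on h (S \<times> T)"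
    using finite_imp_inj_to_nat_seg[of "S \<times> T"] S T by auto
  define F :: "(nat \<Rightarrow> 'k) \<Rightarrow> 'm" where
    "F u = (\<Oplus>\<^bsub>M\<^esub>s\<in>S. (\<Oplus>\<^bsub>A\<^esub>t\<in>T. u (h (s, t)) \<odot>\<^bsub>A\<^esub> t) \<odot>\<^bsub>M\<^esub> s)" for u
  have "\<exists>u. F u = x" if x: "x \<in> carrier M" for x
  proof -
    obtain c where c: "c \<in> S \<rightarrow> carrier A" "x = (\<Oplus>\<^bsub>M\<^esub>s\<in>S. c s \<odot>\<^bsub>M\<^esub> s)"
      using S(3)[OF x] by blast
    have "\<forall>s\<in>S. \<exists>d\<in>T \<rightarrow> carrier K. c s = (\<Oplus>\<^bsub>A\<^esub>t\<in>T. d t \<odot>\<^bsub>A\<^esub> t)"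
      using T(3) c(1) by blast
    then obtain d where d: "\<And>s. s \<in> S \<Longrightarrow> d s \<in> T \<rightarrow> carrier K"
      "\<And>s. s \<in> S \<Longrightarrow> c s = (\<Oplus>\<^bsub>A\<^esub>t\<in>T. d s t \<odot>\<^bsub>A\<^esub> t)"
      unfolding Bex_def by metis
    define u where "u n = (case inv_into (S \<times> T) h n of (s, t) \<Rightarrow> d s t)" for n
    have u: "u (h (s, t)) = d s t" if "s \<in> S" "t \<in> T" for s t
      using h that by (simp add: u_def)
    have inner: "(\<Oplus>\<^bsub>A\<^esub>t\<in>T. u (h (s, t)) \<odot>\<^bsub>A\<^esub> t) = c s" if "s \<in> S" for s
      unfolding d(2)[OF that] using d(1)[OF that] T that
      by (intro A.finsum_cong') (auto simp: u subset_iff Pi_iff)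
    have "F u = x" unfolding F_def c(2) using c S
      by (intro M.M.finsum_cong') (auto simp: inner subset_iff intro!: M.smult_closed)
    then show ?thesis by blast
  qed
  then have "F (SOME u. F u = x) = x" if "x \<in> carrier M" for x
    using that by (intro someI_ex[of "\<lambda>u. F u = x"])
  then have "inj_on (\<lambda>x. SOME u. F u = x) (carrier M)"
    by (rule inj_on_inverseI[where g = F])
  from module_iso_transport[OF M this] show ?thesis .
qed

definition direct_summand ::
    "('k, 'r) module \<Rightarrow> ('r, 'm, 'd) module_scheme \<Rightarrow> ('r, 'n, 'e) module_scheme \<Rightarrow> bool" where
  "direct_summand R X Y \<longleftrightarrow>
    (\<exists>Z :: ('k, 'r) small_module. fg_module R Z \<and> module_iso R Y (direct_sum X Z))"

text \<open>Finitely generated projective: a direct summand of a free module of finite rank.\<close>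

definition fg_projective :: "('k, 'r) module \<Rightarrow> ('r, 'm, 'd) module_scheme \<Rightarrow> bool" where
  "fg_projective R P \<longleftrightarrow>
    fg_module R P \<and> (\<exists>n. direct_summand R P (direct_power n (regular_module R)))"

definition indecomposable :: "('k, 'r) module \<Rightarrow> ('r, 'm, 'd) module_scheme \<Rightarrow> bool" where
  "indecomposable R X \<longleftrightarrow>
    left_module R X \<and> carrier X \<noteq> {\<zero>\<^bsub>X\<^esub>} \<and>
    (\<forall>(Y :: ('k, 'r) small_module) (Z :: ('k, 'r) small_module).
      fg_module R Y \<longrightarrow> fg_module R Z \<longrightarrow> module_iso R X (direct_sum Y Z) \<longrightarrow>
        carrier Y = {\<zero>\<^bsub>Y\<^esub>} \<or> carrier Z = {\<zero>\<^bsub>Z\<^esub>})"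


section \<open>Syzygies, syzygy-finite and Igusa-Todorov algebras\<close>

text \<open>
  Projective presentations are not required to be minimal: a syzygy is determined up to projective
  direct summands, that is, up to isomorphism in the stable category.
\<close>

definition is_syzygy ::
    "('k, 'r) module \<Rightarrow> ('r, 'm, 'd) module_scheme \<Rightarrow> ('k, 'r) small_module \<Rightarrow> bool" where
  "is_syzygy R M X \<longleftrightarrow> fg_module R X \<and>
    (\<exists>(P :: ('k, 'r) small_module) f g. fg_projective R P \<and> short_exact R X P M f g)"

primrec is_nth_syzygy ::
    "('k, 'r) module \<Rightarrow> nat \<Rightarrow> ('r, 'm, 'd) module_scheme \<Rightarrow> ('k, 'r) small_module \<Rightarrow> bool" where
  "is_nth_syzygy R 0 M X \<longleftrightarrow> fg_module R X \<and> module_iso R X M"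
| "is_nth_syzygy R (Suc n) M X \<longleftrightarrow> (\<exists>L. is_nth_syzygy R n M L \<and> is_syzygy R L X)"

definition representation_finite ::
    "('k, 'r) module \<Rightarrow> ('k, 'r) small_module set \<Rightarrow> bool" where
  "representation_finite R C \<longleftrightarrow>
    (\<exists>S :: ('k, 'r) small_module set. finite S \<and>
      (\<forall>Y\<in>C. \<forall>X :: ('k, 'r) small_module.
        fg_module R X \<and> indecomposable R X \<and> direct_summand R X Y \<longrightarrow> (\<exists>Z\<in>S. module_iso R X Z)))"

definition syzygy_finite :: "('k, 'r) module \<Rightarrow> bool" where
  "syzygy_finite R \<longleftrightarrow>
    (\<exists>s :: int. representation_finite R
      {X. \<exists>n (M :: ('k, 'r) small_module). int n > s \<and> fg_module R M \<and> is_nth_syzygy R n M X})"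

definition in_add ::
    "('k, 'r) module \<Rightarrow> ('r, 'm, 'd) module_scheme \<Rightarrow> ('r, 'n, 'e) module_scheme \<Rightarrow> bool" where
  "in_add R V X \<longleftrightarrow> fg_module R X \<and> (\<exists>m. direct_summand R X (direct_power m V))"

definition igusa_todorov :: "('k, 'r) module \<Rightarrow> bool" where
  "igusa_todorov R \<longleftrightarrow>
    (\<exists>(V :: ('k, 'r) small_module) (n :: nat). fg_module R V \<and>
      (\<forall>(L :: ('k, 'r) small_module) M. fg_module R L \<and> is_nth_syzygy R n L M \<longrightarrow>
        (\<exists>(V1 :: ('k, 'r) small_module) (V0 :: ('k, 'r) small_module) f g.
          in_add R V V1 \<and> in_add R V V0 \<and> short_exact R V1 V0 M f g)))"


section \<open>The stable category\<close>

definition factors_through_projective ::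
    "('k, 'r) module \<Rightarrow> ('r, 'm, 'd) module_scheme \<Rightarrow> ('r, 'n, 'e) module_scheme
      \<Rightarrow> ('m \<Rightarrow> 'n) \<Rightarrow> bool" where
  "factors_through_projective R X Y h \<longleftrightarrow>
    (\<exists>(P :: ('k, 'r) small_module) u v. fg_projective R P \<and>
      u \<in> module_homs R X P \<and> v \<in> module_homs R P Y \<and> (\<forall>x\<in>carrier X. h x = v (u x)))"

definition stably_isomorphic ::
    "('k, 'r) module \<Rightarrow> ('r, 'm, 'd) module_scheme \<Rightarrow> ('r, 'n, 'e) module_scheme \<Rightarrow> bool" where
  "stably_isomorphic R X Y \<longleftrightarrow>
    (\<exists>f\<in>module_homs R X Y. \<exists>g\<in>module_homs R Y X.
      factors_through_projective R X X (\<lambda>x. x \<ominus>\<^bsub>X\<^esub> g (f x)) \<and>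
      factors_through_projective R Y Y (\<lambda>y. y \<ominus>\<^bsub>Y\<^esub> f (g y)))"


section \<open>Tensor products\<close>

text \<open>
  The tensor product over a ring \<open>S\<close> of \<open>M\<close>, with right action \<open>ra\<close> of \<open>S\<close>, and \<open>N\<close>, with left
  action \<open>la\<close>, is the free abelian group on the pairs modulo the balanced bilinear relations.
  Its elements are cosets; \<open>tensor_rep\<close> picks a formal sum representing a coset.
\<close>

definition tensor_free ::
    "('m, 'd) ring_scheme \<Rightarrow> ('n, 'e) ring_scheme \<Rightarrow> ('m \<times> 'n \<Rightarrow>\<^sub>0 int) monoid" where
  "tensor_free M N = free_Abelian_group (carrier M \<times> carrier N)"

definition tensor_relators ::
    "('s, 'c) ring_scheme \<Rightarrow> ('m \<Rightarrow> 's \<Rightarrow> 'm) \<Rightarrow> ('s \<Rightarrow> 'n \<Rightarrow> 'n) \<Rightarrow>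
      ('m, 'd) ring_scheme \<Rightarrow> ('n, 'e) ring_scheme \<Rightarrow> ('m \<times> 'n \<Rightarrow>\<^sub>0 int) set" where
  "tensor_relators S ra la M N =
    {frag_of (x \<oplus>\<^bsub>M\<^esub> x', y) - frag_of (x, y) - frag_of (x', y) | x x' y.
      x \<in> carrier M \<and> x' \<in> carrier M \<and> y \<in> carrier N} \<union>
    {frag_of (x, y \<oplus>\<^bsub>N\<^esub> y') - frag_of (x, y) - frag_of (x, y') | x y y'.
      x \<in> carrier M \<and> y \<in> carrier N \<and> y' \<in> carrier N} \<union>
    {frag_of (ra x s, y) - frag_of (x, la s y) | x s y.
      x \<in> carrier M \<and> s \<in> carrier S \<and> y \<in> carrier N}"

definition tensor_relations ::
    "('s, 'c) ring_scheme \<Rightarrow> ('m \<Rightarrow> 's \<Rightarrow> 'm) \<Rightarrow> ('s \<Rightarrow> 'n \<Rightarrow> 'n) \<Rightarrow>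
      ('m, 'd) ring_scheme \<Rightarrow> ('n, 'e) ring_scheme \<Rightarrow> ('m \<times> 'n \<Rightarrow>\<^sub>0 int) set" where
  "tensor_relations S ra la M N = generate (tensor_free M N) (tensor_relators S ra la M N)"

definition tensor_group ::
    "('s, 'c) ring_scheme \<Rightarrow> ('m \<Rightarrow> 's \<Rightarrow> 'm) \<Rightarrow> ('s \<Rightarrow> 'n \<Rightarrow> 'n) \<Rightarrow>
      ('m, 'd) ring_scheme \<Rightarrow> ('n, 'e) ring_scheme \<Rightarrow> ('m \<times> 'n \<Rightarrow>\<^sub>0 int) set monoid" where
  "tensor_group S ra la M N = tensor_free M N Mod tensor_relations S ra la M N"

definition tensor_class ::
    "('s, 'c) ring_scheme \<Rightarrow> ('m \<Rightarrow> 's \<Rightarrow> 'm) \<Rightarrow> ('s \<Rightarrow> 'n \<Rightarrow> 'n) \<Rightarrow>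
      ('m, 'd) ring_scheme \<Rightarrow> ('n, 'e) ring_scheme \<Rightarrow>
      ('m \<times> 'n \<Rightarrow>\<^sub>0 int) \<Rightarrow> ('m \<times> 'n \<Rightarrow>\<^sub>0 int) set" where
  "tensor_class S ra la M N t = tensor_relations S ra la M N #>\<^bsub>tensor_free M N\<^esub> t"

definition tensor_rep :: "('m \<times> 'n \<Rightarrow>\<^sub>0 int) set \<Rightarrow> ('m \<times> 'n \<Rightarrow>\<^sub>0 int)" where
  "tensor_rep T = (SOME t. t \<in> T)"

definition opposite :: "('k, 'a) module \<Rightarrow> ('k, 'a) module" where
  "opposite A = A\<lparr>mult := \<lambda>x y. y \<otimes>\<^bsub>A\<^esub> x\<rparr>"

definition tensor_algebra ::
    "'k ring \<Rightarrow> ('k, 'a) module \<Rightarrow> ('k, 'b) module \<Rightarrow> ('k, ('a \<times> 'b \<Rightarrow>\<^sub>0 int) set) module" where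
  "tensor_algebra K A B =
    (let G = tensor_group K (\<lambda>x c. c \<odot>\<^bsub>A\<^esub> x) (smult B) A B;
         cl = tensor_class K (\<lambda>x c. c \<odot>\<^bsub>A\<^esub> x) (smult B) A B
     in \<lparr>carrier = carrier G,
         mult = (\<lambda>T U. cl (frag_extend (\<lambda>(a, b). frag_extend
           (\<lambda>(a', b'). frag_of (a \<otimes>\<^bsub>A\<^esub> a', b \<otimes>\<^bsub>B\<^esub> b')) (tensor_rep U)) (tensor_rep T))),
         one = cl (frag_of (\<one>\<^bsub>A\<^esub>, \<one>\<^bsub>B\<^esub>)),
         zero = \<one>\<^bsub>G\<^esub>,
         add = mult G,
         smult = (\<lambda>c T. cl (frag_extend (\<lambda>(a, b). frag_of (c \<odot>\<^bsub>A\<^esub> a, b)) (tensor_rep T)))\<rparr>)"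

definition enveloping ::
    "'k ring \<Rightarrow> ('k, 'a) module \<Rightarrow> ('k, ('a \<times> 'a \<Rightarrow>\<^sub>0 int) set) module" where
  "enveloping K A = tensor_algebra K A (opposite A)"


section \<open>Bimodules\<close>

record ('a, 'b, 'm) bimodule = "('a, 'm) module" +
  rsmult :: "'m \<Rightarrow> 'b \<Rightarrow> 'm"

text \<open>A right \<open>B\<close>-module is a left module over the opposite algebra.\<close>

definition right_part :: "('a, 'b, 'm) bimodule \<Rightarrow> ('b, 'm) module" where
  "right_part M = \<lparr>carrier = carrier M, mult = mult M, one = one M, zero = zero M, add = add M,
    smult = (\<lambda>b x. rsmult M x b)\<rparr>"

locale central_bimodule =
  fixes K :: "'k ring" and A :: "('k, 'a) module" and B :: "('k, 'b) module"
    and M :: "('a, 'b, 'm) bimodule"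
  assumes left: "left_module A M"
    and right: "left_module (opposite B) (right_part M)"
    and assoc: "\<lbrakk>a \<in> carrier A; x \<in> carrier M; b \<in> carrier B\<rbrakk> \<Longrightarrow>
      rsmult M (a \<odot>\<^bsub>M\<^esub> x) b = a \<odot>\<^bsub>M\<^esub> (rsmult M x b)"
    and central: "\<lbrakk>c \<in> carrier K; x \<in> carrier M\<rbrakk> \<Longrightarrow>
      (c \<odot>\<^bsub>A\<^esub> \<one>\<^bsub>A\<^esub>) \<odot>\<^bsub>M\<^esub> x = rsmult M x (c \<odot>\<^bsub>B\<^esub> \<one>\<^bsub>B\<^esub>)"

definition regular_bimodule :: "('k, 'a) module \<Rightarrow> ('a, 'a, 'a) bimodule" where
  "regular_bimodule A = \<lparr>carrier = carrier A, mult = mult A, one = one A, zero = zero A,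
    add = add A, smult = mult A, rsmult = mult A\<rparr>"

definition tensor_bimodule ::
    "('k, 'b) module \<Rightarrow> ('a, 'b, 'm) bimodule \<Rightarrow> ('b, 'c, 'n) bimodule
      \<Rightarrow> ('a, 'c, ('m \<times> 'n \<Rightarrow>\<^sub>0 int) set) bimodule" where
  "tensor_bimodule B M N =
    (let G = tensor_group B (rsmult M) (smult N) M N;
         cl = tensor_class B (rsmult M) (smult N) M N
     in \<lparr>carrier = carrier G, mult = undefined, one = undefined, zero = \<one>\<^bsub>G\<^esub>, add = mult G,
         smult = (\<lambda>a T. cl (frag_extend (\<lambda>(x, y). frag_of (a \<odot>\<^bsub>M\<^esub> x, y)) (tensor_rep T))),
         rsmult = (\<lambda>T c. cl (frag_extend (\<lambda>(x, y). frag_of (x, rsmult N y c)) (tensor_rep T)))\<rparr>)"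

text \<open>An \<open>A\<close>-\<open>A\<close>-bimodule as a left module over \<open>A \<otimes> A\<^sup>o\<^sup>p\<close>, via \<open>(a \<otimes> b) x = a x b\<close>.\<close>

definition enveloping_module ::
    "('a, 'a, 'm) bimodule \<Rightarrow> (('a \<times> 'a \<Rightarrow>\<^sub>0 int) set, 'm) module" where
  "enveloping_module M = \<lparr>carrier = carrier M, mult = mult M, one = one M, zero = zero M,
    add = add M,
    smult = (\<lambda>T x. \<Oplus>\<^bsub>M\<^esub>p\<in>Poly_Mapping.keys (tensor_rep T).
      [Poly_Mapping.lookup (tensor_rep T) p] \<cdot>\<^bsub>M\<^esub> rsmult M (fst p \<odot>\<^bsub>M\<^esub> x) (snd p))\<rparr>"


section \<open>Singular equivalence of Morita type with level\<close>

text \<open>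
  The existential over the syzygies is harmless: any two \<open>n\<close>-th syzygies of the same module are
  stably isomorphic.
\<close>

definition singularly_equivalent_morita_level ::
    "'k ring \<Rightarrow> ('k, 'a) module \<Rightarrow> ('k, 'b) module \<Rightarrow> bool" where
  "singularly_equivalent_morita_level K A B \<longleftrightarrow>
    (\<exists>(M :: ('a, 'b, nat \<Rightarrow> 'k) bimodule) (N :: ('b, 'a, nat \<Rightarrow> 'k) bimodule) (n :: nat).
      central_bimodule K A B M \<and> central_bimodule K B A N \<and>
      fg_projective A M \<and> fg_projective (opposite B) (right_part M) \<and>
      fg_projective B N \<and> fg_projective (opposite A) (right_part N) \<and>
      (\<exists>X. is_nth_syzygy (enveloping K A) n (enveloping_module (regular_bimodule A)) X \<and>
        stably_isomorphic (enveloping K A) (enveloping_module (tensor_bimodule B M N)) X) \<and>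
      (\<exists>Y. is_nth_syzygy (enveloping K B) n (enveloping_module (regular_bimodule B)) Y \<and>
        stably_isomorphic (enveloping K B) (enveloping_module (tensor_bimodule A N M)) Y))"

end

theory Submission
  imports Defs
begin

text \<open>
  Let \<open>M\<close> and \<open>N\<close> be the bimodules of the equivalence, \<open>F = N \<otimes>\<^sub>A _\<close> and \<open>G = M \<otimes>\<^sub>B _\<close>.  Both functors are exact
  and preserve projectives, so they carry syzygies to syzygies.  A projective resolution of the bimodule
  \<open>A\<close> splits on the right, hence tensoring it with an \<open>A\<close>-module \<open>L\<close> yields a projective resolution of
  \<open>L\<close>, and \<open>G (F L)\<close> is stably isomorphic to every \<open>n\<close>-th syzygy of \<open>L\<close>.

  If \<open>L\<close> is itself an \<open>m\<close>-th syzygy, then \<open>F L\<close> is an \<open>m\<close>-th syzygy over \<open>B\<close>.  For syzygy-finiteness, an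
  indecomposable summand of an \<open>(n + m)\<close>-th syzygy is, by the local endomorphism ring of an
  indecomposable module, a summand of \<open>A\<close> or of \<open>G Z\<close> for an indecomposable summand \<open>Z\<close> of \<open>F L\<close>.  For the
  Igusa-Todorov property, \<open>G\<close> is applied to the short exact sequence of \<open>F L\<close>, and the result is
  moved along the stable isomorphism.
\<close>

section \<open>Modules and homomorphisms\<close>

text \<open>Every hypothesis is a stable statement, blind to projective summands, while both
  conclusions speak of actual modules. So each use of a stable isomorphism leaves a projective error
  term. It is caught by allowing summands of \<open>A\<close> next to those of
  \<open>M \<otimes> Z\<close>, and by replacing \<open>M \<otimes> V\<close> with
  \<open>(M \<otimes> V) \<oplus> A\<close>. Right projectivity of \<open>M\<close> and
  \<open>N\<close> gives exactness, left projectivity keeps projectives projective. A second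
  obstacle is size: \<open>M \<otimes> (N \<otimes> L)\<close> consists of cosets of formal sums,
  whereas the definitions quantify over modules on \<open>nat \<Rightarrow> 'k\<close>. Hence small
  copies are taken at every stage. Maps through projectives are encoded as finite sums of composites
  through one fixed module (\<open>add_map\<close>). Lifting, exactness of tensoring and the
  Krull-Schmidt argument all become inductions over such a sum. The level \<open>n\<close> only
  shifts indices: a bound \<open>s\<close> for \<open>B\<close> becomes \<open>n + max s 0\<close>
  for \<open>A\<close>, and an Igusa-Todorov index \<open>m\<close> becomes
  \<open>n + m\<close>.\<close>

context abelian_group
begin

lemma minus_eq_zero_iff: "x \<in> carrier G \<Longrightarrow> y \<in> carrier G \<Longrightarrow> x \<ominus> y = \<zero> \<longleftrightarrow> x = y"
  unfolding a_minus_def by (metis a_inv_closed add.inv_inv minus_equality r_neg)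

lemma minus_plus_cancel: "x \<in> carrier G \<Longrightarrow> y \<in> carrier G \<Longrightarrow> (x \<ominus> y) \<oplus> y = x"
  by (simp add: a_minus_def a_assoc l_neg)

lemma plus_minus_cancel: "x \<in> carrier G \<Longrightarrow> y \<in> carrier G \<Longrightarrow> (x \<oplus> y) \<ominus> y = x"
  by (simp add: a_minus_def a_assoc r_neg)

lemma minus_self: "x \<in> carrier G \<Longrightarrow> x \<ominus> x = \<zero>"
  by (simp add: minus_eq_zero_iff)

end

context left_module
begin

lemma smult_r_null: "a \<in> carrier R \<Longrightarrow> a \<odot>\<^bsub>M\<^esub> \<zero>\<^bsub>M\<^esub> = \<zero>\<^bsub>M\<^esub>"
  using smult_r_distr[of a "\<zero>\<^bsub>M\<^esub>" "\<zero>\<^bsub>M\<^esub>"] smult_closed[of a "\<zero>\<^bsub>M\<^esub>"]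
  by (metis M.add.l_cancel_one' M.l_zero M.zero_closed)

lemma smult_l_null: "x \<in> carrier M \<Longrightarrow> \<zero>\<^bsub>R\<^esub> \<odot>\<^bsub>M\<^esub> x = \<zero>\<^bsub>M\<^esub>"
  using smult_l_distr[of "\<zero>\<^bsub>R\<^esub>" "\<zero>\<^bsub>R\<^esub>" x] smult_closed[of "\<zero>\<^bsub>R\<^esub>" x]
  by (metis M.add.l_cancel_one' R.add.one_closed R.l_zero)

lemma smult_r_minus: "a \<in> carrier R \<Longrightarrow> x \<in> carrier M \<Longrightarrow> a \<odot>\<^bsub>M\<^esub> (\<ominus>\<^bsub>M\<^esub> x) = \<ominus>\<^bsub>M\<^esub> (a \<odot>\<^bsub>M\<^esub> x)"
  by (metis M.a_inv_closed M.minus_equality smult_closed smult_r_distr smult_r_null M.l_neg)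

lemma smult_l_minus: "a \<in> carrier R \<Longrightarrow> x \<in> carrier M \<Longrightarrow> (\<ominus>\<^bsub>R\<^esub> a) \<odot>\<^bsub>M\<^esub> x = \<ominus>\<^bsub>M\<^esub> (a \<odot>\<^bsub>M\<^esub> x)"
  by (metis M.minus_equality R.a_inv_closed R.l_neg smult_closed smult_l_distr smult_l_null)

text \<open>Negatives need no clause of their own, since \<open>-x = (-1) x\<close>. The library
  predicate \<open>submodule\<close> asks only for an additive subgroup stable under scalars and so
  makes sense over a noncommutative ring.\<close>

lemma submodule_intro:
  assumes "H \<subseteq> carrier M" "\<zero>\<^bsub>M\<^esub> \<in> H"
    and "\<And>x y. x \<in> H \<Longrightarrow> y \<in> H \<Longrightarrow> x \<oplus>\<^bsub>M\<^esub> y \<in> H"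
    and sm: "\<And>a x. a \<in> carrier R \<Longrightarrow> x \<in> H \<Longrightarrow> a \<odot>\<^bsub>M\<^esub> x \<in> H"
  shows "submodule H R M"
proof -
  have "\<ominus>\<^bsub>M\<^esub> x \<in> H" if "x \<in> H" for x
    using sm[of "\<ominus>\<^bsub>R\<^esub> \<one>\<^bsub>R\<^esub>" x] that assms(1) smult_l_minus[of "\<one>\<^bsub>R\<^esub>" x] smult_one[of x] by auto
  then have "subgroup H (add_monoid M)"
    using assms unfolding subgroup_def by (auto simp: a_inv_def)
  then show ?thesis
    using sm unfolding submodule_def submodule_axioms_def by auto
qed

lemma submoduleD:
  assumes "submodule H R M"
  shows "H \<subseteq> carrier M" "\<zero>\<^bsub>M\<^esub> \<in> H" "\<And>x y. x \<in> H \<Longrightarrow> y \<in> H \<Longrightarrow> x \<oplus>\<^bsub>M\<^esub> y \<in> H"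
    "\<And>a x. a \<in> carrier R \<Longrightarrow> x \<in> H \<Longrightarrow> a \<odot>\<^bsub>M\<^esub> x \<in> H" "\<And>x. x \<in> H \<Longrightarrow> \<ominus>\<^bsub>M\<^esub> x \<in> H"
    "\<And>x y. x \<in> H \<Longrightarrow> y \<in> H \<Longrightarrow> x \<ominus>\<^bsub>M\<^esub> y \<in> H"
proof -
  interpret H: submodule H R M by fact
  have sg: "subgroup H (add_monoid M)" by (rule H.subgroup_axioms)
  show 1: "H \<subseteq> carrier M" "\<zero>\<^bsub>M\<^esub> \<in> H" "\<And>x y. x \<in> H \<Longrightarrow> y \<in> H \<Longrightarrow> x \<oplus>\<^bsub>M\<^esub> y \<in> H"
    using subgroup.subset[OF sg] subgroup.one_closed[OF sg] subgroup.m_closed[OF sg] by auto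
  show "\<And>a x. a \<in> carrier R \<Longrightarrow> x \<in> H \<Longrightarrow> a \<odot>\<^bsub>M\<^esub> x \<in> H" by auto
  show 2: "\<And>x. x \<in> H \<Longrightarrow> \<ominus>\<^bsub>M\<^esub> x \<in> H"
    using subgroup.m_inv_closed[OF sg] by (simp add: a_inv_def)
  show "\<And>x y. x \<in> H \<Longrightarrow> y \<in> H \<Longrightarrow> x \<ominus>\<^bsub>M\<^esub> y \<in> H" unfolding a_minus_def using 1 2 by auto
qed

lemma left_module_submodule:
  assumes "submodule H R M"
  shows "left_module R (M\<lparr>carrier := H\<rparr>)"
proof -
  note H = submoduleD[OF assms]
  have "abelian_group (M\<lparr>carrier := H\<rparr>)"
  proof (rule abelian_groupI)
    fix x assume "x \<in> carrier (M\<lparr>carrier := H\<rparr>)"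
    then have "x \<in> H" by simp
    then show "\<exists>y\<in>carrier (M\<lparr>carrier := H\<rparr>). y \<oplus>\<^bsub>M\<lparr>carrier := H\<rparr>\<^esub> x = \<zero>\<^bsub>M\<lparr>carrier := H\<rparr>\<^esub>"
      using H(1,5) M.l_neg by auto
  qed (use H in \<open>auto intro!: M.a_assoc M.a_comm\<close>)
  then show ?thesis
    using H(1) by (intro left_module.intro left_module_axioms.intro R.ring_axioms)
      (auto intro!: smult_l_distr smult_r_distr smult_assoc smult_one H(4))
qed

end

text \<open>Kept apart from \<open>module_homs\<close>: a map out of a tensor product is first
  obtained as a group homomorphism, and the contractions
  \<open>M \<otimes> L \<rightarrow> L\<close> used for exactness connect modules over two different
  rings.\<close>

definition additive_map :: "('m, 'd) ring_scheme \<Rightarrow> ('n, 'e) ring_scheme \<Rightarrow> ('m \<Rightarrow> 'n) \<Rightarrow> bool" where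
  "additive_map X Y f \<longleftrightarrow> (\<forall>x\<in>carrier X. f x \<in> carrier Y) \<and>
    (\<forall>x\<in>carrier X. \<forall>y\<in>carrier X. f (x \<oplus>\<^bsub>X\<^esub> y) = f x \<oplus>\<^bsub>Y\<^esub> f y)"

lemma additive_mapI:
  "(\<And>x. x \<in> carrier X \<Longrightarrow> f x \<in> carrier Y) \<Longrightarrow>
   (\<And>x y. x \<in> carrier X \<Longrightarrow> y \<in> carrier X \<Longrightarrow> f (x \<oplus>\<^bsub>X\<^esub> y) = f x \<oplus>\<^bsub>Y\<^esub> f y) \<Longrightarrow> additive_map X Y f"
  by (simp add: additive_map_def)

lemma additive_map_closed: "additive_map X Y f \<Longrightarrow> x \<in> carrier X \<Longrightarrow> f x \<in> carrier Y"
  by (simp add: additive_map_def)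

lemma additive_map_add:
  "additive_map X Y f \<Longrightarrow> x \<in> carrier X \<Longrightarrow> y \<in> carrier X \<Longrightarrow> f (x \<oplus>\<^bsub>X\<^esub> y) = f x \<oplus>\<^bsub>Y\<^esub> f y"
  by (simp add: additive_map_def)

lemma additive_map_zero:
  assumes "additive_map X Y f" "abelian_group X" "abelian_group Y"
  shows "f \<zero>\<^bsub>X\<^esub> = \<zero>\<^bsub>Y\<^esub>"
proof -
  interpret X: abelian_group X by fact
  interpret Y: abelian_group Y by fact
  show ?thesis
    using additive_map_add[OF assms(1), of "\<zero>\<^bsub>X\<^esub>" "\<zero>\<^bsub>X\<^esub>"] additive_map_closed[OF assms(1), of "\<zero>\<^bsub>X\<^esub>"]
    by simp
qed

lemma additive_map_minus:
  assumes "additive_map X Y f" "abelian_group X" "abelian_group Y" "x \<in> carrier X"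
  shows "f (\<ominus>\<^bsub>X\<^esub> x) = \<ominus>\<^bsub>Y\<^esub> f x"
proof -
  interpret X: abelian_group X by fact
  interpret Y: abelian_group Y by fact
  have "f (\<ominus>\<^bsub>X\<^esub> x) \<oplus>\<^bsub>Y\<^esub> f x = \<zero>\<^bsub>Y\<^esub>"
    using additive_map_add[OF assms(1), of "\<ominus>\<^bsub>X\<^esub> x" x] assms(4)
    by (simp add: X.l_neg additive_map_zero[OF assms(1-3)])
  then show ?thesis
    using additive_map_closed[OF assms(1)] assms(4) Y.minus_equality by (metis X.a_inv_closed)
qed

lemma additive_map_diff:
  assumes "additive_map X Y f" "abelian_group X" "abelian_group Y" "x \<in> carrier X" "y \<in> carrier X"
  shows "f (x \<ominus>\<^bsub>X\<^esub> y) = f x \<ominus>\<^bsub>Y\<^esub> f y"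
proof -
  interpret X: abelian_group X by fact
  show ?thesis using assms
    by (simp add: a_minus_def additive_map_add additive_map_minus)
qed

lemma additive_map_inj_on:
  assumes "additive_map X Y f" "abelian_group X" "abelian_group Y"
    and "\<And>x. x \<in> carrier X \<Longrightarrow> f x = \<zero>\<^bsub>Y\<^esub> \<Longrightarrow> x = \<zero>\<^bsub>X\<^esub>"
  shows "inj_on f (carrier X)"
proof (rule inj_onI)
  interpret X: abelian_group X by fact
  interpret Y: abelian_group Y by fact
  fix x y assume xy: "x \<in> carrier X" "y \<in> carrier X" "f x = f y"
  then have "f (x \<ominus>\<^bsub>X\<^esub> y) = \<zero>\<^bsub>Y\<^esub>"
    using additive_map_diff[OF assms(1-3), of x y] additive_map_closed[OF assms(1)]
    by (simp add: Y.minus_eq_zero_iff)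
  then show "x = y" using assms(4)[of "x \<ominus>\<^bsub>X\<^esub> y"] xy by (simp add: X.minus_eq_zero_iff)
qed

lemma left_module_abelian_group: "left_module R X \<Longrightarrow> abelian_group X"
  by (simp add: left_module_def)

lemma left_module_ring: "left_module R X \<Longrightarrow> ring R"
  by (simp add: left_module_def)

section \<open>Module homomorphisms\<close>

lemma module_homsI:
  "(\<And>x. x \<in> carrier X \<Longrightarrow> f x \<in> carrier Y) \<Longrightarrow>
   (\<And>x y. x \<in> carrier X \<Longrightarrow> y \<in> carrier X \<Longrightarrow> f (x \<oplus>\<^bsub>X\<^esub> y) = f x \<oplus>\<^bsub>Y\<^esub> f y) \<Longrightarrow>
   (\<And>a x. a \<in> carrier R \<Longrightarrow> x \<in> carrier X \<Longrightarrow> f (a \<odot>\<^bsub>X\<^esub> x) = a \<odot>\<^bsub>Y\<^esub> f x) \<Longrightarrow> f \<in> module_homs R X Y"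
  by (auto simp: module_homs_def)

lemma hom_closed: "f \<in> module_homs R X Y \<Longrightarrow> x \<in> carrier X \<Longrightarrow> f x \<in> carrier Y"
  by (auto simp: module_homs_def)

lemma hom_add:
  "f \<in> module_homs R X Y \<Longrightarrow> x \<in> carrier X \<Longrightarrow> y \<in> carrier X \<Longrightarrow> f (x \<oplus>\<^bsub>X\<^esub> y) = f x \<oplus>\<^bsub>Y\<^esub> f y"
  by (auto simp: module_homs_def)

lemma hom_smult:
  "f \<in> module_homs R X Y \<Longrightarrow> a \<in> carrier R \<Longrightarrow> x \<in> carrier X \<Longrightarrow> f (a \<odot>\<^bsub>X\<^esub> x) = a \<odot>\<^bsub>Y\<^esub> f x"
  by (auto simp: module_homs_def)

lemma hom_additive: "f \<in> module_homs R X Y \<Longrightarrow> additive_map X Y f"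
  by (auto simp: module_homs_def additive_map_def)

lemma hom_zero:
  "f \<in> module_homs R X Y \<Longrightarrow> left_module R X \<Longrightarrow> left_module R Y \<Longrightarrow> f \<zero>\<^bsub>X\<^esub> = \<zero>\<^bsub>Y\<^esub>"
  by (meson additive_map_zero hom_additive left_module_abelian_group)

lemma hom_diff:
  "f \<in> module_homs R X Y \<Longrightarrow> left_module R X \<Longrightarrow> left_module R Y \<Longrightarrow> x \<in> carrier X \<Longrightarrow> y \<in> carrier X
    \<Longrightarrow> f (x \<ominus>\<^bsub>X\<^esub> y) = f x \<ominus>\<^bsub>Y\<^esub> f y"
  by (meson additive_map_diff hom_additive left_module_abelian_group)

lemma hom_inj_on:
  assumes "f \<in> module_homs R X Y" "left_module R X" "left_module R Y"
    and "\<And>x. x \<in> carrier X \<Longrightarrow> f x = \<zero>\<^bsub>Y\<^esub> \<Longrightarrow> x = \<zero>\<^bsub>X\<^esub>"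
  shows "inj_on f (carrier X)"
  using assms by (meson additive_map_inj_on hom_additive left_module_abelian_group)

lemma hom_inj_onD:
  assumes "f \<in> module_homs R X Y" "left_module R X" "left_module R Y" "inj_on f (carrier X)"
    "x \<in> carrier X" "f x = \<zero>\<^bsub>Y\<^esub>"
  shows "x = \<zero>\<^bsub>X\<^esub>"
proof -
  interpret X: left_module R X by fact
  show ?thesis using assms hom_zero[OF assms(1-3)] inj_onD[OF assms(4), of x "\<zero>\<^bsub>X\<^esub>"] by simp
qed

lemma hom_id: "(\<lambda>x. x) \<in> module_homs R X X"
  by (auto simp: module_homs_def)

lemma hom_comp: "f \<in> module_homs R X Y \<Longrightarrow> g \<in> module_homs R Y Z \<Longrightarrow> (\<lambda>x. g (f x)) \<in> module_homs R X Z"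
  by (intro module_homsI) (simp_all add: hom_closed hom_add hom_smult)

lemma hom_cong:
  assumes "left_module R X" "f \<in> module_homs R X Y" "\<And>x. x \<in> carrier X \<Longrightarrow> f x = g x"
  shows "g \<in> module_homs R X Y"
proof -
  interpret X: left_module R X by fact
  show ?thesis using assms(2,3)
    by (intro module_homsI) (metis hom_closed, metis hom_add X.M.a_closed, metis hom_smult X.smult_closed)
qed

lemma hom_zero_map: "left_module R Y \<Longrightarrow> (\<lambda>x. \<zero>\<^bsub>Y\<^esub>) \<in> module_homs R X Y"
proof -
  assume "left_module R Y"
  then interpret Y: left_module R Y .
  show ?thesis by (intro module_homsI) (auto simp: Y.smult_r_null)
qed

lemma hom_plus:
  assumes "left_module R X" "left_module R Y" "f \<in> module_homs R X Y" "g \<in> module_homs R X Y"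
  shows "(\<lambda>x. f x \<oplus>\<^bsub>Y\<^esub> g x) \<in> module_homs R X Y"
proof -
  interpret X: left_module R X by fact
  interpret Y: left_module R Y by fact
  show ?thesis
    using assms(3,4)
    by (intro module_homsI) (auto simp: hom_closed hom_add hom_smult Y.smult_r_distr Y.M.a_ac)
qed

lemma hom_minus:
  assumes "left_module R X" "left_module R Y" "f \<in> module_homs R X Y" "g \<in> module_homs R X Y"
  shows "(\<lambda>x. f x \<ominus>\<^bsub>Y\<^esub> g x) \<in> module_homs R X Y"
proof -
  interpret X: left_module R X by fact
  interpret Y: left_module R Y by fact
  show ?thesis
    using assms(3,4) unfolding a_minus_def
    by (intro module_homsI)
      (auto simp: hom_closed hom_add hom_smult Y.smult_r_distr Y.smult_r_minus Y.M.minus_add Y.M.a_ac)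
qed

section \<open>Images, kernels and the regular module\<close>

lemma submodule_image:
  assumes "left_module R X" "left_module R Y" "f \<in> module_homs R X Y"
  shows "submodule (f ` carrier X) R Y"
proof -
  interpret X: left_module R X by fact
  interpret Y: left_module R Y by fact
  show ?thesis
  proof (rule Y.submodule_intro)
    show "\<zero>\<^bsub>Y\<^esub> \<in> f ` carrier X" using hom_zero[OF assms(3,1,2)] by (metis X.M.zero_closed imageI)
    show "x \<oplus>\<^bsub>Y\<^esub> y \<in> f ` carrier X" if "x \<in> f ` carrier X" "y \<in> f ` carrier X" for x y
      using that hom_add[OF assms(3), symmetric] by auto
    show "a \<odot>\<^bsub>Y\<^esub> x \<in> f ` carrier X" if "a \<in> carrier R" "x \<in> f ` carrier X" for a x
      using that hom_smult[OF assms(3), symmetric] X.smult_closed by auto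
  qed (use assms(3) in \<open>auto simp: hom_closed\<close>)
qed

lemma mem_a_kernel: "x \<in> a_kernel X Y f \<longleftrightarrow> x \<in> carrier X \<and> f x = \<zero>\<^bsub>Y\<^esub>"
  by (auto simp: a_kernel_def kernel_def)

lemma submodule_kernel:
  assumes "left_module R X" "left_module R Y" "f \<in> module_homs R X Y"
  shows "submodule (a_kernel X Y f) R X"
proof -
  interpret X: left_module R X by fact
  interpret Y: left_module R Y by fact
  show ?thesis
    by (rule X.submodule_intro)
      (use hom_zero[OF assms(3,1,2)] hom_add[OF assms(3)] hom_smult[OF assms(3)] Y.smult_r_null
        X.smult_closed in \<open>auto simp: mem_a_kernel\<close>)
qed

lemma hom_incl: "H \<subseteq> carrier X \<Longrightarrow> (\<lambda>x. x) \<in> module_homs R (X\<lparr>carrier := H\<rparr>) X"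
  by (auto simp: module_homs_def)

lemma hom_corestrict:
  "f \<in> module_homs R X Y \<Longrightarrow> (\<And>x. x \<in> carrier X \<Longrightarrow> f x \<in> H) \<Longrightarrow> f \<in> module_homs R X (Y\<lparr>carrier := H\<rparr>)"
  by (auto simp: module_homs_def)

lemma left_module_regular: "ring R \<Longrightarrow> left_module R (regular_module R)"
proof -
  assume "ring R"
  then interpret R: ring R .
  have "abelian_group (regular_module R)"
    by (rule abelian_groupI)
      (auto simp: regular_module_def R.a_assoc intro!: R.a_comm bexI[of _ "\<ominus>\<^bsub>R\<^esub> x" for x] R.l_neg)
  then show ?thesis
    by (intro left_module.intro left_module_axioms.intro R.ring_axioms)
      (auto simp: regular_module_def R.l_distr R.r_distr R.m_assoc)
qed

lemma regular_module_simps [simp]: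
  "carrier (regular_module R) = carrier R" "zero (regular_module R) = zero R"
  "add (regular_module R) = add R" "smult (regular_module R) = mult R"
  by (auto simp: regular_module_def)

lemma hom_from_regular:
  assumes "left_module R Y" "y \<in> carrier Y"
  shows "(\<lambda>r. r \<odot>\<^bsub>Y\<^esub> y) \<in> module_homs R (regular_module R) Y"
proof -
  interpret Y: left_module R Y by fact
  show ?thesis using assms(2)
    by (intro module_homsI) (auto simp: Y.smult_l_distr Y.smult_assoc Y.smult_closed)
qed

lemma hom_regular_eq:
  assumes "left_module R Y" "f \<in> module_homs R (regular_module R) Y" "r \<in> carrier R"
  shows "f r = r \<odot>\<^bsub>Y\<^esub> f \<one>\<^bsub>R\<^esub>"
proof -
  interpret Y: left_module R Y by fact
  show ?thesis using hom_smult[OF assms(2,3), of "\<one>\<^bsub>R\<^esub>"] assms(3) by simp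
qed


section \<open>Finitely generated modules\<close>

text \<open>Linear combinations built one term at a time, so that facts about spans go by induction
  instead of by manipulating coefficient functions. Repeated generators are allowed.\<close>

inductive_set lspan :: "('r, 'c) ring_scheme \<Rightarrow> ('r, 'm, 'd) module_scheme \<Rightarrow> 'm set \<Rightarrow> 'm set"
  for R X S where
  zero: "\<zero>\<^bsub>X\<^esub> \<in> lspan R X S"
| step: "x \<in> lspan R X S \<Longrightarrow> a \<in> carrier R \<Longrightarrow> s \<in> S \<Longrightarrow> x \<oplus>\<^bsub>X\<^esub> a \<odot>\<^bsub>X\<^esub> s \<in> lspan R X S"

lemma submodule_lspan:
  assumes "left_module R X" "S \<subseteq> carrier X"
  shows "submodule (lspan R X S) R X"
proof -
  interpret X: left_module R X by fact
  have c: "x \<in> carrier X" if "x \<in> lspan R X S" for x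
    using that by induction (use assms X.smult_closed in auto)
  have "x \<oplus>\<^bsub>X\<^esub> y \<in> lspan R X S" if "y \<in> lspan R X S" "x \<in> lspan R X S" for x y
    using that
  proof induction
    case zero
    then show ?case using c by simp
  next
    case (step y a s)
    then have "x \<oplus>\<^bsub>X\<^esub> (y \<oplus>\<^bsub>X\<^esub> a \<odot>\<^bsub>X\<^esub> s) = (x \<oplus>\<^bsub>X\<^esub> y) \<oplus>\<^bsub>X\<^esub> a \<odot>\<^bsub>X\<^esub> s"
      using c assms X.smult_closed by (simp add: X.M.a_assoc subset_iff)
    then show ?case using step by (simp add: lspan.step)
  qed
  moreover have "b \<odot>\<^bsub>X\<^esub> x \<in> lspan R X S" if "x \<in> lspan R X S" "b \<in> carrier R" for x b
    using that
  proof induction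
    case zero
    then show ?case by (simp add: X.smult_r_null lspan.zero)
  next
    case (step x a s)
    then have "b \<odot>\<^bsub>X\<^esub> (x \<oplus>\<^bsub>X\<^esub> a \<odot>\<^bsub>X\<^esub> s) = b \<odot>\<^bsub>X\<^esub> x \<oplus>\<^bsub>X\<^esub> (b \<otimes>\<^bsub>R\<^esub> a) \<odot>\<^bsub>X\<^esub> s"
      using c assms X.smult_closed by (simp add: X.smult_r_distr X.smult_assoc subset_iff)
    then show ?case using step by (simp add: lspan.step)
  qed
  ultimately show ?thesis
    using c by (intro X.submodule_intro) (auto intro: lspan.zero)
qed

lemma lspan_base:
  assumes "left_module R X" "S \<subseteq> carrier X" "s \<in> S"
  shows "s \<in> lspan R X S"
proof -
  interpret X: left_module R X by fact
  have "s \<in> carrier X" using assms by auto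
  then show ?thesis
    using lspan.step[OF lspan.zero X.R.one_closed assms(3), of X] by (simp add: X.smult_one)
qed

lemma lspan_least:
  assumes "left_module R X" "submodule H R X" "S \<subseteq> H"
  shows "lspan R X S \<subseteq> H"
proof
  interpret X: left_module R X by fact
  note H = X.submoduleD[OF assms(2)]
  fix x assume "x \<in> lspan R X S"
  then show "x \<in> H" by induction (use H assms(3) in auto)
qed

lemma lspan_mono: "S \<subseteq> T \<Longrightarrow> lspan R X S \<subseteq> lspan R X T"
proof
  fix x assume "S \<subseteq> T" "x \<in> lspan R X S"
  from this(2,1) show "x \<in> lspan R X T" by induction (auto intro: lspan.intros)
qed

text \<open>The bridge from the coefficient functions in \<open>finitely_generated\<close> to the
  inductive span. From here on, generation is handled through \<open>lspan\<close>.\<close>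

lemma finitely_generated_iff:
  assumes "left_module R X"
  shows "finitely_generated R X \<longleftrightarrow> (\<exists>S. finite S \<and> S \<subseteq> carrier X \<and> carrier X \<subseteq> lspan R X S)"
proof -
  interpret X: left_module R X by fact
  have 1: "(\<Oplus>\<^bsub>X\<^esub>s\<in>T. c s \<odot>\<^bsub>X\<^esub> s) \<in> lspan R X S"
    if "finite T" "T \<subseteq> S" "S \<subseteq> carrier X" "c \<in> S \<rightarrow> carrier R" for S T c
    using that
  proof (induction T rule: finite_induct)
    case empty
    then show ?case by (simp add: lspan.zero)
  next
    case (insert s T)
    have sS: "s \<in> S" "c s \<in> carrier R" using insert by auto
    have "(\<Oplus>\<^bsub>X\<^esub>s\<in>insert s T. c s \<odot>\<^bsub>X\<^esub> s) = c s \<odot>\<^bsub>X\<^esub> s \<oplus>\<^bsub>X\<^esub> (\<Oplus>\<^bsub>X\<^esub>s\<in>T. c s \<odot>\<^bsub>X\<^esub> s)"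
      using insert by (intro X.M.finsum_insert) (auto intro!: X.smult_closed)
    also have "\<dots> = (\<Oplus>\<^bsub>X\<^esub>s\<in>T. c s \<odot>\<^bsub>X\<^esub> s) \<oplus>\<^bsub>X\<^esub> c s \<odot>\<^bsub>X\<^esub> s"
      using insert sS by (intro X.M.a_comm X.M.finsum_closed) (auto intro!: X.smult_closed)
    finally show ?case using insert sS by (simp add: lspan.step)
  qed
  have 2: "\<exists>c\<in>S \<rightarrow> carrier R. x = (\<Oplus>\<^bsub>X\<^esub>s\<in>S. c s \<odot>\<^bsub>X\<^esub> s)"
    if "finite S" "S \<subseteq> carrier X" "x \<in> lspan R X S" for S x
    using that(3)
  proof induction
    case zero
    have "(\<Oplus>\<^bsub>X\<^esub>s\<in>S. \<zero>\<^bsub>R\<^esub> \<odot>\<^bsub>X\<^esub> s) = (\<Oplus>\<^bsub>X\<^esub>s\<in>S. \<zero>\<^bsub>X\<^esub>)"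
      using that by (intro X.M.finsum_cong') (auto simp: X.smult_l_null subset_iff)
    then show ?case by (intro bexI[of _ "\<lambda>_. \<zero>\<^bsub>R\<^esub>"]) auto
  next
    case (step x a s)
    then obtain c where c: "c \<in> S \<rightarrow> carrier R" "x = (\<Oplus>\<^bsub>X\<^esub>s\<in>S. c s \<odot>\<^bsub>X\<^esub> s)" by auto
    \<comment> \<open>The new term is absorbed by adding \<open>a\<close> to the coefficient of
      \<open>s\<close>, which may already be nonzero.\<close>
    let ?d = "\<lambda>t. if t = s then a else \<zero>\<^bsub>R\<^esub>"
    have "(\<Oplus>\<^bsub>X\<^esub>t\<in>S. ?d t \<odot>\<^bsub>X\<^esub> t) = (\<Oplus>\<^bsub>X\<^esub>t\<in>S. if s = t then a \<odot>\<^bsub>X\<^esub> t else \<zero>\<^bsub>X\<^esub>)"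
      using that step by (intro X.M.finsum_cong') (auto simp: X.smult_l_null subset_iff X.smult_closed)
    also have "\<dots> = a \<odot>\<^bsub>X\<^esub> s"
      using that step by (intro X.M.add.finprod_singleton) (auto intro!: X.smult_closed)
    finally have d: "a \<odot>\<^bsub>X\<^esub> s = (\<Oplus>\<^bsub>X\<^esub>t\<in>S. ?d t \<odot>\<^bsub>X\<^esub> t)" by simp
    have "x \<oplus>\<^bsub>X\<^esub> a \<odot>\<^bsub>X\<^esub> s = (\<Oplus>\<^bsub>X\<^esub>t\<in>S. c t \<odot>\<^bsub>X\<^esub> t \<oplus>\<^bsub>X\<^esub> ?d t \<odot>\<^bsub>X\<^esub> t)"
      unfolding c(2) d using that step c(1)
      by (intro X.M.finsum_addf[symmetric]) (auto intro!: X.smult_closed)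
    also have "\<dots> = (\<Oplus>\<^bsub>X\<^esub>t\<in>S. (c t \<oplus>\<^bsub>R\<^esub> ?d t) \<odot>\<^bsub>X\<^esub> t)"
    proof (rule X.M.finsum_cong')
      show "(\<lambda>t. (c t \<oplus>\<^bsub>R\<^esub> ?d t) \<odot>\<^bsub>X\<^esub> t) \<in> S \<rightarrow> carrier X"
        using that step c(1) by (auto intro!: X.smult_closed)
      fix t assume "t \<in> S"
      then show "c t \<odot>\<^bsub>X\<^esub> t \<oplus>\<^bsub>X\<^esub> ?d t \<odot>\<^bsub>X\<^esub> t = (c t \<oplus>\<^bsub>R\<^esub> ?d t) \<odot>\<^bsub>X\<^esub> t"
        using that step c(1) by (intro X.smult_l_distr[symmetric]) auto
    qed simp
    finally show ?case
      using c(1) step(2) by (intro bexI[of _ "\<lambda>t. c t \<oplus>\<^bsub>R\<^esub> ?d t"]) auto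
  qed
  have "(\<forall>x\<in>carrier X. \<exists>c\<in>S \<rightarrow> carrier R. x = (\<Oplus>\<^bsub>X\<^esub>s\<in>S. c s \<odot>\<^bsub>X\<^esub> s)) \<longleftrightarrow> carrier X \<subseteq> lspan R X S"
    if "finite S" "S \<subseteq> carrier X" for S
  proof
    assume L: "\<forall>x\<in>carrier X. \<exists>c\<in>S \<rightarrow> carrier R. x = (\<Oplus>\<^bsub>X\<^esub>s\<in>S. c s \<odot>\<^bsub>X\<^esub> s)"
    show "carrier X \<subseteq> lspan R X S"
    proof
      fix x assume "x \<in> carrier X"
      then obtain c where "c \<in> S \<rightarrow> carrier R" "x = (\<Oplus>\<^bsub>X\<^esub>s\<in>S. c s \<odot>\<^bsub>X\<^esub> s)" using L by blast
      then show "x \<in> lspan R X S" using 1[OF that(1) subset_refl that(2)] by simp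
    qed
  qed (use 2[OF that] in blast)
  then show ?thesis
    unfolding finitely_generated_def by (simp cong: conj_cong)
qed

lemma lspan_image:
  assumes "left_module R X" "left_module R Y" "f \<in> module_homs R X Y" "S \<subseteq> carrier X" "x \<in> lspan R X S"
  shows "f x \<in> lspan R Y (f ` S)"
  using assms(5)
proof induction
  case zero
  show ?case using hom_zero[OF assms(3,1,2)] by (simp add: lspan.zero)
next
  case (step x a s)
  interpret X: left_module R X by fact
  have "x \<in> carrier X" using step X.submoduleD(1)[OF submodule_lspan[OF assms(1,4)]] by auto
  then have "f (x \<oplus>\<^bsub>X\<^esub> a \<odot>\<^bsub>X\<^esub> s) = f x \<oplus>\<^bsub>Y\<^esub> a \<odot>\<^bsub>Y\<^esub> f s"
    using step assms X.smult_closed hom_add[OF assms(3)] hom_smult[OF assms(3)] by (simp add: subset_iff)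
  then show ?case using step by (auto intro: lspan.step)
qed

lemma fg_module_image:
  assumes "fg_module R X" "left_module R Y" "f \<in> module_homs R X Y" "f ` carrier X = carrier Y"
  shows "fg_module R Y"
proof -
  have X: "left_module R X" using assms(1) by (simp add: fg_module_def)
  obtain S where S: "finite S" "S \<subseteq> carrier X" "carrier X \<subseteq> lspan R X S"
    using assms(1) finitely_generated_iff[OF X] by (auto simp: fg_module_def)
  have "carrier Y \<subseteq> lspan R Y (f ` S)"
    using lspan_image[OF X assms(2,3) S(2)] S(3) by (auto simp flip: assms(4))
  moreover have "f ` S \<subseteq> carrier Y" using S(2) assms(4) by auto
  ultimately show ?thesis
    using S(1) finitely_generated_iff[OF assms(2)] assms(2) by (auto simp: fg_module_def)
qed

lemma fg_module_left: "fg_module R X \<Longrightarrow> left_module R X"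
  by (simp add: fg_module_def)

lemma fg_module_regular: "ring R \<Longrightarrow> fg_module R (regular_module R)"
proof -
  assume R: "ring R"
  then interpret R: ring R .
  note lm = left_module_regular[OF R]
  have "r \<in> lspan R (regular_module R) {\<one>\<^bsub>R\<^esub>}" if "r \<in> carrier R" for r
    using lspan.step[OF lspan.zero that, of "\<one>\<^bsub>R\<^esub>" "{\<one>\<^bsub>R\<^esub>}" "regular_module R"] that by simp
  then show ?thesis
    unfolding fg_module_def finitely_generated_iff[OF lm] using lm
    by (intro conjI exI[of _ "{\<one>\<^bsub>R\<^esub>}"]) auto
qed


section \<open>Isomorphisms\<close>

lemma bij_hom_inverse:
  assumes f: "f \<in> module_homs R X Y" "bij_betw f (carrier X) (carrier Y)"
    and X: "left_module R X" and Y: "left_module R Y"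
  obtains g where "g \<in> module_homs R Y X" "\<And>x. x \<in> carrier X \<Longrightarrow> g (f x) = x"
    "\<And>y. y \<in> carrier Y \<Longrightarrow> f (g y) = y"
proof -
  interpret X: left_module R X by fact
  interpret Y: left_module R Y by fact
  define g where "g = inv_into (carrier X) f"
  have gf: "g (f x) = x" if "x \<in> carrier X" for x
    using f(2) that by (simp add: g_def bij_betw_inv_into_left)
  have fg: "f (g y) = y" if "y \<in> carrier Y" for y
    using f(2) that by (simp add: g_def bij_betw_inv_into_right)
  have gc: "g y \<in> carrier X" if "y \<in> carrier Y" for y
    using f(2) that by (metis bij_betw_def g_def inv_into_into)
  have "g \<in> module_homs R Y X"
  proof (rule module_homsI)
    fix x y assume xy: "x \<in> carrier Y" "y \<in> carrier Y"
    then have "f (g x \<oplus>\<^bsub>X\<^esub> g y) = x \<oplus>\<^bsub>Y\<^esub> y" by (simp add: hom_add[OF f(1)] gc fg)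
    then show "g (x \<oplus>\<^bsub>Y\<^esub> y) = g x \<oplus>\<^bsub>X\<^esub> g y" using gf[of "g x \<oplus>\<^bsub>X\<^esub> g y"] xy gc by simp
  next
    fix a y assume xy: "a \<in> carrier R" "y \<in> carrier Y"
    then have "f (a \<odot>\<^bsub>X\<^esub> g y) = a \<odot>\<^bsub>Y\<^esub> y" by (simp add: hom_smult[OF f(1)] gc fg)
    then show "g (a \<odot>\<^bsub>Y\<^esub> y) = a \<odot>\<^bsub>X\<^esub> g y" using gf[of "a \<odot>\<^bsub>X\<^esub> g y"] xy gc X.smult_closed by simp
  qed (fact gc)
  with that gf fg show thesis by blast
qed

lemma module_isoE:
  assumes "module_iso R X Y" "left_module R X" "left_module R Y"
  obtains f g where "f \<in> module_homs R X Y" "g \<in> module_homs R Y X"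
    "\<And>x. x \<in> carrier X \<Longrightarrow> g (f x) = x" "\<And>y. y \<in> carrier Y \<Longrightarrow> f (g y) = y"
  using assms bij_hom_inverse[of _ R X Y] unfolding module_iso_def by metis

lemma module_isoI:
  assumes "f \<in> module_homs R X Y" "g \<in> module_homs R Y X"
    "\<And>x. x \<in> carrier X \<Longrightarrow> g (f x) = x" "\<And>y. y \<in> carrier Y \<Longrightarrow> f (g y) = y"
  shows "module_iso R X Y"
  unfolding module_iso_def
  by (intro bexI[OF _ assms(1)] bij_betwI[where g = g])
    (use assms hom_closed[OF assms(1)] hom_closed[OF assms(2)] in auto)

lemma module_iso_refl: "module_iso R X X"
  by (rule module_isoI[of "\<lambda>x. x" R X X "\<lambda>x. x"]) (auto simp: hom_id)

lemma module_iso_sym: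
  assumes "module_iso R X Y" "left_module R X" "left_module R Y"
  shows "module_iso R Y X"
proof -
  obtain f g where "f \<in> module_homs R X Y" "g \<in> module_homs R Y X"
    "\<And>x. x \<in> carrier X \<Longrightarrow> g (f x) = x" "\<And>y. y \<in> carrier Y \<Longrightarrow> f (g y) = y"
    using module_isoE[OF assms] by blast
  then show ?thesis by (intro module_isoI[of g R Y X f]) auto
qed

lemma module_iso_trans:
  assumes "module_iso R X Y" "module_iso R Y Z"
  shows "module_iso R X Z"
proof -
  obtain f g where "f \<in> module_homs R X Y" "bij_betw f (carrier X) (carrier Y)"
    "g \<in> module_homs R Y Z" "bij_betw g (carrier Y) (carrier Z)"
    using assms by (auto simp: module_iso_def)
  then show ?thesis unfolding module_iso_def
    by (intro bexI[of _ "\<lambda>x. g (f x)"]) (auto simp: hom_comp bij_betw_trans[unfolded comp_def])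
qed

text \<open>Kernels, free modules and tensor products live on other types than the one over which
  the definitions quantify. They are exchanged for a copy in the universe through this pair of
  mutually inverse maps.\<close>

lemma small_copyE:
  fixes K :: "'k ring" and R :: "('k, 'r) module"
  assumes "fd_algebra K R" "fg_module R X"
  obtains X' :: "('k, 'r) small_module" and f g where "fg_module R X'"
    "f \<in> module_homs R X X'" "g \<in> module_homs R X' X"
    "\<And>x. x \<in> carrier X \<Longrightarrow> g (f x) = x" "\<And>y. y \<in> carrier X' \<Longrightarrow> f (g y) = y"
proof -
  obtain X' :: "('k, 'r) small_module" where X': "fg_module R X'" "module_iso R X X'"
    using fg_module_in_universe[OF assms] by blast
  obtain f g where "f \<in> module_homs R X X'" "g \<in> module_homs R X' X"
    "\<And>x. x \<in> carrier X \<Longrightarrow> g (f x) = x" "\<And>y. y \<in> carrier X' \<Longrightarrow> f (g y) = y"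
    using module_isoE[OF X'(2) fg_module_left[OF assms(2)] fg_module_left[OF X'(1)]] by metis
  with that X'(1) show thesis by blast
qed


section \<open>Direct sums\<close>

lemma direct_sum_simps [simp]:
  "carrier (direct_sum X Y) = carrier X \<times> carrier Y"
  "zero (direct_sum X Y) = (\<zero>\<^bsub>X\<^esub>, \<zero>\<^bsub>Y\<^esub>)"
  "add (direct_sum X Y) = (\<lambda>(x, y) (x', y'). (x \<oplus>\<^bsub>X\<^esub> x', y \<oplus>\<^bsub>Y\<^esub> y'))"
  "smult (direct_sum X Y) = (\<lambda>a (x, y). (a \<odot>\<^bsub>X\<^esub> x, a \<odot>\<^bsub>Y\<^esub> y))"
  by (auto simp: direct_sum_def)

lemma left_module_direct_sum:
  assumes "left_module R X" "left_module R Y"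
  shows "left_module R (direct_sum X Y)"
proof -
  interpret X: left_module R X by fact
  interpret Y: left_module R Y by fact
  have "abelian_group (direct_sum X Y)"
  proof (rule abelian_groupI)
    fix z assume "z \<in> carrier (direct_sum X Y)"
    then show "\<exists>y\<in>carrier (direct_sum X Y). y \<oplus>\<^bsub>direct_sum X Y\<^esub> z = \<zero>\<^bsub>direct_sum X Y\<^esub>"
      by (intro bexI[of _ "(\<ominus>\<^bsub>X\<^esub> fst z, \<ominus>\<^bsub>Y\<^esub> snd z)"]) (auto simp: X.M.l_neg Y.M.l_neg)
  qed (auto simp: X.M.a_ac Y.M.a_ac)
  then show ?thesis
    by (intro left_module.intro left_module_axioms.intro X.R.ring_axioms)
      (auto simp: X.smult_closed Y.smult_closed X.smult_l_distr Y.smult_l_distr X.smult_r_distr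
        Y.smult_r_distr X.smult_assoc Y.smult_assoc X.smult_one Y.smult_one)
qed

lemma hom_fst: "fst \<in> module_homs R (direct_sum X Y) X"
  by (auto simp: module_homs_def)

lemma hom_snd: "snd \<in> module_homs R (direct_sum X Y) Y"
  by (auto simp: module_homs_def)

lemma hom_pair:
  "f \<in> module_homs R Z X \<Longrightarrow> g \<in> module_homs R Z Y \<Longrightarrow> (\<lambda>z. (f z, g z)) \<in> module_homs R Z (direct_sum X Y)"
  by (intro module_homsI) (simp_all add: hom_closed hom_add hom_smult)

lemma hom_copair:
  assumes "left_module R Z" "f \<in> module_homs R X Z" "g \<in> module_homs R Y Z"
  shows "(\<lambda>(x, y). f x \<oplus>\<^bsub>Z\<^esub> g y) \<in> module_homs R (direct_sum X Y) Z"
proof -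
  interpret Z: left_module R Z by fact
  show ?thesis using assms(2,3)
    by (intro module_homsI) (auto simp: hom_closed hom_add hom_smult Z.M.a_ac Z.smult_r_distr)
qed

lemma lspan_sub_image:
  assumes "left_module R X" "left_module R Y" "f \<in> module_homs R X Y" "fg_module R X"
  obtains S where "finite S" "S \<subseteq> carrier Y" "f ` carrier X \<subseteq> lspan R Y S"
proof -
  obtain S where S: "finite S" "S \<subseteq> carrier X" "carrier X \<subseteq> lspan R X S"
    using assms(4) finitely_generated_iff[OF assms(1)] by (auto simp: fg_module_def)
  show thesis
  proof (rule that[of "f ` S"])
    show "f ` carrier X \<subseteq> lspan R Y (f ` S)" using lspan_image[OF assms(1-3) S(2)] S(3) by auto
  qed (use S hom_closed[OF assms(3)] in auto)
qed

lemma fg_module_direct_sum: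
  assumes "fg_module R X" "fg_module R Y"
  shows "fg_module R (direct_sum X Y)"
proof -
  let ?Z = "direct_sum X Y"
  note X = fg_module_left[OF assms(1)] and Y = fg_module_left[OF assms(2)]
  note Z = left_module_direct_sum[OF X Y]
  interpret X: left_module R X by fact
  interpret Y: left_module R Y by fact
  interpret Z: left_module R ?Z by fact
  have i: "(\<lambda>x. (x, \<zero>\<^bsub>Y\<^esub>)) \<in> module_homs R X ?Z" "(\<lambda>y. (\<zero>\<^bsub>X\<^esub>, y)) \<in> module_homs R Y ?Z"
    by (intro hom_pair hom_id hom_zero_map X Y)+
  obtain S where S: "finite S" "S \<subseteq> carrier ?Z" "(\<lambda>x. (x, \<zero>\<^bsub>Y\<^esub>)) ` carrier X \<subseteq> lspan R ?Z S"
    using lspan_sub_image[OF X Z i(1) assms(1)] .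
  obtain T where T: "finite T" "T \<subseteq> carrier ?Z" "(\<lambda>y. (\<zero>\<^bsub>X\<^esub>, y)) ` carrier Y \<subseteq> lspan R ?Z T"
    using lspan_sub_image[OF Y Z i(2) assms(2)] .
  have ST: "S \<union> T \<subseteq> carrier ?Z" using S T by auto
  note sub = Z.submoduleD[OF submodule_lspan[OF Z ST]]
  have "carrier ?Z \<subseteq> lspan R ?Z (S \<union> T)"
  proof
    fix z assume z: "z \<in> carrier ?Z"
    then have "(fst z, \<zero>\<^bsub>Y\<^esub>) \<in> lspan R ?Z S" "(\<zero>\<^bsub>X\<^esub>, snd z) \<in> lspan R ?Z T"
      using S(3) T(3) by auto
    then have "(fst z, \<zero>\<^bsub>Y\<^esub>) \<oplus>\<^bsub>?Z\<^esub> (\<zero>\<^bsub>X\<^esub>, snd z) \<in> lspan R ?Z (S \<union> T)"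
      using lspan_mono[of S "S \<union> T"] lspan_mono[of T "S \<union> T"] by (intro sub(3)) blast+
    then show "z \<in> lspan R ?Z (S \<union> T)" using z by auto
  qed
  then show ?thesis
    unfolding fg_module_def finitely_generated_iff[OF Z] using Z S T ST by blast
qed

section \<open>Sums of composites through a fixed module\<close>

text \<open>
  With the regular module for \<open>V\<close> these are the maps that factor through a finitely generated
  projective module, and the identity of \<open>X\<close> is such a sum if and only if \<open>X\<close> is a direct summand of a
  finite power of \<open>V\<close>.  An additive functor visibly preserves this form.
\<close>

inductive add_map ::
    "('r, 'c) ring_scheme \<Rightarrow> ('r, 'v, 'd) module_scheme \<Rightarrow> ('r, 'm, 'e) module_scheme
      \<Rightarrow> ('r, 'n, 'f) module_scheme \<Rightarrow> ('m \<Rightarrow> 'n) \<Rightarrow> bool"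
  for R V X Y where
  zero: "(\<And>x. x \<in> carrier X \<Longrightarrow> h x = \<zero>\<^bsub>Y\<^esub>) \<Longrightarrow> add_map R V X Y h"
| step: "add_map R V X Y h \<Longrightarrow> a \<in> module_homs R X V \<Longrightarrow> b \<in> module_homs R V Y \<Longrightarrow>
    (\<And>x. x \<in> carrier X \<Longrightarrow> h' x = h x \<oplus>\<^bsub>Y\<^esub> b (a x)) \<Longrightarrow> add_map R V X Y h'"

abbreviation mem_add ::
    "('r, 'c) ring_scheme \<Rightarrow> ('r, 'v, 'd) module_scheme \<Rightarrow> ('r, 'm, 'e) module_scheme \<Rightarrow> bool" where
  "mem_add R V X \<equiv> add_map R V X X (\<lambda>x. x)"

abbreviation projective_module :: "('r, 'c) ring_scheme \<Rightarrow> ('r, 'm, 'e) module_scheme \<Rightarrow> bool" where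
  "projective_module R X \<equiv> mem_add R (regular_module R) X"

lemma add_map_cong:
  assumes "add_map R V X Y h" "\<And>x. x \<in> carrier X \<Longrightarrow> h x = k x"
  shows "add_map R V X Y k"
  using assms(1)
proof cases
  case zero
  then show ?thesis using assms(2) by (intro add_map.zero) auto
next
  case (step h0 a b)
  then show ?thesis
    by (intro add_map.step[OF step(1-3)]) (use assms(2) in auto)
qed

lemma add_map_hom:
  assumes "add_map R V X Y h" and X: "left_module R X" and Y: "left_module R Y"
  shows "h \<in> module_homs R X Y"
  using assms(1)
proof induction
  case (zero h)
  then show ?case by (intro hom_cong[OF X hom_zero_map[OF Y]]) auto
next
  case (step h a b h')
  show ?case
    by (rule hom_cong[OF X hom_plus[OF X Y step.IH hom_comp[OF step.hyps(2,3)]]]) (use step in auto)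
qed

lemma add_map_single:
  assumes "left_module R Y" "a \<in> module_homs R X V" "b \<in> module_homs R V Y"
  shows "add_map R V X Y (\<lambda>x. b (a x))"
proof -
  interpret Y: left_module R Y by fact
  show ?thesis
    by (rule add_map.step[OF add_map.zero assms(2,3), of "\<lambda>x. \<zero>\<^bsub>Y\<^esub>"])
      (use assms in \<open>auto dest: hom_closed\<close>)
qed

lemma add_map_plus:
  assumes h: "add_map R V X Y h" and "add_map R V X Y k" and X: "left_module R X" and Y: "left_module R Y"
  shows "add_map R V X Y (\<lambda>x. h x \<oplus>\<^bsub>Y\<^esub> k x)"
  using assms(2)
proof induction
  case (zero k)
  interpret Y: left_module R Y by fact
  show ?case
    by (rule add_map_cong[OF h]) (use zero hom_closed[OF add_map_hom[OF h X Y]] in auto)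
next
  case (step k a b k')
  interpret Y: left_module R Y by fact
  show ?case
  proof (rule add_map.step[OF step.IH step.hyps(2,3)])
    fix x assume x: "x \<in> carrier X"
    then have "h x \<in> carrier Y" "k x \<in> carrier Y" "b (a x) \<in> carrier Y"
      using hom_closed[OF add_map_hom[OF h X Y]] hom_closed[OF add_map_hom[OF step(1) X Y]]
        hom_closed[OF step(2)] hom_closed[OF step(3)] by auto
    then show "h x \<oplus>\<^bsub>Y\<^esub> k' x = h x \<oplus>\<^bsub>Y\<^esub> k x \<oplus>\<^bsub>Y\<^esub> b (a x)"
      using step(4)[OF x] by (simp add: Y.M.a_assoc)
  qed
qed

lemma add_map_comp_left:
  assumes "add_map R V X Y h" and X: "left_module R X" and Y: "left_module R Y" and Z: "left_module R Z"
    and g: "g \<in> module_homs R Y Z"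
  shows "add_map R V X Z (\<lambda>x. g (h x))"
  using assms(1)
proof induction
  case (zero h)
  then show ?case using hom_zero[OF g Y Z] by (intro add_map.zero) auto
next
  case (step h a b h')
  show ?case
  proof (rule add_map.step[OF step.IH step(2) hom_comp[OF step(3) g]])
    fix x assume x: "x \<in> carrier X"
    then show "g (h' x) = g (h x) \<oplus>\<^bsub>Z\<^esub> g (b (a x))"
      using step hom_closed[OF add_map_hom[OF step(1) X Y]]
        hom_closed[OF step(2)] hom_closed[OF step(3)] by (auto simp: hom_add[OF g])
  qed
qed

lemma add_map_comp_right:
  assumes "add_map R V X Y h" and f: "f \<in> module_homs R W X"
  shows "add_map R V W Y (\<lambda>x. h (f x))"
  using assms(1)
proof induction
  case (zero h)
  then show ?case using hom_closed[OF f] by (intro add_map.zero) auto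
next
  case (step h a b h')
  show ?case
    by (rule add_map.step[OF step.IH hom_comp[OF f step(2)] step(3)]) (use step(4) hom_closed[OF f] in auto)
qed

text \<open>Write each summand \<open>b \<circ> a\<close> as \<open>b \<circ> id \<circ> a\<close>
  and expand the identity of \<open>V\<close> into composites through \<open>V'\<close>.\<close>

lemma add_map_trans:
  assumes "add_map R V X Y h" and V: "mem_add R V' V"
    and X: "left_module R X" and Y: "left_module R Y" and lV: "left_module R V"
  shows "add_map R V' X Y h"
  using assms(1)
proof induction
  case (zero h)
  then show ?case by (intro add_map.zero) auto
next
  case (step h a b h')
  have "add_map R V' X Y (\<lambda>x. b (a x))"
    by (rule add_map_comp_left[OF add_map_comp_right[OF V step(2)] X lV Y step(3)])
  from add_map_plus[OF step.IH this X Y] show ?case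
    by (rule add_map_cong) (use step(4) in auto)
qed

lemma add_map_retract:
  assumes "left_module R X" "f \<in> module_homs R X V" "g \<in> module_homs R V X"
    "\<And>x. x \<in> carrier X \<Longrightarrow> g (f x) = x"
  shows "mem_add R V X"
  by (rule add_map_cong[OF add_map_single[OF assms(1-3)]]) (use assms(4) in auto)

text \<open>Every summand takes its values in the image of the finitely generated \<open>V\<close>;
  the generators of these images are collected over the sum.\<close>

lemma add_map_fg_image:
  assumes "add_map R V X Y h" and X: "left_module R X" and Y: "left_module R Y" and V: "fg_module R V"
  shows "\<exists>S. finite S \<and> S \<subseteq> carrier Y \<and> h ` carrier X \<subseteq> lspan R Y S"
  using assms(1)
proof induction
  case (zero h)
  then show ?case by (intro exI[of _ "{}"]) (auto intro: lspan.zero)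
next
  case (step h a b h')
  interpret Y: left_module R Y by fact
  obtain S where S: "finite S" "S \<subseteq> carrier Y" "h ` carrier X \<subseteq> lspan R Y S"
    using step.IH by auto
  obtain T where T: "finite T" "T \<subseteq> carrier Y" "b ` carrier V \<subseteq> lspan R Y T"
    using lspan_sub_image[OF fg_module_left[OF V] Y step(3) V] .
  have ST: "S \<union> T \<subseteq> carrier Y" using S T by auto
  note sub = Y.submoduleD[OF submodule_lspan[OF Y ST]]
  have "h' ` carrier X \<subseteq> lspan R Y (S \<union> T)"
  proof (rule image_subsetI)
    fix x assume x: "x \<in> carrier X"
    then have "h x \<in> lspan R Y (S \<union> T)" "b (a x) \<in> lspan R Y (S \<union> T)"
      using S(3) T(3) lspan_mono[of S "S \<union> T" R Y] lspan_mono[of T "S \<union> T" R Y] hom_closed[OF step(2)]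
      by blast+
    then show "h' x \<in> lspan R Y (S \<union> T)" using step(4)[OF x] sub(3) by simp
  qed
  then show ?case using S(1) T(1) ST by blast
qed

lemma add_map_fg_module:
  assumes "mem_add R V X" "left_module R X" "fg_module R V"
  shows "fg_module R X"
  using add_map_fg_image[OF assms(1,2,2,3)] finitely_generated_iff[OF assms(2)] assms(2)
  by (auto simp: fg_module_def)

text \<open>A map \<open>b\<close> out of the regular module is determined by \<open>b 1\<close>;
  choosing a preimage \<open>p\<close> of \<open>b 1\<close> under \<open>g\<close> and replacing
  \<open>b\<close> by \<open>r \<mapsto> r p\<close> lifts one summand. The claim covers all maps of
  this form and not just identities, because the comparison of syzygies has to lift the error term
  \<open>1 - p i\<close> of a stable isomorphism.\<close>

lemma add_map_regular_lift:
  assumes "add_map R (regular_module R) X Y h" and X: "left_module R X" and Y: "left_module R Y"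
    and P: "left_module R P" and g: "g \<in> module_homs R P Y" "g ` carrier P = carrier Y"
  shows "\<exists>h'. add_map R (regular_module R) X P h' \<and> (\<forall>x\<in>carrier X. g (h' x) = h x)"
  using assms(1)
proof induction
  case (zero h)
  then show ?case using hom_zero[OF g(1) P Y]
    by (intro exI[of _ "\<lambda>x. \<zero>\<^bsub>P\<^esub>"]) (auto intro: add_map.zero)
next
  case (step h a b h')
  interpret P: left_module R P by fact
  obtain k where k: "add_map R (regular_module R) X P k" "\<And>x. x \<in> carrier X \<Longrightarrow> g (k x) = h x"
    using step.IH by auto
  have "b \<one>\<^bsub>R\<^esub> \<in> carrier Y" using hom_closed[OF step(3)] by simp
  then obtain p where p: "p \<in> carrier P" "g p = b \<one>\<^bsub>R\<^esub>" using g(2) by (metis imageE)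
  have gb: "g (r \<odot>\<^bsub>P\<^esub> p) = b r" if "r \<in> carrier R" for r
    using hom_regular_eq[OF Y step(3) that] hom_smult[OF g(1) that p(1)] p by simp
  have a: "a x \<in> carrier R" if "x \<in> carrier X" for x using hom_closed[OF step(2) that] by simp
  show ?case
  proof (intro exI conjI ballI)
    show "add_map R (regular_module R) X P (\<lambda>x. k x \<oplus>\<^bsub>P\<^esub> a x \<odot>\<^bsub>P\<^esub> p)"
      by (rule add_map.step[OF k(1) step(2) hom_from_regular[OF P p(1)]]) auto
    fix x assume x: "x \<in> carrier X"
    show "g (k x \<oplus>\<^bsub>P\<^esub> a x \<odot>\<^bsub>P\<^esub> p) = h' x"
      using x k(2) gb a step(4) hom_closed[OF add_map_hom[OF k(1) X P]] p(1)
      by (simp add: hom_add[OF g(1)] P.smult_closed)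
  qed
qed

lemma projective_lift:
  assumes "projective_module R Q" and Q: "left_module R Q" and Y: "left_module R Y"
    and P: "left_module R P" and g: "g \<in> module_homs R P Y" "g ` carrier P = carrier Y"
    and h: "h \<in> module_homs R Q Y"
  obtains h' where "h' \<in> module_homs R Q P" "\<And>x. x \<in> carrier Q \<Longrightarrow> g (h' x) = h x"
proof -
  obtain h' where "add_map R (regular_module R) Q P h'" "\<forall>x\<in>carrier Q. g (h' x) = h x"
    using add_map_regular_lift[OF add_map_comp_left[OF assms(1) Q Q Y h] Q Y P g] by blast
  with that show thesis using add_map_hom[OF _ Q P] by blast
qed


section \<open>Direct powers and direct summands\<close>

lemma direct_power_simps:
  "zero (direct_power n X) = (\<lambda>i. if i < n then \<zero>\<^bsub>X\<^esub> else undefined)"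
  "add (direct_power n X) = (\<lambda>x y i. if i < n then x i \<oplus>\<^bsub>X\<^esub> y i else undefined)"
  "smult (direct_power n X) = (\<lambda>a x i. if i < n then a \<odot>\<^bsub>X\<^esub> x i else undefined)"
  by (simp_all add: direct_power_def fun_eq_iff)

lemma mem_direct_power:
  "x \<in> carrier (direct_power n X) \<longleftrightarrow> (\<forall>i<n. x i \<in> carrier X) \<and> (\<forall>i. \<not> i < n \<longrightarrow> x i = undefined)"
  by (auto simp: direct_power_def PiE_iff extensional_def)

lemma left_module_direct_power:
  assumes "left_module R X"
  shows "left_module R (direct_power n X)"
proof -
  interpret X: left_module R X by fact
  have ag: "abelian_group (direct_power n X)"
  proof (rule abelian_groupI)
    fix x assume x: "x \<in> carrier (direct_power n X)"
    then show "\<exists>y\<in>carrier (direct_power n X). y \<oplus>\<^bsub>direct_power n X\<^esub> x = \<zero>\<^bsub>direct_power n X\<^esub>"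
      by (intro bexI[of _ "\<lambda>i. if i < n then \<ominus>\<^bsub>X\<^esub> x i else undefined"])
        (simp_all add: mem_direct_power direct_power_simps X.M.l_neg cong: if_cong)
  qed (simp_all add: mem_direct_power direct_power_simps fun_eq_iff X.M.a_ac)
  show ?thesis
    by (intro left_module.intro left_module_axioms.intro X.R.ring_axioms ag)
      (simp_all add: mem_direct_power direct_power_simps fun_eq_iff X.smult_closed X.smult_l_distr
        X.smult_r_distr X.smult_assoc X.smult_one)
qed

text \<open>A sum of \<open>n\<close> composites through \<open>V\<close> is one composite through
  the power \<open>V^n\<close>: the maps \<open>a\<close> are the components of \<open>u\<close>,
  and \<open>v\<close> adds up the maps \<open>b\<close>.\<close>

lemma add_map_factor:
  assumes "add_map R V X Y h" and X: "left_module R X" and Y: "left_module R Y" and V: "left_module R V"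
  shows "\<exists>n. \<exists>u\<in>module_homs R X (direct_power n V). \<exists>v\<in>module_homs R (direct_power n V) Y.
    \<forall>x\<in>carrier X. h x = v (u x)"
  using assms(1)
proof induction
  case (zero h)
  have "(\<lambda>x. \<zero>\<^bsub>direct_power 0 V\<^esub>) \<in> module_homs R X (direct_power 0 V)"
    by (rule hom_zero_map[OF left_module_direct_power[OF V]])
  moreover have "(\<lambda>x. \<zero>\<^bsub>Y\<^esub>) \<in> module_homs R (direct_power 0 V) Y"
    by (rule hom_zero_map[OF Y])
  ultimately show ?case using zero
    by (intro exI[of _ 0] bexI[of _ "\<lambda>x. \<zero>\<^bsub>direct_power 0 V\<^esub>"] bexI[of _ "\<lambda>x. \<zero>\<^bsub>Y\<^esub>"]) auto
next
  case (step h a b h')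
  obtain n u v where uv: "u \<in> module_homs R X (direct_power n V)" "v \<in> module_homs R (direct_power n V) Y"
    "\<And>x. x \<in> carrier X \<Longrightarrow> h x = v (u x)"
    using step.IH by auto
  \<comment> \<open>The new component takes index \<open>n\<close>. Elements of a direct power are
    \<open>undefined\<close> outside the index range, so both the extension and the truncation must
    restore that value.\<close>
  let ?u = "\<lambda>x i. if i < n then u x i else if i = n then a x else undefined"
  let ?w = "\<lambda>z i. if i < n then z i else undefined"
  have uc: "\<forall>i<n. u x i \<in> carrier V" "\<forall>i. \<not> i < n \<longrightarrow> u x i = undefined" if "x \<in> carrier X" for x
    using hom_closed[OF uv(1) that] by (simp_all add: mem_direct_power)
  have u': "?u \<in> module_homs R X (direct_power (Suc n) V)"
  proof (rule module_homsI)
    show "?u x \<in> carrier (direct_power (Suc n) V)" if "x \<in> carrier X" for x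
      using uc[OF that] hom_closed[OF step(2) that] by (simp add: mem_direct_power)
  qed (auto simp: direct_power_simps fun_eq_iff hom_add[OF uv(1)] hom_smult[OF uv(1)]
      hom_add[OF step(2)] hom_smult[OF step(2)])
  have w: "?w \<in> module_homs R (direct_power (Suc n) V) (direct_power n V)"
    by (rule module_homsI) (auto simp: direct_power_simps mem_direct_power fun_eq_iff)
  have e: "(\<lambda>z. z n) \<in> module_homs R (direct_power (Suc n) V) V"
    by (rule module_homsI) (auto simp: direct_power_simps mem_direct_power)
  have v': "(\<lambda>z. v (?w z) \<oplus>\<^bsub>Y\<^esub> b (z n)) \<in> module_homs R (direct_power (Suc n) V) Y"
    by (intro hom_plus left_module_direct_power V Y hom_comp[OF w uv(2)] hom_comp[OF e step(3)])
  have "h' x = v (?w (?u x)) \<oplus>\<^bsub>Y\<^esub> b (?u x n)" if "x \<in> carrier X" for x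
  proof -
    have "?w (?u x) = u x" using uc[OF that] by (auto simp: fun_eq_iff)
    then show ?thesis using uv(3)[OF that] step(4)[OF that] by simp
  qed
  then show ?case by (intro exI[of _ "Suc n"] bexI[OF _ u'] bexI[OF _ v']) auto
qed

lemma add_map_direct_power:
  assumes V: "left_module R V"
  shows "mem_add R V (direct_power n V)"
proof -
  interpret V: left_module R V by fact
  let ?P = "direct_power n V"
  \<comment> \<open>\<open>?p k\<close> is the projection onto the first \<open>k\<close>
    coordinates; one more coordinate is one more composite through \<open>V\<close>.\<close>
  let ?p = "\<lambda>k x i. if i < n then if i < k then x i else \<zero>\<^bsub>V\<^esub> else undefined"
  have "add_map R V ?P ?P (?p k)" if "k \<le> n" for k
    using that
  proof (induction k)
    case 0
    show ?case by (intro add_map.zero) (auto simp: direct_power_simps)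
  next
    case (Suc k)
    then have k: "k < n" and IH: "add_map R V ?P ?P (?p k)" by auto
    have a: "(\<lambda>x. x k) \<in> module_homs R ?P V"
      using k by (intro module_homsI) (auto simp: direct_power_simps mem_direct_power)
    have b: "(\<lambda>y i. if i < n then if i = k then y else \<zero>\<^bsub>V\<^esub> else undefined) \<in> module_homs R V ?P"
      by (intro module_homsI) (auto simp: direct_power_simps mem_direct_power fun_eq_iff V.smult_r_null)
    show ?case
      by (rule add_map.step[OF IH a b])
        (use k in \<open>auto simp: direct_power_simps mem_direct_power fun_eq_iff less_Suc_eq\<close>)
  qed
  from this[OF order_refl] show ?thesis
    by (rule add_map_cong) (auto simp: mem_direct_power fun_eq_iff)
qed

text \<open>The complement is the kernel of \<open>g\<close>. It is also the image of
  \<open>Y\<close> under \<open>1 - f g\<close>, which makes it finitely generated without any chain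
  condition. The last clause is recorded because a vanishing complement turns the retraction into an
  isomorphism; indecomposability is always exploited in this way.\<close>

lemma retract_complement:
  fixes K :: "'k ring" and R :: "('k, 'r) module"
  assumes R: "fd_algebra K R" and Y: "fg_module R Y" and X: "left_module R X"
    and f: "f \<in> module_homs R X Y" and g: "g \<in> module_homs R Y X"
    and gf: "\<And>x. x \<in> carrier X \<Longrightarrow> g (f x) = x"
  obtains Z :: "('k, 'r) small_module" where "fg_module R Z" "module_iso R Y (direct_sum X Z)"
    "carrier Z = {\<zero>\<^bsub>Z\<^esub>} \<longrightarrow> (\<forall>y\<in>carrier Y. f (g y) = y)"
proof -
  note lY = fg_module_left[OF Y]
  interpret X: left_module R X by fact
  interpret Y: left_module R Y by fact
  define H where "H = a_kernel Y X g"
  have H: "submodule H R Y" unfolding H_def by (rule submodule_kernel[OF lY X g])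
  note HD = Y.submoduleD[OF H]
  let ?H = "Y\<lparr>carrier := H\<rparr>"
  have lH: "left_module R ?H" by (rule Y.left_module_submodule[OF H])
  have fc: "f x \<in> carrier Y" if "x \<in> carrier X" for x using hom_closed[OF f that] .
  have gc: "g x \<in> carrier X" if "x \<in> carrier Y" for x using hom_closed[OF g that] .
  have eH: "y \<ominus>\<^bsub>Y\<^esub> f (g y) \<in> H" if "y \<in> carrier Y" for y
    using that by (simp add: H_def mem_a_kernel hom_diff[OF g lY X] fc gc gf X.M.minus_self)
  have e0: "(\<lambda>y. y \<ominus>\<^bsub>Y\<^esub> f (g y)) \<in> module_homs R Y Y"
    by (intro hom_minus lY hom_id hom_comp[OF g f])
  have e: "(\<lambda>y. y \<ominus>\<^bsub>Y\<^esub> f (g y)) \<in> module_homs R Y ?H"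
    by (rule hom_corestrict[OF e0 eH])
  have eid: "y \<ominus>\<^bsub>Y\<^esub> f (g y) = y" if "y \<in> H" for y
    using that hom_zero[OF f X lY] by (auto simp: H_def mem_a_kernel a_minus_def)
  have "fg_module R ?H"
  proof (rule fg_module_image[OF Y lH e])
    show "(\<lambda>y. y \<ominus>\<^bsub>Y\<^esub> f (g y)) ` carrier Y = carrier ?H"
      using eH eid HD(1) by force
  qed
  then obtain Z :: "('k, 'r) small_module" and s t where Z: "fg_module R Z"
    and s: "s \<in> module_homs R ?H Z" and t: "t \<in> module_homs R Z ?H"
    and ts: "\<And>x. x \<in> carrier ?H \<Longrightarrow> t (s x) = x" and st: "\<And>y. y \<in> carrier Z \<Longrightarrow> s (t y) = y"
    using small_copyE[OF R] by blast
  have lZ: "left_module R Z" by (rule fg_module_left[OF Z])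
  have t': "t \<in> module_homs R Z Y"
    using hom_comp[OF t hom_incl[OF HD(1)]] by simp
  have tH: "t z \<in> H" if "z \<in> carrier Z" for z using hom_closed[OF t that] by simp
  have tY: "t z \<in> carrier Y" if "z \<in> carrier Z" for z using hom_closed[OF t' that] by simp
  have "module_iso R Y (direct_sum X Z)"
  proof (rule module_isoI)
    show "(\<lambda>y. (g y, s (y \<ominus>\<^bsub>Y\<^esub> f (g y)))) \<in> module_homs R Y (direct_sum X Z)"
      by (rule hom_pair[OF g hom_comp[OF e s]])
    show "(\<lambda>(x, z). f x \<oplus>\<^bsub>Y\<^esub> t z) \<in> module_homs R (direct_sum X Z) Y"
      by (rule hom_copair[OF lY f t'])
    show "(\<lambda>(x, z). f x \<oplus>\<^bsub>Y\<^esub> t z) (g y, s (y \<ominus>\<^bsub>Y\<^esub> f (g y))) = y" if "y \<in> carrier Y" for y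
      using that ts[of "y \<ominus>\<^bsub>Y\<^esub> f (g y)"] eH[OF that] fc gc
      by (simp add: Y.M.minus_plus_cancel Y.M.a_comm[of "f (g y)"])
    fix w assume "w \<in> carrier (direct_sum X Z)"
    then obtain x z where w: "w = (x, z)" "x \<in> carrier X" "z \<in> carrier Z" by auto
    have 0: "g (t z) = \<zero>\<^bsub>X\<^esub>" using tH[OF w(3)] by (simp add: H_def mem_a_kernel)
    have 1: "g (f x \<oplus>\<^bsub>Y\<^esub> t z) = x"
      using w fc tY by (simp add: hom_add[OF g] gf 0)
    have "f x \<oplus>\<^bsub>Y\<^esub> t z \<ominus>\<^bsub>Y\<^esub> f x = t z"
      using w fc tY by (simp add: Y.M.plus_minus_cancel Y.M.a_comm[of "f x"])
    then show "(\<lambda>y. (g y, s (y \<ominus>\<^bsub>Y\<^esub> f (g y)))) ((\<lambda>(x, z). f x \<oplus>\<^bsub>Y\<^esub> t z) w) = w"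
      using w 1 st by simp
  qed
  moreover have "f (g y) = y" if "carrier Z = {\<zero>\<^bsub>Z\<^esub>}" "y \<in> carrier Y" for y
  proof -
    have "s (y \<ominus>\<^bsub>Y\<^esub> f (g y)) \<in> carrier Z" using hom_closed[OF s] eH[OF that(2)] by simp
    then have "s (y \<ominus>\<^bsub>Y\<^esub> f (g y)) = \<zero>\<^bsub>Z\<^esub>" using that by simp
    then have "y \<ominus>\<^bsub>Y\<^esub> f (g y) = t \<zero>\<^bsub>Z\<^esub>" using ts[of "y \<ominus>\<^bsub>Y\<^esub> f (g y)"] eH[OF that(2)] by simp
    then have "y \<ominus>\<^bsub>Y\<^esub> f (g y) = \<zero>\<^bsub>Y\<^esub>" using hom_zero[OF t' lZ lY] by simp
    then show ?thesis using that fc gc by (simp add: Y.M.minus_eq_zero_iff)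
  qed
  ultimately show thesis using that Z by blast
qed

lemma direct_summand_retract:
  fixes R :: "('k, 'r) module"
  assumes "direct_summand R X Y" "left_module R X" "left_module R Y"
  obtains f g where "f \<in> module_homs R X Y" "g \<in> module_homs R Y X" "\<And>x. x \<in> carrier X \<Longrightarrow> g (f x) = x"
proof -
  obtain Z :: "('k, 'r) small_module" where Z: "fg_module R Z" "module_iso R Y (direct_sum X Z)"
    using assms(1) by (auto simp: direct_summand_def)
  note lZ = fg_module_left[OF Z(1)]
  interpret Z: left_module R Z by fact
  obtain \<phi> \<psi> where p: "\<phi> \<in> module_homs R Y (direct_sum X Z)" "\<psi> \<in> module_homs R (direct_sum X Z) Y"
    "\<And>z. z \<in> carrier (direct_sum X Z) \<Longrightarrow> \<phi> (\<psi> z) = z"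
    using module_isoE[OF Z(2) assms(3) left_module_direct_sum[OF assms(2) lZ]] by metis
  show thesis
  proof (rule that)
    show "(\<lambda>x. \<psi> (x, \<zero>\<^bsub>Z\<^esub>)) \<in> module_homs R X Y"
      by (intro hom_comp[OF _ p(2)] hom_pair hom_id hom_zero_map lZ)
    show "(\<lambda>y. fst (\<phi> y)) \<in> module_homs R Y X"
      by (rule hom_comp[OF p(1) hom_fst])
    show "fst (\<phi> (\<psi> (x, \<zero>\<^bsub>Z\<^esub>))) = x" if "x \<in> carrier X" for x
      using p(3)[of "(x, \<zero>\<^bsub>Z\<^esub>)"] that by simp
  qed
qed

lemma direct_summandI:
  fixes K :: "'k ring" and R :: "('k, 'r) module"
  assumes "fd_algebra K R" "fg_module R Y" "left_module R X"
    and "f \<in> module_homs R X Y" "g \<in> module_homs R Y X" "\<And>x. x \<in> carrier X \<Longrightarrow> g (f x) = x"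
  shows "direct_summand R X Y"
  using retract_complement[OF assms] unfolding direct_summand_def by metis

lemma in_add_add_map:
  assumes "in_add R V X" "left_module R V"
  shows "mem_add R V X"
proof -
  obtain m where m: "direct_summand R X (direct_power m V)" "fg_module R X"
    using assms(1) by (auto simp: in_add_def)
  note X = fg_module_left[OF m(2)]
  note P = left_module_direct_power[OF assms(2), of m]
  obtain f g where fg: "f \<in> module_homs R X (direct_power m V)" "g \<in> module_homs R (direct_power m V) X"
    "\<And>x. x \<in> carrier X \<Longrightarrow> g (f x) = x"
    using direct_summand_retract[OF m(1) X P] by blast
  have "add_map R V X X (\<lambda>x. g (f x))"
    by (rule add_map_comp_left[OF add_map_comp_right[OF add_map_direct_power[OF assms(2)] fg(1)] X P X fg(2)])
  then show ?thesis by (rule add_map_cong) (use fg(3) in auto)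
qed

lemma in_addI:
  fixes K :: "'k ring" and R :: "('k, 'r) module"
  assumes R: "fd_algebra K R" and V: "fg_module R V" and X: "left_module R X"
    and "mem_add R V X"
  shows "in_add R V X"
proof -
  note lV = fg_module_left[OF V]
  obtain n u v where "u \<in> module_homs R X (direct_power n V)" "v \<in> module_homs R (direct_power n V) X"
    "\<forall>x\<in>carrier X. x = v (u x)"
    using add_map_factor[OF assms(4) X X lV] by blast
  moreover have "fg_module R (direct_power n V)"
    by (rule add_map_fg_module[OF add_map_direct_power[OF lV] left_module_direct_power[OF lV] V])
  ultimately have "direct_summand R X (direct_power n V)"
    using X by (intro direct_summandI[OF R]) auto
  then show ?thesis
    using add_map_fg_module[OF assms(4) X V] by (auto simp: in_add_def)
qed

lemma fg_projective_in_add: "fg_projective R P \<longleftrightarrow> in_add R (regular_module R) P"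
  by (simp add: fg_projective_def in_add_def)

lemma fg_projective_add_map: 
  "fg_projective R P \<Longrightarrow> projective_module R P"
  using in_add_add_map[of R "regular_module R" P] left_module_regular[of R] left_module_ring[of R P]
  by (simp add: fg_projective_in_add in_add_def fg_module_def)

lemma fd_algebra_ring: "fd_algebra K R \<Longrightarrow> ring R"
  by (simp add: fd_algebra_def)

lemma fg_projectiveI:
  assumes "fd_algebra K R" "left_module R P" "projective_module R P"
  shows "fg_projective R P"
  unfolding fg_projective_in_add
  using in_addI[OF assms(1) fg_module_regular[OF fd_algebra_ring[OF assms(1)]] assms(2,3)] .

lemma factors_through_projective_add_map:
  fixes R :: "('k, 'r) module"
  assumes "factors_through_projective R X Y h" "left_module R X" "left_module R Y"
  shows "add_map R (regular_module R) X Y h"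
proof -
  obtain P :: "('k, 'r) small_module" and u v where P: "fg_projective R P" "u \<in> module_homs R X P" "v \<in> module_homs R P Y"
    "\<And>x. x \<in> carrier X \<Longrightarrow> h x = v (u x)"
    using assms(1) by (auto simp: factors_through_projective_def)
  have lP: "left_module R P" using P(1) by (simp add: fg_projective_def fg_module_def)
  have "add_map R (regular_module R) X Y (\<lambda>x. v (u x))"
    by (rule add_map_comp_left[OF add_map_comp_right[OF fg_projective_add_map[OF P(1)] P(2)]
      assms(2) lP assms(3) P(3)])
  then show ?thesis by (rule add_map_cong) (use P(4) in auto)
qed

text \<open>Collects a sum of composites into a single projective from the universe. The
  construction of an exact sequence from a stable isomorphism needs one such module as a direct
  summand.\<close>

lemma add_map_free:
  fixes K :: "'k ring" and R :: "('k, 'r) module"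
  assumes R: "fd_algebra K R" and "add_map R (regular_module R) X Y h"
    and X: "left_module R X" and Y: "left_module R Y"
  obtains P :: "('k, 'r) small_module" and u v where "fg_projective R P"
    "u \<in> module_homs R X P" "v \<in> module_homs R P Y" "\<And>x. x \<in> carrier X \<Longrightarrow> h x = v (u x)"
proof -
  note rg = fg_module_regular[OF fd_algebra_ring[OF R]]
  note lr = fg_module_left[OF rg]
  obtain n u v where uv: "u \<in> module_homs R X (direct_power n (regular_module R))"
    "v \<in> module_homs R (direct_power n (regular_module R)) Y" "\<And>x. x \<in> carrier X \<Longrightarrow> h x = v (u x)"
    using add_map_factor[OF assms(2) X Y lr] by blast
  let ?F = "direct_power n (regular_module R)"
  note lF = left_module_direct_power[OF lr, of n]
  have "fg_module R ?F"
    by (rule add_map_fg_module[OF add_map_direct_power[OF lr] lF rg])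
  then obtain P :: "('k, 'r) small_module" and s t where P: "fg_module R P"
    and s: "s \<in> module_homs R ?F P" and t: "t \<in> module_homs R P ?F"
    and ts: "\<And>x. x \<in> carrier ?F \<Longrightarrow> t (s x) = x" and st: "\<And>y. y \<in> carrier P \<Longrightarrow> s (t y) = y"
    using small_copyE[OF R] by blast
  note lP = fg_module_left[OF P]
  have "add_map R (regular_module R) P P (\<lambda>x. s (t x))"
    by (rule add_map_comp_left[OF add_map_comp_right[OF add_map_direct_power[OF lr] t] lP lF lP s])
  then have "projective_module R P"
    by (rule add_map_cong) (simp add: st)
  from fg_projectiveI[OF R lP this] have "fg_projective R P" .
  moreover have "h x = v (t (s (u x)))" if "x \<in> carrier X" for x
    using uv(3)[OF that] ts[OF hom_closed[OF uv(1) that]] by simp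
  ultimately show thesis
    using that[of P "\<lambda>x. s (u x)" "\<lambda>x. v (t x)"] hom_comp[OF uv(1) s] hom_comp[OF t uv(2)] by blast
qed


section \<open>Stable isomorphisms and syzygies\<close>

text \<open>Same notion as \<open>stably_isomorphic\<close>, with the factorisation through a
  projective in the form \<open>add_map\<close>: no module from the universe is mentioned, and
  tensor functors preserve this form.\<close>

definition stable_iso ::
    "('r, 'c) ring_scheme \<Rightarrow> ('r, 'm, 'd) module_scheme \<Rightarrow> ('r, 'n, 'e) module_scheme \<Rightarrow> bool" where
  "stable_iso R X Y \<longleftrightarrow> (\<exists>f\<in>module_homs R X Y. \<exists>g\<in>module_homs R Y X.
    add_map R (regular_module R) X X (\<lambda>x. x \<ominus>\<^bsub>X\<^esub> g (f x)) \<and>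
    add_map R (regular_module R) Y Y (\<lambda>y. y \<ominus>\<^bsub>Y\<^esub> f (g y)))"

lemma stably_isomorphic_stable_iso:
  assumes "stably_isomorphic R X Y" "left_module R X" "left_module R Y"
  shows "stable_iso R X Y"
  using assms factors_through_projective_add_map[of R X X] factors_through_projective_add_map[of R Y Y]
  unfolding stably_isomorphic_def stable_iso_def by blast

lemma stable_iso_sym: "stable_iso R X Y \<Longrightarrow> stable_iso R Y X"
  unfolding stable_iso_def by blast

lemma module_iso_stable_iso:
  assumes "module_iso R X Y" and X: "left_module R X" and Y: "left_module R Y"
  shows "stable_iso R X Y"
proof -
  interpret X: left_module R X by fact
  interpret Y: left_module R Y by fact
  obtain f g where fg: "f \<in> module_homs R X Y" "g \<in> module_homs R Y X"
    "\<And>x. x \<in> carrier X \<Longrightarrow> g (f x) = x" "\<And>y. y \<in> carrier Y \<Longrightarrow> f (g y) = y"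
    using module_isoE[OF assms] by blast
  show ?thesis unfolding stable_iso_def
    by (intro bexI[OF _ fg(1)] bexI[OF _ fg(2)] conjI add_map.zero)
      (auto simp: fg X.M.minus_self Y.M.minus_self)
qed

text \<open>The error terms combine by \<open>1 - g g' f' f = (1 - g f) + g (1 - g' f') f\<close>.
  Both directions of transitivity are instances.\<close>

lemma stable_comp_half:
  assumes X: "left_module R X" and Y: "left_module R Y"
    and f: "f \<in> module_homs R X Y" and g: "g \<in> module_homs R Y X"
    and f': "f' \<in> module_homs R Y Z" and g': "g' \<in> module_homs R Z Y"
    and 1: "add_map R V X X (\<lambda>x. x \<ominus>\<^bsub>X\<^esub> g (f x))" and 2: "add_map R V Y Y (\<lambda>y. y \<ominus>\<^bsub>Y\<^esub> g' (f' y))"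
  shows "add_map R V X X (\<lambda>x. x \<ominus>\<^bsub>X\<^esub> g (g' (f' (f x))))"
proof (rule add_map_cong[OF add_map_plus[OF 1 add_map_comp_left[OF add_map_comp_right[OF 2 f] X Y X g] X X]])
  interpret X: left_module R X by fact
  fix x assume x: "x \<in> carrier X"
  have c: "f x \<in> carrier Y" "g' (f' (f x)) \<in> carrier Y"
    using x hom_closed f f' g' by metis+
  then have c': "g (f x) \<in> carrier X" "g (g' (f' (f x))) \<in> carrier X"
    using hom_closed[OF g] by auto
  have "x \<ominus>\<^bsub>X\<^esub> g (f x) \<oplus>\<^bsub>X\<^esub> (g (f x) \<ominus>\<^bsub>X\<^esub> g (g' (f' (f x)))) = x \<ominus>\<^bsub>X\<^esub> g (g' (f' (f x)))"
    using x c' by (metis X.M.a_assoc X.M.minus_closed X.M.minus_plus_cancel a_minus_def X.M.a_inv_closed)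
  then show "x \<ominus>\<^bsub>X\<^esub> g (f x) \<oplus>\<^bsub>X\<^esub> g (f x \<ominus>\<^bsub>Y\<^esub> g' (f' (f x))) = x \<ominus>\<^bsub>X\<^esub> g (g' (f' (f x)))"
    using c by (simp add: hom_diff[OF g Y X])
qed

lemma stable_iso_trans:
  assumes "stable_iso R X Y" "stable_iso R Y Z"
    and X: "left_module R X" and Y: "left_module R Y" and Z: "left_module R Z"
  shows "stable_iso R X Z"
proof -
  obtain f g where 1: "f \<in> module_homs R X Y" "g \<in> module_homs R Y X"
    "add_map R (regular_module R) X X (\<lambda>x. x \<ominus>\<^bsub>X\<^esub> g (f x))"
    "add_map R (regular_module R) Y Y (\<lambda>y. y \<ominus>\<^bsub>Y\<^esub> f (g y))"
    using assms(1) by (auto simp: stable_iso_def)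
  obtain f' g' where 2: "f' \<in> module_homs R Y Z" "g' \<in> module_homs R Z Y"
    "add_map R (regular_module R) Y Y (\<lambda>x. x \<ominus>\<^bsub>Y\<^esub> g' (f' x))"
    "add_map R (regular_module R) Z Z (\<lambda>y. y \<ominus>\<^bsub>Z\<^esub> f' (g' y))"
    using assms(2) by (auto simp: stable_iso_def)
  show ?thesis unfolding stable_iso_def
    by (intro bexI[OF _ hom_comp[OF 1(1) 2(1)]] bexI[OF _ hom_comp[OF 2(2) 1(2)]] conjI
      stable_comp_half[OF X Y 1(1,2) 2(1,2) 1(3) 2(3)] stable_comp_half[OF Z Y 2(2,1) 1(2,1) 2(4) 1(4)])
qed

section \<open>Short exact sequences and uniqueness of syzygies up to stable isomorphism\<close>

lemma short_exactD:
  assumes "short_exact R L M N f g"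
  shows "f \<in> module_homs R L M" "g \<in> module_homs R M N" "inj_on f (carrier L)"
    "\<And>x. x \<in> carrier L \<Longrightarrow> g (f x) = \<zero>\<^bsub>N\<^esub>"
    "\<And>y. y \<in> carrier M \<Longrightarrow> g y = \<zero>\<^bsub>N\<^esub> \<Longrightarrow> \<exists>x\<in>carrier L. f x = y"
    "g ` carrier M = carrier N"
proof -
  show "f \<in> module_homs R L M" "g \<in> module_homs R M N" "inj_on f (carrier L)" "g ` carrier M = carrier N"
    using assms by (auto simp: short_exact_def)
  have im: "f ` carrier L = a_kernel M N g" using assms by (simp add: short_exact_def)
  show "g (f x) = \<zero>\<^bsub>N\<^esub>" if "x \<in> carrier L" for x
    using im that by (metis imageI mem_a_kernel)
  show "\<exists>x\<in>carrier L. f x = y" if "y \<in> carrier M" "g y = \<zero>\<^bsub>N\<^esub>" for y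
  proof -
    have "y \<in> f ` carrier L" unfolding im using that by (simp add: mem_a_kernel)
    then show ?thesis by blast
  qed
qed

lemma short_exactI:
  assumes "f \<in> module_homs R L M" "g \<in> module_homs R M N" "inj_on f (carrier L)"
    "\<And>x. x \<in> carrier L \<Longrightarrow> g (f x) = \<zero>\<^bsub>N\<^esub>"
    "\<And>y. y \<in> carrier M \<Longrightarrow> g y = \<zero>\<^bsub>N\<^esub> \<Longrightarrow> \<exists>x\<in>carrier L. f x = y"
    "\<And>y. y \<in> carrier N \<Longrightarrow> \<exists>x\<in>carrier M. g x = y"
  shows "short_exact R L M N f g"
proof -
  have "f ` carrier L = a_kernel M N g"
    using assms(1,4,5) by (force simp: mem_a_kernel hom_closed)
  moreover have "g ` carrier M = carrier N"
    using assms(2,6) by (force simp: hom_closed)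
  ultimately show ?thesis using assms(1-3) by (simp add: short_exact_def)
qed

text \<open>The universal property of the kernel: preimages under \<open>j\<close> are unique, and
  injectivity of \<open>j\<close> transfers linearity from \<open>e\<close> to the map of
  preimages.\<close>

lemma short_exact_kernel_lift:
  assumes ex: "short_exact R L M N j \<pi>" and L: "left_module R L" and M: "left_module R M"
    and T: "left_module R T"
    and e: "e \<in> module_homs R T M" "\<And>t. t \<in> carrier T \<Longrightarrow> \<pi> (e t) = \<zero>\<^bsub>N\<^esub>"
  obtains e' where "e' \<in> module_homs R T L" "\<And>t. t \<in> carrier T \<Longrightarrow> j (e' t) = e t"
proof -
  note E = short_exactD[OF ex]
  interpret L: left_module R L by fact
  interpret T: left_module R T by fact
  define e' where "e' = (\<lambda>t. inv_into (carrier L) j (e t))"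
  have je: "j (e' t) = e t \<and> e' t \<in> carrier L" if "t \<in> carrier T" for t
  proof -
    have "e t \<in> j ` carrier L" using E(5)[OF hom_closed[OF e(1) that] e(2)[OF that]] by (metis imageI)
    then show ?thesis by (simp add: e'_def f_inv_into_f inv_into_into)
  qed
  have "e' \<in> module_homs R T L"
  proof (rule module_homsI)
    fix x y assume xy: "x \<in> carrier T" "y \<in> carrier T"
    have "j (e' (x \<oplus>\<^bsub>T\<^esub> y)) = j (e' x \<oplus>\<^bsub>L\<^esub> e' y)"
      using je xy by (simp add: hom_add[OF E(1)] hom_add[OF e(1)])
    then show "e' (x \<oplus>\<^bsub>T\<^esub> y) = e' x \<oplus>\<^bsub>L\<^esub> e' y"
      using je xy by (intro inj_onD[OF E(3)]) auto
  next
    fix a x assume xy: "a \<in> carrier R" "x \<in> carrier T"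
    have "j (e' (a \<odot>\<^bsub>T\<^esub> x)) = j (a \<odot>\<^bsub>L\<^esub> e' x)"
      using je xy by (simp add: hom_smult[OF E(1)] hom_smult[OF e(1)] T.smult_closed)
    then show "e' (a \<odot>\<^bsub>T\<^esub> x) = a \<odot>\<^bsub>L\<^esub> e' x"
      using je xy by (intro inj_onD[OF E(3)]) (auto simp: T.smult_closed L.smult_closed)
  qed (use je in auto)
  with that je show thesis by blast
qed

text \<open>The error \<open>1 - p i\<close> on \<open>L\<close> factors through a projective and
  lifts along \<open>\<pi>\<close> to a map \<open>h\<close>. Then \<open>1 - P I - h \<pi>\<close>
  on \<open>Q\<close> is killed by \<open>\<pi>\<close> and comes from a map \<open>e'\<close> into
  \<open>W\<close>. On \<open>W\<close> the term with \<open>h\<close> disappears because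
  \<open>\<pi> j = 0\<close>, so \<open>1 - \<psi> \<phi> = e' j\<close> passes through the
  projective \<open>Q\<close>.\<close>

lemma syzygy_stable_half:
  assumes ex: "short_exact R W Q L j \<pi>"
    and W: "left_module R W" and Q: "left_module R Q" and L: "left_module R L"
    and Q': "left_module R Q'"
    and pQ: "projective_module R Q"
    and i: "i \<in> module_homs R L L'" and p: "p \<in> module_homs R L' L"
    and pi: "add_map R (regular_module R) L L (\<lambda>x. x \<ominus>\<^bsub>L\<^esub> p (i x))"
    and I: "I \<in> module_homs R Q Q'" "\<And>x. x \<in> carrier Q \<Longrightarrow> \<pi>' (I x) = i (\<pi> x)"
    and P: "P \<in> module_homs R Q' Q" "\<And>x. x \<in> carrier Q' \<Longrightarrow> \<pi> (P x) = p (\<pi>' x)"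
    and \<phi>: "\<phi> \<in> module_homs R W W'" "\<And>x. x \<in> carrier W \<Longrightarrow> j' (\<phi> x) = I (j x)"
    and \<psi>: "\<psi> \<in> module_homs R W' W" "\<And>x. x \<in> carrier W' \<Longrightarrow> j (\<psi> x) = P (j' x)"
  shows "add_map R (regular_module R) W W (\<lambda>x. x \<ominus>\<^bsub>W\<^esub> \<psi> (\<phi> x))"
proof -
  interpret Q: left_module R Q by fact
  interpret L: left_module R L by fact
  interpret W: left_module R W by fact
  note E = short_exactD[OF ex]
  obtain h where h: "add_map R (regular_module R) L Q h" "\<forall>x\<in>carrier L. \<pi> (h x) = x \<ominus>\<^bsub>L\<^esub> p (i x)"
    using add_map_regular_lift[OF pi L L Q E(2,6)] by blast
  note hh = add_map_hom[OF h(1) L Q]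
  define e where "e = (\<lambda>x. (x \<ominus>\<^bsub>Q\<^esub> P (I x)) \<ominus>\<^bsub>Q\<^esub> h (\<pi> x))"
  have eh: "e \<in> module_homs R Q Q" unfolding e_def
    by (intro hom_minus Q hom_id hom_comp[OF I(1) P(1)] hom_comp[OF E(2) hh])
  have c: "P (I x) \<in> carrier Q" "h (\<pi> x) \<in> carrier Q" "\<pi> x \<in> carrier L" "p (i (\<pi> x)) \<in> carrier L"
    "I x \<in> carrier Q'"
    if "x \<in> carrier Q" for x
    using that hom_closed[OF P(1)] hom_closed[OF I(1)] hom_closed[OF hh] hom_closed[OF E(2)]
      hom_closed[OF p] hom_closed[OF i] by auto
  have "\<pi> (e x) = \<zero>\<^bsub>L\<^esub>" if "x \<in> carrier Q" for x
    using that c[OF that] h(2) I(2) P(2)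
    by (simp add: e_def hom_diff[OF E(2) Q L] L.M.minus_self)
  then obtain e' where e': "e' \<in> module_homs R Q W" "\<And>x. x \<in> carrier Q \<Longrightarrow> j (e' x) = e x"
    using short_exact_kernel_lift[OF ex W Q Q eh] by blast
  have "add_map R (regular_module R) W W (\<lambda>x. e' (j x))"
    by (rule add_map_comp_left[OF add_map_comp_right[OF pQ E(1)] W Q W e'(1)])
  then show ?thesis
  proof (rule add_map_cong)
    fix x assume x: "x \<in> carrier W"
    note jx = hom_closed[OF E(1) x] and px = hom_closed[OF \<phi>(1) x]
    note ppx = hom_closed[OF \<psi>(1) px]
    have "j (x \<ominus>\<^bsub>W\<^esub> \<psi> (\<phi> x)) = j x \<ominus>\<^bsub>Q\<^esub> P (I (j x))"
      using x px ppx by (simp add: hom_diff[OF E(1) W Q] \<psi>(2) \<phi>(2))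
    also have "\<dots> = e (j x)"
      using c[OF jx] jx E(4)[OF x] hom_zero[OF hh L Q] by (simp add: e_def a_minus_def)
    also have "\<dots> = j (e' (j x))" using e'(2)[OF jx] by simp
    finally show "e' (j x) = x \<ominus>\<^bsub>W\<^esub> \<psi> (\<phi> x)"
      using x ppx hom_closed[OF e'(1) jx] by (intro inj_onD[OF E(3)]) auto
  qed
qed

text \<open>Schanuel's lemma in stable form: a stable isomorphism between the modules is lifted to
  the projective terms and restricted to the kernels. With equal modules it shows that the choice of
  presentation does not matter stably.\<close>

lemma is_syzygy_stable_iso:
  fixes R :: "('k, 'r) module"
  assumes "is_syzygy R L W" "is_syzygy R L' W'" "stable_iso R L L'"
    and L: "left_module R L" and L': "left_module R L'"
  shows "stable_iso R W W'"
proof -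
  obtain Q :: "('k, 'r) small_module" and j \<pi> where Q: "fg_projective R Q" "short_exact R W Q L j \<pi>" and fW: "fg_module R W"
    using assms(1) by (auto simp: is_syzygy_def)
  obtain Q' :: "('k, 'r) small_module" and j' \<pi>' where Q': "fg_projective R Q'" "short_exact R W' Q' L' j' \<pi>'" and fW': "fg_module R W'"
    using assms(2) by (auto simp: is_syzygy_def)
  obtain i p where ip: "i \<in> module_homs R L L'" "p \<in> module_homs R L' L"
    "add_map R (regular_module R) L L (\<lambda>x. x \<ominus>\<^bsub>L\<^esub> p (i x))"
    "add_map R (regular_module R) L' L' (\<lambda>x. x \<ominus>\<^bsub>L'\<^esub> i (p x))"
    using assms(3) by (auto simp: stable_iso_def)
  note W = fg_module_left[OF fW] and W' = fg_module_left[OF fW']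
  have lQ: "left_module R Q" and lQ': "left_module R Q'"
    using Q(1) Q'(1) by (auto simp: fg_projective_def fg_module_def)
  note E = short_exactD[OF Q(2)] and E' = short_exactD[OF Q'(2)]
  note pQ = fg_projective_add_map[OF Q(1)] and pQ' = fg_projective_add_map[OF Q'(1)]
  obtain I where I: "I \<in> module_homs R Q Q'" "\<And>x. x \<in> carrier Q \<Longrightarrow> \<pi>' (I x) = i (\<pi> x)"
    using projective_lift[OF pQ lQ L' lQ' E'(2,6) hom_comp[OF E(2) ip(1)]] by blast
  obtain P where P: "P \<in> module_homs R Q' Q" "\<And>x. x \<in> carrier Q' \<Longrightarrow> \<pi> (P x) = p (\<pi>' x)"
    using projective_lift[OF pQ' lQ' L lQ E(2,6) hom_comp[OF E'(2) ip(2)]] by blast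
  have "\<pi>' (I (j x)) = \<zero>\<^bsub>L'\<^esub>" if "x \<in> carrier W" for x
    using that I(2) E(4) hom_closed[OF E(1)] hom_zero[OF ip(1) L L'] by simp
  then obtain \<phi> where \<phi>: "\<phi> \<in> module_homs R W W'" "\<And>x. x \<in> carrier W \<Longrightarrow> j' (\<phi> x) = I (j x)"
    using short_exact_kernel_lift[OF Q'(2) W' lQ' W hom_comp[OF E(1) I(1)]] by blast
  have "\<pi> (P (j' x)) = \<zero>\<^bsub>L\<^esub>" if "x \<in> carrier W'" for x
    using that P(2) E'(4) hom_closed[OF E'(1)] hom_zero[OF ip(2) L' L] by simp
  then obtain \<psi> where \<psi>: "\<psi> \<in> module_homs R W' W" "\<And>x. x \<in> carrier W' \<Longrightarrow> j (\<psi> x) = P (j' x)"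
    using short_exact_kernel_lift[OF Q(2) W lQ W' hom_comp[OF E'(1) P(1)]] by blast
  have "add_map R (regular_module R) W W (\<lambda>x. x \<ominus>\<^bsub>W\<^esub> \<psi> (\<phi> x))"
    by (rule syzygy_stable_half[OF Q(2) W lQ L lQ' pQ ip(1,2,3) I(1) _ P(1) _ \<phi>(1) _ \<psi>(1)])
      (use I P \<phi> \<psi> in auto)
  moreover have "add_map R (regular_module R) W' W' (\<lambda>x. x \<ominus>\<^bsub>W'\<^esub> \<phi> (\<psi> x))"
    by (rule syzygy_stable_half[OF Q'(2) W' lQ' L' lQ pQ' ip(2,1,4) P(1) _ I(1) _ \<psi>(1) _ \<phi>(1)])
      (use I P \<phi> \<psi> in auto)
  ultimately show ?thesis
    using \<phi>(1) \<psi>(1) by (auto simp: stable_iso_def)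
qed

lemma is_nth_syzygy_fg: "is_nth_syzygy R n L W \<Longrightarrow> fg_module R W"
  by (cases n) (auto simp: is_syzygy_def)

lemma is_nth_syzygy_stable_iso:
  assumes "is_nth_syzygy R n L W" "is_nth_syzygy R n L' W'" "stable_iso R L L'"
    and L: "left_module R L" and L': "left_module R L'"
  shows "stable_iso R W W'"
  using assms(1,2)
proof (induction n arbitrary: W W')
  case 0
  then have W: "left_module R W" "left_module R W'" and i: "module_iso R W L" "module_iso R W' L'"
    by (auto simp: fg_module_def)
  note s = module_iso_stable_iso[OF i(1) W(1) L] stable_iso_sym[OF module_iso_stable_iso[OF i(2) W(2) L']]
  show ?case
    by (rule stable_iso_trans[OF stable_iso_trans[OF s(1) assms(3) W(1) L L'] s(2) W(1) L' W(2)])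
next
  case (Suc n)
  then obtain X X' where X: "is_nth_syzygy R n L X" "is_syzygy R X W"
    "is_nth_syzygy R n L' X'" "is_syzygy R X' W'" by auto
  show ?case
    by (rule is_syzygy_stable_iso[OF X(2,4) Suc.IH[OF X(1,3)]])
      (use is_nth_syzygy_fg X fg_module_left in blast)+
qed

lemma is_nth_syzygy_iso_base:
  assumes "is_nth_syzygy R n L W" "module_iso R L L'"
  shows "is_nth_syzygy R n L' W"
  using assms(1)
  by (induction n arbitrary: W) (auto intro: module_iso_trans[OF _ assms(2)])

text \<open>The recursion peels off the last syzygy taken, so the induction runs over
  \<open>n\<close>, the number of steps after the intermediate module.\<close>

lemma is_nth_syzygy_add:
  "is_nth_syzygy R (n + m) L W \<Longrightarrow> \<exists>L'. is_nth_syzygy R m L L' \<and> is_nth_syzygy R n L' W"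
proof (induction n arbitrary: W)
  case 0
  then show ?case using is_nth_syzygy_fg module_iso_refl by force
next
  case (Suc n)
  then obtain X where X: "is_nth_syzygy R (n + m) L X" "is_syzygy R X W" by auto
  from Suc.IH[OF X(1)] X(2) show ?case by auto
qed

section \<open>Restriction of scalars\<close>

definition restrict_scalars :: "('r \<Rightarrow> 's) \<Rightarrow> ('s, 'm, 'd) module_scheme \<Rightarrow> ('r, 'm) module" where
  "restrict_scalars \<rho> X = \<lparr>carrier = carrier X, mult = undefined, one = undefined, zero = zero X,
    add = add X, smult = (\<lambda>r x. \<rho> r \<odot>\<^bsub>X\<^esub> x)\<rparr>"

lemma restrict_scalars_simps [simp]:
  "carrier (restrict_scalars \<rho> X) = carrier X" "zero (restrict_scalars \<rho> X) = zero X"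
  "add (restrict_scalars \<rho> X) = add X" "smult (restrict_scalars \<rho> X) r x = \<rho> r \<odot>\<^bsub>X\<^esub> x"
  by (simp_all add: restrict_scalars_def)

lemma left_module_restrict_scalars:
  assumes "ring R" "\<rho> \<in> ring_hom R S" "left_module S X"
  shows "left_module R (restrict_scalars \<rho> X)"
proof -
  interpret X: left_module S X by fact
  interpret R: ring R by fact
  have "abelian_group (restrict_scalars \<rho> X)"
  proof (rule abelian_groupI)
    fix x assume "x \<in> carrier (restrict_scalars \<rho> X)"
    then show "\<exists>y\<in>carrier (restrict_scalars \<rho> X). y \<oplus>\<^bsub>restrict_scalars \<rho> X\<^esub> x = \<zero>\<^bsub>restrict_scalars \<rho> X\<^esub>"
      by (intro bexI[of _ "\<ominus>\<^bsub>X\<^esub> x"]) (simp_all add: X.M.l_neg)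
  qed (simp_all add: X.M.a_ac)
  then show ?thesis
    using ring_hom_closed[OF assms(2)] ring_hom_add[OF assms(2)] ring_hom_mult[OF assms(2)]
      ring_hom_one[OF assms(2)]
    by (intro left_module.intro left_module_axioms.intro R.ring_axioms)
      (simp_all add: X.smult_closed X.smult_l_distr X.smult_r_distr X.smult_assoc X.smult_one)
qed

lemma hom_restrict_scalars:
  assumes "\<rho> \<in> ring_hom R S" "f \<in> module_homs S X Y"
  shows "f \<in> module_homs R (restrict_scalars \<rho> X) (restrict_scalars \<rho> Y)"
  using ring_hom_closed[OF assms(1)]
  by (intro module_homsI) (simp_all add: hom_closed[OF assms(2)] hom_add[OF assms(2)] hom_smult[OF assms(2)])

lemma submodule_restrict_scalars:
  assumes "ring R" "\<rho> \<in> ring_hom R S" "left_module S X" "submodule H S X"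
  shows "submodule H R (restrict_scalars \<rho> X)"
proof -
  interpret X: left_module S X by fact
  interpret rX: left_module R "restrict_scalars \<rho> X" by (rule left_module_restrict_scalars[OF assms(1-3)])
  note H = X.submoduleD[OF assms(4)]
  show ?thesis
    by (rule rX.submodule_intro) (use H ring_hom_closed[OF assms(2)] in simp_all)
qed

text \<open>If \<open>S\<close> is finitely generated over \<open>R\<close>, then so is each cyclic
  piece \<open>S b\<close>, being an image of \<open>S\<close>; finitely many generators
  \<open>b\<close> give finitely many pieces.\<close>

lemma fg_module_restrict_scalars:
  assumes R: "ring R" and \<rho>: "\<rho> \<in> ring_hom R S" and X: "fg_module S X"
    and S: "fg_module R (restrict_scalars \<rho> (regular_module S))"
  shows "fg_module R (restrict_scalars \<rho> X)"
proof -
  let ?X = "restrict_scalars \<rho> X"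
  note lX = fg_module_left[OF X]
  note rX = left_module_restrict_scalars[OF R \<rho> lX]
  interpret X: left_module S X by fact
  interpret rX: left_module R ?X by fact
  obtain B where B: "finite B" "B \<subseteq> carrier X" "carrier X \<subseteq> lspan S X B"
    using X finitely_generated_iff[OF lX] by (auto simp: fg_module_def)
  have "\<exists>T. finite T \<and> T \<subseteq> carrier X \<and> (\<forall>a\<in>carrier S. a \<odot>\<^bsub>X\<^esub> b \<in> lspan R ?X T)" if "b \<in> B" for b
  proof -
    have "(\<lambda>r. r \<odot>\<^bsub>X\<^esub> b) \<in> module_homs R (restrict_scalars \<rho> (regular_module S)) ?X"
      using that B by (intro hom_restrict_scalars[OF \<rho>] hom_from_regular lX) auto
    from lspan_sub_image[OF fg_module_left[OF S] rX this S]
    obtain T where "finite T" "T \<subseteq> carrier ?X"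
      "(\<lambda>r. r \<odot>\<^bsub>X\<^esub> b) ` carrier (restrict_scalars \<rho> (regular_module S)) \<subseteq> lspan R ?X T" .
    then show ?thesis by (intro exI[of _ T]) auto
  qed
  then obtain T where T: "\<And>b. b \<in> B \<Longrightarrow> finite (T b)" "\<And>b. b \<in> B \<Longrightarrow> T b \<subseteq> carrier X"
    "\<And>b a. b \<in> B \<Longrightarrow> a \<in> carrier S \<Longrightarrow> a \<odot>\<^bsub>X\<^esub> b \<in> lspan R ?X (T b)"
    by metis
  let ?T = "\<Union>b\<in>B. T b"
  have cT: "?T \<subseteq> carrier ?X" using T(2) by auto
  note sub = rX.submoduleD[OF submodule_lspan[OF rX cT]]
  have "x \<in> lspan R ?X ?T" if "x \<in> lspan S X B" for x
    using that
  proof induction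
    case zero
    then show ?case using sub(2) by simp
  next
    case (step x a b)
    have "a \<odot>\<^bsub>X\<^esub> b \<in> lspan R ?X ?T"
      using T(3)[OF step(3,2)] lspan_mono[of "T b" ?T R ?X] step(3) by blast
    then show ?case using sub(3)[OF step.IH] by simp
  qed
  then have "carrier ?X \<subseteq> lspan R ?X ?T" using B(3) by auto
  moreover have "finite ?T" using B(1) T(1) by simp
  ultimately show ?thesis
    using cT rX finitely_generated_iff[OF rX] unfolding fg_module_def by blast
qed


section \<open>Chain conditions\<close>

lemma field_inverse:
  assumes "field K" "c \<in> carrier K" "c \<noteq> \<zero>\<^bsub>K\<^esub>"
  obtains d where "d \<in> carrier K" "d \<otimes>\<^bsub>K\<^esub> c = \<one>\<^bsub>K\<^esub>"
proof -
  interpret K: field K by fact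
  have "c \<in> Units K" using assms K.field_Units by auto
  then show thesis using that K.Units_inv_closed K.Units_l_inv by blast
qed

lemma lspan_insert:
  assumes "left_module R V" "insert s S \<subseteq> carrier V" "x \<in> lspan R V (insert s S)"
  shows "\<exists>y\<in>lspan R V S. \<exists>c\<in>carrier R. x = y \<oplus>\<^bsub>V\<^esub> c \<odot>\<^bsub>V\<^esub> s"
  using assms(3)
proof induction
  case zero
  interpret V: left_module R V by fact
  show ?case using assms(2)
    by (intro bexI[of _ "\<zero>\<^bsub>V\<^esub>"] bexI[of _ "\<zero>\<^bsub>R\<^esub>"]) (auto simp: V.smult_l_null intro: lspan.zero)
next
  case (step x a t)
  interpret V: left_module R V by fact
  have S: "S \<subseteq> carrier V" "s \<in> carrier V" using assms(2) by auto
  note sub = V.submoduleD[OF submodule_lspan[OF assms(1) S(1)]]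
  obtain y c where yc: "y \<in> lspan R V S" "c \<in> carrier R" "x = y \<oplus>\<^bsub>V\<^esub> c \<odot>\<^bsub>V\<^esub> s" using step.IH by auto
  have y: "y \<in> carrier V" "t \<in> carrier V" using yc(1) sub(1) step(3) assms(2) by auto
  show ?case
  proof (cases "t = s")
    case True
    then have "x \<oplus>\<^bsub>V\<^esub> a \<odot>\<^bsub>V\<^esub> t = y \<oplus>\<^bsub>V\<^esub> (c \<oplus>\<^bsub>R\<^esub> a) \<odot>\<^bsub>V\<^esub> s"
      using yc y S step(2) by (simp add: V.smult_l_distr V.smult_closed V.M.a_assoc)
    then show ?thesis using yc step(2) by (intro bexI[OF _ yc(1)] bexI[of _ "c \<oplus>\<^bsub>R\<^esub> a"]) auto
  next
    case False
    then have "x \<oplus>\<^bsub>V\<^esub> a \<odot>\<^bsub>V\<^esub> t = (y \<oplus>\<^bsub>V\<^esub> a \<odot>\<^bsub>V\<^esub> t) \<oplus>\<^bsub>V\<^esub> c \<odot>\<^bsub>V\<^esub> s"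
      using yc y S step(2) by (simp add: V.smult_closed V.M.a_ac)
    moreover have "y \<oplus>\<^bsub>V\<^esub> a \<odot>\<^bsub>V\<^esub> t \<in> lspan R V S" using False step yc by (auto intro: lspan.step)
    ultimately show ?thesis using yc(2) by blast
  qed
qed

text \<open>The measure does duty for the dimension of subspaces.\<close>

lemma field_chain_measure:
  assumes K: "field K" and V: "left_module K V" and "finite S" "S \<subseteq> carrier V"
  shows "\<exists>\<mu> :: 'v set \<Rightarrow> nat. \<forall>W W'. submodule W K V \<longrightarrow> submodule W' K V \<longrightarrow> W' \<subseteq> lspan K V S \<longrightarrow> W \<subset> W'
    \<longrightarrow> \<mu> W < \<mu> W'"
  using assms(3,4)
proof (induction S rule: finite_induct)
  case empty
  have "lspan K V {} \<subseteq> {\<zero>\<^bsub>V\<^esub>}"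
  proof
    fix x assume "x \<in> lspan K V {}"
    then show "x \<in> {\<zero>\<^bsub>V\<^esub>}" by cases auto
  qed
  moreover have "\<zero>\<^bsub>V\<^esub> \<in> W" if "submodule W K V" for W
    using left_module.submoduleD(2)[OF V that] .
  ultimately show ?case by (intro exI[of _ "\<lambda>_. 0"]) blast
next
  case (insert s S)
  interpret V: left_module K V by fact
  interpret K: field K by fact
  have s: "s \<in> carrier V" "S \<subseteq> carrier V" using insert.prems by auto
  obtain \<mu> :: "'v set \<Rightarrow> nat" where
    \<mu>: "\<And>W W'. submodule W K V \<Longrightarrow> submodule W' K V \<Longrightarrow> W' \<subseteq> lspan K V S \<Longrightarrow> W \<subset> W' \<Longrightarrow> \<mu> W < \<mu> W'"
    using insert.IH[OF s(2)] by metis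
  let ?Y = "lspan K V S"
  note Y = submodule_lspan[OF V s(2)]
  note YD = V.submoduleD[OF Y]
  \<comment> \<open>Enlarging the spanning set by \<open>s\<close> adds at most one dimension; the
    indicator counts it. If \<open>W\<close> and \<open>W'\<close> meet \<open>?Y\<close> in the
    same subspace, then only \<open>W'\<close> can leave \<open>?Y\<close>.\<close>
  define \<nu> where "\<nu> W = \<mu> (W \<inter> ?Y) + (if W \<subseteq> ?Y then 0 else 1)" for W
  have int: "submodule (W \<inter> ?Y) K V" if "submodule W K V" for W
    using V.submoduleD[OF that] YD by (intro V.submodule_intro) auto
  have "\<nu> W < \<nu> W'" if W: "submodule W K V" and W': "submodule W' K V"
    and sp: "W' \<subseteq> lspan K V (insert s S)" and lt: "W \<subset> W'" for W W'
  proof (cases "W \<inter> ?Y = W' \<inter> ?Y")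
    case False
    then have "\<mu> (W \<inter> ?Y) < \<mu> (W' \<inter> ?Y)" using lt by (intro \<mu> int W W') auto
    then show ?thesis using lt by (auto simp: \<nu>_def)
  next
    case True
    note WD = V.submoduleD[OF W] and WD' = V.submoduleD[OF W']
    have "W \<subseteq> ?Y"
    proof (rule ccontr)
      assume "\<not> W \<subseteq> ?Y"
      then obtain w where w: "w \<in> W" "w \<notin> ?Y" by auto
      obtain y c where yc: "y \<in> ?Y" "c \<in> carrier K" "w = y \<oplus>\<^bsub>V\<^esub> c \<odot>\<^bsub>V\<^esub> s"
        using lspan_insert[OF V insert.prems] w(1) lt sp by blast
      have yV: "y \<in> carrier V" using yc(1) YD(1) by auto
      have "c \<noteq> \<zero>\<^bsub>K\<^esub>" using yc w s yV by (auto simp: V.smult_l_null)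
      then obtain d where d: "d \<in> carrier K" "d \<otimes>\<^bsub>K\<^esub> c = \<one>\<^bsub>K\<^esub>" using field_inverse[OF K yc(2)] by blast
      have "W' \<subseteq> W"
      proof
        fix w' assume w': "w' \<in> W'"
        obtain y' c' where yc': "y' \<in> ?Y" "c' \<in> carrier K" "w' = y' \<oplus>\<^bsub>V\<^esub> c' \<odot>\<^bsub>V\<^esub> s"
          using lspan_insert[OF V insert.prems] w' sp by blast
        have yV': "y' \<in> carrier V" using yc'(1) YD(1) by auto
        \<comment> \<open>This multiple of \<open>w\<close> has the same
          \<open>s\<close>-coefficient as \<open>w'\<close>, so the difference falls into
          \<open>?Y\<close>, where \<open>W\<close> and \<open>W'\<close> agree.\<close>
        let ?e = "c' \<otimes>\<^bsub>K\<^esub> d"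
        have eW: "?e \<odot>\<^bsub>V\<^esub> w \<in> W" using w(1) yc'(2) d(1) by (intro WD(4)) auto
        have "?e \<odot>\<^bsub>V\<^esub> w = ?e \<odot>\<^bsub>V\<^esub> y \<oplus>\<^bsub>V\<^esub> (?e \<otimes>\<^bsub>K\<^esub> c) \<odot>\<^bsub>V\<^esub> s"
          unfolding yc(3) using yc yc' d s yV
          by (simp add: V.smult_r_distr V.smult_closed V.smult_assoc)
        also have "?e \<otimes>\<^bsub>K\<^esub> c = c'" using yc yc' d by (simp add: V.R.m_assoc)
        finally have ew: "?e \<odot>\<^bsub>V\<^esub> w = ?e \<odot>\<^bsub>V\<^esub> y \<oplus>\<^bsub>V\<^esub> c' \<odot>\<^bsub>V\<^esub> s" .
        have eyc: "?e \<odot>\<^bsub>V\<^esub> y \<in> carrier V" "c' \<odot>\<^bsub>V\<^esub> s \<in> carrier V"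
          using yV yc' d s by (auto intro!: V.smult_closed)
        have "w' \<ominus>\<^bsub>V\<^esub> ?e \<odot>\<^bsub>V\<^esub> w = y' \<ominus>\<^bsub>V\<^esub> ?e \<odot>\<^bsub>V\<^esub> y"
          unfolding ew unfolding yc'(3) using eyc yV'
          by (simp add: a_minus_def V.M.minus_add V.M.a_ac V.M.r_neg1 V.M.r_neg V.M.l_neg V.M.r_neg2)
        moreover have "y' \<ominus>\<^bsub>V\<^esub> ?e \<odot>\<^bsub>V\<^esub> y \<in> ?Y"
          using yc' yc d by (intro YD(6) YD(4)) auto
        moreover have "w' \<ominus>\<^bsub>V\<^esub> ?e \<odot>\<^bsub>V\<^esub> w \<in> W'" using eW lt w' by (intro WD'(6)) auto
        ultimately have "w' \<ominus>\<^bsub>V\<^esub> ?e \<odot>\<^bsub>V\<^esub> w \<in> W" using True by auto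
        then have "w' \<ominus>\<^bsub>V\<^esub> ?e \<odot>\<^bsub>V\<^esub> w \<oplus>\<^bsub>V\<^esub> ?e \<odot>\<^bsub>V\<^esub> w \<in> W" using eW by (intro WD(3))
        then show "w' \<in> W" using w' eW WD(1) WD'(1) by (simp add: V.M.minus_plus_cancel subset_iff)
      qed
      then show False using lt by auto
    qed
    moreover have "\<not> W' \<subseteq> ?Y" using True lt calculation by auto
    ultimately show ?thesis using True by (simp add: \<nu>_def)
  qed
  then show ?case by blast
qed

text \<open>Modules over \<open>A\<close> carry no action of \<open>K\<close> of their own;
  restriction along the structure map \<open>c \<mapsto> c 1\<close> supplies it, and on the regular
  module it gives back the vector space \<open>A\<close>.\<close>

lemma fd_algebra_scalars:
  assumes "fd_algebra K A"
  shows "(\<lambda>c. c \<odot>\<^bsub>A\<^esub> \<one>\<^bsub>A\<^esub>) \<in> ring_hom K A"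
    "fg_module K (restrict_scalars (\<lambda>c. c \<odot>\<^bsub>A\<^esub> \<one>\<^bsub>A\<^esub>) (regular_module A))"
    "left_module K A" "field K"
proof -
  interpret fd_algebra K A by fact
  show h: "(\<lambda>c. c \<odot>\<^bsub>A\<^esub> \<one>\<^bsub>A\<^esub>) \<in> ring_hom K A"
    by (rule ring_hom_memI) (simp_all add: smult_mult_left smult_assoc1 smult_l_distr)
  show K: "field K" by unfold_locales
  show A: "left_module K A"
    by unfold_locales (simp_all add: smult_l_distr smult_r_distr smult_assoc1)
  have fA: "fg_module K A" using A finite_dim by (simp add: fg_module_def)
  have lR: "left_module K (restrict_scalars (\<lambda>c. c \<odot>\<^bsub>A\<^esub> \<one>\<^bsub>A\<^esub>) (regular_module A))"
    by (rule left_module_restrict_scalars[OF K.ring_axioms h left_module_regular]) (rule A.ring_axioms)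
  have "(\<lambda>x. x) \<in> module_homs K A (restrict_scalars (\<lambda>c. c \<odot>\<^bsub>A\<^esub> \<one>\<^bsub>A\<^esub>) (regular_module A))"
    by (rule module_homsI) (simp_all add: smult_mult_left)
  from fg_module_image[OF fA lR this]
  show "fg_module K (restrict_scalars (\<lambda>c. c \<odot>\<^bsub>A\<^esub> \<one>\<^bsub>A\<^esub>) (regular_module A))" by simp
qed

text \<open>Submodules are subspaces of a finite-dimensional space. This strictly monotone measure
  yields both chain conditions for Fitting's lemma and the termination of decompositions.\<close>

lemma chain_measure:
  fixes X :: "('a, 'm, 'd) module_scheme"
  assumes A: "fd_algebra K A" and X: "fg_module A X"
  obtains \<mu> :: "'m set \<Rightarrow> nat" where
    "\<And>W W'. submodule W A X \<Longrightarrow> submodule W' A X \<Longrightarrow> W \<subset> W' \<Longrightarrow> \<mu> W < \<mu> W'"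
proof -
  note s = fd_algebra_scalars[OF A]
  let ?X = "restrict_scalars (\<lambda>c. c \<odot>\<^bsub>A\<^esub> \<one>\<^bsub>A\<^esub>) X"
  note lX = fg_module_left[OF X]
  have K: "ring K" using left_module_ring[OF s(3)] .
  have fX: "fg_module K ?X" by (rule fg_module_restrict_scalars[OF K s(1) X s(2)])
  note rX = fg_module_left[OF fX]
  obtain S where S: "finite S" "S \<subseteq> carrier ?X" "carrier ?X \<subseteq> lspan K ?X S"
    using fX finitely_generated_iff[OF rX] by (auto simp: fg_module_def)
  obtain \<mu> :: "'m set \<Rightarrow> nat" where \<mu>: "\<forall>W W'. submodule W K ?X \<longrightarrow> submodule W' K ?X \<longrightarrow>
      W' \<subseteq> lspan K ?X S \<longrightarrow> W \<subset> W' \<longrightarrow> \<mu> W < \<mu> W'"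
    using field_chain_measure[OF s(4) rX S(1,2)] by blast
  show thesis
  proof (rule that)
    fix W W' assume W: "submodule W A X" "submodule W' A X" and lt: "W \<subset> W'"
    note sr = submodule_restrict_scalars[OF K s(1) lX]
    have "W' \<subseteq> lspan K ?X S" using left_module.submoduleD(1)[OF lX W(2)] S(3) by auto
    then show "\<mu> W < \<mu> W'" using \<mu> sr[OF W(1)] sr[OF W(2)] lt by blast
  qed
qed


section \<open>The Krull-Schmidt property\<close>

text \<open>A direct summand without a named complement. It relates modules on arbitrary types, is
  transitive, and is visibly preserved by functors.\<close>

definition retract ::
    "('r, 'c) ring_scheme \<Rightarrow> ('r, 'm, 'd) module_scheme \<Rightarrow> ('r, 'n, 'e) module_scheme \<Rightarrow> bool" where
  "retract R X Y \<longleftrightarrow> (\<exists>f\<in>module_homs R X Y. \<exists>g\<in>module_homs R Y X. \<forall>x\<in>carrier X. g (f x) = x)"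

lemma retract_trans:
  assumes "retract R X Y" "retract R Y Z"
  shows "retract R X Z"
proof -
  obtain f g f' g' where "f \<in> module_homs R X Y" "g \<in> module_homs R Y X" "\<forall>x\<in>carrier X. g (f x) = x"
    "f' \<in> module_homs R Y Z" "g' \<in> module_homs R Z Y" "\<forall>x\<in>carrier Y. g' (f' x) = x"
    using assms by (auto simp: retract_def)
  then show ?thesis unfolding retract_def
    by (intro bexI[of _ "\<lambda>x. f' (f x)"] bexI[of _ "\<lambda>x. g (g' x)"]) (auto simp: hom_comp hom_closed)
qed

lemma module_iso_retract:
  assumes "module_iso R X Y" "left_module R X" "left_module R Y"
  shows "retract R X Y" "retract R Y X"
  using module_isoE[OF assms] unfolding retract_def by metis+

lemma retract_summands:
  assumes "left_module R X" "left_module R Y"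
  shows "retract R X (direct_sum X Y)" "retract R Y (direct_sum X Y)"
proof -
  have "(\<lambda>x. (x, \<zero>\<^bsub>Y\<^esub>)) \<in> module_homs R X (direct_sum X Y)"
    "(\<lambda>y. (\<zero>\<^bsub>X\<^esub>, y)) \<in> module_homs R Y (direct_sum X Y)"
    by (intro hom_pair hom_id hom_zero_map assms)+
  then show "retract R X (direct_sum X Y)" "retract R Y (direct_sum X Y)"
    unfolding retract_def by (metis hom_fst fst_conv, metis hom_snd snd_conv)
qed

lemma direct_summand_iff_retract:
  fixes R :: "('k, 'r) module"
  assumes "fd_algebra K R" "fg_module R Y" "left_module R X"
  shows "direct_summand R X Y \<longleftrightarrow> retract R X Y"
proof
  assume "direct_summand R X Y"
  then show "retract R X Y"
    using direct_summand_retract[OF _ assms(3) fg_module_left[OF assms(2)]] unfolding retract_def by metis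
next
  assume "retract R X Y"
  then show "direct_summand R X Y"
    using direct_summandI[OF assms] unfolding retract_def by blast
qed

section \<open>Fitting's lemma and local endomorphism rings\<close>

lemma hom_funpow: "f \<in> module_homs R X X \<Longrightarrow> (f ^^ n) \<in> module_homs R X X"
proof (induction n)
  case 0
  then show ?case using hom_id[of R X] by (simp add: id_def)
next
  case (Suc n)
  then show ?case using hom_comp[OF Suc.IH[OF Suc.prems] Suc.prems] by (simp add: comp_def)
qed

text \<open>The images decrease, so one of least measure is reached; the kernels increase and their
  measures are bounded by that of \<open>X\<close>, so one of greatest measure is reached. Strict
  monotonicity of the measure turns equal measure into equality.\<close>

lemma funpow_stabilise:
  fixes R :: "('k, 'r) module"
  assumes R: "fd_algebra K R" and X: "fg_module R X" and f: "f \<in> module_homs R X X"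
  obtains N where "\<And>n. n \<ge> N \<Longrightarrow> (f ^^ n) ` carrier X = (f ^^ N) ` carrier X"
    "\<And>n. n \<ge> N \<Longrightarrow> a_kernel X X (f ^^ n) = a_kernel X X (f ^^ N)"
proof -
  note lX = fg_module_left[OF X]
  note fn = hom_funpow[OF f]
  obtain \<mu> where \<mu>: "\<And>W W'. submodule W R X \<Longrightarrow> submodule W' R X \<Longrightarrow> W \<subset> W' \<Longrightarrow> \<mu> W < (\<mu> W' :: nat)"
    using chain_measure[OF R X] by blast
  let ?I = "\<lambda>n. (f ^^ n) ` carrier X" and ?K = "\<lambda>n. a_kernel X X (f ^^ n)"
  have sI: "submodule (?I n) R X" for n by (rule submodule_image[OF lX lX fn])
  have sK: "submodule (?K n) R X" for n by (rule submodule_kernel[OF lX lX fn])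
  have I: "?I n \<subseteq> ?I m" if "m \<le> n" for m n
  proof -
    have "(f ^^ n) x = (f ^^ m) ((f ^^ (n - m)) x)" for x
      using that funpow_add[of m "n - m" f] by simp
    then show ?thesis using hom_closed[OF fn] by auto
  qed
  have K: "?K m \<subseteq> ?K n" if "m \<le> n" for m n
  proof -
    have "(f ^^ n) x = (f ^^ (n - m)) ((f ^^ m) x)" for x
      using that funpow_add[of "n - m" m f] by simp
    then show ?thesis using hom_zero[OF fn lX lX] by (auto simp: mem_a_kernel)
  qed
  obtain N1 where N1: "\<And>n. \<mu> (?I N1) \<le> \<mu> (?I n)"
    using exists_least_iff[of "\<lambda>k. \<exists>n. \<mu> (?I n) = k"] by (metis linorder_not_less)
  have e1: "?I n = ?I N1" if "n \<ge> N1" for n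
    using I[OF that] \<mu>[OF sI[of n] sI[of N1]] N1[of n] by (metis linorder_not_less psubsetI)
  have "submodule (carrier X) R X" using submodule_image[OF lX lX hom_id] by simp
  then have "\<mu> (?K n) \<le> \<mu> (carrier X)" for n
    using \<mu>[OF sK[of n], of "carrier X"] left_module.submoduleD(1)[OF lX sK[of n]]
    by (metis le_eq_less_or_eq psubsetI)
  then obtain N2 where N2: "\<And>n. \<mu> (?K n) \<le> \<mu> (?K N2)"
    using ex_has_greatest_nat[of "\<lambda>_. True" 0 "\<lambda>n. \<mu> (?K n)" "Suc (\<mu> (carrier X))"]
    by (auto simp: less_Suc_eq_le)
  have e2: "?K n = ?K N2" if "n \<ge> N2" for n
    using K[OF that] \<mu>[OF sK[of N2] sK[of n]] N2[of n] by (metis linorder_not_less psubsetI)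
  show thesis
    by (rule that[of "max N1 N2"]) (use e1 e2 in \<open>metis max.bounded_iff max.cobounded1, metis max.bounded_iff max.cobounded2\<close>)
qed

text \<open>For a high power \<open>g\<close> of \<open>f\<close> the stable image and kernel make
  \<open>g\<close> bijective on its own image. That image is then a retract of \<open>X\<close>, and
  indecomposability leaves only zero or everything.\<close>

lemma fitting:
  fixes R :: "('k, 'r) module"
  assumes R: "fd_algebra K R" and X: "fg_module R X" and ind: "indecomposable R X"
    and f: "f \<in> module_homs R X X"
  shows "bij_betw f (carrier X) (carrier X) \<or> (\<exists>n. \<forall>x\<in>carrier X. (f ^^ n) x = \<zero>\<^bsub>X\<^esub>)"
proof -
  note lX = fg_module_left[OF X]
  interpret X: left_module R X by fact
  note fn = hom_funpow[OF f]
  obtain N where N: "\<And>n. n \<ge> N \<Longrightarrow> (f ^^ n) ` carrier X = (f ^^ N) ` carrier X"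
    "\<And>n. n \<ge> N \<Longrightarrow> a_kernel X X (f ^^ n) = a_kernel X X (f ^^ N)"
    using funpow_stabilise[OF R X f] by blast
  \<comment> \<open>The exponent is positive so that \<open>f\<close> can be split off as a first
    and as a last factor; injectivity and surjectivity of \<open>f\<close> are read off from
    \<open>g\<close> in this way.\<close>
  define g where "g = f ^^ Suc N"
  note g = fn[of "Suc N", folded g_def]
  have gg: "g (g x) = (f ^^ (Suc N + Suc N)) x" for x
    unfolding g_def by (simp only: funpow_add comp_def)
  have im: "g ` g ` carrier X = g ` carrier X"
    using N(1)[of "Suc N + Suc N"] N(1)[of "Suc N"]
    unfolding image_image gg by (simp only: g_def)
  have ker: "g x = \<zero>\<^bsub>X\<^esub>" if "x \<in> carrier X" "g (g x) = \<zero>\<^bsub>X\<^esub>" for x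
  proof -
    have "x \<in> a_kernel X X (f ^^ (Suc N + Suc N))" using that gg by (simp add: mem_a_kernel)
    then have "x \<in> a_kernel X X g" unfolding g_def using N(2)[of "Suc N + Suc N"] N(2)[of "Suc N"] by simp
    then show ?thesis by (simp add: mem_a_kernel)
  qed
  let ?H = "g ` carrier X"
  let ?Y = "X\<lparr>carrier := ?H\<rparr>"
  have sH: "submodule ?H R X" by (rule submodule_image[OF lX lX g])
  note HD = X.submoduleD[OF sH]
  have carrier_update: "carrier ?Y = ?H" by simp
  have lY: "left_module R ?Y" by (rule X.left_module_submodule[OF sH])
  have gY: "g \<in> module_homs R X ?Y" by (rule hom_corestrict[OF g]) auto
  have gYY: "g \<in> module_homs R ?Y ?Y" using hom_comp[OF hom_incl[OF HD(1)] gY] by simp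
  have "inj_on g (carrier ?Y)"
    by (rule hom_inj_on[OF gYY lY lY]) (use ker in auto)
  then have "bij_betw g (carrier ?Y) (carrier ?Y)" using im by (simp add: bij_betw_def)
  then obtain h where h: "h \<in> module_homs R ?Y ?Y" "\<And>y. y \<in> ?H \<Longrightarrow> h (g y) = y"
    using bij_hom_inverse[OF gYY _ lY lY] by (metis carrier_update)
  have fY: "fg_module R ?Y" by (rule fg_module_image[OF X lY gY]) simp
  obtain Y' :: "('k, 'r) small_module" and s t where Y': "fg_module R Y'"
    and s: "s \<in> module_homs R ?Y Y'" and t: "t \<in> module_homs R Y' ?Y"
    and ts: "\<And>x. x \<in> carrier ?Y \<Longrightarrow> t (s x) = x" and st: "\<And>y. y \<in> carrier Y' \<Longrightarrow> s (t y) = y"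
    using small_copyE[OF R fY] by blast
  note lY' = fg_module_left[OF Y']
  have tX: "t \<in> module_homs R Y' X" using hom_comp[OF t hom_incl[OF HD(1)]] by simp
  \<comment> \<open>As \<open>h\<close> inverts \<open>g\<close> on the image of \<open>g\<close>,
    the composite \<open>h g\<close> is a projection of \<open>X\<close> onto that image.\<close>
  have p: "(\<lambda>x. s (h (g x))) \<in> module_homs R X Y'"
    by (rule hom_comp[OF hom_comp[OF gY h(1)] s])
  have pt: "s (h (g (t y))) = y" if "y \<in> carrier Y'" for y
    using st[OF that] h(2)[of "t y"] hom_closed[OF t that] by simp
  obtain Z :: "('k, 'r) small_module" where Z: "fg_module R Z" "module_iso R X (direct_sum Y' Z)"
    "carrier Z = {\<zero>\<^bsub>Z\<^esub>} \<longrightarrow> (\<forall>x\<in>carrier X. t (s (h (g x))) = x)"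
    using retract_complement[OF R X lY' tX p pt] by metis
  from ind Y' Z(1,2) consider "carrier Y' = {\<zero>\<^bsub>Y'\<^esub>}" | "carrier Z = {\<zero>\<^bsub>Z\<^esub>}"
    unfolding indecomposable_def by blast
  then show ?thesis
  proof cases
    case 1
    have "g x = \<zero>\<^bsub>X\<^esub>" if "x \<in> carrier X" for x
    proof -
      have "s (g x) = \<zero>\<^bsub>Y'\<^esub>" using hom_closed[OF s, of "g x"] that 1 by auto
      then have "g x = t \<zero>\<^bsub>Y'\<^esub>" using ts[of "g x"] that by auto
      then show ?thesis using hom_zero[OF tX lY' lX] by simp
    qed
    then show ?thesis unfolding g_def by blast
  next
    case 2
    have tsp: "t (s (h (g x))) = x" if "x \<in> carrier X" for x using Z(3) 2 that by blast
    have hg: "h (g x) = x" if "x \<in> carrier X" for x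
      using tsp[OF that] ts[of "h (g x)"] hom_closed[OF h(1), of "g x"] that by auto
    have surj: "x \<in> ?H" if "x \<in> carrier X" for x
      using hg[OF that] hom_closed[OF h(1), of "g x"] that by auto
    have "inj_on f (carrier X)"
    proof (rule inj_onI)
      fix x y assume xy: "x \<in> carrier X" "y \<in> carrier X" "f x = f y"
      then have "g x = g y" unfolding g_def by (simp only: funpow_Suc_right comp_def)
      then show "x = y" using hg xy by metis
    qed
    moreover have "f ` carrier X = carrier X"
    proof
      show "carrier X \<subseteq> f ` carrier X"
      proof
        fix x assume "x \<in> carrier X"
        then obtain y where "y \<in> carrier X" "x = g y" using surj by auto
        then show "x \<in> f ` carrier X"
          unfolding g_def using hom_closed[OF fn, of y N] by auto
      qed
    qed (use hom_closed[OF f] in auto)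
    ultimately show ?thesis by (simp add: bij_betw_def)
  qed
qed

lemma indecomposable_nonzero:
  assumes "indecomposable R X"
  obtains x where "x \<in> carrier X" "x \<noteq> \<zero>\<^bsub>X\<^esub>"
proof -
  have "\<zero>\<^bsub>X\<^esub> \<in> carrier X"
    using assms left_module_abelian_group[of R X] by (auto simp: indecomposable_def abelian_group_def abelian_monoidE)
  then show thesis using assms that by (auto simp: indecomposable_def)
qed

lemma nilpotent_not_injective:
  assumes X: "left_module R X" and f: "f \<in> module_homs R X X"
    and inj: "\<And>x. x \<in> carrier X \<Longrightarrow> f x = \<zero>\<^bsub>X\<^esub> \<Longrightarrow> x = \<zero>\<^bsub>X\<^esub>"
    and "x \<in> carrier X" "(f ^^ n) x = \<zero>\<^bsub>X\<^esub>"
  shows "x = \<zero>\<^bsub>X\<^esub>"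
  using assms(5)
proof (induction n)
  case (Suc n)
  then show ?case using inj[of "(f ^^ n) x"] hom_closed[OF hom_funpow[OF f] assms(4)] by simp
qed simp

text \<open>If \<open>g\<close> is nilpotent and \<open>f x = 0\<close>, then
  \<open>g x = x\<close>, hence \<open>x = 0\<close>. So \<open>f\<close> is injective, and an
  injective endomorphism of a nonzero module is not nilpotent; Fitting's lemma makes
  \<open>f\<close> bijective without a geometric series.\<close>

lemma local_endomorphisms_one:
  fixes R :: "('k, 'r) module"
  assumes R: "fd_algebra K R" and X: "fg_module R X" and ind: "indecomposable R X"
    and f: "f \<in> module_homs R X X" and g: "g \<in> module_homs R X X"
    and sum: "\<And>x. x \<in> carrier X \<Longrightarrow> f x \<oplus>\<^bsub>X\<^esub> g x = x"
  shows "bij_betw f (carrier X) (carrier X) \<or> bij_betw g (carrier X) (carrier X)"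
proof (rule disjCI)
  assume "\<not> bij_betw g (carrier X) (carrier X)"
  note lX = fg_module_left[OF X]
  interpret X: left_module R X by fact
  obtain n where n: "\<And>x. x \<in> carrier X \<Longrightarrow> (g ^^ n) x = \<zero>\<^bsub>X\<^esub>"
    using fitting[OF R X ind g] \<open>\<not> bij_betw g _ _\<close> by blast
  have inj: "x = \<zero>\<^bsub>X\<^esub>" if x: "x \<in> carrier X" "f x = \<zero>\<^bsub>X\<^esub>" for x
  proof -
    have "g x = x" using sum[OF x(1)] x hom_closed[OF g x(1)] by simp
    then have "(g ^^ n) x = x" by (induction n) auto
    then show ?thesis using n[OF x(1)] by simp
  qed
  obtain x where x: "x \<in> carrier X" "x \<noteq> \<zero>\<^bsub>X\<^esub>" using indecomposable_nonzero[OF ind] .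
  show "bij_betw f (carrier X) (carrier X)"
    using fitting[OF R X ind f] nilpotent_not_injective[OF lX f inj x(1)] x by blast
qed

text \<open>Precomposing both maps with the inverse \<open>t\<close> of their sum reduces this to
  the case where the sum is the identity.\<close>

lemma local_endomorphisms:
  fixes R :: "('k, 'r) module"
  assumes R: "fd_algebra K R" and X: "fg_module R X" and ind: "indecomposable R X"
    and f: "f \<in> module_homs R X X" and g: "g \<in> module_homs R X X"
    and bij: "bij_betw (\<lambda>x. f x \<oplus>\<^bsub>X\<^esub> g x) (carrier X) (carrier X)"
  shows "bij_betw f (carrier X) (carrier X) \<or> bij_betw g (carrier X) (carrier X)"
proof -
  note lX = fg_module_left[OF X]
  note s = hom_plus[OF lX lX f g]
  obtain t where t: "t \<in> module_homs R X X" "\<And>x. x \<in> carrier X \<Longrightarrow> t (f x \<oplus>\<^bsub>X\<^esub> g x) = x"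
    "\<And>y. y \<in> carrier X \<Longrightarrow> f (t y) \<oplus>\<^bsub>X\<^esub> g (t y) = y"
    using bij_hom_inverse[OF s bij lX lX] by blast
  have *: "bij_betw k (carrier X) (carrier X)" if "bij_betw (\<lambda>x. k (t x)) (carrier X) (carrier X)" for k
  proof -
    have "bij_betw ((\<lambda>x. k (t x)) \<circ> (\<lambda>x. f x \<oplus>\<^bsub>X\<^esub> g x)) (carrier X) (carrier X)"
      by (rule bij_betw_trans[OF bij that])
    then show ?thesis by (rule iffD1[OF bij_betw_cong, rotated]) (use t(2) in simp)
  qed
  show ?thesis
    using local_endomorphisms_one[OF R X ind hom_comp[OF t(1) f] hom_comp[OF t(1) g] t(3)] * by blast
qed

text \<open>The summands of \<open>h\<close> are moved one at a time into the free map
  \<open>k\<close>. At each stage the local endomorphism ring makes either a single composite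
  \<open>b \<circ> a\<close> bijective, which exhibits \<open>X\<close> as a retract of
  \<open>V\<close>, or the remaining map.\<close>

lemma indecomposable_add_map:
  fixes R :: "('k, 'r) module"
  assumes R: "fd_algebra K R" and X: "fg_module R X" and ind: "indecomposable R X"
    and "add_map R V X X h" and "k \<in> module_homs R X X"
    and "bij_betw (\<lambda>x. h x \<oplus>\<^bsub>X\<^esub> k x) (carrier X) (carrier X)"
  shows "retract R X V \<or> bij_betw k (carrier X) (carrier X)"
  using assms(4,5,6)
proof (induction arbitrary: k)
  case (zero h)
  interpret X: left_module R X by (rule fg_module_left[OF X])
  from zero(3) have "bij_betw k (carrier X) (carrier X)"
    by (rule iffD1[OF bij_betw_cong, rotated]) (use zero(1) hom_closed[OF zero(2)] in auto)
  then show ?case ..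
next
  case (step h a b h')
  note lX = fg_module_left[OF X]
  interpret X: left_module R X by fact
  note ba = hom_comp[OF step(2,3)]
  note hh = add_map_hom[OF step(1) lX lX]
  have "bij_betw (\<lambda>x. h x \<oplus>\<^bsub>X\<^esub> (b (a x) \<oplus>\<^bsub>X\<^esub> k x)) (carrier X) (carrier X)"
    using step(7)
    by (rule iffD1[OF bij_betw_cong, rotated])
      (use step(4) hom_closed[OF ba] hom_closed[OF hh] hom_closed[OF step(6)] in \<open>auto simp: X.M.a_assoc\<close>)
  then consider "retract R X V" | "bij_betw (\<lambda>x. b (a x) \<oplus>\<^bsub>X\<^esub> k x) (carrier X) (carrier X)"
    using step.IH[OF hom_plus[OF lX lX ba step(6)]] by blast
  then show ?case
  proof cases
    case 2
    then consider "bij_betw (\<lambda>x. b (a x)) (carrier X) (carrier X)" | "bij_betw k (carrier X) (carrier X)"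
      using local_endomorphisms[OF R X ind ba step(6)] by blast
    then show ?thesis
    proof cases
      case 1
      then obtain t where "t \<in> module_homs R X X" "\<And>x. x \<in> carrier X \<Longrightarrow> t (b (a x)) = x"
        using bij_hom_inverse[OF ba 1 lX lX] by metis
      then have "retract R X V"
        unfolding retract_def using step(2) hom_comp[OF step(3)] by metis
      then show ?thesis ..
    qed blast
  qed blast
qed

text \<open>The form in which Krull-Schmidt enters: \<open>h\<close> is stripped off first, then
  \<open>k\<close>. If neither module has \<open>X\<close> as a retract, the zero map would be
  bijective on a nonzero module.\<close>

lemma indecomposable_add_map_sum:
  fixes R :: "('k, 'r) module"
  assumes R: "fd_algebra K R" and X: "fg_module R X" and ind: "indecomposable R X"
    and h: "add_map R V X X h" and k: "add_map R V' X X k"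
    and sum: "\<And>x. x \<in> carrier X \<Longrightarrow> h x \<oplus>\<^bsub>X\<^esub> k x = x"
  shows "retract R X V \<or> retract R X V'"
proof (rule disjCI)
  assume nr: "\<not> retract R X V'"
  note lX = fg_module_left[OF X]
  interpret X: left_module R X by fact
  note kk = add_map_hom[OF k lX lX]
  obtain x where x: "x \<in> carrier X" "x \<noteq> \<zero>\<^bsub>X\<^esub>" using indecomposable_nonzero[OF ind] .
  have "bij_betw (\<lambda>x. h x \<oplus>\<^bsub>X\<^esub> k x) (carrier X) (carrier X)"
    by (rule iffD2[OF bij_betw_cong bij_betw_id]) (use sum in simp)
  then consider "retract R X V" | "bij_betw k (carrier X) (carrier X)"
    using indecomposable_add_map[OF R X ind h kk] by blast
  then show "retract R X V"
  proof cases
    case 2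
    have "bij_betw (\<lambda>x. k x \<oplus>\<^bsub>X\<^esub> \<zero>\<^bsub>X\<^esub>) (carrier X) (carrier X)"
      using 2 by (rule iffD1[OF bij_betw_cong, rotated]) (use hom_closed[OF kk] in auto)
    then have "bij_betw (\<lambda>x. \<zero>\<^bsub>X\<^esub>) (carrier X) (carrier X)"
      using indecomposable_add_map[OF R X ind k hom_zero_map[OF lX]] nr by blast
    from inj_onD[OF bij_betw_imp_inj_on[OF this], of x "\<zero>\<^bsub>X\<^esub>"] have False using x by simp
    then show ?thesis ..
  qed
qed

text \<open>Takes the place of an induction on dimension. The measure itself is generalised: a
  summand \<open>Z\<close> embedded by \<open>i\<close> inherits the measure
  \<open>W \<mapsto> \<mu> (i W)\<close>, which is smaller on the whole of \<open>Z\<close> as soon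
  as the image of \<open>i\<close> is proper.\<close>

lemma decomposition_induct [consumes 2, case_names zero indecomposable sum]:
  fixes R :: "('k, 'r) module" and Y :: "('k, 'r) small_module"
  assumes R: "fd_algebra K R" and Y: "fg_module R Y"
    and zero: "\<And>Y :: ('k, 'r) small_module. fg_module R Y \<Longrightarrow> carrier Y = {\<zero>\<^bsub>Y\<^esub>} \<Longrightarrow> P Y"
    and ind: "\<And>Y :: ('k, 'r) small_module. fg_module R Y \<Longrightarrow> indecomposable R Y \<Longrightarrow> P Y"
    and sum: "\<And>(Y :: ('k, 'r) small_module) Y1 Y2. fg_module R Y \<Longrightarrow> fg_module R Y1 \<Longrightarrow> fg_module R Y2
      \<Longrightarrow> module_iso R Y (direct_sum Y1 Y2) \<Longrightarrow> P Y1 \<Longrightarrow> P Y2 \<Longrightarrow> P Y"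
  shows "P Y"
proof -
  have "P Y" if "fg_module R Y" "\<And>W W'. submodule W R Y \<Longrightarrow> submodule W' R Y \<Longrightarrow> W \<subset> W' \<Longrightarrow> \<mu> W < (\<mu> W' :: nat)"
    for Y :: "('k, 'r) small_module" and \<mu>
    using that
  proof (induction "\<mu> (carrier Y)" arbitrary: Y \<mu> rule: less_induct)
    case less
    note Y = less.prems(1) and \<mu> = less.prems(2)
    note lY = fg_module_left[OF Y]
    interpret Y: left_module R Y by fact
    consider "carrier Y = {\<zero>\<^bsub>Y\<^esub>}" | "indecomposable R Y" |
      Y1 Y2 :: "('k, 'r) small_module" where "fg_module R Y1" "fg_module R Y2"
        "module_iso R Y (direct_sum Y1 Y2)" "carrier Y1 \<noteq> {\<zero>\<^bsub>Y1\<^esub>}" "carrier Y2 \<noteq> {\<zero>\<^bsub>Y2\<^esub>}"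
      using lY unfolding indecomposable_def by blast
    then show ?case
    proof cases
      case 1
      then show ?thesis using zero Y by blast
    next
      case 2
      then show ?thesis using ind Y by blast
    next
      case (3 Y1 Y2)
      note l1 = fg_module_left[OF 3(1)] and l2 = fg_module_left[OF 3(2)]
      interpret Y1: left_module R Y1 by fact
      interpret Y2: left_module R Y2 by fact
      obtain \<phi> \<psi> where p: "\<phi> \<in> module_homs R Y (direct_sum Y1 Y2)" "\<psi> \<in> module_homs R (direct_sum Y1 Y2) Y"
        "\<And>z. z \<in> carrier (direct_sum Y1 Y2) \<Longrightarrow> \<phi> (\<psi> z) = z"
        using module_isoE[OF 3(3) lY left_module_direct_sum[OF l1 l2]] by metis
      have step: "P Z" if Z: "fg_module R Z" and i: "i \<in> module_homs R Z Y" "inj_on i (carrier Z)"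
        and y: "y \<in> carrier Y" "y \<notin> i ` carrier Z" for i y and Z :: "('k, 'r) small_module"
      proof (rule less.hyps[OF _ Z])
        note lZ = fg_module_left[OF Z]
        have sub: "submodule (i ` W) R Y" if "submodule W R Z" for W
        proof -
          have "W \<subseteq> carrier Z" using left_module.submoduleD(1)[OF lZ that] .
          from submodule_image[OF left_module.left_module_submodule[OF lZ that] lY hom_comp[OF hom_incl[OF this] i(1)]]
          show ?thesis by simp
        qed
        have car: "submodule (carrier Z) R Z" "submodule (carrier Y) R Y"
          using submodule_image[OF lZ lZ hom_id] submodule_image[OF lY lY hom_id] by simp_all
        show "\<mu> (i ` carrier Z) < \<mu> (carrier Y)"
          by (rule \<mu>[OF sub[OF car(1)] car(2)]) (use y hom_closed[OF i(1)] in blast)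
        fix W W' assume W: "submodule W R Z" "submodule W' R Z" "W \<subset> W'"
        have "W \<subseteq> carrier Z" "W' \<subseteq> carrier Z" using left_module.submoduleD(1)[OF lZ] W by auto
        then have "i ` W \<subset> i ` W'"
          using W(3) inj_on_image_eq_iff[OF i(2), of W W'] by blast
        then show "\<mu> (i ` W) < \<mu> (i ` W')" by (intro \<mu> sub W)
      qed
      have i1: "(\<lambda>y. \<psi> (y, \<zero>\<^bsub>Y2\<^esub>)) \<in> module_homs R Y1 Y" and i2: "(\<lambda>y. \<psi> (\<zero>\<^bsub>Y1\<^esub>, y)) \<in> module_homs R Y2 Y"
        by (intro hom_comp[OF _ p(2)] hom_pair hom_id hom_zero_map l1 l2)+
      \<comment> \<open>Nonzero elements of each summand witness that the embedding of the other
        summand is not onto.\<close>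
      obtain y1 where y1: "y1 \<in> carrier Y1" "y1 \<noteq> \<zero>\<^bsub>Y1\<^esub>" using 3(4) Y1.M.zero_closed by blast
      obtain y2 where y2: "y2 \<in> carrier Y2" "y2 \<noteq> \<zero>\<^bsub>Y2\<^esub>" using 3(5) Y2.M.zero_closed by blast
      have "P Y1"
      proof (rule step[OF 3(1) i1])
        show "inj_on (\<lambda>y. \<psi> (y, \<zero>\<^bsub>Y2\<^esub>)) (carrier Y1)"
          by (rule inj_on_inverseI[where g = "\<lambda>y. fst (\<phi> y)"]) (use p(3) in auto)
        show "\<psi> (\<zero>\<^bsub>Y1\<^esub>, y2) \<in> carrier Y" using hom_closed[OF i2 y2(1)] .
        show "\<psi> (\<zero>\<^bsub>Y1\<^esub>, y2) \<notin> (\<lambda>y. \<psi> (y, \<zero>\<^bsub>Y2\<^esub>)) ` carrier Y1"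
        proof
          assume "\<psi> (\<zero>\<^bsub>Y1\<^esub>, y2) \<in> (\<lambda>y. \<psi> (y, \<zero>\<^bsub>Y2\<^esub>)) ` carrier Y1"
          then obtain y where y: "y \<in> carrier Y1" "\<psi> (\<zero>\<^bsub>Y1\<^esub>, y2) = \<psi> (y, \<zero>\<^bsub>Y2\<^esub>)" by auto
          then show False using p(3)[of "(\<zero>\<^bsub>Y1\<^esub>, y2)"] p(3)[of "(y, \<zero>\<^bsub>Y2\<^esub>)"] y2 by simp
        qed
      qed
      moreover have "P Y2"
      proof (rule step[OF 3(2) i2])
        show "inj_on (\<lambda>y. \<psi> (\<zero>\<^bsub>Y1\<^esub>, y)) (carrier Y2)"
          by (rule inj_on_inverseI[where g = "\<lambda>y. snd (\<phi> y)"]) (use p(3) in auto)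
        show "\<psi> (y1, \<zero>\<^bsub>Y2\<^esub>) \<in> carrier Y" using hom_closed[OF i1 y1(1)] .
        show "\<psi> (y1, \<zero>\<^bsub>Y2\<^esub>) \<notin> (\<lambda>y. \<psi> (\<zero>\<^bsub>Y1\<^esub>, y)) ` carrier Y2"
        proof
          assume "\<psi> (y1, \<zero>\<^bsub>Y2\<^esub>) \<in> (\<lambda>y. \<psi> (\<zero>\<^bsub>Y1\<^esub>, y)) ` carrier Y2"
          then obtain y where y: "y \<in> carrier Y2" "\<psi> (y1, \<zero>\<^bsub>Y2\<^esub>) = \<psi> (\<zero>\<^bsub>Y1\<^esub>, y)" by auto
          then show False using p(3)[of "(y1, \<zero>\<^bsub>Y2\<^esub>)"] p(3)[of "(\<zero>\<^bsub>Y1\<^esub>, y)"] y1 by simp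
        qed
      qed
      ultimately show ?thesis using sum[OF Y 3(1-3)] by blast
    qed
  qed
  then show ?thesis using Y chain_measure[OF R Y] by metis
qed

lemma indecomposable_retract_iso:
  fixes R :: "('k, 'r) module" and X :: "('k, 'r) small_module"
  assumes R: "fd_algebra K R" and X: "fg_module R X" "indecomposable R X"
    and Y: "fg_module R Y" "indecomposable R Y" and r: "retract R X Y"
  shows "module_iso R X Y"
proof -
  obtain f g where fg: "f \<in> module_homs R X Y" "g \<in> module_homs R Y X" "\<And>x. x \<in> carrier X \<Longrightarrow> g (f x) = x"
    using r by (auto simp: retract_def)
  obtain Z :: "('k, 'r) small_module" where Z: "fg_module R Z" "module_iso R Y (direct_sum X Z)"
    "carrier Z = {\<zero>\<^bsub>Z\<^esub>} \<longrightarrow> (\<forall>y\<in>carrier Y. f (g y) = y)"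
    using retract_complement[OF R Y(1) fg_module_left[OF X(1)] fg] by metis
  have "carrier X \<noteq> {\<zero>\<^bsub>X\<^esub>}" using X(2) by (simp add: indecomposable_def)
  then have "carrier Z = {\<zero>\<^bsub>Z\<^esub>}" using Y(2) X(1) Z(1,2) unfolding indecomposable_def by blast
  then show ?thesis using Z(3) by (intro module_isoI[OF fg]) auto
qed

text \<open>The part of Krull-Schmidt that counts: decompose \<open>Y\<close>. An indecomposable
  retract of a direct sum is a retract of one of the two terms, and an indecomposable retract of an
  indecomposable module is isomorphic to it.\<close>

lemma finite_indecomposable_retracts:
  fixes R :: "('k, 'r) module" and Y :: "('k, 'r) small_module"
  assumes R: "fd_algebra K R" and "fg_module R Y"
  shows "\<exists>S :: ('k, 'r) small_module set. finite S \<and> (\<forall>X :: ('k, 'r) small_module.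
    fg_module R X \<longrightarrow> indecomposable R X \<longrightarrow> retract R X Y \<longrightarrow> (\<exists>Z\<in>S. module_iso R X Z))"
  using assms
proof (induction rule: decomposition_induct)
  case (zero Y)
  have "\<not> retract R X Y" if X: "indecomposable R X" "fg_module R X" for X :: "('k, 'r) small_module"
  proof
    assume "retract R X Y"
    then obtain f g where fg: "f \<in> module_homs R X Y" "g \<in> module_homs R Y X" "\<And>x. x \<in> carrier X \<Longrightarrow> g (f x) = x"
      by (auto simp: retract_def)
    obtain x where x: "x \<in> carrier X" "x \<noteq> \<zero>\<^bsub>X\<^esub>" using indecomposable_nonzero[OF X(1)] .
    have "f x = \<zero>\<^bsub>Y\<^esub>" using hom_closed[OF fg(1) x(1)] zero(2) by simp
    then show False
      using fg(3)[OF x(1)] hom_zero[OF fg(2) fg_module_left[OF zero(1)] fg_module_left[OF X(2)]] x by simp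
  qed
  then show ?case by (intro exI[of _ "{}"]) blast
next
  case (indecomposable Y)
  then show ?case using indecomposable_retract_iso[OF R] by (intro exI[of _ "{Y}"]) blast
next
  case (sum Y Y1 Y2)
  note l = fg_module_left[OF sum(1)] fg_module_left[OF sum(2)] fg_module_left[OF sum(3)]
  note ls = left_module_direct_sum[OF l(2,3)]
  interpret Y1: left_module R Y1 by fact
  interpret Y2: left_module R Y2 by fact
  from sum.IH(1) obtain S1 :: "('k, 'r) small_module set" where S1: "finite S1"
    "\<forall>X :: ('k, 'r) small_module. fg_module R X \<longrightarrow> indecomposable R X \<longrightarrow> retract R X Y1
      \<longrightarrow> (\<exists>Z\<in>S1. module_iso R X Z)" by metis
  from sum.IH(2) obtain S2 :: "('k, 'r) small_module set" where S2: "finite S2"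
    "\<forall>X :: ('k, 'r) small_module. fg_module R X \<longrightarrow> indecomposable R X \<longrightarrow> retract R X Y2
      \<longrightarrow> (\<exists>Z\<in>S2. module_iso R X Z)" by metis
  have "retract R X Y1 \<or> retract R X Y2"
    if X: "fg_module R X" "indecomposable R X" "retract R X Y" for X :: "('k, 'r) small_module"
  proof -
    note lX = fg_module_left[OF X(1)]
    have "retract R X (direct_sum Y1 Y2)"
      by (rule retract_trans[OF X(3) module_iso_retract(1)[OF sum(4) l(1) ls]])
    then obtain f g where fg: "f \<in> module_homs R X (direct_sum Y1 Y2)" "g \<in> module_homs R (direct_sum Y1 Y2) X"
      "\<And>x. x \<in> carrier X \<Longrightarrow> g (f x) = x"
      by (auto simp: retract_def)
    have i: "(\<lambda>y. g (y, \<zero>\<^bsub>Y2\<^esub>)) \<in> module_homs R Y1 X" "(\<lambda>y. g (\<zero>\<^bsub>Y1\<^esub>, y)) \<in> module_homs R Y2 X"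
      by (intro hom_comp[OF _ fg(2)] hom_pair hom_id hom_zero_map l)+
    show ?thesis
    proof (rule indecomposable_add_map_sum[OF R X(1,2)])
      show "add_map R Y1 X X (\<lambda>x. g (fst (f x), \<zero>\<^bsub>Y2\<^esub>))"
        by (rule add_map_single[OF lX hom_comp[OF fg(1) hom_fst] i(1)])
      show "add_map R Y2 X X (\<lambda>x. g (\<zero>\<^bsub>Y1\<^esub>, snd (f x)))"
        by (rule add_map_single[OF lX hom_comp[OF fg(1) hom_snd] i(2)])
      fix x assume x: "x \<in> carrier X"
      obtain y1 y2 where y: "f x = (y1, y2)" "y1 \<in> carrier Y1" "y2 \<in> carrier Y2"
        using hom_closed[OF fg(1) x] by auto
      show "g (fst (f x), \<zero>\<^bsub>Y2\<^esub>) \<oplus>\<^bsub>X\<^esub> g (\<zero>\<^bsub>Y1\<^esub>, snd (f x)) = x"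
        using hom_add[OF fg(2), of "(y1, \<zero>\<^bsub>Y2\<^esub>)" "(\<zero>\<^bsub>Y1\<^esub>, y2)"] y fg(3)[OF x] by simp
    qed
  qed
  then show ?case
    by (intro exI[of _ "S1 \<union> S2"] conjI allI impI) (use S1 S2 in \<open>simp, metis UnCI\<close>)
qed

section \<open>Tensor products\<close>

text \<open>
  \<open>W\<close> stands for any of the records (algebra, bimodule, module) built on the group \<open>tensor_group\<close>.
\<close>

locale tensor_product =
  fixes M :: "('m, 'd) ring_scheme" and N :: "('n, 'e) ring_scheme" and S :: "('s, 'c) ring_scheme"
    and ra :: "'m \<Rightarrow> 's \<Rightarrow> 'm" and la :: "'s \<Rightarrow> 'n \<Rightarrow> 'n"
    and W :: "(('m \<times> 'n \<Rightarrow>\<^sub>0 int) set, 'w) ring_scheme"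
  assumes M: "abelian_group M" and N: "abelian_group N"
    and ra_closed: "\<lbrakk>x \<in> carrier M; s \<in> carrier S\<rbrakk> \<Longrightarrow> ra x s \<in> carrier M"
    and la_closed: "\<lbrakk>s \<in> carrier S; y \<in> carrier N\<rbrakk> \<Longrightarrow> la s y \<in> carrier N"
    and carrier_W: "carrier W = carrier (tensor_group S ra la M N)"
    and zero_W: "zero W = one (tensor_group S ra la M N)"
    and add_W: "add W = mult (tensor_group S ra la M N)"
begin

sublocale M: abelian_group M by (rule M)
sublocale N: abelian_group N by (rule N)

abbreviation "cl \<equiv> tensor_class S ra la M N"

abbreviation pure_tensor :: "'m \<Rightarrow> 'n \<Rightarrow> ('m \<times> 'n \<Rightarrow>\<^sub>0 int) set" where
  "pure_tensor x y \<equiv> tensor_class S ra la M N (frag_of (x, y))"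

lemma free: "comm_group (tensor_free M N)" "group (tensor_free M N)"
  by (simp_all add: tensor_free_def abelian_free_Abelian_group)

lemma free_simps [simp]:
  "t \<in> carrier (tensor_free M N) \<longleftrightarrow> Poly_Mapping.keys t \<subseteq> carrier M \<times> carrier N"
  "one (tensor_free M N) = 0" "mult (tensor_free M N) = (+)"
  by (auto simp: tensor_free_def fun_eq_iff)

lemma frag_diff_free:
  "t \<in> carrier (tensor_free M N) \<Longrightarrow> u \<in> carrier (tensor_free M N) \<Longrightarrow> t - u \<in> carrier (tensor_free M N)"
  using keys_diff[of t u] by auto

lemma frag_add_free:
  "t \<in> carrier (tensor_free M N) \<Longrightarrow> u \<in> carrier (tensor_free M N) \<Longrightarrow> t + u \<in> carrier (tensor_free M N)"
  using keys_add[of t u] by auto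

lemma relators_subset: "tensor_relators S ra la M N \<subseteq> carrier (tensor_free M N)"
proof
  fix t assume "t \<in> tensor_relators S ra la M N"
  then show "t \<in> carrier (tensor_free M N)"
    unfolding tensor_relators_def
    by (elim UnE CollectE exE conjE; hypsubst; intro frag_diff_free) (simp_all add: ra_closed la_closed)
qed

lemma subgroup_relations: "subgroup (tensor_relations S ra la M N) (tensor_free M N)"
  unfolding tensor_relations_def by (rule group.generate_is_subgroup[OF free(2) relators_subset])

lemma normal_relations: "tensor_relations S ra la M N \<lhd> tensor_free M N"
  by (rule comm_group.subgroup_imp_normal[OF free(1) subgroup_relations])

lemma cl_add:
  assumes "t \<in> carrier (tensor_free M N)" "u \<in> carrier (tensor_free M N)"
  shows "cl (t + u) = cl t \<oplus>\<^bsub>W\<^esub> cl u"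
  using normal.rcos_sum[OF normal_relations assms]
  by (simp add: add_W tensor_group_def tensor_class_def FactGroup_def)

lemma cl_closed: "t \<in> carrier (tensor_free M N) \<Longrightarrow> cl t \<in> carrier W"
  using group.rcosetsI[OF free(2)] subgroup.subset[OF subgroup_relations]
  by (auto simp: carrier_W tensor_group_def tensor_class_def FactGroup_def RCOSETS_def)

lemma cl_surj: "w \<in> carrier W \<Longrightarrow> \<exists>t\<in>carrier (tensor_free M N). w = cl t"
  by (auto simp: carrier_W tensor_group_def tensor_class_def FactGroup_def RCOSETS_def)

lemma cl_eqI:
  assumes "t \<in> carrier (tensor_free M N)" "u \<in> carrier (tensor_free M N)"
    "t - u \<in> tensor_relations S ra la M N"
  shows "cl t = cl u"
proof -
  have "t \<in> tensor_relations S ra la M N #>\<^bsub>tensor_free M N\<^esub> u"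
    unfolding r_coset_def using assms(3) by (auto intro!: bexI[of _ "t - u"])
  from group.repr_independence[OF free(2) this assms(2) subgroup_relations]
  show ?thesis by (simp add: tensor_class_def)
qed

lemma cl_zero: "cl 0 = \<zero>\<^bsub>W\<^esub>"
  using group.coset_join2[OF free(2) _ subgroup_relations, of 0] subgroup.one_closed[OF subgroup_relations]
  by (simp add: zero_W tensor_group_def tensor_class_def FactGroup_def)

lemma tensor_rep:
  assumes "t \<in> carrier (tensor_free M N)"
  shows "tensor_rep (cl t) \<in> carrier (tensor_free M N)"
    "tensor_rep (cl t) - t \<in> tensor_relations S ra la M N"
proof -
  have "t \<in> cl t"
    using group.rcos_self[OF free(2) assms subgroup_relations] by (simp add: tensor_class_def)
  then have "tensor_rep (cl t) \<in> cl t" unfolding tensor_rep_def by (rule someI)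
  then obtain h where h: "h \<in> tensor_relations S ra la M N" "tensor_rep (cl t) = h + t"
    by (auto simp: tensor_class_def r_coset_def)
  have "h \<in> carrier (tensor_free M N)"
    using h(1) subgroup.subset[OF subgroup_relations] by blast
  then show "tensor_rep (cl t) \<in> carrier (tensor_free M N)" using h(2) assms frag_add_free by simp
  show "tensor_rep (cl t) - t \<in> tensor_relations S ra la M N" using h by simp
qed

lemma tensor_rep_cl: "w \<in> carrier W \<Longrightarrow> tensor_rep w \<in> carrier (tensor_free M N) \<and> cl (tensor_rep w) = w"
  using cl_surj[of w] tensor_rep cl_eqI by metis

lemma relatorD:
  assumes "t - u \<in> tensor_relators S ra la M N" "t \<in> carrier (tensor_free M N)" "u \<in> carrier (tensor_free M N)"
  shows "cl t = cl u"
  using assms group.generate_incl[OF free(2) relators_subset] unfolding tensor_relations_def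
  by (intro cl_eqI) (auto simp: tensor_relations_def intro: generate.incl)

lemma pure_closed: "x \<in> carrier M \<Longrightarrow> y \<in> carrier N \<Longrightarrow> pure_tensor x y \<in> carrier W"
  by (intro cl_closed) simp

lemma pure_add_left:
  assumes "x \<in> carrier M" "x' \<in> carrier M" "y \<in> carrier N"
  shows "pure_tensor (x \<oplus>\<^bsub>M\<^esub> x') y = pure_tensor x y \<oplus>\<^bsub>W\<^esub> pure_tensor x' y"
proof -
  have "pure_tensor (x \<oplus>\<^bsub>M\<^esub> x') y = cl (frag_of (x, y) + frag_of (x', y))"
  proof (rule relatorD)
    show "frag_of (x \<oplus>\<^bsub>M\<^esub> x', y) - (frag_of (x, y) + frag_of (x', y)) \<in> tensor_relators S ra la M N"
      unfolding tensor_relators_def diff_diff_eq[symmetric] using assms by blast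
  qed (use assms frag_add_free in simp_all)
  then show ?thesis using assms by (simp add: cl_add)
qed

lemma pure_add_right:
  assumes "x \<in> carrier M" "y \<in> carrier N" "y' \<in> carrier N"
  shows "pure_tensor x (y \<oplus>\<^bsub>N\<^esub> y') = pure_tensor x y \<oplus>\<^bsub>W\<^esub> pure_tensor x y'"
proof -
  have "pure_tensor x (y \<oplus>\<^bsub>N\<^esub> y') = cl (frag_of (x, y) + frag_of (x, y'))"
  proof (rule relatorD)
    show "frag_of (x, y \<oplus>\<^bsub>N\<^esub> y') - (frag_of (x, y) + frag_of (x, y')) \<in> tensor_relators S ra la M N"
      unfolding tensor_relators_def diff_diff_eq[symmetric] using assms by blast
  qed (use assms frag_add_free in simp_all)
  then show ?thesis using assms by (simp add: cl_add)
qed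

lemma pure_balanced:
  assumes "x \<in> carrier M" "s \<in> carrier S" "y \<in> carrier N"
  shows "pure_tensor (ra x s) y = pure_tensor x (la s y)"
proof (rule relatorD)
  show "frag_of (ra x s, y) - frag_of (x, la s y) \<in> tensor_relators S ra la M N"
    unfolding tensor_relators_def using assms by blast
qed (use assms ra_closed la_closed in simp_all)

lemma abelian_group_W: "abelian_group W"
proof -
  interpret G: comm_group "tensor_free M N" by (rule free)
  interpret T: comm_group "tensor_group S ra la M N"
    unfolding tensor_group_def by (rule G.abelian_FactGroup[OF subgroup_relations])
  show ?thesis
    by (rule abelian_groupI) (simp_all add: carrier_W zero_W add_W T.m_assoc T.m_ac T.l_inv_ex)
qed

sublocale W: abelian_group W by (rule abelian_group_W)

text \<open>Integer coefficients can be avoided because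
  \<open>-(x \<otimes> y) = (-x) \<otimes> y\<close> is again pure, so sums of pure tensors exhaust
  the group.\<close>

lemma tensor_induct [consumes 1, case_names zero add pure]:
  assumes w: "w \<in> carrier W" and zero: "P \<zero>\<^bsub>W\<^esub>"
    and add: "\<And>u v. u \<in> carrier W \<Longrightarrow> v \<in> carrier W \<Longrightarrow> P u \<Longrightarrow> P v \<Longrightarrow> P (u \<oplus>\<^bsub>W\<^esub> v)"
    and pure: "\<And>x y. x \<in> carrier M \<Longrightarrow> y \<in> carrier N \<Longrightarrow> P (pure_tensor x y)"
  shows "P w"
proof -
  obtain t where t: "t \<in> carrier (tensor_free M N)" "w = cl t" using cl_surj[OF w] by auto
  have neg: "- u \<in> carrier (tensor_free M N)" if "u \<in> carrier (tensor_free M N)" for u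
    using that by simp
  \<comment> \<open>The induction principle of free abelian groups uses differences, hence the claim
    is carried for \<open>t\<close> and \<open>-t\<close> together.\<close>
  have "P (cl t) \<and> P (cl (- t))"
  proof (rule free_Abelian_group_induct[of t "carrier M \<times> carrier N"])
    fix t u :: "'m \<times> 'n \<Rightarrow>\<^sub>0 int"
    assume tu: "Poly_Mapping.keys t \<subseteq> carrier M \<times> carrier N" "Poly_Mapping.keys u \<subseteq> carrier M \<times> carrier N"
      and P: "P (cl t) \<and> P (cl (- t))" "P (cl u) \<and> P (cl (- u))"
    have "cl (t - u) = cl t \<oplus>\<^bsub>W\<^esub> cl (- u)" "cl (- (t - u)) = cl (- t) \<oplus>\<^bsub>W\<^esub> cl u"
      using cl_add[of t "- u"] cl_add[of "- t" u] tu by simp_all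
    then show "P (cl (t - u)) \<and> P (cl (- (t - u)))"
      using P add[of "cl t" "cl (- u)"] add[of "cl (- t)" "cl u"] tu by (simp add: cl_closed)
  next
    fix a assume "a \<in> carrier M \<times> carrier N"
    then obtain x y where a: "a = (x, y)" "x \<in> carrier M" "y \<in> carrier N" by auto
    have "pure_tensor \<zero>\<^bsub>M\<^esub> y \<oplus>\<^bsub>W\<^esub> pure_tensor \<zero>\<^bsub>M\<^esub> y = pure_tensor \<zero>\<^bsub>M\<^esub> y"
      using pure_add_left[of "\<zero>\<^bsub>M\<^esub>" "\<zero>\<^bsub>M\<^esub>" y] a by simp
    then have z: "pure_tensor \<zero>\<^bsub>M\<^esub> y = \<zero>\<^bsub>W\<^esub>"
      using pure_closed[of "\<zero>\<^bsub>M\<^esub>" y] a by (simp add: W.add.r_cancel_one')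
    have "cl (- frag_of a) \<oplus>\<^bsub>W\<^esub> pure_tensor x y = \<zero>\<^bsub>W\<^esub>"
      using cl_add[of "- frag_of (x, y)" "frag_of (x, y)"] a by (simp add: cl_zero)
    moreover have "pure_tensor (\<ominus>\<^bsub>M\<^esub> x) y \<oplus>\<^bsub>W\<^esub> pure_tensor x y = \<zero>\<^bsub>W\<^esub>"
      using pure_add_left[of "\<ominus>\<^bsub>M\<^esub> x" x y] a by (simp add: M.l_neg z)
    ultimately have "cl (- frag_of a) = pure_tensor (\<ominus>\<^bsub>M\<^esub> x) y"
      using a pure_closed cl_closed[of "- frag_of a"] by (metis M.a_inv_closed W.minus_equality neg frag_of_in_free_Abelian_group tensor_free_def SigmaI)
    then show "P (cl (frag_of a)) \<and> P (cl (- frag_of a))" using pure a by simp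
  qed (use t zero cl_zero in simp_all)
  then show ?thesis using t by simp
qed

text \<open>The uniqueness half of the universal property. Almost every identity between maps on
  tensor products below is reduced to pure tensors by it.\<close>

lemma additive_map_eqI:
  assumes "additive_map W H f" "additive_map W H g" "abelian_group H" "w \<in> carrier W"
    and "\<And>x y. x \<in> carrier M \<Longrightarrow> y \<in> carrier N \<Longrightarrow> f (pure_tensor x y) = g (pure_tensor x y)"
  shows "f w = g w"
  using assms(4)
proof (induction rule: tensor_induct)
  case zero
  show ?case
    using additive_map_zero[OF assms(1) abelian_group_W assms(3)]
      additive_map_zero[OF assms(2) abelian_group_W assms(3)] by simp
next
  case (add u v)
  then show ?case using additive_map_add[OF assms(1)] additive_map_add[OF assms(2)] by simp
next
  case (pure x y)
  then show ?case using assms(5) by simp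
qed

section \<open>The universal property of the tensor product\<close>

definition balanced :: "('h, 'z) ring_scheme \<Rightarrow> ('m \<Rightarrow> 'n \<Rightarrow> 'h) \<Rightarrow> bool" where
  "balanced H \<beta> \<longleftrightarrow>
    (\<forall>x\<in>carrier M. \<forall>y\<in>carrier N. \<beta> x y \<in> carrier H) \<and>
    (\<forall>x\<in>carrier M. \<forall>x'\<in>carrier M. \<forall>y\<in>carrier N. \<beta> (x \<oplus>\<^bsub>M\<^esub> x') y = \<beta> x y \<oplus>\<^bsub>H\<^esub> \<beta> x' y) \<and>
    (\<forall>x\<in>carrier M. \<forall>y\<in>carrier N. \<forall>y'\<in>carrier N. \<beta> x (y \<oplus>\<^bsub>N\<^esub> y') = \<beta> x y \<oplus>\<^bsub>H\<^esub> \<beta> x y') \<and>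
    (\<forall>x\<in>carrier M. \<forall>s\<in>carrier S. \<forall>y\<in>carrier N. \<beta> (ra x s) y = \<beta> x (la s y))"

lemma balancedI:
  assumes "\<And>x y. x \<in> carrier M \<Longrightarrow> y \<in> carrier N \<Longrightarrow> \<beta> x y \<in> carrier H"
    "\<And>x x' y. x \<in> carrier M \<Longrightarrow> x' \<in> carrier M \<Longrightarrow> y \<in> carrier N \<Longrightarrow> \<beta> (x \<oplus>\<^bsub>M\<^esub> x') y = \<beta> x y \<oplus>\<^bsub>H\<^esub> \<beta> x' y"
    "\<And>x y y'. x \<in> carrier M \<Longrightarrow> y \<in> carrier N \<Longrightarrow> y' \<in> carrier N \<Longrightarrow> \<beta> x (y \<oplus>\<^bsub>N\<^esub> y') = \<beta> x y \<oplus>\<^bsub>H\<^esub> \<beta> x y'"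
    "\<And>x s y. x \<in> carrier M \<Longrightarrow> s \<in> carrier S \<Longrightarrow> y \<in> carrier N \<Longrightarrow> \<beta> (ra x s) y = \<beta> x (la s y)"
  shows "balanced H \<beta>"
  using assms by (simp add: balanced_def)

text \<open>The operations on cosets are defined through a chosen representative. The zero set of
  \<open>\<phi>\<close> is a subgroup that contains the relators, hence all relations, so the value
  of \<open>\<phi>\<close> does not depend on the choice.\<close>

lemma descend:
  assumes H: "abelian_group H"
    and \<phi>: "\<And>t. t \<in> carrier (tensor_free M N) \<Longrightarrow> \<phi> t \<in> carrier H"
      "\<And>t u. t \<in> carrier (tensor_free M N) \<Longrightarrow> u \<in> carrier (tensor_free M N) \<Longrightarrow> \<phi> (t + u) = \<phi> t \<oplus>\<^bsub>H\<^esub> \<phi> u"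
    and \<beta>: "balanced H (\<lambda>x y. \<phi> (frag_of (x, y)))"
  shows "additive_map W H (\<lambda>w. \<phi> (tensor_rep w))"
    "\<And>t. t \<in> carrier (tensor_free M N) \<Longrightarrow> \<phi> (tensor_rep (cl t)) = \<phi> t"
proof -
  interpret H: abelian_group H by fact
  let ?F = "carrier (tensor_free M N)"
  have z: "\<phi> 0 = \<zero>\<^bsub>H\<^esub>"
    using \<phi>(1)[of 0] \<phi>(2)[of 0 0] by simp
  have d: "\<phi> (t - u) = \<phi> t \<ominus>\<^bsub>H\<^esub> \<phi> u" if "t \<in> ?F" "u \<in> ?F" for t u
  proof -
    have "\<phi> (t - u) \<oplus>\<^bsub>H\<^esub> \<phi> u = \<phi> t" using \<phi>(2)[OF frag_diff_free[OF that] that(2)] by simp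
    then show ?thesis
      using H.plus_minus_cancel[OF \<phi>(1)[OF frag_diff_free[OF that]] \<phi>(1)[OF that(2)]] by simp
  qed
  have "subgroup {t \<in> ?F. \<phi> t = \<zero>\<^bsub>H\<^esub>} (tensor_free M N)"
  proof (rule group.subgroupI[OF free(2)])
    show "{t \<in> ?F. \<phi> t = \<zero>\<^bsub>H\<^esub>} \<noteq> {}" using z by (auto intro: exI[of _ 0])
    fix t assume t: "t \<in> {t \<in> ?F. \<phi> t = \<zero>\<^bsub>H\<^esub>}"
    then have "\<phi> (- t) = \<zero>\<^bsub>H\<^esub>" using d[of 0 t] z by (simp add: a_minus_def)
    moreover have "inv\<^bsub>tensor_free M N\<^esub> t = - t" using t by (simp add: tensor_free_def)
    ultimately show "inv\<^bsub>tensor_free M N\<^esub> t \<in> {t \<in> ?F. \<phi> t = \<zero>\<^bsub>H\<^esub>}" using t by simp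
  next
    fix t u assume "t \<in> {t \<in> ?F. \<phi> t = \<zero>\<^bsub>H\<^esub>}" "u \<in> {t \<in> ?F. \<phi> t = \<zero>\<^bsub>H\<^esub>}"
    then show "t \<otimes>\<^bsub>tensor_free M N\<^esub> u \<in> {t \<in> ?F. \<phi> t = \<zero>\<^bsub>H\<^esub>}"
      using frag_add_free[of t u] \<phi>(2)[of t u] by simp
  qed auto
  moreover have "tensor_relators S ra la M N \<subseteq> {t \<in> ?F. \<phi> t = \<zero>\<^bsub>H\<^esub>}"
  proof
    fix t assume t: "t \<in> tensor_relators S ra la M N"
    have f: "frag_of (x, y) \<in> ?F" "\<phi> (frag_of (x, y)) \<in> carrier H" if "x \<in> carrier M" "y \<in> carrier N" for x y
      using that by (simp_all add: \<phi>(1))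
    from t have "\<phi> t = \<zero>\<^bsub>H\<^esub>"
      unfolding tensor_relators_def
    proof (elim UnE CollectE exE conjE)
      fix x x' y assume t: "t = frag_of (x \<oplus>\<^bsub>M\<^esub> x', y) - frag_of (x, y) - frag_of (x', y)"
        and xy: "x \<in> carrier M" "x' \<in> carrier M" "y \<in> carrier N"
      have "\<phi> t = \<phi> (frag_of (x \<oplus>\<^bsub>M\<^esub> x', y)) \<ominus>\<^bsub>H\<^esub> (\<phi> (frag_of (x, y)) \<oplus>\<^bsub>H\<^esub> \<phi> (frag_of (x', y)))"
        unfolding t diff_diff_eq using xy f by (simp add: d frag_add_free \<phi>(2) del: free_simps)
      then show ?thesis using \<beta> xy f by (simp add: balanced_def H.minus_self)
    next
      fix x y y' assume t: "t = frag_of (x, y \<oplus>\<^bsub>N\<^esub> y') - frag_of (x, y) - frag_of (x, y')"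
        and xy: "x \<in> carrier M" "y \<in> carrier N" "y' \<in> carrier N"
      have "\<phi> t = \<phi> (frag_of (x, y \<oplus>\<^bsub>N\<^esub> y')) \<ominus>\<^bsub>H\<^esub> (\<phi> (frag_of (x, y)) \<oplus>\<^bsub>H\<^esub> \<phi> (frag_of (x, y')))"
        unfolding t diff_diff_eq using xy f by (simp add: d frag_add_free \<phi>(2) del: free_simps)
      then show ?thesis using \<beta> xy f by (simp add: balanced_def H.minus_self)
    next
      fix x s y assume t: "t = frag_of (ra x s, y) - frag_of (x, la s y)"
        and xy: "x \<in> carrier M" "s \<in> carrier S" "y \<in> carrier N"
      have "\<phi> t = \<phi> (frag_of (ra x s, y)) \<ominus>\<^bsub>H\<^esub> \<phi> (frag_of (x, la s y))"
        unfolding t using xy f ra_closed la_closed by (simp add: d del: free_simps)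
      then show ?thesis using \<beta> xy f la_closed by (simp add: balanced_def H.minus_self)
    qed
    then show "t \<in> {t \<in> ?F. \<phi> t = \<zero>\<^bsub>H\<^esub>}" using t relators_subset by blast
  qed
  ultimately have rel: "tensor_relations S ra la M N \<subseteq> {t \<in> ?F. \<phi> t = \<zero>\<^bsub>H\<^esub>}"
    unfolding tensor_relations_def by (rule group.generate_subgroup_incl[OF free(2), rotated])
  show e: "\<phi> (tensor_rep (cl t)) = \<phi> t" if "t \<in> ?F" for t
  proof -
    have "\<phi> (tensor_rep (cl t) - t) = \<zero>\<^bsub>H\<^esub>" using tensor_rep(2)[OF that] rel by auto
    then show ?thesis
      using d[OF tensor_rep(1)[OF that] that] \<phi>(1)[OF that] \<phi>(1)[OF tensor_rep(1)[OF that]]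
      by (simp add: H.minus_eq_zero_iff)
  qed
  show "additive_map W H (\<lambda>w. \<phi> (tensor_rep w))"
  proof (rule additive_mapI)
    fix w assume "w \<in> carrier W"
    then show "\<phi> (tensor_rep w) \<in> carrier H" using tensor_rep_cl \<phi>(1) by blast
  next
    fix u v assume uv: "u \<in> carrier W" "v \<in> carrier W"
    obtain t s where "t \<in> ?F" "u = cl t" "s \<in> ?F" "v = cl s" using cl_surj uv by meson
    then show "\<phi> (tensor_rep (u \<oplus>\<^bsub>W\<^esub> v)) = \<phi> (tensor_rep u) \<oplus>\<^bsub>H\<^esub> \<phi> (tensor_rep v)"
      using e[of t] e[of s] e[of "t + s"] frag_add_free \<phi>(2) by (simp add: cl_add[symmetric] del: free_simps)
  qed
qed

lemma lift:
  assumes H: "abelian_group H" and \<beta>: "balanced H \<beta>"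
  obtains h where "additive_map W H h"
    "\<And>x y. x \<in> carrier M \<Longrightarrow> y \<in> carrier N \<Longrightarrow> h (pure_tensor x y) = \<beta> x y"
proof -
  interpret H: abelian_group H by fact
  have "(\<lambda>(x, y). \<beta> x y) ` (carrier M \<times> carrier N) \<subseteq> carrier (add_monoid H)"
    using \<beta> by (auto simp: balanced_def)
  from comm_group.free_Abelian_group_universal[OF H.a_comm_group this] obtain \<phi> where
    \<phi>: "\<phi> \<in> hom (free_Abelian_group (carrier M \<times> carrier N)) (add_monoid H)"
      "\<And>p. p \<in> carrier M \<times> carrier N \<Longrightarrow> \<phi> (frag_of p) = (\<lambda>(x, y). \<beta> x y) p"
    by metis
  have 1: "\<phi> t \<in> carrier H" if "t \<in> carrier (tensor_free M N)" for t
    using hom_in_carrier[OF \<phi>(1), of t] that by (simp add: tensor_free_def)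
  have 2: "\<phi> (t + u) = \<phi> t \<oplus>\<^bsub>H\<^esub> \<phi> u"
    if "t \<in> carrier (tensor_free M N)" "u \<in> carrier (tensor_free M N)" for t u
    using hom_mult[OF \<phi>(1), of t u] that by (simp add: tensor_free_def)
  have 3: "\<phi> (frag_of (x, y)) = \<beta> x y" if "x \<in> carrier M" "y \<in> carrier N" for x y
    using \<phi>(2)[of "(x, y)"] that by simp
  have "balanced H (\<lambda>x y. \<phi> (frag_of (x, y)))"
    using \<beta> ra_closed la_closed by (simp add: balanced_def 3)
  from descend[OF H 1 2 this] have "additive_map W H (\<lambda>w. \<phi> (tensor_rep w))"
    "\<And>t. t \<in> carrier (tensor_free M N) \<Longrightarrow> \<phi> (tensor_rep (cl t)) = \<phi> t" by auto
  then show thesis using that[of "\<lambda>w. \<phi> (tensor_rep w)"] 3 by simp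
qed

end

text \<open>The common shape of the scalar actions, of the multiplication in
  \<open>tensor_algebra\<close> and of the induced maps: extend \<open>\<gamma>\<close> linearly
  over a representative and take the class. Well-definedness of all of them comes from this one
  statement.\<close>

lemma tensor_product_rep_map:
  assumes T: "tensor_product M N S ra la W" and T': "tensor_product M' N' S' ra' la' W'"
    and \<gamma>: "\<And>x y. x \<in> carrier M \<Longrightarrow> y \<in> carrier N \<Longrightarrow>
      Poly_Mapping.keys (\<gamma> (x, y)) \<subseteq> carrier M' \<times> carrier N'"
    and \<beta>: "tensor_product.balanced M N S ra la W' (\<lambda>x y. tensor_class S' ra' la' M' N' (\<gamma> (x, y)))"
  shows "additive_map W W' (\<lambda>w. tensor_class S' ra' la' M' N' (frag_extend \<gamma> (tensor_rep w)))"
    "\<And>t. t \<in> carrier (tensor_free M N) \<Longrightarrow>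
      tensor_class S' ra' la' M' N' (frag_extend \<gamma> (tensor_rep (tensor_class S ra la M N t)))
      = tensor_class S' ra' la' M' N' (frag_extend \<gamma> t)"
proof -
  interpret T: tensor_product M N S ra la W by fact
  interpret T': tensor_product M' N' S' ra' la' W' by fact
  have k: "frag_extend \<gamma> t \<in> carrier (tensor_free M' N')" if "t \<in> carrier (tensor_free M N)" for t
  proof -
    have "(\<Union>p\<in>Poly_Mapping.keys t. Poly_Mapping.keys (\<gamma> p)) \<subseteq> carrier M' \<times> carrier N'"
    proof (rule UN_least)
      fix p assume "p \<in> Poly_Mapping.keys t"
      then have "p \<in> carrier M \<times> carrier N" using that by auto
      then show "Poly_Mapping.keys (\<gamma> p) \<subseteq> carrier M' \<times> carrier N'" using \<gamma> by (cases p) simp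
    qed
    then have "Poly_Mapping.keys (frag_extend \<gamma> t) \<subseteq> carrier M' \<times> carrier N'"
      by (rule order_trans[OF keys_frag_extend])
    then show ?thesis by simp
  qed
  have 1: "T'.cl (frag_extend \<gamma> t) \<in> carrier W'" if "t \<in> carrier (tensor_free M N)" for t
    by (rule T'.cl_closed[OF k[OF that]])
  have 2: "T'.cl (frag_extend \<gamma> (t + u)) = T'.cl (frag_extend \<gamma> t) \<oplus>\<^bsub>W'\<^esub> T'.cl (frag_extend \<gamma> u)"
    if "t \<in> carrier (tensor_free M N)" "u \<in> carrier (tensor_free M N)" for t u
    unfolding frag_extend_add by (rule T'.cl_add[OF k k]) fact+
  have 3: "T.balanced W' (\<lambda>x y. T'.cl (frag_extend \<gamma> (frag_of (x, y))))"
    using \<beta> by simp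
  show "additive_map W W' (\<lambda>w. T'.cl (frag_extend \<gamma> (tensor_rep w)))"
    "\<And>t. t \<in> carrier (tensor_free M N) \<Longrightarrow> T'.cl (frag_extend \<gamma> (tensor_rep (T.cl t))) = T'.cl (frag_extend \<gamma> t)"
    using T.descend[OF T'.abelian_group_W 1 2 3] by blast+
qed

section \<open>The tensor functor of a bimodule\<close>

lemma additive_map_comp:
  "additive_map X Y f \<Longrightarrow> additive_map Y Z g \<Longrightarrow> additive_map X Z (\<lambda>x. g (f x))"
  by (simp add: additive_map_def)

lemma additive_map_plus:
  assumes "additive_map X Y f" "additive_map X Y g" "abelian_group Y"
  shows "additive_map X Y (\<lambda>x. f x \<oplus>\<^bsub>Y\<^esub> g x)"
proof -
  interpret Y: abelian_group Y by fact
  show ?thesis using assms(1,2) by (simp add: additive_map_def Y.a_ac)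
qed

lemma additive_map_id: "additive_map X X (\<lambda>x. x)"
  by (simp add: additive_map_def)

lemma additive_map_zero_map:
  assumes "abelian_group Y"
  shows "additive_map X Y (\<lambda>x. \<zero>\<^bsub>Y\<^esub>)"
proof -
  interpret Y: abelian_group Y by fact
  show ?thesis by (simp add: additive_map_def)
qed

lemma right_part_simps [simp]:
  "carrier (right_part M) = carrier M" "zero (right_part M) = zero M" "add (right_part M) = add M"
  "smult (right_part M) b x = rsmult M x b"
  by (simp_all add: right_part_def)

lemma opposite_simps [simp]:
  "carrier (opposite B) = carrier B" "zero (opposite B) = zero B" "add (opposite B) = add B"
  "one (opposite B) = one B" "mult (opposite B) x y = y \<otimes>\<^bsub>B\<^esub> x"
  by (simp_all add: opposite_def)

lemma smult_opposite: "smult (opposite B) = smult B"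
  by (simp add: opposite_def)

text \<open>The two commuting actions without a base field, so that the bimodules underlying
  arbitrary modules over the enveloping algebra are covered too. Centrality enters only when a
  bimodule is turned into such a module.\<close>

locale lr_bimodule =
  fixes A :: "('k, 'a) module" and B :: "('l, 'b) module" and M :: "('a, 'b, 'm) bimodule"
  assumes left: "left_module A M"
    and right: "left_module (opposite B) (right_part M)"
    and assoc: "\<lbrakk>a \<in> carrier A; x \<in> carrier M; b \<in> carrier B\<rbrakk> \<Longrightarrow>
      rsmult M (a \<odot>\<^bsub>M\<^esub> x) b = a \<odot>\<^bsub>M\<^esub> (rsmult M x b)"
begin

sublocale M: left_module A M by (rule left)
sublocale rM: left_module "opposite B" "right_part M" by (rule right)

lemma rsmult_closed: "x \<in> carrier M \<Longrightarrow> b \<in> carrier B \<Longrightarrow> rsmult M x b \<in> carrier M"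
  using rM.smult_closed[of b x] by simp

lemma rsmult_l_distr:
  "x \<in> carrier M \<Longrightarrow> y \<in> carrier M \<Longrightarrow> b \<in> carrier B \<Longrightarrow>
    rsmult M (x \<oplus>\<^bsub>M\<^esub> y) b = rsmult M x b \<oplus>\<^bsub>M\<^esub> rsmult M y b"
  using rM.smult_r_distr[of b x y] by simp

lemma rsmult_r_distr:
  "x \<in> carrier M \<Longrightarrow> b \<in> carrier B \<Longrightarrow> c \<in> carrier B \<Longrightarrow>
    rsmult M x (b \<oplus>\<^bsub>B\<^esub> c) = rsmult M x b \<oplus>\<^bsub>M\<^esub> rsmult M x c"
  using rM.smult_l_distr[of b c x] by simp

lemma rsmult_mult:
  "x \<in> carrier M \<Longrightarrow> b \<in> carrier B \<Longrightarrow> c \<in> carrier B \<Longrightarrow> rsmult M x (b \<otimes>\<^bsub>B\<^esub> c) = rsmult M (rsmult M x b) c"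
  using rM.smult_assoc[of c b x] by simp

lemma rsmult_one: "x \<in> carrier M \<Longrightarrow> rsmult M x \<one>\<^bsub>B\<^esub> = x"
  using rM.smult_one[of x] by simp

end

lemma central_bimodule_lr: "central_bimodule K A B M \<Longrightarrow> lr_bimodule A B M"
  by (simp add: central_bimodule_def lr_bimodule_def)

text \<open>The functor \<open>M \<otimes>\<^sub>B _\<close> on left modules. The shared fields are
  written exactly as in \<open>tensor_bimodule\<close>, so the two constructions agree on them by
  unfolding.\<close>

definition tensor_module ::
    "('b, 'c) ring_scheme \<Rightarrow> ('a, 'b, 'm) bimodule \<Rightarrow> ('b, 'n, 'e) module_scheme
      \<Rightarrow> ('a, ('m \<times> 'n \<Rightarrow>\<^sub>0 int) set) module" where
  "tensor_module B M L =
    (let G = tensor_group B (rsmult M) (smult L) M L;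
         cl = tensor_class B (rsmult M) (smult L) M L
     in \<lparr>carrier = carrier G, mult = undefined, one = undefined, zero = \<one>\<^bsub>G\<^esub>, add = mult G,
         smult = (\<lambda>a T. cl (frag_extend (\<lambda>(x, y). frag_of (a \<odot>\<^bsub>M\<^esub> x, y)) (tensor_rep T)))\<rparr>)"

text \<open>The source does not occur as an argument because the map acts on representatives. The
  left slot accepts maps that are linear only from the right: this is what allows splittings of
  right modules to be tensored.\<close>

definition tensor_map ::
    "('b, 'c) ring_scheme \<Rightarrow> ('a, 'b, 'm) bimodule \<Rightarrow> ('b, 'n, 'e) module_scheme
      \<Rightarrow> ('m0 \<Rightarrow> 'm) \<Rightarrow> ('n0 \<Rightarrow> 'n) \<Rightarrow> ('m0 \<times> 'n0 \<Rightarrow>\<^sub>0 int) set \<Rightarrow> ('m \<times> 'n \<Rightarrow>\<^sub>0 int) set" where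
  "tensor_map B M L g f w =
    tensor_class B (rsmult M) (smult L) M L (frag_extend (\<lambda>(x, y). frag_of (g x, f y)) (tensor_rep w))"

locale tensor_mod = lr_bimodule A B M
  for A :: "('k, 'a) module" and B :: "('l, 'b) module" and M :: "('a, 'b, 'm) bimodule" +
  fixes L :: "('b, 'n, 'e) module_scheme"
  assumes L: "left_module B L"
begin

sublocale L: left_module B L by (rule L)

sublocale T: tensor_product M L B "rsmult M" "smult L" "tensor_module B M L"
  by (unfold_locales)
    (simp_all add: M.M.abelian_group_axioms L.M.abelian_group_axioms rsmult_closed L.smult_closed
      tensor_module_def Let_def)

lemma smult_tensor:
  assumes a: "a \<in> carrier A"
  shows "additive_map (tensor_module B M L) (tensor_module B M L) (\<lambda>w. a \<odot>\<^bsub>tensor_module B M L\<^esub> w)"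
    "\<And>x y. x \<in> carrier M \<Longrightarrow> y \<in> carrier L \<Longrightarrow>
      a \<odot>\<^bsub>tensor_module B M L\<^esub> T.pure_tensor x y = T.pure_tensor (a \<odot>\<^bsub>M\<^esub> x) y"
proof -
  let ?\<gamma> = "\<lambda>(x, y). frag_of (a \<odot>\<^bsub>M\<^esub> x, y)"
  have b: "T.balanced (tensor_module B M L) (\<lambda>x y. T.cl (?\<gamma> (x, y)))"
    using a by (intro T.balancedI)
      (simp_all add: T.pure_closed M.smult_closed M.smult_r_distr T.pure_add_left T.pure_add_right
        assoc[symmetric] T.pure_balanced)
  have k: "Poly_Mapping.keys (?\<gamma> (x, y)) \<subseteq> carrier M \<times> carrier L"
    if "x \<in> carrier M" "y \<in> carrier L" for x y
    using a that by (simp add: M.smult_closed)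
  note r = tensor_product_rep_map[OF T.tensor_product_axioms T.tensor_product_axioms k b]
  show "additive_map (tensor_module B M L) (tensor_module B M L) (\<lambda>w. a \<odot>\<^bsub>tensor_module B M L\<^esub> w)"
    using r(1) by (simp add: tensor_module_def Let_def additive_map_def)
  show "a \<odot>\<^bsub>tensor_module B M L\<^esub> T.pure_tensor x y = T.pure_tensor (a \<odot>\<^bsub>M\<^esub> x) y"
    if "x \<in> carrier M" "y \<in> carrier L" for x y
    using r(2)[of "frag_of (x, y)"] that by (simp add: tensor_module_def Let_def)
qed

lemma left_module_tensor: "left_module A (tensor_module B M L)"
proof (intro left_module.intro left_module_axioms.intro T.abelian_group_W M.R.ring_axioms)
  note s = smult_tensor and W = T.abelian_group_W
  note eq = T.additive_map_eqI[OF _ _ W]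
  let ?T = "tensor_module B M L"
  show "a \<odot>\<^bsub>?T\<^esub> w \<in> carrier ?T" if "a \<in> carrier A" "w \<in> carrier ?T" for a w
    using additive_map_closed[OF s(1)] that by simp
  show "a \<odot>\<^bsub>?T\<^esub> (w \<oplus>\<^bsub>?T\<^esub> v) = a \<odot>\<^bsub>?T\<^esub> w \<oplus>\<^bsub>?T\<^esub> a \<odot>\<^bsub>?T\<^esub> v"
    if "a \<in> carrier A" "w \<in> carrier ?T" "v \<in> carrier ?T" for a w v
    using additive_map_add[OF s(1)] that by simp
  show "(a \<oplus>\<^bsub>A\<^esub> b) \<odot>\<^bsub>?T\<^esub> w = a \<odot>\<^bsub>?T\<^esub> w \<oplus>\<^bsub>?T\<^esub> b \<odot>\<^bsub>?T\<^esub> w"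
    if ab: "a \<in> carrier A" "b \<in> carrier A" and w: "w \<in> carrier ?T" for a b w
    by (rule eq[where f = "\<lambda>w. (a \<oplus>\<^bsub>A\<^esub> b) \<odot>\<^bsub>?T\<^esub> w", OF s(1) additive_map_plus[OF s(1) s(1) W] w])
      (use ab in \<open>simp_all add: s(2) M.smult_l_distr T.pure_add_left M.smult_closed\<close>)
  show "(a \<otimes>\<^bsub>A\<^esub> b) \<odot>\<^bsub>?T\<^esub> w = a \<odot>\<^bsub>?T\<^esub> (b \<odot>\<^bsub>?T\<^esub> w)"
    if ab: "a \<in> carrier A" "b \<in> carrier A" and w: "w \<in> carrier ?T" for a b w
    by (rule eq[where f = "\<lambda>w. (a \<otimes>\<^bsub>A\<^esub> b) \<odot>\<^bsub>?T\<^esub> w", OF s(1) additive_map_comp[OF s(1) s(1)] w])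
      (use ab in \<open>simp_all add: s(2) M.smult_assoc M.smult_closed\<close>)
  show "\<one>\<^bsub>A\<^esub> \<odot>\<^bsub>?T\<^esub> w = w" if w: "w \<in> carrier ?T" for w
    by (rule eq[where f = "\<lambda>w. \<one>\<^bsub>A\<^esub> \<odot>\<^bsub>?T\<^esub> w", OF s(1) additive_map_id w])
      (simp_all add: s(2) M.smult_one)
qed

sublocale W: left_module A "tensor_module B M L" by (rule left_module_tensor)

lemma lift_hom:
  assumes H: "left_module A H" and \<beta>: "T.balanced H \<beta>"
    and lin: "\<And>a x y. a \<in> carrier A \<Longrightarrow> x \<in> carrier M \<Longrightarrow> y \<in> carrier L \<Longrightarrow> \<beta> (a \<odot>\<^bsub>M\<^esub> x) y = a \<odot>\<^bsub>H\<^esub> \<beta> x y"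
  obtains h where "h \<in> module_homs A (tensor_module B M L) H"
    "\<And>x y. x \<in> carrier M \<Longrightarrow> y \<in> carrier L \<Longrightarrow> h (T.pure_tensor x y) = \<beta> x y"
proof -
  interpret H: left_module A H by fact
  obtain h where h: "additive_map (tensor_module B M L) H h"
    "\<And>x y. x \<in> carrier M \<Longrightarrow> y \<in> carrier L \<Longrightarrow> h (T.pure_tensor x y) = \<beta> x y"
    using T.lift[OF H.M.abelian_group_axioms \<beta>] by blast
  have aH: "additive_map H H (\<lambda>x. a \<odot>\<^bsub>H\<^esub> x)" if "a \<in> carrier A" for a
    using that by (simp add: additive_map_def H.smult_closed H.smult_r_distr)
  have "h \<in> module_homs A (tensor_module B M L) H"
  proof (rule module_homsI)
    fix a w assume a: "a \<in> carrier A" and w: "w \<in> carrier (tensor_module B M L)"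
    show "h (a \<odot>\<^bsub>tensor_module B M L\<^esub> w) = a \<odot>\<^bsub>H\<^esub> h w"
      by (rule T.additive_map_eqI[OF additive_map_comp[OF smult_tensor(1)[OF a] h(1)]
        additive_map_comp[OF h(1) aH[OF a]] H.M.abelian_group_axioms w])
        (use a in \<open>simp_all add: smult_tensor(2) h(2) lin M.smult_closed\<close>)
  qed (use additive_map_closed[OF h(1)] additive_map_add[OF h(1)] in simp_all)
  with that h(2) show thesis by blast
qed

lemma pure_zero_left: "y \<in> carrier L \<Longrightarrow> T.pure_tensor \<zero>\<^bsub>M\<^esub> y = \<zero>\<^bsub>tensor_module B M L\<^esub>"
  using T.pure_add_left[of "\<zero>\<^bsub>M\<^esub>" "\<zero>\<^bsub>M\<^esub>" y] T.pure_closed[of "\<zero>\<^bsub>M\<^esub>" y]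
  by (simp add: T.W.add.r_cancel_one')

lemma pure_zero_right: "x \<in> carrier M \<Longrightarrow> T.pure_tensor x \<zero>\<^bsub>L\<^esub> = \<zero>\<^bsub>tensor_module B M L\<^esub>"
  using T.pure_add_right[of x "\<zero>\<^bsub>L\<^esub>" "\<zero>\<^bsub>L\<^esub>"] T.pure_closed[of x "\<zero>\<^bsub>L\<^esub>"]
  by (simp add: T.W.add.r_cancel_one')

text \<open>Generators are the tensors of generators: in \<open>x \<otimes> b u\<close> the
  coefficient moves to the left, and \<open>x b\<close> is an \<open>A\<close>-combination of
  generators of \<open>M\<close>.\<close>

lemma fg_module_tensor:
  assumes M: "fg_module A M" and L: "fg_module B L"
  shows "fg_module A (tensor_module B M L)"
proof -
  let ?T = "tensor_module B M L"
  obtain S where S: "finite S" "S \<subseteq> carrier M" "carrier M \<subseteq> lspan A M S"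
    using M finitely_generated_iff[OF left] by (auto simp: fg_module_def)
  obtain U where U: "finite U" "U \<subseteq> carrier L" "carrier L \<subseteq> lspan B L U"
    using L finitely_generated_iff[OF L.left_module_axioms] by (auto simp: fg_module_def)
  let ?V = "(\<lambda>(s, u). T.pure_tensor s u) ` (S \<times> U)"
  have V: "?V \<subseteq> carrier ?T" using S(2) U(2) by (auto intro!: T.pure_closed)
  note sub = W.submoduleD[OF submodule_lspan[OF left_module_tensor V]]
  have 1: "T.pure_tensor x u \<in> lspan A ?T ?V" if "x \<in> lspan A M S" "u \<in> U" for x u
    using that
  proof induction
    case zero
    then show ?case using U sub(2) by (simp add: pure_zero_left subset_iff)
  next
    case (step x a s)
    have m: "x \<in> carrier M" "s \<in> carrier M" "u \<in> carrier L"
      using step S U M.submoduleD(1)[OF submodule_lspan[OF left S(2)]] by auto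
    have "a \<odot>\<^bsub>?T\<^esub> T.pure_tensor s u \<in> lspan A ?T ?V"
      using step lspan_base[OF left_module_tensor V, of "T.pure_tensor s u"] by (intro sub(4)) auto
    then show ?case
      using sub(3)[OF step.IH[OF step.prems]] m step
      by (simp add: T.pure_add_left M.smult_closed smult_tensor(2))
  qed
  have 2: "T.pure_tensor x y \<in> lspan A ?T ?V" if "y \<in> lspan B L U" "x \<in> carrier M" for x y
    using that
  proof (induction arbitrary: x)
    case zero
    then show ?case using sub(2) by (simp add: pure_zero_right)
  next
    case (step y b u)
    have m: "y \<in> carrier L" "u \<in> carrier L"
      using step U L.submoduleD(1)[OF submodule_lspan[OF L.left_module_axioms U(2)]] by auto
    have "T.pure_tensor x (y \<oplus>\<^bsub>L\<^esub> b \<odot>\<^bsub>L\<^esub> u) = T.pure_tensor x y \<oplus>\<^bsub>?T\<^esub> T.pure_tensor (rsmult M x b) u"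
      using m step by (simp add: T.pure_add_right L.smult_closed T.pure_balanced)
    moreover have "T.pure_tensor (rsmult M x b) u \<in> lspan A ?T ?V"
      using step S(3) rsmult_closed by (intro 1) auto
    ultimately show ?case using sub(3) step by simp
  qed
  have "w \<in> lspan A ?T ?V" if "w \<in> carrier ?T" for w
    using that
  proof (induction rule: T.tensor_induct)
    case (pure x y)
    then show ?case using 2 U(3) by auto
  qed (use sub in auto)
  moreover have "finite ?V" using S U by simp
  ultimately show ?thesis
    using V left_module_tensor finitely_generated_iff[OF left_module_tensor] unfolding fg_module_def by blast
qed

end

section \<open>Functoriality in both arguments\<close>

lemma tensor_map:
  assumes T: "tensor_mod A B M L" and T': "tensor_mod A' B M' L'"
    and g: "g \<in> module_homs (opposite B) (right_part M) (right_part M')" and f: "f \<in> module_homs B L L'"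
  shows "additive_map (tensor_module B M L) (tensor_module B M' L') (tensor_map B M' L' g f)"
    "\<And>x y. x \<in> carrier M \<Longrightarrow> y \<in> carrier L \<Longrightarrow>
      tensor_map B M' L' g f (tensor_class B (rsmult M) (smult L) M L (frag_of (x, y)))
      = tensor_class B (rsmult M') (smult L') M' L' (frag_of (g x, f y))"
proof -
  interpret T: tensor_mod A B M L by fact
  interpret T': tensor_mod A' B M' L' by fact
  let ?\<gamma> = "\<lambda>(x, y). frag_of (g x, f y)"
  have gc: "g x \<in> carrier M'" if "x \<in> carrier M" for x using hom_closed[OF g, of x] that by simp
  have ga: "g (x \<oplus>\<^bsub>M\<^esub> y) = g x \<oplus>\<^bsub>M'\<^esub> g y" if "x \<in> carrier M" "y \<in> carrier M" for x y
    using hom_add[OF g, of x y] that by simp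
  have gr: "g (rsmult M x b) = rsmult M' (g x) b" if "x \<in> carrier M" "b \<in> carrier B" for x b
    using hom_smult[OF g, of b x] that by simp
  have b: "T.T.balanced (tensor_module B M' L') (\<lambda>x y. T'.T.cl (?\<gamma> (x, y)))"
    by (intro T.T.balancedI)
      (simp_all add: gc ga gr hom_closed[OF f] hom_add[OF f] hom_smult[OF f] T'.T.pure_closed
        T'.T.pure_add_left T'.T.pure_add_right T'.T.pure_balanced)
  have k: "Poly_Mapping.keys (?\<gamma> (x, y)) \<subseteq> carrier M' \<times> carrier L'"
    if "x \<in> carrier M" "y \<in> carrier L" for x y
    using gc hom_closed[OF f] that by simp
  note r = tensor_product_rep_map[OF T.T.tensor_product_axioms T'.T.tensor_product_axioms k b]
  show "additive_map (tensor_module B M L) (tensor_module B M' L') (tensor_map B M' L' g f)"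
    using r(1) by (simp add: tensor_map_def additive_map_def)
  show "tensor_map B M' L' g f (T.T.pure_tensor x y) = T'.T.pure_tensor (g x) (f y)"
    if "x \<in> carrier M" "y \<in> carrier L" for x y
    using r(2)[of "frag_of (x, y)"] that by (simp add: tensor_map_def)
qed

lemma tensor_map_hom:
  assumes T: "tensor_mod A B M L" and T': "tensor_mod A B M' L'"
    and g: "g \<in> module_homs (opposite B) (right_part M) (right_part M')" "g \<in> module_homs A M M'"
    and f: "f \<in> module_homs B L L'"
  shows "tensor_map B M' L' g f \<in> module_homs A (tensor_module B M L) (tensor_module B M' L')"
proof (rule module_homsI)
  interpret T: tensor_mod A B M L by fact
  interpret T': tensor_mod A B M' L' by fact
  note m = tensor_map[OF T T' g(1) f]
  fix a w assume a: "a \<in> carrier A" and w: "w \<in> carrier (tensor_module B M L)"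
  show "tensor_map B M' L' g f (a \<odot>\<^bsub>tensor_module B M L\<^esub> w) = a \<odot>\<^bsub>tensor_module B M' L'\<^esub> tensor_map B M' L' g f w"
    by (rule T.T.additive_map_eqI[OF additive_map_comp[OF T.smult_tensor(1)[OF a] m(1)]
      additive_map_comp[OF m(1) T'.smult_tensor(1)[OF a]] T'.T.abelian_group_W w])
      (use a in \<open>simp_all add: m(2) T.smult_tensor(2) T'.smult_tensor(2) T.M.smult_closed
        hom_closed[OF g(2)] hom_closed[OF f] hom_smult[OF g(2)]\<close>)
qed (use tensor_map(1)[OF T T' g(1) f] in \<open>simp_all add: additive_map_def\<close>)

lemma tensor_map_comp:
  assumes T: "tensor_mod A B M L" and T': "tensor_mod A' B M' L'" and T'': "tensor_mod A'' B M'' L''"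
    and g: "g \<in> module_homs (opposite B) (right_part M) (right_part M')" and f: "f \<in> module_homs B L L'"
    and g': "g' \<in> module_homs (opposite B) (right_part M') (right_part M'')" and f': "f' \<in> module_homs B L' L''"
    and w: "w \<in> carrier (tensor_module B M L)"
  shows "tensor_map B M'' L'' g' f' (tensor_map B M' L' g f w)
    = tensor_map B M'' L'' (\<lambda>x. g' (g x)) (\<lambda>x. f' (f x)) w"
proof -
  interpret T: tensor_mod A B M L by fact
  interpret T'': tensor_mod A'' B M'' L'' by fact
  note m = tensor_map[OF T T' g f] and m' = tensor_map[OF T' T'' g' f']
    and m'' = tensor_map[OF T T'' hom_comp[OF g g'] hom_comp[OF f f']]
  show ?thesis
    by (rule T.T.additive_map_eqI[OF additive_map_comp[OF m(1) m'(1)] m''(1) T''.T.abelian_group_W w])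
      (use hom_closed[OF g] hom_closed[OF f] in \<open>simp add: m(2) m'(2) m''(2)\<close>)
qed

lemma tensor_map_cong:
  assumes T: "tensor_mod A B M L" and T': "tensor_mod A' B M' L'"
    and g: "g \<in> module_homs (opposite B) (right_part M) (right_part M')" and f: "f \<in> module_homs B L L'"
    and g': "g' \<in> module_homs (opposite B) (right_part M) (right_part M')" and f': "f' \<in> module_homs B L L'"
    and w: "w \<in> carrier (tensor_module B M L)"
    and "\<And>x. x \<in> carrier M \<Longrightarrow> g x = g' x" "\<And>x. x \<in> carrier L \<Longrightarrow> f x = f' x"
  shows "tensor_map B M' L' g f w = tensor_map B M' L' g' f' w"
proof -
  interpret T: tensor_mod A B M L by fact
  interpret T': tensor_mod A' B M' L' by fact
  note m = tensor_map[OF T T' g f] and m' = tensor_map[OF T T' g' f']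
  show ?thesis
    by (rule T.T.additive_map_eqI[OF m(1) m'(1) T'.T.abelian_group_W w])
      (use assms(8,9) in \<open>simp add: m(2) m'(2)\<close>)
qed

lemma tensor_map_id:
  assumes T: "tensor_mod A B M L" and w: "w \<in> carrier (tensor_module B M L)"
  shows "tensor_map B M L (\<lambda>x. x) (\<lambda>x. x) w = w"
proof -
  interpret T: tensor_mod A B M L by fact
  note m = tensor_map[OF T T hom_id hom_id]
  show ?thesis
    by (rule T.T.additive_map_eqI[OF m(1) additive_map_id T.T.abelian_group_W w]) (simp add: m(2))
qed

lemma tensor_map_plus_left:
  assumes T: "tensor_mod A B M L" and T': "tensor_mod A' B M' L'"
    and g: "g \<in> module_homs (opposite B) (right_part M) (right_part M')"
    and g': "g' \<in> module_homs (opposite B) (right_part M) (right_part M')"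
    and h: "h \<in> module_homs (opposite B) (right_part M) (right_part M')"
    and f: "f \<in> module_homs B L L'"
    and w: "w \<in> carrier (tensor_module B M L)"
    and e: "\<And>x. x \<in> carrier M \<Longrightarrow> h x = g x \<oplus>\<^bsub>M'\<^esub> g' x"
  shows "tensor_map B M' L' h f w = tensor_map B M' L' g f w \<oplus>\<^bsub>tensor_module B M' L'\<^esub> tensor_map B M' L' g' f w"
proof -
  interpret T: tensor_mod A B M L by fact
  interpret T': tensor_mod A' B M' L' by fact
  note m = tensor_map[OF T T' g f] and m' = tensor_map[OF T T' g' f] and mh = tensor_map[OF T T' h f]
  show ?thesis
    by (rule T.T.additive_map_eqI[OF mh(1) additive_map_plus[OF m(1) m'(1) T'.T.abelian_group_W]
        T'.T.abelian_group_W w])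
      (use hom_closed[OF g] hom_closed[OF g'] hom_closed[OF f] in
        \<open>simp add: m(2) m'(2) mh(2) e T'.T.pure_add_left\<close>)
qed

lemma tensor_map_plus_right:
  assumes T: "tensor_mod A B M L" and T': "tensor_mod A' B M' L'"
    and g: "g \<in> module_homs (opposite B) (right_part M) (right_part M')"
    and f: "f \<in> module_homs B L L'" and f': "f' \<in> module_homs B L L'" and h: "h \<in> module_homs B L L'"
    and w: "w \<in> carrier (tensor_module B M L)"
    and e: "\<And>x. x \<in> carrier L \<Longrightarrow> h x = f x \<oplus>\<^bsub>L'\<^esub> f' x"
  shows "tensor_map B M' L' g h w = tensor_map B M' L' g f w \<oplus>\<^bsub>tensor_module B M' L'\<^esub> tensor_map B M' L' g f' w"
proof -
  interpret T: tensor_mod A B M L by fact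
  interpret T': tensor_mod A' B M' L' by fact
  note m = tensor_map[OF T T' g f] and m' = tensor_map[OF T T' g f'] and mh = tensor_map[OF T T' g h]
  show ?thesis
    by (rule T.T.additive_map_eqI[OF mh(1) additive_map_plus[OF m(1) m'(1) T'.T.abelian_group_W]
        T'.T.abelian_group_W w])
      (use hom_closed[OF g] hom_closed[OF f'] hom_closed[OF f] in
        \<open>simp add: m(2) m'(2) mh(2) e T'.T.pure_add_right\<close>)
qed

lemma tensor_map_zero:
  assumes T: "tensor_mod A B M L" and T': "tensor_mod A' B M' L'"
    and g: "g \<in> module_homs (opposite B) (right_part M) (right_part M')" and f: "f \<in> module_homs B L L'"
    and w: "w \<in> carrier (tensor_module B M L)"
    and e: "(\<forall>x\<in>carrier M. g x = \<zero>\<^bsub>M'\<^esub>) \<or> (\<forall>x\<in>carrier L. f x = \<zero>\<^bsub>L'\<^esub>)"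
  shows "tensor_map B M' L' g f w = \<zero>\<^bsub>tensor_module B M' L'\<^esub>"
proof -
  interpret T: tensor_mod A B M L by fact
  interpret T': tensor_mod A' B M' L' by fact
  note m = tensor_map[OF T T' g f]
  have c: "g x \<in> carrier M'" if "x \<in> carrier M" for x using hom_closed[OF g, of x] that by simp
  show ?thesis
    by (rule T.T.additive_map_eqI[OF m(1) additive_map_zero_map[OF T'.T.abelian_group_W] T'.T.abelian_group_W w])
      (use e c hom_closed[OF f] in \<open>auto simp add: m(2) T'.pure_zero_left T'.pure_zero_right\<close>)
qed

abbreviation "tensor_fun B M L \<equiv> tensor_map B M L (\<lambda>x. x)"

lemma tensor_fun_hom:
  assumes "lr_bimodule A B M" "left_module B L" "left_module B L'" "f \<in> module_homs B L L'"
  shows "tensor_fun B M L' f \<in> module_homs A (tensor_module B M L) (tensor_module B M L')"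
  by (rule tensor_map_hom) (use assms in \<open>auto simp: tensor_mod_def tensor_mod_axioms_def hom_id\<close>)

lemma tensor_modI: "lr_bimodule A B M \<Longrightarrow> left_module B L \<Longrightarrow> tensor_mod A B M L"
  by (simp add: tensor_mod_def tensor_mod_axioms_def)

lemma left_module_tensor_module: "lr_bimodule A B M \<Longrightarrow> left_module B L \<Longrightarrow> left_module A (tensor_module B M L)"
  by (rule tensor_mod.left_module_tensor[OF tensor_modI])

lemma tensor_fun_comp:
  assumes M: "lr_bimodule A B M" and L: "left_module B L" "left_module B L'" "left_module B L''"
    and f: "f \<in> module_homs B L L'" "f' \<in> module_homs B L' L''" and w: "w \<in> carrier (tensor_module B M L)"
    and e: "\<And>x. x \<in> carrier L \<Longrightarrow> f' (f x) = f'' x" and f'': "f'' \<in> module_homs B L L''"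
  shows "tensor_fun B M L'' f' (tensor_fun B M L' f w) = tensor_fun B M L'' f'' w"
  using tensor_map_comp[OF tensor_modI[OF M L(1)] tensor_modI[OF M L(2)] tensor_modI[OF M L(3)]
    hom_id f(1) hom_id f(2) w]
    tensor_map_cong[OF tensor_modI[OF M L(1)] tensor_modI[OF M L(3)] hom_id hom_comp[OF f] hom_id f'' w _ e]
  by simp

lemma tensor_retract:
  assumes M: "lr_bimodule A B M" and L: "left_module B L" "left_module B L'" and r: "retract B L L'"
  shows "retract A (tensor_module B M L) (tensor_module B M L')"
proof -
  obtain f g where fg: "f \<in> module_homs B L L'" "g \<in> module_homs B L' L" "\<And>x. x \<in> carrier L \<Longrightarrow> g (f x) = x"
    using r by (auto simp: retract_def)
  have "tensor_fun B M L g (tensor_fun B M L' f w) = w" if w: "w \<in> carrier (tensor_module B M L)" for w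
    using tensor_fun_comp[OF M L L(1) fg(1,2) w fg(3) hom_id] tensor_map_id[OF tensor_modI[OF M L(1)] w] by simp
  then show ?thesis unfolding retract_def
    using tensor_fun_hom[OF M L fg(1)] tensor_fun_hom[OF M L(2,1) fg(2)] by blast
qed

lemma tensor_iso:
  assumes M: "lr_bimodule A B M" and L: "left_module B L" "left_module B L'" and i: "module_iso B L L'"
  shows "module_iso A (tensor_module B M L) (tensor_module B M L')"
proof -
  obtain f g where fg: "f \<in> module_homs B L L'" "g \<in> module_homs B L' L" "\<And>x. x \<in> carrier L \<Longrightarrow> g (f x) = x"
    "\<And>x. x \<in> carrier L' \<Longrightarrow> f (g x) = x"
    using module_isoE[OF i L] by metis
  have 1: "tensor_fun B M L g (tensor_fun B M L' f w) = w" if w: "w \<in> carrier (tensor_module B M L)" for w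
    using tensor_fun_comp[OF M L L(1) fg(1,2) w fg(3) hom_id] tensor_map_id[OF tensor_modI[OF M L(1)] w] by simp
  have 2: "tensor_fun B M L' f (tensor_fun B M L g w) = w" if w: "w \<in> carrier (tensor_module B M L')" for w
    using tensor_fun_comp[OF M L(2,1) L(2) fg(2,1) w fg(4) hom_id] tensor_map_id[OF tensor_modI[OF M L(2)] w] by simp
  show ?thesis
    by (rule module_isoI[OF tensor_fun_hom[OF M L fg(1)] tensor_fun_hom[OF M L(2,1) fg(2)] 1 2])
qed

lemma tensor_add_map:
  assumes M: "lr_bimodule A B M" and h: "add_map B V L L' h"
    and V: "left_module B V" and L: "left_module B L" and L': "left_module B L'"
  shows "add_map A (tensor_module B M V) (tensor_module B M L) (tensor_module B M L') (tensor_fun B M L' h)"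
  using h
proof induction
  case (zero h)
  have "add_map B V L L' h" by (rule add_map.zero) (rule zero)
  note hh = add_map_hom[OF this L L']
  show ?case
    by (rule add_map.zero, rule tensor_map_zero[OF tensor_modI[OF M L] tensor_modI[OF M L'] hom_id hh])
      (use zero in auto)
next
  case (step h a b h')
  note hh = add_map_hom[OF step(1) L L'] and hh' = add_map_hom[OF add_map.step[OF step(1-4)] L L']
  show ?case
  proof (rule add_map.step[OF step.IH tensor_fun_hom[OF M L V step(2)] tensor_fun_hom[OF M V L' step(3)]])
    fix w assume w: "w \<in> carrier (tensor_module B M L)"
    show "tensor_fun B M L' h' w = tensor_fun B M L' h w \<oplus>\<^bsub>tensor_module B M L'\<^esub> tensor_fun B M L' b (tensor_fun B M V a w)"
      using tensor_map_plus_right[OF tensor_modI[OF M L] tensor_modI[OF M L'] hom_id hh hom_comp[OF step(2,3)] hh' w step(4)]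
        tensor_fun_comp[OF M L V L' step(2,3) w refl hom_comp[OF step(2,3)]]
      by simp
  qed
qed

lemma tensor_add_map_id:
  assumes M: "lr_bimodule A B M" and h: "mem_add B V L"
    and V: "left_module B V" and L: "left_module B L"
  shows "mem_add A (tensor_module B M V) (tensor_module B M L)"
  by (rule add_map_cong[OF tensor_add_map[OF M h V L L] tensor_map_id[OF tensor_modI[OF M L]]])

text \<open>The isomorphism between \<open>M \<otimes> B\<close> and \<open>M\<close>, of which only
  the direction exhibiting \<open>M \<otimes> B\<close> as a retract of \<open>M\<close> is
  recorded; this is enough to pass projectivity from \<open>M\<close> to
  \<open>M \<otimes> B\<close>.\<close>

lemma tensor_regular:
  assumes M: "lr_bimodule A B M" and B: "ring B"
  obtains i k where "i \<in> module_homs A M (tensor_module B M (regular_module B))"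
    "k \<in> module_homs A (tensor_module B M (regular_module B)) M"
    "\<And>w. w \<in> carrier (tensor_module B M (regular_module B)) \<Longrightarrow> i (k w) = w"
proof -
  interpret B: ring B by fact
  note r = left_module_regular[OF B]
  interpret T: tensor_mod A B M "regular_module B" by (rule tensor_modI[OF M r])
  let ?T = "tensor_module B M (regular_module B)"
  have "T.T.balanced M (\<lambda>x b. rsmult M x b)"
    by (intro T.T.balancedI) (simp_all add: T.rsmult_closed T.rsmult_l_distr T.rsmult_r_distr T.rsmult_mult)
  then obtain k where k: "k \<in> module_homs A ?T M"
    "\<And>x y. x \<in> carrier M \<Longrightarrow> y \<in> carrier (regular_module B) \<Longrightarrow> k (T.T.pure_tensor x y) = rsmult M x y"
    using T.lift_hom[OF T.left] by (metis T.assoc regular_module_simps(1))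
  have i: "(\<lambda>x. T.T.pure_tensor x \<one>\<^bsub>B\<^esub>) \<in> module_homs A M ?T"
    by (rule module_homsI)
      (simp_all add: T.T.pure_closed T.T.pure_add_left T.smult_tensor(2) del: regular_module_simps(4))
  have "T.T.pure_tensor (k w) \<one>\<^bsub>B\<^esub> = w" if w: "w \<in> carrier ?T" for w
  proof (rule T.T.additive_map_eqI[OF hom_additive[OF hom_comp[OF k(1) i]] additive_map_id T.T.abelian_group_W w])
    fix x y assume xy: "x \<in> carrier M" "y \<in> carrier (regular_module B)"
    then show "T.T.pure_tensor (k (T.T.pure_tensor x y)) \<one>\<^bsub>B\<^esub> = T.T.pure_tensor x y"
      using T.T.pure_balanced[of x y "\<one>\<^bsub>B\<^esub>"] by (simp add: k(2)[OF xy] del: regular_module_simps(4)) simp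
  qed
  with that i k(1) show thesis by blast
qed

text \<open>Tensoring the decomposition of the identity of \<open>L\<close> through \<open>B\<close>
  gives one of the identity of \<open>M \<otimes> L\<close> through \<open>M \<otimes> B\<close>,
  which is projective along with \<open>M\<close>.\<close>

lemma tensor_projective:
  assumes M: "lr_bimodule A B M" and pM: "projective_module A M"
    and L: "left_module B L" and pL: "projective_module B L"
  shows "projective_module A (tensor_module B M L)"
proof -
  note B = left_module_ring[OF L]
  note r = left_module_regular[OF B]
  interpret M: lr_bimodule A B M by fact
  let ?R = "tensor_module B M (regular_module B)"
  note lR = left_module_tensor_module[OF M r] and lT = left_module_tensor_module[OF M L]
  obtain i k where ik: "i \<in> module_homs A M ?R" "k \<in> module_homs A ?R M" "\<And>w. w \<in> carrier ?R \<Longrightarrow> i (k w) = w"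
    using tensor_regular[OF M B] by blast
  have "add_map A (regular_module A) ?R ?R (\<lambda>w. i (k w))"
    by (rule add_map_comp_left[OF add_map_comp_right[OF pM ik(2)] lR M.left lR ik(1)])
  then have "projective_module A ?R"
    by (rule add_map_cong) (use ik(3) in auto)
  then show ?thesis
    by (rule add_map_trans[OF tensor_add_map_id[OF M pL r L] _ lT lT lR])
qed

section \<open>Exactness of tensoring with a right projective bimodule\<close>

lemma contraction:
  assumes M: "lr_bimodule A B M" and L: "left_module B L"
    and a: "a \<in> module_homs (opposite B) (right_part M) (regular_module (opposite B))"
  obtains \<alpha> where "additive_map (tensor_module B M L) L \<alpha>"
    "\<And>x y. x \<in> carrier M \<Longrightarrow> y \<in> carrier L \<Longrightarrow>
      \<alpha> (tensor_class B (rsmult M) (smult L) M L (frag_of (x, y))) = a x \<odot>\<^bsub>L\<^esub> y"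
proof -
  interpret T: tensor_mod A B M L by (rule tensor_modI[OF M L])
  have ac: "a x \<in> carrier B" if "x \<in> carrier M" for x using hom_closed[OF a, of x] that by simp
  have aa: "a (x \<oplus>\<^bsub>M\<^esub> y) = a x \<oplus>\<^bsub>B\<^esub> a y" if "x \<in> carrier M" "y \<in> carrier M" for x y
    using hom_add[OF a, of x y] that by simp
  have ar: "a (rsmult M x b) = a x \<otimes>\<^bsub>B\<^esub> b" if "x \<in> carrier M" "b \<in> carrier B" for x b
    using hom_smult[OF a, of b x] that by simp
  have "T.T.balanced L (\<lambda>x y. a x \<odot>\<^bsub>L\<^esub> y)"
    by (intro T.T.balancedI)
      (simp_all add: ac aa ar T.L.smult_closed T.L.smult_l_distr T.L.smult_r_distr T.L.smult_assoc)
  from T.T.lift[OF T.L.M.abelian_group_axioms this] that show thesis by blast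
qed

text \<open>Flatness by induction over a sum of composites. For a right endomorphism
  \<open>h\<close> of \<open>M\<close> that factors through free modules,
  \<open>h \<otimes> 1\<close> kills the kernel of \<open>1 \<otimes> j\<close> and sends the kernel
  of \<open>1 \<otimes> \<pi>\<close> into the image of \<open>1 \<otimes> j\<close>. Right
  projectivity of \<open>M\<close> allows \<open>h\<close> to be the identity, which is
  exactness.\<close>

lemma tensor_exact_aux:
  fixes M :: "('a, 'b, 'm) bimodule"
  assumes M: "lr_bimodule A B M"
    and h: "add_map (opposite B) (regular_module (opposite B)) (right_part M) (right_part M) h"
    and X: "left_module B X" and P: "left_module B P" and Y: "left_module B Y"
    and ex: "short_exact B X P Y j \<pi>"
  shows "(\<forall>w\<in>carrier (tensor_module B M X). tensor_fun B M P j w = \<zero>\<^bsub>tensor_module B M P\<^esub> \<longrightarrow>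
      tensor_map B M X h (\<lambda>x. x) w = \<zero>\<^bsub>tensor_module B M X\<^esub>) \<and>
    (\<forall>w\<in>carrier (tensor_module B M P). tensor_fun B M Y \<pi> w = \<zero>\<^bsub>tensor_module B M Y\<^esub> \<longrightarrow>
      (\<exists>v\<in>carrier (tensor_module B M X). tensor_map B M P h (\<lambda>x. x) w = tensor_fun B M P j v))"
  using h
proof induction
  case (zero h)
  interpret M: lr_bimodule A B M by fact
  note E = short_exactD[OF ex]
  interpret TX: tensor_mod A B M X by (rule tensor_modI[OF M X])
  have "add_map (opposite B) (regular_module (opposite B)) (right_part M) (right_part M) h"
    by (rule add_map.zero) (rule zero)
  note hh = add_map_hom[OF this M.right M.right]
  have z: "tensor_map B M Z h (\<lambda>x. x) w = \<zero>\<^bsub>tensor_module B M Z\<^esub>"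
    if "left_module B Z" "w \<in> carrier (tensor_module B M Z)" for w and Z :: "('b, 'z, 'y) module_scheme"
    by (rule tensor_map_zero[OF tensor_modI[OF M that(1)] tensor_modI[OF M that(1)] hh hom_id that(2)])
      (use zero in auto)
  note jz = hom_zero[OF tensor_fun_hom[OF M X P E(1)] left_module_tensor_module[OF M X] left_module_tensor_module[OF M P]]
  show ?case
    using z[OF X] z[OF P] jz TX.T.W.zero_closed by (metis (no_types, lifting))
next
  case (step h a b h')
  interpret M: lr_bimodule A B M by fact
  interpret TX: tensor_mod A B M X by (rule tensor_modI[OF M X])
  interpret TP: tensor_mod A B M P by (rule tensor_modI[OF M P])
  interpret TY: tensor_mod A B M Y by (rule tensor_modI[OF M Y])
  note E = short_exactD[OF ex]
  let ?TX = "tensor_module B M X" and ?TP = "tensor_module B M P" and ?TY = "tensor_module B M Y"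
  define m where "m = b \<one>\<^bsub>B\<^esub>"
  have m: "m \<in> carrier M" using hom_closed[OF step(3), of "\<one>\<^bsub>B\<^esub>"] M.rM.R.one_closed by (simp add: m_def)
  have ac: "a x \<in> carrier B" if "x \<in> carrier M" for x using hom_closed[OF step(2), of x] that by simp
  have b: "b r = rsmult M m r" if "r \<in> carrier B" for r
    using hom_regular_eq[OF M.right step(3), of r] that by (simp add: m_def)
  note hh = add_map_hom[OF step(1) M.right M.right]
    and hh' = add_map_hom[OF add_map.step[OF step(1-4)] M.right M.right]
    and ba = hom_comp[OF step(2,3)]
  have hsum: "h' x = h x \<oplus>\<^bsub>M\<^esub> b (a x)" if "x \<in> carrier M" for x
    using step(4)[of x] that by simp
  have pl: "tensor_map B M Z h' (\<lambda>x. x) w = tensor_map B M Z h (\<lambda>x. x) w \<oplus>\<^bsub>tensor_module B M Z\<^esub>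
      tensor_map B M Z (\<lambda>x. b (a x)) (\<lambda>x. x) w"
    if "left_module B Z" "w \<in> carrier (tensor_module B M Z)" for w and Z :: "('b, 'z, 'y) module_scheme"
    by (rule tensor_map_plus_left[OF tensor_modI[OF M that(1)] tensor_modI[OF M that(1)] hh ba hh' hom_id that(2)])
      (simp_all add: hsum)
  \<comment> \<open>With \<open>m = b 1\<close>, balancing gives \<open>b (a x) \<otimes> z = m a(x)
    \<otimes> z = m \<otimes> a(x) z\<close>: a rank-one summand contracts into \<open>Z\<close> and
    then tensors with \<open>m\<close>.\<close>
  have ct: "tensor_map B M Z (\<lambda>x. b (a x)) (\<lambda>x. x) w
      = tensor_class B (rsmult M) (smult Z) M Z (frag_of (m, \<alpha> w))"
    if Z: "left_module B Z" and \<alpha>: "additive_map (tensor_module B M Z) Z \<alpha>"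
      "\<And>x y. x \<in> carrier M \<Longrightarrow> y \<in> carrier Z \<Longrightarrow>
        \<alpha> (tensor_class B (rsmult M) (smult Z) M Z (frag_of (x, y))) = a x \<odot>\<^bsub>Z\<^esub> y"
      and w: "w \<in> carrier (tensor_module B M Z)" for w \<alpha> and Z :: "('b, 'z, 'y) module_scheme"
  proof -
    interpret TZ: tensor_mod A B M Z by (rule tensor_modI[OF M Z])
    note bm = tensor_map[OF TZ.tensor_mod_axioms TZ.tensor_mod_axioms ba hom_id]
    have pm: "additive_map Z (tensor_module B M Z) (\<lambda>z. TZ.T.pure_tensor m z)"
      by (rule additive_mapI) (simp_all add: m TZ.T.pure_closed TZ.T.pure_add_right)
    show ?thesis
    proof (rule TZ.T.additive_map_eqI[OF bm(1) additive_map_comp[OF \<alpha>(1) pm] TZ.T.abelian_group_W w])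
      fix x y assume xy: "x \<in> carrier M" "y \<in> carrier Z"
      then show "tensor_map B M Z (\<lambda>x. b (a x)) (\<lambda>x. x) (TZ.T.pure_tensor x y)
          = TZ.T.pure_tensor m (\<alpha> (TZ.T.pure_tensor x y))"
        using TZ.T.pure_balanced[OF m ac[OF xy(1)] xy(2)] by (simp add: bm(2) \<alpha>(2) b ac)
    qed
  qed
  obtain \<alpha>X where \<alpha>X: "additive_map ?TX X \<alpha>X"
    "\<And>x y. x \<in> carrier M \<Longrightarrow> y \<in> carrier X \<Longrightarrow> \<alpha>X (TX.T.pure_tensor x y) = a x \<odot>\<^bsub>X\<^esub> y"
    using contraction[OF M X step(2)] by blast
  obtain \<alpha>P where \<alpha>P: "additive_map ?TP P \<alpha>P"
    "\<And>x y. x \<in> carrier M \<Longrightarrow> y \<in> carrier P \<Longrightarrow> \<alpha>P (TP.T.pure_tensor x y) = a x \<odot>\<^bsub>P\<^esub> y"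
    using contraction[OF M P step(2)] by blast
  obtain \<alpha>Y where \<alpha>Y: "additive_map ?TY Y \<alpha>Y"
    "\<And>x y. x \<in> carrier M \<Longrightarrow> y \<in> carrier Y \<Longrightarrow> \<alpha>Y (TY.T.pure_tensor x y) = a x \<odot>\<^bsub>Y\<^esub> y"
    using contraction[OF M Y step(2)] by blast
  note jm = tensor_map[OF TX.tensor_mod_axioms TP.tensor_mod_axioms hom_id E(1)]
  note \<pi>m = tensor_map[OF TP.tensor_mod_axioms TY.tensor_mod_axioms hom_id E(2)]
  \<comment> \<open>Contraction is natural, so a condition on the tensor product becomes one in
    \<open>P\<close> or \<open>Y\<close>, where the exactness of the given sequence applies.\<close>
  have nj: "\<alpha>P (tensor_fun B M P j w) = j (\<alpha>X w)" if "w \<in> carrier ?TX" for w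
    by (rule TX.T.additive_map_eqI[OF additive_map_comp[OF jm(1) \<alpha>P(1)]
      additive_map_comp[OF \<alpha>X(1) hom_additive[OF E(1)]] TP.L.M.abelian_group_axioms that])
      (simp add: jm(2) \<alpha>P(2) \<alpha>X(2) hom_closed[OF E(1)] hom_smult[OF E(1)] ac)
  have np: "\<alpha>Y (tensor_fun B M Y \<pi> w) = \<pi> (\<alpha>P w)" if "w \<in> carrier ?TP" for w
    by (rule TP.T.additive_map_eqI[OF additive_map_comp[OF \<pi>m(1) \<alpha>Y(1)]
      additive_map_comp[OF \<alpha>P(1) hom_additive[OF E(2)]] TY.L.M.abelian_group_axioms that])
      (simp add: \<pi>m(2) \<alpha>P(2) \<alpha>Y(2) hom_closed[OF E(2)] hom_smult[OF E(2)] ac)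
  show ?case
  proof (intro conjI ballI impI)
    fix w assume w: "w \<in> carrier ?TX" "tensor_fun B M P j w = \<zero>\<^bsub>?TP\<^esub>"
    then have "j (\<alpha>X w) = \<zero>\<^bsub>P\<^esub>"
      using nj[OF w(1)] additive_map_zero[OF \<alpha>P(1) TP.T.abelian_group_W TP.L.M.abelian_group_axioms] by simp
    then have "\<alpha>X w = \<zero>\<^bsub>X\<^esub>" using hom_inj_onD[OF E(1) X P E(3)] additive_map_closed[OF \<alpha>X(1) w(1)] by simp
    then show "tensor_map B M X h' (\<lambda>x. x) w = \<zero>\<^bsub>?TX\<^esub>"
      using pl[OF X w(1)] ct[OF X \<alpha>X w(1)] step.IH w m by (simp add: TX.pure_zero_right)
  next
    fix w assume w: "w \<in> carrier ?TP" "tensor_fun B M Y \<pi> w = \<zero>\<^bsub>?TY\<^esub>"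
    then have "\<pi> (\<alpha>P w) = \<zero>\<^bsub>Y\<^esub>"
      using np[OF w(1)] additive_map_zero[OF \<alpha>Y(1) TY.T.abelian_group_W TY.L.M.abelian_group_axioms] by simp
    then obtain x where x: "x \<in> carrier X" "j x = \<alpha>P w" using E(5) additive_map_closed[OF \<alpha>P(1) w(1)] by blast
    obtain v where v: "v \<in> carrier ?TX" "tensor_map B M P h (\<lambda>x. x) w = tensor_fun B M P j v"
      using step.IH w by blast
    have "tensor_map B M P h' (\<lambda>x. x) w = tensor_fun B M P j (v \<oplus>\<^bsub>?TX\<^esub> TX.T.pure_tensor m x)"
      using pl[OF P w(1)] ct[OF P \<alpha>P w(1)] v x m additive_map_add[OF jm(1) v(1) TX.T.pure_closed[OF m x(1)]]
      by (simp add: jm(2))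
    then show "\<exists>v\<in>carrier ?TX. tensor_map B M P h' (\<lambda>x. x) w = tensor_fun B M P j v"
      using v(1) TX.T.pure_closed[OF m x(1)] TX.T.W.a_closed by blast
  qed
qed

lemma tensor_fun_surj:
  assumes M: "lr_bimodule A B M" and P: "left_module B P" and Y: "left_module B Y"
    and f: "f \<in> module_homs B P Y" "f ` carrier P = carrier Y" and w: "w \<in> carrier (tensor_module B M Y)"
  shows "\<exists>v\<in>carrier (tensor_module B M P). tensor_fun B M Y f v = w"
proof -
  interpret TP: tensor_mod A B M P by (rule tensor_modI[OF M P])
  interpret TY: tensor_mod A B M Y by (rule tensor_modI[OF M Y])
  note m = tensor_map[OF TP.tensor_mod_axioms TY.tensor_mod_axioms hom_id f(1)]
  show ?thesis
    using w
  proof (induction rule: TY.T.tensor_induct)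
    case zero
    show ?case
      using additive_map_zero[OF m(1) TP.T.abelian_group_W TY.T.abelian_group_W] TP.T.W.zero_closed by blast
  next
    case (add u v)
    then obtain u' v' where "u' \<in> carrier (tensor_module B M P)" "tensor_fun B M Y f u' = u"
      "v' \<in> carrier (tensor_module B M P)" "tensor_fun B M Y f v' = v" by blast
    then show ?case
      using additive_map_add[OF m(1)] TP.T.W.a_closed by (intro bexI[of _ "u' \<oplus>\<^bsub>tensor_module B M P\<^esub> v'"]) auto
  next
    case (pure x y)
    then obtain z where "z \<in> carrier P" "y = f z" using f(2) by auto
    then show ?case using m(2) TP.T.pure_closed pure by blast
  qed
qed

lemma tensor_short_exact:
  assumes M: "lr_bimodule A B M"
    and pM: "projective_module (opposite B) (right_part M)"
    and X: "left_module B X" and P: "left_module B P" and Y: "left_module B Y"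
    and ex: "short_exact B X P Y j \<pi>"
  shows "short_exact A (tensor_module B M X) (tensor_module B M P) (tensor_module B M Y)
    (tensor_fun B M P j) (tensor_fun B M Y \<pi>)"
proof -
  note E = short_exactD[OF ex]
  note aux = tensor_exact_aux[OF M pM X P Y ex]
  note lm = left_module_tensor_module[OF M]
  note j = tensor_fun_hom[OF M X P E(1)] and p = tensor_fun_hom[OF M P Y E(2)]
  show ?thesis
  proof (rule short_exactI[OF j p])
    show "inj_on (tensor_fun B M P j) (carrier (tensor_module B M X))"
      by (rule hom_inj_on[OF j lm[OF X] lm[OF P]]) (use aux tensor_map_id[OF tensor_modI[OF M X]] in auto)
    fix w assume w: "w \<in> carrier (tensor_module B M X)"
    have "tensor_fun B M Y \<pi> (tensor_fun B M P j w) = tensor_fun B M Y (\<lambda>x. \<pi> (j x)) w"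
      by (rule tensor_fun_comp[OF M X P Y E(1,2) w refl hom_comp[OF E(1,2)]])
    also have "\<dots> = \<zero>\<^bsub>tensor_module B M Y\<^esub>"
      by (rule tensor_map_zero[OF tensor_modI[OF M X] tensor_modI[OF M Y] hom_id hom_comp[OF E(1,2)] w])
        (use E(4) in auto)
    finally show "tensor_fun B M Y \<pi> (tensor_fun B M P j w) = \<zero>\<^bsub>tensor_module B M Y\<^esub>" .
  next
    fix w assume w: "w \<in> carrier (tensor_module B M P)" "tensor_fun B M Y \<pi> w = \<zero>\<^bsub>tensor_module B M Y\<^esub>"
    then show "\<exists>v\<in>carrier (tensor_module B M X). tensor_fun B M P j v = w"
      using aux tensor_map_id[OF tensor_modI[OF M P] w(1)] by metis
  qed (use tensor_fun_surj[OF M P Y E(2,6)] in blast)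
qed

text \<open>Moves an exact sequence of tensor products onto small copies of its terms, as
  \<open>is_syzygy\<close> requires.\<close>

lemma short_exact_iso:
  assumes ex: "short_exact R X P Y j \<pi>"
    and l: "left_module R X" "left_module R P" "left_module R Y"
      "left_module R X'" "left_module R P'" "left_module R Y'"
    and i: "module_iso R X X'" "module_iso R P P'" "module_iso R Y Y'"
  shows "\<exists>j' \<pi>'. short_exact R X' P' Y' j' \<pi>'"
proof -
  note E = short_exactD[OF ex]
  obtain f f' where f: "f \<in> module_homs R X X'" "f' \<in> module_homs R X' X"
    "\<And>x. x \<in> carrier X \<Longrightarrow> f' (f x) = x" "\<And>y. y \<in> carrier X' \<Longrightarrow> f (f' y) = y"
    using module_isoE[OF i(1) l(1,4)] by metis
  obtain g g' where g: "g \<in> module_homs R P P'" "g' \<in> module_homs R P' P"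
    "\<And>x. x \<in> carrier P \<Longrightarrow> g' (g x) = x" "\<And>y. y \<in> carrier P' \<Longrightarrow> g (g' y) = y"
    using module_isoE[OF i(2) l(2,5)] by metis
  obtain h h' where h: "h \<in> module_homs R Y Y'" "h' \<in> module_homs R Y' Y"
    "\<And>x. x \<in> carrier Y \<Longrightarrow> h' (h x) = x" "\<And>y. y \<in> carrier Y' \<Longrightarrow> h (h' y) = y"
    using module_isoE[OF i(3) l(3,6)] by metis
  have "short_exact R X' P' Y' (\<lambda>x. g (j (f' x))) (\<lambda>x. h (\<pi> (g' x)))"
  proof (rule short_exactI)
    show j': "(\<lambda>x. g (j (f' x))) \<in> module_homs R X' P'" by (rule hom_comp[OF hom_comp[OF f(2) E(1)] g(1)])
    show "(\<lambda>x. h (\<pi> (g' x))) \<in> module_homs R P' Y'" by (rule hom_comp[OF hom_comp[OF g(2) E(2)] h(1)])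
    show "inj_on (\<lambda>x. g (j (f' x))) (carrier X')"
    proof (rule hom_inj_on[OF j' l(4,5)])
      fix x assume x: "x \<in> carrier X'" "g (j (f' x)) = \<zero>\<^bsub>P'\<^esub>"
      note fx = hom_closed[OF f(2) x(1)]
      have "j (f' x) = \<zero>\<^bsub>P\<^esub>"
        using g(3)[OF hom_closed[OF E(1) fx]] x(2) hom_zero[OF g(2) l(5,2)] by simp
      then have "f' x = \<zero>\<^bsub>X\<^esub>" using hom_inj_onD[OF E(1) l(1,2) E(3) fx] by simp
      then show "x = \<zero>\<^bsub>X'\<^esub>" using f(4)[OF x(1)] hom_zero[OF f(1) l(1,4)] by simp
    qed
    show "h (\<pi> (g' (g (j (f' x))))) = \<zero>\<^bsub>Y'\<^esub>" if "x \<in> carrier X'" for x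
      using E(4) g(3) hom_closed[OF f(2) that] hom_closed[OF E(1)] hom_zero[OF h(1) l(3,6)] by simp
    show "\<exists>x\<in>carrier X'. g (j (f' x)) = y" if y: "y \<in> carrier P'" "h (\<pi> (g' y)) = \<zero>\<^bsub>Y'\<^esub>" for y
    proof -
      note gy = hom_closed[OF g(2) y(1)]
      have "\<pi> (g' y) = \<zero>\<^bsub>Y\<^esub>" using h(3)[OF hom_closed[OF E(2) gy]] y(2) hom_zero[OF h(2) l(6,3)] by simp
      then obtain x where "x \<in> carrier X" "j x = g' y" using E(5)[OF gy] by blast
      then show ?thesis using f(3) g(4)[OF y(1)] hom_closed[OF f(1)] by (intro bexI[of _ "f x"]) auto
    qed
    show "\<exists>x\<in>carrier P'. h (\<pi> (g' x)) = y" if y: "y \<in> carrier Y'" for y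
    proof -
      obtain p where "p \<in> carrier P" "\<pi> p = h' y" using E(6) hom_closed[OF h(2) y] by (metis imageE)
      then show ?thesis using g(3) h(4)[OF y] hom_closed[OF g(1)] by (intro bexI[of _ "g p"]) auto
    qed
  qed
  then show ?thesis by blast
qed

lemma add_map_id_iso:
  assumes "mem_add R V X" "module_iso R X Y" and X: "left_module R X" and Y: "left_module R Y"
  shows "mem_add R V Y"
proof -
  obtain f g where fg: "f \<in> module_homs R X Y" "g \<in> module_homs R Y X" "\<And>y. y \<in> carrier Y \<Longrightarrow> f (g y) = y"
    using module_isoE[OF assms(2) X Y] by metis
  show ?thesis
    by (rule add_map_cong[OF add_map_comp_left[OF add_map_comp_right[OF assms(1) fg(2)] Y X Y fg(1)]])
      (use fg(3) in auto)
qed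

text \<open>The whole resolution of \<open>L\<close> is tensored. The result is stated through a
  module \<open>W\<close> because \<open>is_nth_syzygy\<close> admits only small modules, and the
  isomorphism records that \<open>W\<close> is \<open>M \<otimes> L'\<close>.\<close>

lemma tensor_nth_syzygy:
  fixes A :: "('k, 'a) module" and B :: "('k, 'b) module" and L L' :: "('k, 'b) small_module"
  assumes A: "fd_algebra K A" and M: "lr_bimodule A B M"
    and pM: "projective_module (opposite B) (right_part M)"
    and qM: "fg_projective A M" and L: "fg_module B L" and s: "is_nth_syzygy B n L L'"
  shows "\<exists>W :: ('k, 'a) small_module. is_nth_syzygy A n (tensor_module B M L) W \<and>
    module_iso A W (tensor_module B M L')"
  using s
proof (induction n arbitrary: L')
  case 0
  then have L': "fg_module B L'" "module_iso B L' L" by auto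
  have fM: "fg_module A M" using qM by (simp add: fg_projective_def)
  have lL: "left_module B L" "left_module B L'" using L L' by (simp_all add: fg_module_def)
  note fT = tensor_mod.fg_module_tensor[OF tensor_modI[OF M lL(2)] fM L'(1)]
  obtain W :: "('k, 'a) small_module" where W: "fg_module A W" "module_iso A (tensor_module B M L') W"
    using fg_module_in_universe[OF A fT] by blast
  note W' = module_iso_sym[OF W(2) fg_module_left[OF fT] fg_module_left[OF W(1)]]
  have "module_iso A W (tensor_module B M L)"
    by (rule module_iso_trans[OF W' tensor_iso[OF M lL(2,1) L'(2)]])
  then show ?case using W W' by (intro exI[of _ W]) simp
next
  case (Suc n)
  then obtain X where X: "is_nth_syzygy B n L X" "is_syzygy B X L'" by auto
  have fM: "fg_module A M" using qM by (simp add: fg_projective_def)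
  obtain V :: "('k, 'a) small_module" where V: "is_nth_syzygy A n (tensor_module B M L) V"
    "module_iso A V (tensor_module B M X)"
    using Suc.IH[OF X(1)] by blast
  obtain P :: "('k, 'b) small_module" and j \<pi> where P: "fg_projective B P" "short_exact B L' P X j \<pi>"
    and fL': "fg_module B L'"
    using X(2) by (auto simp: is_syzygy_def)
  have fP: "fg_module B P" using P(1) by (simp add: fg_projective_def)
  note fX = is_nth_syzygy_fg[OF X(1)] and fV = is_nth_syzygy_fg[OF V(1)]
  note l = fg_module_left[OF fL'] fg_module_left[OF fP] fg_module_left[OF fX]
  note lT = left_module_tensor_module[OF M]
  note ex = tensor_short_exact[OF M pM l P(2)]
  have fT: "fg_module A (tensor_module B M L')" "fg_module A (tensor_module B M P)"
    using tensor_mod.fg_module_tensor[OF tensor_modI[OF M]] l fL' fP fM by blast+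
  obtain W :: "('k, 'a) small_module" where W: "fg_module A W" "module_iso A (tensor_module B M L') W"
    using fg_module_in_universe[OF A fT(1)] by blast
  obtain Q :: "('k, 'a) small_module" where Q: "fg_module A Q" "module_iso A (tensor_module B M P) Q"
    using fg_module_in_universe[OF A fT(2)] by blast
  note lWQ = fg_module_left[OF W(1)] fg_module_left[OF Q(1)] fg_module_left[OF fV]
  have "\<exists>j' \<pi>'. short_exact A W Q V j' \<pi>'"
    by (rule short_exact_iso[OF ex lT[OF l(1)] lT[OF l(2)] lT[OF l(3)] lWQ W(2) Q(2)
      module_iso_sym[OF V(2) lWQ(3) lT[OF l(3)]]])
  moreover have "fg_projective A Q"
    by (rule fg_projectiveI[OF A lWQ(2) add_map_id_iso[OF tensor_projective[OF M
      fg_projective_add_map[OF qM] l(2) fg_projective_add_map[OF P(1)]] Q(2) lT[OF l(2)] lWQ(2)]])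
  ultimately have "is_syzygy A V W" using W(1) unfolding is_syzygy_def by blast
  then show ?case
    using V(1) module_iso_sym[OF W(2) lT[OF l(1)] lWQ(1)] by (intro exI[of _ W]) auto
qed

section \<open>Finite-dimensional vector spaces are projective\<close>

text \<open>In the language of \<open>add_map\<close> a basis is a decomposition of the identity
  into rank-one maps. A generator \<open>s\<close> outside the earlier span contributes the map
  \<open>x \<mapsto> l(x) s\<close>, where \<open>l\<close> reads off the coefficient of
  \<open>s\<close>, and \<open>x - l(x) s\<close> lies in the earlier span.\<close>

lemma field_projective_span:
  assumes K: "field K" and V: "left_module K V" and "finite S" "S \<subseteq> carrier V"
  shows "projective_module K (V\<lparr>carrier := lspan K V S\<rparr>)"
  using assms(3,4)
proof (induction S rule: finite_induct)
  case empty
  have "x = \<zero>\<^bsub>V\<^esub>" if "x \<in> lspan K V {}" for x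
    using that by cases auto
  then show ?case by (intro add_map.zero) simp
next
  case (insert s S)
  interpret V: left_module K V by fact
  have s: "s \<in> carrier V" "S \<subseteq> carrier V" using insert.prems by auto
  let ?Y = "lspan K V S" and ?Z = "lspan K V (insert s S)"
  let ?VY = "V\<lparr>carrier := ?Y\<rparr>" and ?VZ = "V\<lparr>carrier := ?Z\<rparr>"
  note Y = submodule_lspan[OF V s(2)] and Z = submodule_lspan[OF V insert.prems]
  note YD = V.submoduleD[OF Y] and ZD = V.submoduleD[OF Z]
  have lY: "left_module K ?VY" and lZ: "left_module K ?VZ"
    by (rule V.left_module_submodule, fact)+
  have YZ: "?Y \<subseteq> ?Z" by (rule lspan_mono) auto
  have sZ: "s \<in> ?Z" by (rule lspan_base[OF V insert.prems]) simp
  show ?case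
  proof (cases "s \<in> ?Y")
    case True
    have "?Z \<subseteq> ?Y"
      by (rule lspan_least[OF V Y]) (use True lspan_base[OF V s(2)] in auto)
    then have "?Z = ?Y" using YZ by auto
    then show ?thesis using insert.IH[OF s(2)] by simp
  next
    case False
    have dec: "\<exists>y\<in>?Y. \<exists>c\<in>carrier K. x = y \<oplus>\<^bsub>V\<^esub> c \<odot>\<^bsub>V\<^esub> s" if "x \<in> ?Z" for x
      using lspan_insert[OF V insert.prems that] .
    \<comment> \<open>Two different coefficients of \<open>s\<close> would, after division by their
      difference, put \<open>s\<close> into the smaller span.\<close>
    have uniq: "c = d"
      if y: "y \<in> ?Y" "z \<in> ?Y" and c: "c \<in> carrier K" "d \<in> carrier K"
        and e: "y \<oplus>\<^bsub>V\<^esub> c \<odot>\<^bsub>V\<^esub> s = z \<oplus>\<^bsub>V\<^esub> d \<odot>\<^bsub>V\<^esub> s" for y z c d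
    proof (rule ccontr)
      assume "c \<noteq> d"
      then have n: "c \<ominus>\<^bsub>K\<^esub> d \<noteq> \<zero>\<^bsub>K\<^esub>" using c by (simp add: V.R.minus_eq_zero_iff)
      obtain r where r: "r \<in> carrier K" "r \<otimes>\<^bsub>K\<^esub> (c \<ominus>\<^bsub>K\<^esub> d) = \<one>\<^bsub>K\<^esub>"
        using field_inverse[OF K _ n] c by auto
      have v: "y \<in> carrier V" "z \<in> carrier V" using y YD(1) by auto
      have cs: "c \<odot>\<^bsub>V\<^esub> s \<in> carrier V" "d \<odot>\<^bsub>V\<^esub> s \<in> carrier V" using c s by (auto intro: V.smult_closed)
      have "(c \<ominus>\<^bsub>K\<^esub> d) \<odot>\<^bsub>V\<^esub> s = c \<odot>\<^bsub>V\<^esub> s \<ominus>\<^bsub>V\<^esub> d \<odot>\<^bsub>V\<^esub> s"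
        using c s by (simp add: a_minus_def V.smult_l_distr V.smult_l_minus)
      also have "\<dots> = ((y \<oplus>\<^bsub>V\<^esub> c \<odot>\<^bsub>V\<^esub> s) \<ominus>\<^bsub>V\<^esub> y) \<ominus>\<^bsub>V\<^esub> d \<odot>\<^bsub>V\<^esub> s"
        using v cs by (simp add: V.M.plus_minus_cancel V.M.a_comm[of y])
      also have "\<dots> = ((z \<oplus>\<^bsub>V\<^esub> d \<odot>\<^bsub>V\<^esub> s) \<ominus>\<^bsub>V\<^esub> y) \<ominus>\<^bsub>V\<^esub> d \<odot>\<^bsub>V\<^esub> s"
        by (simp only: e)
      also have "\<dots> = z \<ominus>\<^bsub>V\<^esub> y"
        using v cs by (simp add: a_minus_def V.M.a_ac V.M.r_neg V.M.r_neg1 V.M.r_neg2)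
      finally have "(c \<ominus>\<^bsub>K\<^esub> d) \<odot>\<^bsub>V\<^esub> s \<in> ?Y" using YD(6) y by simp
      then have "r \<odot>\<^bsub>V\<^esub> ((c \<ominus>\<^bsub>K\<^esub> d) \<odot>\<^bsub>V\<^esub> s) \<in> ?Y" using YD(4) r(1) by blast
      moreover have "r \<odot>\<^bsub>V\<^esub> ((c \<ominus>\<^bsub>K\<^esub> d) \<odot>\<^bsub>V\<^esub> s) = s"
        using r c s V.smult_assoc[of r "c \<ominus>\<^bsub>K\<^esub> d" s] by (simp add: V.smult_one)
      ultimately show False using False by simp
    qed
    define l where "l = (\<lambda>x. SOME c. c \<in> carrier K \<and> (\<exists>y\<in>?Y. x = y \<oplus>\<^bsub>V\<^esub> c \<odot>\<^bsub>V\<^esub> s))"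
    have l: "l (y \<oplus>\<^bsub>V\<^esub> c \<odot>\<^bsub>V\<^esub> s) = c" if "y \<in> ?Y" "c \<in> carrier K" for y c
      unfolding l_def by (rule some_equality) (use that uniq in blast)+
    have lr: "l \<in> module_homs K ?VZ (regular_module K)"
    proof (rule module_homsI)
      fix x assume "x \<in> carrier ?VZ"
      then show "l x \<in> carrier (regular_module K)" using dec[of x] l by auto
    next
      fix x x' assume "x \<in> carrier ?VZ" "x' \<in> carrier ?VZ"
      then obtain y c y' c' where x: "y \<in> ?Y" "c \<in> carrier K" "x = y \<oplus>\<^bsub>V\<^esub> c \<odot>\<^bsub>V\<^esub> s"
        "y' \<in> ?Y" "c' \<in> carrier K" "x' = y' \<oplus>\<^bsub>V\<^esub> c' \<odot>\<^bsub>V\<^esub> s" using dec[of x] dec[of x'] by auto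
      have v: "y \<in> carrier V" "y' \<in> carrier V" using x YD(1) by auto
      have "x \<oplus>\<^bsub>V\<^esub> x' = (y \<oplus>\<^bsub>V\<^esub> y') \<oplus>\<^bsub>V\<^esub> (c \<oplus>\<^bsub>K\<^esub> c') \<odot>\<^bsub>V\<^esub> s"
        using x v s by (simp add: V.smult_l_distr V.smult_closed V.M.a_ac)
      then show "l (x \<oplus>\<^bsub>?VZ\<^esub> x') = l x \<oplus>\<^bsub>regular_module K\<^esub> l x'"
        using x l YD(3) by simp
    next
      fix a x assume a: "a \<in> carrier K" and "x \<in> carrier ?VZ"
      then obtain y c where x: "y \<in> ?Y" "c \<in> carrier K" "x = y \<oplus>\<^bsub>V\<^esub> c \<odot>\<^bsub>V\<^esub> s" using dec[of x] by auto
      have v: "y \<in> carrier V" using x YD(1) by auto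
      have "a \<odot>\<^bsub>V\<^esub> x = a \<odot>\<^bsub>V\<^esub> y \<oplus>\<^bsub>V\<^esub> (a \<otimes>\<^bsub>K\<^esub> c) \<odot>\<^bsub>V\<^esub> s"
        using x v s a by (simp add: V.smult_r_distr V.smult_closed V.smult_assoc)
      then show "l (a \<odot>\<^bsub>?VZ\<^esub> x) = a \<odot>\<^bsub>regular_module K\<^esub> l x"
        using x l YD(4) a by simp
    qed
    have ls: "(\<lambda>x. l x \<odot>\<^bsub>?VZ\<^esub> s) \<in> module_homs K ?VZ ?VZ"
      by (rule hom_comp[OF lr hom_from_regular[OF lZ]]) (use sZ in simp)
    have pz: "(\<lambda>x. x \<ominus>\<^bsub>?VZ\<^esub> l x \<odot>\<^bsub>?VZ\<^esub> s) \<in> module_homs K ?VZ ?VZ"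
      by (rule hom_minus[OF lZ lZ hom_id ls])
    interpret VZ: left_module K ?VZ by (rule lZ)
    have ex: "x \<ominus>\<^bsub>?VZ\<^esub> l x \<odot>\<^bsub>?VZ\<^esub> s \<in> ?Y" if "x \<in> ?Z" for x
    proof -
      obtain y c where x: "y \<in> ?Y" "c \<in> carrier K" "x = y \<oplus>\<^bsub>V\<^esub> c \<odot>\<^bsub>V\<^esub> s" using dec[OF \<open>x \<in> ?Z\<close>] by auto
      have "c \<odot>\<^bsub>V\<^esub> s \<in> ?Z" using x(2) sZ ZD(4) by blast
      then have "x \<ominus>\<^bsub>?VZ\<^esub> c \<odot>\<^bsub>V\<^esub> s = y"
        using VZ.M.plus_minus_cancel[of y "c \<odot>\<^bsub>V\<^esub> s"] x YZ by auto
      then show ?thesis using x l by simp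
    qed
    have p: "(\<lambda>x. x \<ominus>\<^bsub>?VZ\<^esub> l x \<odot>\<^bsub>?VZ\<^esub> s) \<in> module_homs K ?VZ ?VY"
      using hom_corestrict[OF pz, of ?Y] ex by simp
    have i: "(\<lambda>x. x) \<in> module_homs K ?VY ?VZ"
      using YZ by (intro module_homsI) auto
    have "add_map K (regular_module K) ?VZ ?VZ (\<lambda>x. x \<ominus>\<^bsub>?VZ\<^esub> l x \<odot>\<^bsub>?VZ\<^esub> s)"
      by (rule add_map_comp_left[OF add_map_comp_right[OF insert.IH[OF s(2)] p] lZ lY lZ i])
    then show ?thesis
    proof (rule add_map.step[OF _ lr hom_from_regular[OF lZ]])
      show "s \<in> carrier ?VZ" using sZ by simp
      fix x assume x: "x \<in> carrier ?VZ"
      have "l x \<odot>\<^bsub>?VZ\<^esub> s \<in> carrier ?VZ" using hom_closed[OF ls x] .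
      then show "x = x \<ominus>\<^bsub>?VZ\<^esub> l x \<odot>\<^bsub>?VZ\<^esub> s \<oplus>\<^bsub>?VZ\<^esub> l x \<odot>\<^bsub>?VZ\<^esub> s"
        using VZ.M.minus_plus_cancel[OF x] by simp
    qed
  qed
qed

lemma field_projective:
  assumes K: "field K" and V: "fg_module K V"
  shows "projective_module K V"
proof -
  note lV = fg_module_left[OF V]
  interpret V: left_module K V by fact
  obtain S where S: "finite S" "S \<subseteq> carrier V" "carrier V \<subseteq> lspan K V S"
    using V finitely_generated_iff[OF lV] by (auto simp: fg_module_def)
  have "lspan K V S = carrier V" using S(3) V.submoduleD(1)[OF submodule_lspan[OF lV S(2)]] by auto
  then show ?thesis using field_projective_span[OF K lV S(1,2)] by simp
qed


section \<open>The enveloping algebra\<close>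

lemma left_module_cong:
  assumes "left_module R X" "carrier Y = carrier X" "zero Y = zero X" "add Y = add X"
    "\<And>a x. a \<in> carrier R \<Longrightarrow> x \<in> carrier X \<Longrightarrow> a \<odot>\<^bsub>Y\<^esub> x = a \<odot>\<^bsub>X\<^esub> x"
  shows "left_module R Y"
proof -
  interpret X: left_module R X by fact
  have "abelian_group Y"
  proof (rule abelian_groupI)
    fix x assume "x \<in> carrier Y"
    then show "\<exists>y\<in>carrier Y. y \<oplus>\<^bsub>Y\<^esub> x = \<zero>\<^bsub>Y\<^esub>"
      using assms by (intro bexI[of _ "\<ominus>\<^bsub>X\<^esub> x"]) (simp_all add: X.M.l_neg)
  qed (use assms in \<open>simp_all add: X.M.a_ac\<close>)
  then show ?thesis
    by (intro left_module.intro left_module_axioms.intro X.R.ring_axioms)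
      (use assms in \<open>simp_all add: X.smult_closed X.smult_l_distr X.smult_r_distr X.smult_assoc X.smult_one\<close>)
qed

context fd_algebra
begin

lemma abelian_group_opposite: "abelian_group (opposite A)"
proof (rule abelian_groupI)
  fix x assume "x \<in> carrier (opposite A)"
  then show "\<exists>y\<in>carrier (opposite A). y \<oplus>\<^bsub>opposite A\<^esub> x = \<zero>\<^bsub>opposite A\<^esub>"
    by (intro bexI[of _ "\<ominus>\<^bsub>A\<^esub> x"]) (simp_all add: M.l_neg)
qed (simp_all add: M.a_ac)

abbreviation "E \<equiv> enveloping K A"

sublocale E: tensor_product A "opposite A" K "\<lambda>x c. c \<odot>\<^bsub>A\<^esub> x" "smult (opposite A)" "enveloping K A"
  by (intro tensor_product.intro A.is_abelian_group abelian_group_opposite)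
    (simp_all add: enveloping_def tensor_algebra_def Let_def smult_opposite)

abbreviation env :: "'a \<Rightarrow> 'a \<Rightarrow> ('a \<times> 'a \<Rightarrow>\<^sub>0 int) set" where "env a b \<equiv> E.pure_tensor a b"

lemma env_scalar:
  "a \<in> carrier A \<Longrightarrow> b \<in> carrier A \<Longrightarrow> c \<in> carrier K \<Longrightarrow> env (c \<odot>\<^bsub>A\<^esub> a) b = env a (c \<odot>\<^bsub>A\<^esub> b)"
  using E.pure_balanced[of a c b] by (simp add: smult_opposite)

lemma env_mult_left:
  assumes ab: "a \<in> carrier A" "b \<in> carrier A"
  shows "additive_map E E (\<lambda>w. E.cl (frag_extend (\<lambda>(a', b'). frag_of (a \<otimes>\<^bsub>A\<^esub> a', b' \<otimes>\<^bsub>A\<^esub> b)) (tensor_rep w)))"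
    "\<And>a' b'. a' \<in> carrier A \<Longrightarrow> b' \<in> carrier A \<Longrightarrow>
      E.cl (frag_extend (\<lambda>(a', b'). frag_of (a \<otimes>\<^bsub>A\<^esub> a', b' \<otimes>\<^bsub>A\<^esub> b)) (tensor_rep (env a' b')))
      = env (a \<otimes>\<^bsub>A\<^esub> a') (b' \<otimes>\<^bsub>A\<^esub> b)"
proof -
  let ?\<gamma> = "\<lambda>(a', b'). frag_of (a \<otimes>\<^bsub>A\<^esub> a', b' \<otimes>\<^bsub>A\<^esub> b)"
  have b: "E.balanced E (\<lambda>x y. E.cl (?\<gamma> (x, y)))"
  proof (rule E.balancedI)
    fix x s y assume "x \<in> carrier A" "s \<in> carrier K" "y \<in> carrier (opposite A)"
    then show "E.cl (?\<gamma> (s \<odot>\<^bsub>A\<^esub> x, y)) = E.cl (?\<gamma> (x, s \<odot>\<^bsub>opposite A\<^esub> y))"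
      using ab by (simp add: smult_opposite smult_mult_right smult_mult_left env_scalar[unfolded smult_opposite])
  next
    fix x y y' assume "x \<in> carrier A" "y \<in> carrier (opposite A)" "y' \<in> carrier (opposite A)"
    then show "E.cl (?\<gamma> (x, y \<oplus>\<^bsub>opposite A\<^esub> y')) = E.cl (?\<gamma> (x, y)) \<oplus>\<^bsub>E\<^esub> E.cl (?\<gamma> (x, y'))"
      using ab E.pure_add_right[of "a \<otimes>\<^bsub>A\<^esub> x" "y \<otimes>\<^bsub>A\<^esub> b" "y' \<otimes>\<^bsub>A\<^esub> b"] by (simp add: A.l_distr)
  qed (use ab in \<open>simp_all add: E.pure_closed E.pure_add_left A.r_distr\<close>)
  have k: "Poly_Mapping.keys (?\<gamma> (x, y)) \<subseteq> carrier A \<times> carrier (opposite A)"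
    if "x \<in> carrier A" "y \<in> carrier (opposite A)" for x y
    using ab that by simp
  note r = tensor_product_rep_map[OF E.tensor_product_axioms E.tensor_product_axioms k b]
  show "additive_map E E (\<lambda>w. E.cl (frag_extend ?\<gamma> (tensor_rep w)))" by (rule r(1))
  show "E.cl (frag_extend ?\<gamma> (tensor_rep (env a' b'))) = env (a \<otimes>\<^bsub>A\<^esub> a') (b' \<otimes>\<^bsub>A\<^esub> b)"
    if "a' \<in> carrier A" "b' \<in> carrier A" for a' b'
    using r(2)[of "frag_of (a', b')"] that by simp
qed

text \<open>The product is a double extension over two chosen representatives.
  \<open>env_mult_left\<close> settles the inner one for a fixed left pair; here the left pair
  varies. The second factor multiplies in the opposite order.\<close>

lemma env_mult:
  assumes ab: "a \<in> carrier A" "b \<in> carrier A" "a' \<in> carrier A" "b' \<in> carrier A"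
  shows "env a b \<otimes>\<^bsub>E\<^esub> env a' b' = env (a \<otimes>\<^bsub>A\<^esub> a') (b' \<otimes>\<^bsub>A\<^esub> b)"
proof -
  let ?U = "env a' b'"
  let ?g = "\<lambda>(a, b). frag_extend (\<lambda>(a', b'). frag_of (a \<otimes>\<^bsub>A\<^esub> a', b' \<otimes>\<^bsub>A\<^esub> b)) (tensor_rep ?U)"
  have U: "?U \<in> carrier E" using ab by (simp add: E.pure_closed)
  have rU: "Poly_Mapping.keys (tensor_rep ?U) \<subseteq> carrier A \<times> carrier A"
    using E.tensor_rep_cl[OF U] by simp
  have g: "E.cl (?g (x, y)) = env (x \<otimes>\<^bsub>A\<^esub> a') (b' \<otimes>\<^bsub>A\<^esub> y)" if "x \<in> carrier A" "y \<in> carrier A" for x y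
    using env_mult_left(2)[OF that ab(3,4)] by simp
  have b: "E.balanced E (\<lambda>x y. E.cl (?g (x, y)))"
  proof (rule E.balancedI)
    fix x s y assume "x \<in> carrier A" "s \<in> carrier K" "y \<in> carrier (opposite A)"
    then show "E.cl (?g (s \<odot>\<^bsub>A\<^esub> x, y)) = E.cl (?g (x, s \<odot>\<^bsub>opposite A\<^esub> y))"
      using ab by (simp only: g smult_opposite[THEN fun_cong, THEN fun_cong] opposite_simps smult_closed smult_mult_right
        smult_mult_left A.m_closed env_scalar)
  next
    fix x y y' assume "x \<in> carrier A" "y \<in> carrier (opposite A)" "y' \<in> carrier (opposite A)"
    then show "E.cl (?g (x, y \<oplus>\<^bsub>opposite A\<^esub> y')) = E.cl (?g (x, y)) \<oplus>\<^bsub>E\<^esub> E.cl (?g (x, y'))"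
      using ab E.pure_add_right[of "x \<otimes>\<^bsub>A\<^esub> a'" "b' \<otimes>\<^bsub>A\<^esub> y" "b' \<otimes>\<^bsub>A\<^esub> y'"]
      by (simp only: g A.r_distr opposite_simps M.a_closed A.m_closed)
  next
    fix x x' y assume "x \<in> carrier A" "x' \<in> carrier A" "y \<in> carrier (opposite A)"
    then show "E.cl (?g (x \<oplus>\<^bsub>A\<^esub> x', y)) = E.cl (?g (x, y)) \<oplus>\<^bsub>E\<^esub> E.cl (?g (x', y))"
      using ab E.pure_add_left[of "x \<otimes>\<^bsub>A\<^esub> a'" "x' \<otimes>\<^bsub>A\<^esub> a'" "b' \<otimes>\<^bsub>A\<^esub> y"]
      by (simp only: g A.l_distr opposite_simps M.a_closed A.m_closed)
  next
    fix x y assume "x \<in> carrier A" "y \<in> carrier (opposite A)"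
    then show "E.cl (?g (x, y)) \<in> carrier E"
      using ab by (simp only: g opposite_simps) (simp add: E.pure_closed)
  qed
  have k: "Poly_Mapping.keys (?g (x, y)) \<subseteq> carrier A \<times> carrier (opposite A)"
    if "x \<in> carrier A" "y \<in> carrier (opposite A)" for x y
  proof -
    have "(\<Union>p\<in>Poly_Mapping.keys (tensor_rep ?U). Poly_Mapping.keys
      ((\<lambda>(a', b'). frag_of (x \<otimes>\<^bsub>A\<^esub> a', b' \<otimes>\<^bsub>A\<^esub> y)) p)) \<subseteq> carrier A \<times> carrier A"
      using rU that by auto
    then have "Poly_Mapping.keys (frag_extend (\<lambda>(a', b'). frag_of (x \<otimes>\<^bsub>A\<^esub> a', b' \<otimes>\<^bsub>A\<^esub> y)) (tensor_rep ?U))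
      \<subseteq> carrier A \<times> carrier A"
      by (rule order_trans[OF keys_frag_extend])
    then show ?thesis by simp
  qed
  have "E.cl (frag_extend ?g (tensor_rep (env a b))) = E.cl (frag_extend ?g (frag_of (a, b)))"
    using tensor_product_rep_map(2)[OF E.tensor_product_axioms E.tensor_product_axioms k b, of "frag_of (a, b)"] ab
    by simp
  also have "\<dots> = env (a \<otimes>\<^bsub>A\<^esub> a') (b' \<otimes>\<^bsub>A\<^esub> b)"
    using g[OF ab(1,2)] by simp
  finally show ?thesis
    by (simp add: enveloping_def tensor_algebra_def Let_def)
qed

lemma env_one: "\<one>\<^bsub>E\<^esub> = env \<one>\<^bsub>A\<^esub> \<one>\<^bsub>A\<^esub>"
  by (simp add: enveloping_def tensor_algebra_def Let_def)

lemma env_left_hom: "ring E \<Longrightarrow> (\<lambda>a. env a \<one>\<^bsub>A\<^esub>) \<in> ring_hom A E"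
  by (rule ring_hom_memI) (simp_all add: E.pure_closed env_mult E.pure_add_left env_one)

lemma env_right_hom: "ring E \<Longrightarrow> (\<lambda>b. env \<one>\<^bsub>A\<^esub> b) \<in> ring_hom (opposite A) E"
  using E.pure_add_right[of "\<one>\<^bsub>A\<^esub>"]
  by (intro ring_hom_memI) (simp_all add: E.pure_closed env_mult env_one)

lemma ring_opposite: "ring (opposite A)"
proof (rule ringI)
  show "abelian_group (opposite A)" by (rule abelian_group_opposite)
  show "monoid (opposite A)" by (rule monoidI) (simp_all add: A.m_assoc)
qed (simp_all add: A.l_distr A.r_distr)

lemma fg_module_self: "fg_module K A"
  using finite_dim fd_algebra_scalars(3)[OF fd_algebra_axioms] by (simp add: fg_module_def)

text \<open>As a left \<open>A\<close>-module, \<open>enveloping K A\<close> is generated by the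
  tensors \<open>1 \<otimes> s\<close> with \<open>s\<close> from a \<open>K\<close>-spanning set of
  \<open>A\<close>, as \<open>K\<close>-coefficients move to the first factor. The hypothesis
  \<open>ring E\<close>, here and below, is discharged at the end by the given syzygy
  \<open>X\<close>: it is a module over \<open>enveloping K A\<close>, and
  \<open>left_module\<close> includes the ring axioms.\<close>

lemma fg_module_env: 
  assumes E: "ring E"
  shows "fg_module A (restrict_scalars (\<lambda>a. env a \<one>\<^bsub>A\<^esub>) (regular_module E))"
proof -
  interpret rE: ring E by fact
  let ?F = "restrict_scalars (\<lambda>a. env a \<one>\<^bsub>A\<^esub>) (regular_module E)"
  have lF: "left_module A ?F"
    by (rule left_module_restrict_scalars[OF A.ring_axioms env_left_hom[OF E] left_module_regular[OF E]])
  interpret F: left_module A ?F by fact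
  note lK = fd_algebra_scalars(3)[OF fd_algebra_axioms]
  obtain S where S: "finite S" "S \<subseteq> carrier A" "carrier A \<subseteq> lspan K A S"
    using fg_module_self finitely_generated_iff[OF lK] by (auto simp: fg_module_def)
  let ?V = "env \<one>\<^bsub>A\<^esub> ` S"
  have V: "?V \<subseteq> carrier ?F" using S(2) by (auto intro!: E.pure_closed)
  note sub = F.submoduleD[OF submodule_lspan[OF lF V]]
  have "env a b \<in> lspan A ?F ?V" if "b \<in> lspan K A S" "a \<in> carrier A" for a b
    using that
  proof (induction arbitrary: a)
    case zero
    have "env a \<zero>\<^bsub>A\<^esub> \<oplus>\<^bsub>E\<^esub> env a \<zero>\<^bsub>A\<^esub> = env a \<zero>\<^bsub>A\<^esub>"
      using E.pure_add_right[of a "\<zero>\<^bsub>A\<^esub>" "\<zero>\<^bsub>A\<^esub>"] zero by simp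
    then have "env a \<zero>\<^bsub>A\<^esub> = \<zero>\<^bsub>E\<^esub>" using E.pure_closed[of a "\<zero>\<^bsub>A\<^esub>"] zero by (simp add: E.W.add.r_cancel_one')
    then show ?case using sub(2) by simp
  next
    case (step b c s)
    have m: "b \<in> carrier A" "s \<in> carrier A"
      using step S left_module.submoduleD(1)[OF lK submodule_lspan[OF lK S(2)]] by auto
    have "env a (b \<oplus>\<^bsub>A\<^esub> c \<odot>\<^bsub>A\<^esub> s) = env a b \<oplus>\<^bsub>E\<^esub> env (c \<odot>\<^bsub>A\<^esub> a) s"
      using E.pure_add_right[of a b "c \<odot>\<^bsub>A\<^esub> s"] step m by (simp add: env_scalar)
    moreover have "env (c \<odot>\<^bsub>A\<^esub> a) \<one>\<^bsub>A\<^esub> \<otimes>\<^bsub>E\<^esub> env \<one>\<^bsub>A\<^esub> s = env (c \<odot>\<^bsub>A\<^esub> a) s"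
      using step m by (simp add: env_mult)
    moreover have "env (c \<odot>\<^bsub>A\<^esub> a) \<one>\<^bsub>A\<^esub> \<otimes>\<^bsub>E\<^esub> env \<one>\<^bsub>A\<^esub> s \<in> lspan A ?F ?V"
      using sub(4)[of "c \<odot>\<^bsub>A\<^esub> a" "env \<one>\<^bsub>A\<^esub> s"] lspan_base[OF lF V, of "env \<one>\<^bsub>A\<^esub> s"] step by simp
    ultimately show ?case using sub(3)[OF step.IH[OF step.prems]] by simp
  qed
  then have p: "env a b \<in> lspan A ?F ?V" if "a \<in> carrier A" "b \<in> carrier A" for a b
    using that S(3) by blast
  have "w \<in> lspan A ?F ?V" if "w \<in> carrier E" for w
    using that
  proof (induction rule: E.tensor_induct)
    case zero
    show ?case using sub(2) by simp
  next
    case (add u v)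
    then show ?case using sub(3) by simp
  next
    case (pure x y)
    then show ?case using p by simp
  qed
  then have "carrier ?F \<subseteq> lspan A ?F ?V" by auto
  then show ?thesis
    using V S(1) lF finitely_generated_iff[OF lF] unfolding fg_module_def by blast
qed

text \<open>The action is a sum over the support of a representative; independence of the
  representative is \<open>descend\<close> once more. Its balancing condition between
  \<open>c a \<otimes> b\<close> and \<open>a \<otimes> c b\<close> is exactly the centrality of
  \<open>K\<close> on \<open>M\<close>.\<close>

lemma enveloping_module_smult:
  assumes M: "central_bimodule K A A M" and x: "x \<in> carrier M"
  shows "additive_map E M (\<lambda>T. T \<odot>\<^bsub>enveloping_module M\<^esub> x)"
    "\<And>a b. a \<in> carrier A \<Longrightarrow> b \<in> carrier A \<Longrightarrow> env a b \<odot>\<^bsub>enveloping_module M\<^esub> x = rsmult M (a \<odot>\<^bsub>M\<^esub> x) b"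
proof -
  interpret C: central_bimodule K A A M by fact
  interpret M: lr_bimodule A A M by (rule central_bimodule_lr[OF M])
  let ?v = "\<lambda>p. rsmult M (fst p \<odot>\<^bsub>M\<^esub> x) (snd p)"
  define \<phi> where "\<phi> t = (\<Oplus>\<^bsub>M\<^esub>p\<in>Poly_Mapping.keys t. [Poly_Mapping.lookup t p] \<cdot>\<^bsub>M\<^esub> ?v p)" for t :: "'a \<times> 'a \<Rightarrow>\<^sub>0 int"
  have v: "?v p \<in> carrier M" if "p \<in> carrier A \<times> carrier A" for p
    using that x by (auto intro!: M.rsmult_closed M.M.smult_closed)
  \<comment> \<open>Summing over any finite set that contains the support lets two formal sums with
    different supports be added term by term.\<close>
  have \<phi>S: "\<phi> t = (\<Oplus>\<^bsub>M\<^esub>p\<in>S. [Poly_Mapping.lookup t p] \<cdot>\<^bsub>M\<^esub> ?v p)"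
    if "finite S" "Poly_Mapping.keys t \<subseteq> S" "S \<subseteq> carrier A \<times> carrier A" for t S
    unfolding \<phi>_def
  proof (rule M.M.M.add.finprod_mono_neutral_cong_left)
    show "[Poly_Mapping.lookup t i] \<cdot>\<^bsub>M\<^esub> ?v i = \<zero>\<^bsub>M\<^esub>" if "i \<in> S - Poly_Mapping.keys t" for i
      using that by (simp add: in_keys_iff add_pow_def)
    show "(\<lambda>p. [Poly_Mapping.lookup t p] \<cdot>\<^bsub>M\<^esub> ?v p) \<in> S \<rightarrow> carrier M"
      using that(3) v by (auto intro!: M.M.M.add.int_pow_closed)
  qed (use that in auto)
  have 1: "\<phi> t \<in> carrier M" if "t \<in> carrier (tensor_free A (opposite A))" for t
    unfolding \<phi>_def using that v by (intro M.M.M.finsum_closed) (auto intro!: M.M.M.add.int_pow_closed)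
  have 2: "\<phi> (t + u) = \<phi> t \<oplus>\<^bsub>M\<^esub> \<phi> u"
    if t: "t \<in> carrier (tensor_free A (opposite A))" and u: "u \<in> carrier (tensor_free A (opposite A))" for t u
  proof -
    let ?S = "Poly_Mapping.keys t \<union> Poly_Mapping.keys u"
    have S: "finite ?S" "?S \<subseteq> carrier A \<times> carrier A" "Poly_Mapping.keys (t + u) \<subseteq> ?S"
      using t u keys_add[of t u] by auto
    have "\<phi> (t + u) = (\<Oplus>\<^bsub>M\<^esub>p\<in>?S. [Poly_Mapping.lookup t p] \<cdot>\<^bsub>M\<^esub> ?v p \<oplus>\<^bsub>M\<^esub> [Poly_Mapping.lookup u p] \<cdot>\<^bsub>M\<^esub> ?v p)"
      unfolding \<phi>S[OF S(1,3,2)]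
    proof (rule M.M.M.finsum_cong')
      show "(\<lambda>p. [Poly_Mapping.lookup t p] \<cdot>\<^bsub>M\<^esub> ?v p \<oplus>\<^bsub>M\<^esub> [Poly_Mapping.lookup u p] \<cdot>\<^bsub>M\<^esub> ?v p) \<in> ?S \<rightarrow> carrier M"
        using S(2) v by (auto intro!: M.M.M.add.int_pow_closed M.M.M.a_closed)
      fix p assume "p \<in> ?S"
      then have "?v p \<in> carrier M" using S(2) v by blast
      then show "[Poly_Mapping.lookup (t + u) p] \<cdot>\<^bsub>M\<^esub> ?v p
          = [Poly_Mapping.lookup t p] \<cdot>\<^bsub>M\<^esub> ?v p \<oplus>\<^bsub>M\<^esub> [Poly_Mapping.lookup u p] \<cdot>\<^bsub>M\<^esub> ?v p"
        by (simp add: lookup_add M.M.M.add.int_pow_mult)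
    qed simp
    also have "\<dots> = \<phi> t \<oplus>\<^bsub>M\<^esub> \<phi> u"
      unfolding \<phi>S[OF S(1) Un_upper1 S(2)] \<phi>S[OF S(1) Un_upper2 S(2)]
      using S(2) v by (intro M.M.M.finsum_addf) (auto intro!: M.M.M.add.int_pow_closed)
    finally show ?thesis .
  qed
  have 3: "\<phi> (frag_of (a, b)) = rsmult M (a \<odot>\<^bsub>M\<^esub> x) b" if "a \<in> carrier A" "b \<in> carrier A" for a b
    using v[of "(a, b)"] that by (simp add: \<phi>_def M.M.M.add.int_pow_1)
  have b: "E.balanced M (\<lambda>a b. \<phi> (frag_of (a, b)))"
  proof (rule E.balancedI)
    fix a c b assume "a \<in> carrier A" "c \<in> carrier K" "b \<in> carrier (opposite A)"
    then have m: "a \<in> carrier A" "c \<in> carrier K" "b \<in> carrier A" "c \<odot>\<^bsub>A\<^esub> \<one>\<^bsub>A\<^esub> \<in> carrier A"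
      "a \<odot>\<^bsub>M\<^esub> x \<in> carrier M" "c \<odot>\<^bsub>A\<^esub> a \<in> carrier A" "c \<odot>\<^bsub>A\<^esub> b \<in> carrier A"
      using x by (auto intro: M.M.smult_closed)
    have "rsmult M ((c \<odot>\<^bsub>A\<^esub> a) \<odot>\<^bsub>M\<^esub> x) b = rsmult M (((c \<odot>\<^bsub>A\<^esub> \<one>\<^bsub>A\<^esub>) \<otimes>\<^bsub>A\<^esub> a) \<odot>\<^bsub>M\<^esub> x) b"
      using m by (simp add: smult_mult_left)
    also have "\<dots> = rsmult M (rsmult M (a \<odot>\<^bsub>M\<^esub> x) (c \<odot>\<^bsub>A\<^esub> \<one>\<^bsub>A\<^esub>)) b"
      using m x C.central[of c "a \<odot>\<^bsub>M\<^esub> x"] by (simp add: M.M.smult_assoc)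
    also have "\<dots> = rsmult M (a \<odot>\<^bsub>M\<^esub> x) ((c \<odot>\<^bsub>A\<^esub> \<one>\<^bsub>A\<^esub>) \<otimes>\<^bsub>A\<^esub> b)"
      using m by (simp add: M.rsmult_mult)
    also have "\<dots> = rsmult M (a \<odot>\<^bsub>M\<^esub> x) (c \<odot>\<^bsub>A\<^esub> b)"
      using m by (simp add: smult_mult_left)
    finally show "\<phi> (frag_of (c \<odot>\<^bsub>A\<^esub> a, b)) = \<phi> (frag_of (a, c \<odot>\<^bsub>opposite A\<^esub> b))"
      using m by (simp add: 3 smult_opposite)
  qed (use x in \<open>simp_all add: 3 M.rsmult_closed M.M.smult_closed M.M.smult_l_distr M.rsmult_l_distr M.rsmult_r_distr\<close>)
  have \<phi>e: "\<phi> (tensor_rep T) = T \<odot>\<^bsub>enveloping_module M\<^esub> x" for T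
    by (simp add: \<phi>_def enveloping_module_def)
  show "additive_map E M (\<lambda>T. T \<odot>\<^bsub>enveloping_module M\<^esub> x)"
    using E.descend(1)[OF M.M.M.abelian_group_axioms 1 2 b] by (simp add: \<phi>e)
  show "env a b \<odot>\<^bsub>enveloping_module M\<^esub> x = rsmult M (a \<odot>\<^bsub>M\<^esub> x) b"
    if "a \<in> carrier A" "b \<in> carrier A" for a b
    using E.descend(2)[OF M.M.M.abelian_group_axioms 1 2 b, of "frag_of (a, b)"] that
    by (simp add: \<phi>e[symmetric] 3)
qed

lemma enveloping_module_simps [simp]:
  "carrier (enveloping_module M) = carrier M" "zero (enveloping_module M) = zero M"
  "add (enveloping_module M) = add M"
  by (simp_all add: enveloping_module_def)

text \<open>Associativity is the only axiom with two tensors in it. It is checked with a pure left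
  factor first, then extended to all left factors by additivity.\<close>

lemma left_module_enveloping:
  assumes M: "central_bimodule K A A M" and E: "ring E"
  shows "left_module E (enveloping_module M)"
proof -
  interpret M: lr_bimodule A A M by (rule central_bimodule_lr[OF M])
  interpret rE: ring E by fact
  note s = enveloping_module_smult[OF M]
  note eq = E.additive_map_eqI[OF _ _ M.M.M.abelian_group_axioms]
  let ?M = "enveloping_module M"
  have cl: "T \<odot>\<^bsub>?M\<^esub> x \<in> carrier M" if "T \<in> carrier E" "x \<in> carrier M" for T x
    using additive_map_closed[OF s(1)] that by blast
  have ag: "abelian_group ?M"
  proof (rule abelian_groupI)
    fix x assume "x \<in> carrier ?M"
    then show "\<exists>y\<in>carrier ?M. y \<oplus>\<^bsub>?M\<^esub> x = \<zero>\<^bsub>?M\<^esub>"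
      by (intro bexI[of _ "\<ominus>\<^bsub>M\<^esub> x"]) (simp_all add: M.M.M.l_neg)
  qed (simp_all add: M.M.M.a_ac)
  have ad: "T \<odot>\<^bsub>?M\<^esub> (x \<oplus>\<^bsub>M\<^esub> y) = T \<odot>\<^bsub>?M\<^esub> x \<oplus>\<^bsub>M\<^esub> T \<odot>\<^bsub>?M\<^esub> y"
    if "T \<in> carrier E" "x \<in> carrier M" "y \<in> carrier M" for T x y
    by (rule eq[where f = "\<lambda>T. T \<odot>\<^bsub>?M\<^esub> (x \<oplus>\<^bsub>M\<^esub> y)",
        OF s(1) additive_map_plus[OF s(1) s(1) M.M.M.abelian_group_axioms] that(1)])
      (use that in \<open>simp_all add: s(2) M.M.smult_r_distr M.M.smult_closed M.rsmult_l_distr\<close>)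
  have as1: "(env a b \<otimes>\<^bsub>E\<^esub> U) \<odot>\<^bsub>?M\<^esub> x = env a b \<odot>\<^bsub>?M\<^esub> (U \<odot>\<^bsub>?M\<^esub> x)"
    if m: "a \<in> carrier A" "b \<in> carrier A" "U \<in> carrier E" "x \<in> carrier M" for a b U x
  proof (rule eq[where f = "\<lambda>U. (env a b \<otimes>\<^bsub>E\<^esub> U) \<odot>\<^bsub>?M\<^esub> x", OF _ _ m(3)])
    have e: "env a b \<in> carrier E" using m by (simp add: E.pure_closed)
    have "additive_map E E (\<lambda>U. env a b \<otimes>\<^bsub>E\<^esub> U)"
      using e by (simp add: additive_map_def rE.r_distr)
    from additive_map_comp[OF this s(1)[OF m(4)]]
    show "additive_map E M (\<lambda>U. (env a b \<otimes>\<^bsub>E\<^esub> U) \<odot>\<^bsub>?M\<^esub> x)" .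
    have "additive_map M M (\<lambda>y. env a b \<odot>\<^bsub>?M\<^esub> y)"
      using e cl ad by (simp add: additive_map_def)
    from additive_map_comp[OF s(1)[OF m(4)] this]
    show "additive_map E M (\<lambda>U. env a b \<odot>\<^bsub>?M\<^esub> (U \<odot>\<^bsub>?M\<^esub> x))" .
    fix a' b' assume "a' \<in> carrier A" "b' \<in> carrier (opposite A)"
    then show "(env a b \<otimes>\<^bsub>E\<^esub> env a' b') \<odot>\<^bsub>?M\<^esub> x = env a b \<odot>\<^bsub>?M\<^esub> (env a' b' \<odot>\<^bsub>?M\<^esub> x)"
      using m by (simp add: env_mult s(2) M.M.smult_assoc M.M.smult_closed M.rsmult_closed M.rsmult_mult M.assoc)
  qed
  have as: "(T \<otimes>\<^bsub>E\<^esub> U) \<odot>\<^bsub>?M\<^esub> x = T \<odot>\<^bsub>?M\<^esub> (U \<odot>\<^bsub>?M\<^esub> x)"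
    if m: "T \<in> carrier E" "U \<in> carrier E" "x \<in> carrier M" for T U x
  proof (rule eq[where f = "\<lambda>T. (T \<otimes>\<^bsub>E\<^esub> U) \<odot>\<^bsub>?M\<^esub> x", OF _ s(1)[OF cl[OF m(2,3)]] m(1)])
    have "additive_map E E (\<lambda>T. T \<otimes>\<^bsub>E\<^esub> U)"
      using m by (simp add: additive_map_def rE.l_distr)
    from additive_map_comp[OF this s(1)[OF m(3)]]
    show "additive_map E M (\<lambda>T. (T \<otimes>\<^bsub>E\<^esub> U) \<odot>\<^bsub>?M\<^esub> x)" .
  qed (use as1 m in simp)
  show ?thesis
    by (intro left_module.intro left_module_axioms.intro ag E)
      (use cl ad as additive_map_add[OF s(1)] in \<open>simp_all add: env_one s(2) M.M.smult_one M.rsmult_one\<close>)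
qed

end

section \<open>Tensoring bimodules with a fixed module\<close>

context fd_algebra
begin

text \<open>The way back from \<open>enveloping_module\<close>: the two actions are those of
  \<open>a \<otimes> 1\<close> and \<open>1 \<otimes> b\<close>. The syzygies and projective terms
  of a bimodule resolution are given only as modules over \<open>enveloping K A\<close>, and this
  makes them available for tensoring over \<open>A\<close>.\<close>

definition env_bimodule ::
    "(('a \<times> 'a \<Rightarrow>\<^sub>0 int) set, 'm, 'd) module_scheme \<Rightarrow> ('a, 'a, 'm) bimodule" where
  "env_bimodule T = \<lparr>carrier = carrier T, mult = undefined, one = undefined, zero = zero T, add = add T,
    smult = (\<lambda>a x. env a \<one>\<^bsub>A\<^esub> \<odot>\<^bsub>T\<^esub> x), rsmult = (\<lambda>x b. env \<one>\<^bsub>A\<^esub> b \<odot>\<^bsub>T\<^esub> x)\<rparr>"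

lemma env_bimodule_simps [simp]:
  "carrier (env_bimodule T) = carrier T" "zero (env_bimodule T) = zero T" "add (env_bimodule T) = add T"
  "smult (env_bimodule T) a x = env a \<one>\<^bsub>A\<^esub> \<odot>\<^bsub>T\<^esub> x" "rsmult (env_bimodule T) x b = env \<one>\<^bsub>A\<^esub> b \<odot>\<^bsub>T\<^esub> x"
  by (simp_all add: env_bimodule_def)

lemma lr_env_bimodule:
  assumes T: "left_module E T"
  shows "lr_bimodule A A (env_bimodule T)"
proof -
  interpret T: left_module E T by fact
  note E = left_module_ring[OF T]
  show ?thesis
  proof (rule lr_bimodule.intro)
    show "left_module A (env_bimodule T)"
      by (rule left_module_cong[OF left_module_restrict_scalars[OF A.ring_axioms env_left_hom[OF E] T]]) simp_all
    show "left_module (opposite A) (right_part (env_bimodule T))"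
      by (rule left_module_cong[OF left_module_restrict_scalars[OF ring_opposite env_right_hom[OF E] T]]) simp_all
    fix a x b assume "a \<in> carrier A" "x \<in> carrier (env_bimodule T)" "b \<in> carrier A"
    then show "rsmult (env_bimodule T) (a \<odot>\<^bsub>env_bimodule T\<^esub> x) b = a \<odot>\<^bsub>env_bimodule T\<^esub> (rsmult (env_bimodule T) x b)"
      by (simp add: T.smult_assoc[symmetric] E.pure_closed env_mult)
  qed
qed

lemma env_bimodule_homs:
  assumes "g \<in> module_homs E T T'"
  shows "g \<in> module_homs A (env_bimodule T) (env_bimodule T')"
    "g \<in> module_homs (opposite A) (right_part (env_bimodule T)) (right_part (env_bimodule T'))"
  using assms by (auto intro!: module_homsI simp: hom_closed hom_add hom_smult E.pure_closed)

lemma left_module_right_env: "left_module E T \<Longrightarrow> left_module (opposite A) (right_part (env_bimodule T))"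
  by (rule lr_bimodule.right[OF lr_env_bimodule])

lemma add_map_right_env:
  assumes "add_map E V T T' h"
  shows "add_map (opposite A) (right_part (env_bimodule V)) (right_part (env_bimodule T))
    (right_part (env_bimodule T')) h"
  using assms
proof induction
  case (zero h)
  then show ?case by (intro add_map.zero) simp
next
  case (step h a b h')
  show ?case
    by (rule add_map.step[OF step.IH env_bimodule_homs(2)[OF step(2)] env_bimodule_homs(2)[OF step(3)]])
      (use step(4) in simp_all)
qed

lemma fg_env_bimodule:
  assumes T: "fg_module E T"
  shows "fg_module A (env_bimodule T)"
proof -
  note lT = fg_module_left[OF T]
  note E = left_module_ring[OF lT]
  have "(\<lambda>x. x) \<in> module_homs A (restrict_scalars (\<lambda>a. env a \<one>\<^bsub>A\<^esub>) T) (env_bimodule T)"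
    by (rule module_homsI) simp_all
  from fg_module_image[OF fg_module_restrict_scalars[OF A.ring_axioms env_left_hom[OF E] T fg_module_env[OF E]]
    lr_bimodule.left[OF lr_env_bimodule[OF lT]] this]
  show ?thesis by simp
qed

text \<open>
  Over the field \<open>K\<close>, the identity of \<open>A\<close> is a sum of maps \<open>\<alpha>(_) v\<close>; tensored with \<open>A\<close>, each of them factors
  through \<open>A\<close> as a map of right modules.
\<close>

lemma right_projective_regular:
  assumes E: "ring E"
  shows "projective_module (opposite A) (right_part (env_bimodule (regular_module E)))"
proof -
  interpret rE: ring E by fact
  let ?R = "right_part (env_bimodule (regular_module E))"
  let ?O = "regular_module (opposite A)"
  note lE = left_module_regular[OF E]
  have lR: "left_module (opposite A) ?R" by (rule left_module_right_env[OF lE])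
  interpret R: left_module "opposite A" ?R by fact
  note lK = fd_algebra_scalars(3)[OF fd_algebra_axioms]
  interpret lK: left_module K A by (rule lK)
  \<comment> \<open>\<open>\<theta>\<close> is \<open>h \<otimes> 1\<close>. It is built along the
    decomposition of \<open>h\<close>, and its additivity is part of the claim so that it can
    finally be compared with the identity on pure tensors.\<close>
  have "\<exists>\<theta>. additive_map E E \<theta> \<and> (\<forall>a\<in>carrier A. \<forall>b\<in>carrier A. \<theta> (env a b) = env (h a) b) \<and>
      add_map (opposite A) ?O ?R ?R \<theta>"
    if "add_map K (regular_module K) A A h" for h
    using that
  proof induction
    case (zero h)
    have z: "env \<zero>\<^bsub>A\<^esub> b = \<zero>\<^bsub>E\<^esub>" if "b \<in> carrier A" for b
      using E.pure_add_left[of "\<zero>\<^bsub>A\<^esub>" "\<zero>\<^bsub>A\<^esub>" b] that E.pure_closed[of "\<zero>\<^bsub>A\<^esub>" b]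
      by (simp add: E.W.add.r_cancel_one')
    show ?case
      by (intro exI[of _ "\<lambda>_. \<zero>\<^bsub>E\<^esub>"] conjI ballI add_map.zero)
        (simp_all add: additive_map_def zero z)
  next
    case (step h \<alpha> \<beta> h')
    obtain \<theta> where \<theta>: "additive_map E E \<theta>" "\<And>a b. a \<in> carrier A \<Longrightarrow> b \<in> carrier A \<Longrightarrow> \<theta> (env a b) = env (h a) b"
      "add_map (opposite A) ?O ?R ?R \<theta>"
      using step.IH by blast
    define v where "v = \<beta> \<one>\<^bsub>K\<^esub>"
    have v: "v \<in> carrier A" using hom_closed[OF step(3), of "\<one>\<^bsub>K\<^esub>"] by (simp add: v_def)
    have \<alpha>c: "\<alpha> a \<in> carrier K" if "a \<in> carrier A" for a using hom_closed[OF step(2) that] by simp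
    have \<beta>: "\<beta> c = c \<odot>\<^bsub>A\<^esub> v" if "c \<in> carrier K" for c
      using hom_regular_eq[OF lK step(3) that] by (simp add: v_def)
    have "E.balanced A (\<lambda>a b. \<alpha> a \<odot>\<^bsub>A\<^esub> b)"
      by (intro E.balancedI)
        (use \<alpha>c hom_add[OF step(2)] hom_smult[OF step(2)] in
          \<open>simp_all add: smult_l_distr smult_r_distr smult_opposite K.m_comm smult_assoc1[symmetric]\<close>)
    \<comment> \<open>\<open>a'\<close> sends \<open>x \<otimes> y\<close> to
      \<open>\<alpha>(x) y\<close>; followed by \<open>b \<mapsto> v \<otimes> b\<close> it is
      \<open>\<beta> \<alpha> \<otimes> 1\<close>, now factored through \<open>A\<close> as a right
      module.\<close>
    then obtain a' where a': "additive_map E A a'"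
      "\<And>x y. x \<in> carrier A \<Longrightarrow> y \<in> carrier (opposite A) \<Longrightarrow> a' (env x y) = \<alpha> x \<odot>\<^bsub>A\<^esub> y"
      using E.lift[OF A.is_abelian_group] by blast
    have a1: "a' \<in> module_homs (opposite A) ?R ?O"
    proof (rule module_homsI)
      fix b w assume b: "b \<in> carrier (opposite A)" and w: "w \<in> carrier ?R"
      have be: "env \<one>\<^bsub>A\<^esub> b \<in> carrier E" using b by (simp add: E.pure_closed)
      have 1: "additive_map E E (\<lambda>w. env \<one>\<^bsub>A\<^esub> b \<otimes>\<^bsub>E\<^esub> w)"
        using be by (simp add: additive_map_def rE.r_distr)
      have 2: "additive_map A A (\<lambda>x. x \<otimes>\<^bsub>A\<^esub> b)"
        using b by (simp add: additive_map_def A.l_distr)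
      have "a' (env \<one>\<^bsub>A\<^esub> b \<otimes>\<^bsub>E\<^esub> w) = a' w \<otimes>\<^bsub>A\<^esub> b"
        by (rule E.additive_map_eqI[OF additive_map_comp[OF 1 a'(1)] additive_map_comp[OF a'(1) 2]
          A.is_abelian_group])
          (use w b \<alpha>c in \<open>simp_all add: env_mult a'(2) smult_mult_left\<close>)
      then show "a' (b \<odot>\<^bsub>?R\<^esub> w) = b \<odot>\<^bsub>?O\<^esub> a' w" by simp
    qed (use additive_map_closed[OF a'(1)] additive_map_add[OF a'(1)] in simp_all)
    have b1: "(\<lambda>b. env v b) \<in> module_homs (opposite A) ?O ?R"
      by (rule module_homsI)
        (use v E.pure_add_right[of v] in \<open>simp_all add: E.pure_closed env_mult\<close>)
    let ?\<theta> = "\<lambda>w. \<theta> w \<oplus>\<^bsub>E\<^esub> env v (a' w)"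
    have "additive_map E E (\<lambda>w. env v (a' w))"
      using hom_additive[OF hom_comp[OF a1 b1]] by (simp add: additive_map_def)
    from additive_map_plus[OF \<theta>(1) this E.abelian_group_W]
    have "additive_map E E ?\<theta>" .
    moreover have "?\<theta> (env a b) = env (h' a) b" if ab: "a \<in> carrier A" "b \<in> carrier A" for a b
    proof -
      have "h a \<in> carrier A" using hom_closed[OF add_map_hom[OF step(1) lK lK] ab(1)] .
      moreover have "env v (\<alpha> a \<odot>\<^bsub>A\<^esub> b) = env (\<beta> (\<alpha> a)) b"
        using env_scalar[OF v ab(2) \<alpha>c[OF ab(1)]] \<beta>[OF \<alpha>c[OF ab(1)]] by simp
      ultimately show ?thesis
        using ab v step(4) \<theta>(2) a'(2)[of a b] \<alpha>c \<beta> E.pure_add_left[of "h a" "\<beta> (\<alpha> a)" b] by simp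
    qed
    moreover have "add_map (opposite A) ?O ?R ?R ?\<theta>"
      by (rule add_map.step[OF \<theta>(3) a1 b1]) simp
    ultimately show ?case by blast
  qed
  from this[OF field_projective[OF fd_algebra_scalars(4)[OF fd_algebra_axioms] fg_module_self]]
  obtain \<theta> where \<theta>: "additive_map E E \<theta>" "\<forall>a\<in>carrier A. \<forall>b\<in>carrier A. \<theta> (env a b) = env a b"
    "add_map (opposite A) ?O ?R ?R \<theta>" by blast
  have "\<theta> w = w" if "w \<in> carrier E" for w
    by (rule E.additive_map_eqI[OF \<theta>(1) additive_map_id E.abelian_group_W that]) (use \<theta>(2) in simp)
  then show ?thesis by (intro add_map_cong[OF \<theta>(3)]) simp
qed

lemma right_projective:
  assumes P: "left_module E P" and p: "projective_module E P"
  shows "projective_module (opposite A) (right_part (env_bimodule P))"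
proof -
  note E = left_module_ring[OF P]
  note r = left_module_right_env
  show ?thesis
    by (rule add_map_trans[OF add_map_right_env[OF p] right_projective_regular[OF E] r[OF P] r[OF P]
      r[OF left_module_regular[OF E]]])
qed

section \<open>Tensoring modules over the enveloping algebra with a fixed left
  \<open>A\<close>-module\<close>

abbreviation "env_tensor T L \<equiv> tensor_module A (env_bimodule T) L"

abbreviation "env_map T L g \<equiv> tensor_map A (env_bimodule T) L g (\<lambda>x. x)"

lemma env_tensor_mod: "left_module E T \<Longrightarrow> left_module A L \<Longrightarrow> tensor_mod A A (env_bimodule T) L"
  by (rule tensor_modI[OF lr_env_bimodule])

lemma left_module_env_tensor: "left_module E T \<Longrightarrow> left_module A L \<Longrightarrow> left_module A (env_tensor T L)"
  by (rule left_module_tensor_module[OF lr_env_bimodule])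

lemma env_map_hom:
  assumes "left_module E T" "left_module E T'" "left_module A L" "g \<in> module_homs E T T'"
  shows "env_map T' L g \<in> module_homs A (env_tensor T L) (env_tensor T' L)"
  by (rule tensor_map_hom[OF env_tensor_mod env_tensor_mod env_bimodule_homs(2,1) hom_id]) fact+

lemma env_map_comp:
  assumes T: "left_module E T" "left_module E T'" "left_module E T''" and L: "left_module A L"
    and g: "g \<in> module_homs (opposite A) (right_part (env_bimodule T)) (right_part (env_bimodule T'))"
    and g': "g' \<in> module_homs (opposite A) (right_part (env_bimodule T')) (right_part (env_bimodule T''))"
    and w: "w \<in> carrier (env_tensor T L)"
  shows "env_map T'' L g' (env_map T' L g w) = env_map T'' L (\<lambda>x. g' (g x)) w"
  using tensor_map_comp[OF env_tensor_mod[OF T(1) L] env_tensor_mod[OF T(2) L] env_tensor_mod[OF T(3) L]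
    g hom_id g' hom_id w] .

lemma env_add_map:
  assumes h: "add_map E V T T' h" and V: "left_module E V" and T: "left_module E T"
    and T': "left_module E T'" and L: "left_module A L"
  shows "add_map A (env_tensor V L) (env_tensor T L) (env_tensor T' L) (env_map T' L h)"
  using h
proof induction
  case (zero h)
  have "add_map E V T T' h" by (rule add_map.zero) (rule zero)
  note hh = env_bimodule_homs(2)[OF add_map_hom[OF this T T']]
  show ?case
    by (rule add_map.zero, rule tensor_map_zero[OF env_tensor_mod[OF T L] env_tensor_mod[OF T' L] hh hom_id])
      (use zero in auto)
next
  case (step h a b h')
  note hh = env_bimodule_homs(2)[OF add_map_hom[OF step(1) T T']]
  have "add_map E V T T' h'" by (rule add_map.step[OF step(1-3)]) (rule step(4))
  note hh' = env_bimodule_homs(2)[OF add_map_hom[OF this T T']]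
  note a = env_bimodule_homs(2)[OF step(2)] and b = env_bimodule_homs(2)[OF step(3)]
  show ?case
  proof (rule add_map.step[OF step.IH env_map_hom[OF T V L step(2)] env_map_hom[OF V T' L step(3)]])
    fix w assume w: "w \<in> carrier (env_tensor T L)"
    have "env_map T' L h' w = env_map T' L h w \<oplus>\<^bsub>env_tensor T' L\<^esub> env_map T' L (\<lambda>x. b (a x)) w"
      by (rule tensor_map_plus_left[OF env_tensor_mod[OF T L] env_tensor_mod[OF T' L] hh hom_comp[OF a b] hh' hom_id w])
        (use step(4) in simp)
    then show "env_map T' L h' w = env_map T' L h w \<oplus>\<^bsub>env_tensor T' L\<^esub> env_map T' L b (env_map V L a w)"
      using env_map_comp[OF T V T' L a b w] by simp
  qed
qed

text \<open>
  Likewise, \<open>(A \<otimes> A\<^sup>o\<^sup>p) \<otimes> L\<close> is \<open>A \<otimes> L\<close>, and the identity of \<open>L\<close> is a sum of \<open>K\<close>-linear maps of rank one.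
\<close>

lemma env_tensor_regular_projective:
  assumes E: "ring E" and L: "fg_module A L"
  shows "projective_module A (env_tensor (regular_module E) L)"
proof -
  interpret rE: ring E by fact
  let ?R = "regular_module E" and ?T = "env_tensor (regular_module E) L"
  let ?\<rho> = "\<lambda>c. c \<odot>\<^bsub>A\<^esub> \<one>\<^bsub>A\<^esub>"
  note lL = fg_module_left[OF L]
  interpret L: left_module A L by fact
  note lR = left_module_regular[OF E]
  interpret T: tensor_mod A A "env_bimodule ?R" L by (rule env_tensor_mod[OF lR lL])
  note lT = T.left_module_tensor
  note s = fd_algebra_scalars[OF fd_algebra_axioms]
  let ?L = "restrict_scalars ?\<rho> L"
  have fL: "fg_module K ?L" by (rule fg_module_restrict_scalars[OF left_module_ring[OF s(3)] s(1) L s(2)])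
  note lKL = fg_module_left[OF fL]
  \<comment> \<open>Since
    \<open>(a \<otimes> b) \<otimes> l = (a \<otimes> 1) \<otimes> b l\<close>, the formula
    describes \<open>1 \<otimes> h\<close> under the identification with
    \<open>A \<otimes>\<^sub>K L\<close>.\<close>
  have "\<exists>\<theta>. add_map A (regular_module A) ?T ?T \<theta> \<and>
      (\<forall>a\<in>carrier A. \<forall>b\<in>carrier A. \<forall>l\<in>carrier L. \<theta> (T.T.pure_tensor (env a b) l) = T.T.pure_tensor (env a \<one>\<^bsub>A\<^esub>) (h (b \<odot>\<^bsub>L\<^esub> l)))"
    if "add_map K (regular_module K) ?L ?L h" for h
    using that
  proof induction
    case (zero h)
    have z: "T.T.pure_tensor (env a \<one>\<^bsub>A\<^esub>) \<zero>\<^bsub>L\<^esub> = \<zero>\<^bsub>?T\<^esub>" if "a \<in> carrier A" for a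
      using T.pure_zero_right[of "env a \<one>\<^bsub>A\<^esub>"] that by (simp add: E.pure_closed)
    show ?case
    proof (intro exI[of _ "\<lambda>_. \<zero>\<^bsub>?T\<^esub>"] conjI ballI)
      show "add_map A (regular_module A) ?T ?T (\<lambda>_. \<zero>\<^bsub>?T\<^esub>)" by (rule add_map.zero) simp
      fix a b l assume m: "a \<in> carrier A" "b \<in> carrier A" "l \<in> carrier L"
      have "h (b \<odot>\<^bsub>L\<^esub> l) = \<zero>\<^bsub>L\<^esub>" using zero[of "b \<odot>\<^bsub>L\<^esub> l"] m by (simp add: L.smult_closed)
      then show "\<zero>\<^bsub>?T\<^esub> = T.T.pure_tensor (env a \<one>\<^bsub>A\<^esub>) (h (b \<odot>\<^bsub>L\<^esub> l))" using z[OF m(1)] by (simp only:)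
    qed
  next
    case (step h \<alpha> \<beta> h')
    obtain \<theta> where \<theta>: "add_map A (regular_module A) ?T ?T \<theta>"
      "\<And>a b l. a \<in> carrier A \<Longrightarrow> b \<in> carrier A \<Longrightarrow> l \<in> carrier L \<Longrightarrow>
        \<theta> (T.T.pure_tensor (env a b) l) = T.T.pure_tensor (env a \<one>\<^bsub>A\<^esub>) (h (b \<odot>\<^bsub>L\<^esub> l))"
      using step.IH by blast
    define v where "v = \<beta> \<one>\<^bsub>K\<^esub>"
    have v: "v \<in> carrier L" using hom_closed[OF step(3), of "\<one>\<^bsub>K\<^esub>"] by (simp add: v_def)
    have \<alpha>c: "\<alpha> l \<in> carrier K" if "l \<in> carrier L" for l using hom_closed[OF step(2), of l] that by simp
    have \<alpha>a: "\<alpha> (l \<oplus>\<^bsub>L\<^esub> l') = \<alpha> l \<oplus>\<^bsub>K\<^esub> \<alpha> l'" if "l \<in> carrier L" "l' \<in> carrier L" for l l'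
      using hom_add[OF step(2), of l l'] that by simp
    have \<alpha>s: "\<alpha> ((c \<odot>\<^bsub>A\<^esub> \<one>\<^bsub>A\<^esub>) \<odot>\<^bsub>L\<^esub> l) = c \<otimes>\<^bsub>K\<^esub> \<alpha> l" if "c \<in> carrier K" "l \<in> carrier L" for c l
      using hom_smult[OF step(2), of c l] that by simp
    have \<beta>: "\<beta> c = (c \<odot>\<^bsub>A\<^esub> \<one>\<^bsub>A\<^esub>) \<odot>\<^bsub>L\<^esub> v" if "c \<in> carrier K" for c
      using hom_regular_eq[OF lKL step(3) that] by (simp add: v_def)
    \<comment> \<open>For each fixed \<open>l\<close> the rank-one map \<open>\<alpha>\<close> gives
      a map out of the enveloping algebra; letting \<open>l\<close> vary afterwards yields an
      \<open>A\<close>-linear map from the tensor product to \<open>A\<close>.\<close>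
    have "\<exists>f. additive_map E A f \<and> (\<forall>a\<in>carrier A. \<forall>b\<in>carrier A. f (env a b) = \<alpha> (b \<odot>\<^bsub>L\<^esub> l) \<odot>\<^bsub>A\<^esub> a)"
      if l: "l \<in> carrier L" for l
    proof -
      have "E.balanced A (\<lambda>a b. \<alpha> (b \<odot>\<^bsub>L\<^esub> l) \<odot>\<^bsub>A\<^esub> a)"
      proof (rule E.balancedI)
        fix a c b assume m: "a \<in> carrier A" "c \<in> carrier K" "b \<in> carrier (opposite A)"
        have "(c \<odot>\<^bsub>A\<^esub> b) \<odot>\<^bsub>L\<^esub> l = (c \<odot>\<^bsub>A\<^esub> \<one>\<^bsub>A\<^esub>) \<odot>\<^bsub>L\<^esub> (b \<odot>\<^bsub>L\<^esub> l)"
          using m l by (simp add: L.smult_assoc[symmetric] smult_mult_left)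
        then have "\<alpha> ((c \<odot>\<^bsub>A\<^esub> b) \<odot>\<^bsub>L\<^esub> l) = c \<otimes>\<^bsub>K\<^esub> \<alpha> (b \<odot>\<^bsub>L\<^esub> l)"
          using m l \<alpha>s[of c "b \<odot>\<^bsub>L\<^esub> l"] by (simp add: L.smult_closed)
        then show "\<alpha> (b \<odot>\<^bsub>L\<^esub> l) \<odot>\<^bsub>A\<^esub> (c \<odot>\<^bsub>A\<^esub> a) = \<alpha> ((c \<odot>\<^bsub>opposite A\<^esub> b) \<odot>\<^bsub>L\<^esub> l) \<odot>\<^bsub>A\<^esub> a"
          using m l \<alpha>c by (simp add: smult_opposite L.smult_closed smult_assoc1[symmetric] K.m_comm)
      qed (use l in \<open>simp_all add: \<alpha>c \<alpha>a L.smult_closed L.smult_l_distr smult_l_distr smult_r_distr\<close>)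
      from E.lift[OF A.is_abelian_group this] show ?thesis by (metis opposite_simps(1))
    qed
    then obtain F where F: "\<And>l. l \<in> carrier L \<Longrightarrow> additive_map E A (F l)"
      "\<And>l a b. l \<in> carrier L \<Longrightarrow> a \<in> carrier A \<Longrightarrow> b \<in> carrier A \<Longrightarrow> F l (env a b) = \<alpha> (b \<odot>\<^bsub>L\<^esub> l) \<odot>\<^bsub>A\<^esub> a"
      by metis
    note eq = E.additive_map_eqI[OF _ _ A.is_abelian_group]
    have mu: "additive_map E E (\<lambda>e. u \<otimes>\<^bsub>E\<^esub> e)" if "u \<in> carrier E" for u
      using that by (simp add: additive_map_def rE.r_distr)
    have "T.T.balanced (regular_module A) (\<lambda>e l. F l e)"
    proof (rule T.T.balancedI)
      fix e l l' assume m: "e \<in> carrier (env_bimodule ?R)" "l \<in> carrier L" "l' \<in> carrier L"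
      have "F (l \<oplus>\<^bsub>L\<^esub> l') e = F l e \<oplus>\<^bsub>A\<^esub> F l' e"
        by (rule eq[OF F(1) additive_map_plus[OF F(1) F(1) A.is_abelian_group]])
          (use m in \<open>simp_all add: F(2) \<alpha>a \<alpha>c L.smult_r_distr L.smult_closed smult_l_distr\<close>)
      then show "F (l \<oplus>\<^bsub>L\<^esub> l') e = F l e \<oplus>\<^bsub>regular_module A\<^esub> F l' e" by simp
    next
      fix e b l assume m: "e \<in> carrier (env_bimodule ?R)" "b \<in> carrier A" "l \<in> carrier L"
      have "F l (env \<one>\<^bsub>A\<^esub> b \<otimes>\<^bsub>E\<^esub> e) = F (b \<odot>\<^bsub>L\<^esub> l) e"
        by (rule eq[OF additive_map_comp[OF mu F(1)] F(1)])
          (use m in \<open>simp_all add: F(2) env_mult E.pure_closed L.smult_assoc L.smult_closed\<close>)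
      then show "F l (rsmult (env_bimodule ?R) e b) = F (b \<odot>\<^bsub>L\<^esub> l) e" by simp
    qed (use additive_map_closed[OF F(1)] additive_map_add[OF F(1)] in simp_all)
    moreover have "F l (a \<odot>\<^bsub>env_bimodule ?R\<^esub> e) = a \<odot>\<^bsub>regular_module A\<^esub> F l e"
      if m: "a \<in> carrier A" "e \<in> carrier (env_bimodule ?R)" "l \<in> carrier L" for a e l
    proof -
      have ma: "additive_map A A (\<lambda>x. a \<otimes>\<^bsub>A\<^esub> x)" using m by (simp add: additive_map_def A.r_distr)
      have "F l (env a \<one>\<^bsub>A\<^esub> \<otimes>\<^bsub>E\<^esub> e) = a \<otimes>\<^bsub>A\<^esub> F l e"
        by (rule eq[OF additive_map_comp[OF mu F(1)] additive_map_comp[OF F(1) ma]])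
          (use m in \<open>simp_all add: F(2) env_mult E.pure_closed \<alpha>c L.smult_closed smult_mult_right\<close>)
      then show ?thesis by simp
    qed
    ultimately obtain \<alpha>' where \<alpha>': "\<alpha>' \<in> module_homs A ?T (regular_module A)"
      "\<And>e l. e \<in> carrier (env_bimodule ?R) \<Longrightarrow> l \<in> carrier L \<Longrightarrow> \<alpha>' (T.T.pure_tensor e l) = F l e"
      using T.lift_hom[OF left_module_regular[OF A.ring_axioms]] by blast
    have \<beta>': "(\<lambda>a. T.T.pure_tensor (env a \<one>\<^bsub>A\<^esub>) v) \<in> module_homs A (regular_module A) ?T"
    proof (rule module_homsI)
      fix a b assume m: "a \<in> carrier (regular_module A)" "b \<in> carrier (regular_module A)"
      then show "T.T.pure_tensor (env (a \<oplus>\<^bsub>regular_module A\<^esub> b) \<one>\<^bsub>A\<^esub>) v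
        = T.T.pure_tensor (env a \<one>\<^bsub>A\<^esub>) v \<oplus>\<^bsub>?T\<^esub> T.T.pure_tensor (env b \<one>\<^bsub>A\<^esub>) v"
        using T.T.pure_add_left[of "env a \<one>\<^bsub>A\<^esub>" "env b \<one>\<^bsub>A\<^esub>" v] v by (simp add: E.pure_closed E.pure_add_left)
    next
      fix a b assume m: "a \<in> carrier A" "b \<in> carrier (regular_module A)"
      then show "T.T.pure_tensor (env (a \<odot>\<^bsub>regular_module A\<^esub> b) \<one>\<^bsub>A\<^esub>) v = a \<odot>\<^bsub>?T\<^esub> T.T.pure_tensor (env b \<one>\<^bsub>A\<^esub>) v"
        using T.smult_tensor(2)[of a "env b \<one>\<^bsub>A\<^esub>" v] v by (simp add: E.pure_closed env_mult)
    qed (use T.T.pure_closed v in \<open>simp add: E.pure_closed\<close>)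
    have "add_map A (regular_module A) ?T ?T (\<lambda>w. \<theta> w \<oplus>\<^bsub>?T\<^esub> T.T.pure_tensor (env (\<alpha>' w) \<one>\<^bsub>A\<^esub>) v)"
      by (rule add_map.step[OF \<theta>(1) \<alpha>'(1) \<beta>']) simp
    moreover have "\<theta> (T.T.pure_tensor (env a b) l) \<oplus>\<^bsub>?T\<^esub> T.T.pure_tensor (env (\<alpha>' (T.T.pure_tensor (env a b) l)) \<one>\<^bsub>A\<^esub>) v
        = T.T.pure_tensor (env a \<one>\<^bsub>A\<^esub>) (h' (b \<odot>\<^bsub>L\<^esub> l))"
      if m: "a \<in> carrier A" "b \<in> carrier A" "l \<in> carrier L" for a b l
    proof -
      let ?x = "b \<odot>\<^bsub>L\<^esub> l"
      have x: "?x \<in> carrier L" using m by (simp add: L.smult_closed)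
      note c = \<alpha>c[OF x]
      have hx: "h ?x \<in> carrier L" using hom_closed[OF add_map_hom[OF step(1) lKL lKL], of ?x] x by simp
      \<comment> \<open>The scalar \<open>\<alpha>(b l)\<close> is carried from the left factor
        \<open>a\<close> over to the right action, and from there across the tensor sign onto
        \<open>v\<close>.\<close>
      have "env (\<alpha> ?x \<odot>\<^bsub>A\<^esub> a) \<one>\<^bsub>A\<^esub> = env \<one>\<^bsub>A\<^esub> (\<alpha> ?x \<odot>\<^bsub>A\<^esub> \<one>\<^bsub>A\<^esub>) \<otimes>\<^bsub>E\<^esub> env a \<one>\<^bsub>A\<^esub>"
        using m c by (simp add: env_mult env_scalar)
      then have "T.T.pure_tensor (env (\<alpha> ?x \<odot>\<^bsub>A\<^esub> a) \<one>\<^bsub>A\<^esub>) v = T.T.pure_tensor (env a \<one>\<^bsub>A\<^esub>) (\<beta> (\<alpha> ?x))"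
        using T.T.pure_balanced[of "env a \<one>\<^bsub>A\<^esub>" "\<alpha> ?x \<odot>\<^bsub>A\<^esub> \<one>\<^bsub>A\<^esub>" v] m c v \<beta>[OF c] by (simp add: E.pure_closed)
      moreover have "\<alpha>' (T.T.pure_tensor (env a b) l) = \<alpha> ?x \<odot>\<^bsub>A\<^esub> a"
        using \<alpha>'(2)[of "env a b" l] F(2) m by (simp add: E.pure_closed)
      moreover have "T.T.pure_tensor (env a \<one>\<^bsub>A\<^esub>) (h' ?x)
          = T.T.pure_tensor (env a \<one>\<^bsub>A\<^esub>) (h ?x) \<oplus>\<^bsub>?T\<^esub> T.T.pure_tensor (env a \<one>\<^bsub>A\<^esub>) (\<beta> (\<alpha> ?x))"
        using step(4)[of ?x] T.T.pure_add_right[of "env a \<one>\<^bsub>A\<^esub>" "h ?x" "\<beta> (\<alpha> ?x)"] x hx m c v \<beta>[OF c]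
        by (simp add: E.pure_closed L.smult_closed)
      ultimately show ?thesis using \<theta>(2)[OF m] by simp
    qed
    ultimately show ?case by blast
  qed
  from this[OF field_projective[OF s(4) fL]] obtain \<theta> where \<theta>: "add_map A (regular_module A) ?T ?T \<theta>"
    "\<And>a b l. a \<in> carrier A \<Longrightarrow> b \<in> carrier A \<Longrightarrow> l \<in> carrier L \<Longrightarrow>
      \<theta> (T.T.pure_tensor (env a b) l) = T.T.pure_tensor (env a \<one>\<^bsub>A\<^esub>) (b \<odot>\<^bsub>L\<^esub> l)"
    by blast
  note \<theta>a = hom_additive[OF add_map_hom[OF \<theta>(1) lT lT]]
  show ?thesis
  proof (rule add_map_cong[OF \<theta>(1)])
    fix w assume w: "w \<in> carrier ?T"
    show "\<theta> w = w"
    proof (rule T.T.additive_map_eqI[OF \<theta>a additive_map_id T.T.abelian_group_W w])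
      fix e l assume e: "e \<in> carrier (env_bimodule ?R)" and l: "l \<in> carrier L"
      have p: "additive_map E ?T (\<lambda>e. T.T.pure_tensor e l)"
        using l T.T.pure_closed T.T.pure_add_left by (simp add: additive_map_def)
      show "\<theta> (T.T.pure_tensor e l) = T.T.pure_tensor e l"
      proof (rule E.additive_map_eqI[OF additive_map_comp[OF p \<theta>a] p T.T.abelian_group_W])
        fix a b assume "a \<in> carrier A" "b \<in> carrier (opposite A)"
        then show "\<theta> (T.T.pure_tensor (env a b) l) = T.T.pure_tensor (env a b) l"
          using \<theta>(2)[of a b l] l T.T.pure_balanced[of "env a \<one>\<^bsub>A\<^esub>" b l] by (simp add: E.pure_closed env_mult)
      qed (use e in simp)
    qed
  qed
qed

lemma env_tensor_projective:
  assumes P: "left_module E P" and p: "projective_module E P" and L: "fg_module A L"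
  shows "projective_module A (env_tensor P L)"
proof -
  note E = left_module_ring[OF P]
  note lE = left_module_regular[OF E] and lL = fg_module_left[OF L]
  have "mem_add A (env_tensor (regular_module E) L) (env_tensor P L)"
    by (rule add_map_cong[OF env_add_map[OF p lE P P lL]]) (rule tensor_map_id[OF env_tensor_mod[OF P lL]])
  from add_map_trans[OF this env_tensor_regular_projective[OF E L]] P lE lL show ?thesis
    by (simp add: left_module_env_tensor)
qed

text \<open>The error terms factor through the enveloping algebra; after tensoring with
  \<open>L\<close> they factor through \<open>enveloping K A \<otimes> L\<close>, which is
  projective over \<open>A\<close>.\<close>

lemma env_stable_iso:
  assumes s: "stable_iso E T X" and T: "left_module E T" and X: "left_module E X" and L: "fg_module A L"
  shows "stable_iso A (env_tensor T L) (env_tensor X L)"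
proof -
  note E = left_module_ring[OF T]
  note lE = left_module_regular[OF E] and lL = fg_module_left[OF L]
  obtain f g where fg: "f \<in> module_homs E T X" "g \<in> module_homs E X T"
    "add_map E (regular_module E) T T (\<lambda>x. x \<ominus>\<^bsub>T\<^esub> g (f x))"
    "add_map E (regular_module E) X X (\<lambda>x. x \<ominus>\<^bsub>X\<^esub> f (g x))"
    using s by (auto simp: stable_iso_def)
  have half: "add_map A (regular_module A) (env_tensor T L) (env_tensor T L)
      (\<lambda>w. w \<ominus>\<^bsub>env_tensor T L\<^esub> env_map T L g (env_map X L f w))"
    if T: "left_module E T" and X: "left_module E X"
      and f: "f \<in> module_homs E T X" and g: "g \<in> module_homs E X T"
      and a: "add_map E (regular_module E) T T (\<lambda>x. x \<ominus>\<^bsub>T\<^esub> g (f x))"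
    for f g and T :: "(('a \<times> 'a \<Rightarrow>\<^sub>0 int) set, 't, 'u) module_scheme"
      and X :: "(('a \<times> 'a \<Rightarrow>\<^sub>0 int) set, 'x, 'y) module_scheme"
  proof -
    interpret T: left_module E T by fact
    note lT = left_module_env_tensor[OF T lL]
    interpret W: left_module A "env_tensor T L" by (rule lT)
    have "add_map A (regular_module A) (env_tensor T L) (env_tensor T L) (env_map T L (\<lambda>x. x \<ominus>\<^bsub>T\<^esub> g (f x)))"
      by (rule add_map_trans[OF env_add_map[OF a lE T T lL] env_tensor_regular_projective[OF E L] lT lT
        left_module_env_tensor[OF lE lL]])
    then show ?thesis
    proof (rule add_map_cong)
      fix w assume w: "w \<in> carrier (env_tensor T L)"
      note gf = env_bimodule_homs(2)[OF hom_comp[OF f g]]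
      note d = env_bimodule_homs(2)[OF add_map_hom[OF a T T]]
      note c = additive_map_closed[OF tensor_map(1)[OF env_tensor_mod[OF T lL] env_tensor_mod[OF T lL] d hom_id] w]
        additive_map_closed[OF tensor_map(1)[OF env_tensor_mod[OF T lL] env_tensor_mod[OF T lL] gf hom_id] w]
      have "env_map T L (\<lambda>x. x) w = env_map T L (\<lambda>x. x \<ominus>\<^bsub>T\<^esub> g (f x)) w \<oplus>\<^bsub>env_tensor T L\<^esub> env_map T L (\<lambda>x. g (f x)) w"
        by (rule tensor_map_plus_left[OF env_tensor_mod[OF T lL] env_tensor_mod[OF T lL] d gf hom_id hom_id w])
          (use hom_closed[OF f] hom_closed[OF g] in \<open>simp add: T.M.minus_plus_cancel\<close>)
      then have e: "w = env_map T L (\<lambda>x. x \<ominus>\<^bsub>T\<^esub> g (f x)) w \<oplus>\<^bsub>env_tensor T L\<^esub> env_map T L (\<lambda>x. g (f x)) w"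
        using tensor_map_id[OF env_tensor_mod[OF T lL] w] by simp
      have "w \<ominus>\<^bsub>env_tensor T L\<^esub> env_map T L (\<lambda>x. g (f x)) w = env_map T L (\<lambda>x. x \<ominus>\<^bsub>T\<^esub> g (f x)) w"
        using W.M.plus_minus_cancel[OF c] unfolding e[symmetric] .
      then show "env_map T L (\<lambda>x. x \<ominus>\<^bsub>T\<^esub> g (f x)) w = w \<ominus>\<^bsub>env_tensor T L\<^esub> env_map T L g (env_map X L f w)"
        using env_map_comp[OF T X T lL env_bimodule_homs(2)[OF f] env_bimodule_homs(2)[OF g] w] by simp
    qed
  qed
  show ?thesis
    unfolding stable_iso_def
    by (intro bexI[of _ "env_map X L f"] bexI[of _ "env_map T L g"] conjI
      half[OF T X fg(1-3)] half[OF X T fg(2,1,4)] env_map_hom[OF T X lL fg(1)] env_map_hom[OF X T lL fg(2)])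
qed

text \<open>
  As \<open>Y\<close> is projective on the right, the sequence splits on the right, hence it stays exact after tensoring.
\<close>

lemma env_tensor_short_exact:
  assumes X: "left_module E X" and P: "left_module E P" and Y: "left_module E Y" and L: "left_module A L"
    and ex: "short_exact E X P Y j \<pi>"
    and pY: "projective_module (opposite A) (right_part (env_bimodule Y))"
    and pP: "projective_module (opposite A) (right_part (env_bimodule P))"
  shows "short_exact A (env_tensor X L) (env_tensor P L) (env_tensor Y L) (env_map P L j) (env_map Y L \<pi>)"
    "projective_module (opposite A) (right_part (env_bimodule X))"
proof -
  note E = short_exactD[OF ex]
  let ?X = "right_part (env_bimodule X)" and ?P = "right_part (env_bimodule P)"
    and ?Y = "right_part (env_bimodule Y)"
  note lX = left_module_right_env[OF X] and lP = left_module_right_env[OF P] and lY = left_module_right_env[OF Y]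
  note j = env_bimodule_homs(2)[OF E(1)] and p = env_bimodule_homs(2)[OF E(2)]
  interpret P: left_module "opposite A" ?P by (rule lP)
  have exr: "short_exact (opposite A) ?X ?P ?Y j \<pi>"
    using E by (simp add: short_exact_def j p) (auto simp: set_eq_iff mem_a_kernel hom_closed)
  obtain s where s: "s \<in> module_homs (opposite A) ?Y ?P" "\<And>y. y \<in> carrier ?Y \<Longrightarrow> \<pi> (s y) = y"
    using projective_lift[OF pY lY lY lP p _ hom_id] E(6) by auto
  \<comment> \<open>With \<open>s\<close> a right linear section of \<open>\<pi>\<close>, the map
    \<open>1 - s \<pi>\<close> lands in the kernel of \<open>\<pi>\<close> and yields a right linear
    retraction \<open>r\<close> of \<open>j\<close>. These splittings are not left linear, so only
    the maps induced by \<open>j\<close> and \<open>\<pi>\<close> are claimed to be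
    \<open>A\<close>-linear.\<close>
  have e: "(\<lambda>x. x \<ominus>\<^bsub>?P\<^esub> s (\<pi> x)) \<in> module_homs (opposite A) ?P ?P"
    by (rule hom_minus[OF lP lP hom_id hom_comp[OF p s(1)]])
  interpret Y: left_module "opposite A" ?Y by (rule lY)
  have "\<pi> (x \<ominus>\<^bsub>?P\<^esub> s (\<pi> x)) = \<zero>\<^bsub>?Y\<^esub>" if "x \<in> carrier ?P" for x
    using that hom_closed[OF p that] hom_closed[OF s(1) hom_closed[OF p that]] s(2)[OF hom_closed[OF p that]]
    by (simp add: hom_diff[OF p lP lY] Y.M.minus_self del: right_part_simps)
  then obtain r where r: "r \<in> module_homs (opposite A) ?P ?X"
    "\<And>x. x \<in> carrier ?P \<Longrightarrow> j (r x) = x \<ominus>\<^bsub>?P\<^esub> s (\<pi> x)"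
    using short_exact_kernel_lift[OF exr lX lP lP e] by blast
  have sum: "x = j (r x) \<oplus>\<^bsub>?P\<^esub> s (\<pi> x)" if "x \<in> carrier ?P" for x
    using P.M.minus_plus_cancel[OF that hom_closed[OF s(1) hom_closed[OF p that]]] r(2)[OF that] by simp
  have rj: "r (j x) = x" if x: "x \<in> carrier ?X" for x
  proof -
    have jx: "j x \<in> carrier ?P" by (rule hom_closed[OF j x])
    have "s (\<pi> (j x)) = \<zero>\<^bsub>?P\<^esub>"
      using E(4)[of x] x hom_zero[OF s(1) lY lP] by simp
    then have "j (r (j x)) = j x"
      using sum[OF jx] P.M.r_zero[OF hom_closed[OF j hom_closed[OF r(1) jx]]] by metis
    then show ?thesis
      using short_exactD(3)[OF exr] x hom_closed[OF r(1) jx] by (meson inj_onD)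
  qed
  \<comment> \<open>The kernel is a right retract of the middle term, so right projectivity is
    available again for the next step of the resolution.\<close>
  show "projective_module (opposite A) ?X"
    by (rule add_map_cong[OF add_map_comp_left[OF add_map_comp_right[OF pP j] lX lP lX r(1)]]) (rule rj)
  note tX = env_tensor_mod[OF X L] and tP = env_tensor_mod[OF P L] and tY = env_tensor_mod[OF Y L]
  note J = env_map_hom[OF X P L E(1)] and \<Pi> = env_map_hom[OF P Y L E(2)]
  have RJ: "env_map X L r (env_map P L j w) = w" if w: "w \<in> carrier (env_tensor X L)" for w
    using env_map_comp[OF X P X L j r(1) w] tensor_map_cong[OF tX tX hom_comp[OF j r(1)] hom_id hom_id hom_id w]
      tensor_map_id[OF tX w] rj by simp
  have PS: "env_map Y L \<pi> (env_map P L s w) = w" if w: "w \<in> carrier (env_tensor Y L)" for w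
    using env_map_comp[OF Y P Y L s(1) p w] tensor_map_cong[OF tY tY hom_comp[OF s(1) p] hom_id hom_id hom_id w]
      tensor_map_id[OF tY w] s(2) by simp
  note sc = additive_map_closed[OF tensor_map(1)[OF tY tP s(1) hom_id]]
    and rc = additive_map_closed[OF tensor_map(1)[OF tP tX r(1) hom_id]]
  have SUM: "w = env_map P L j (env_map X L r w) \<oplus>\<^bsub>env_tensor P L\<^esub> env_map P L s (env_map Y L \<pi> w)"
    if w: "w \<in> carrier (env_tensor P L)" for w
  proof -
    have "env_map P L (\<lambda>x. x) w = env_map P L (\<lambda>x. j (r x)) w \<oplus>\<^bsub>env_tensor P L\<^esub> env_map P L (\<lambda>x. s (\<pi> x)) w"
      by (rule tensor_map_plus_left[OF tP tP hom_comp[OF r(1) j] hom_comp[OF p s(1)] hom_id hom_id w])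
        (use sum in simp)
    then show ?thesis
      using env_map_comp[OF P X P L r(1) j w] env_map_comp[OF P Y P L p s(1) w] tensor_map_id[OF tP w] by simp
  qed
  show "short_exact A (env_tensor X L) (env_tensor P L) (env_tensor Y L) (env_map P L j) (env_map Y L \<pi>)"
  proof (rule short_exactI[OF J \<Pi>])
    show "inj_on (env_map P L j) (carrier (env_tensor X L))"
      by (rule inj_on_inverseI[where g = "env_map X L r", OF RJ])
    fix w assume w: "w \<in> carrier (env_tensor X L)"
    show "env_map Y L \<pi> (env_map P L j w) = \<zero>\<^bsub>env_tensor Y L\<^esub>"
      using env_map_comp[OF X P Y L j p w] tensor_map_zero[OF tX tY hom_comp[OF j p] hom_id w] E(4) by simp
  next
    fix w assume w: "w \<in> carrier (env_tensor P L)" "env_map Y L \<pi> w = \<zero>\<^bsub>env_tensor Y L\<^esub>"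
    note z = additive_map_zero[OF tensor_map(1)[OF tY tP s(1) hom_id]
      left_module_abelian_group[OF left_module_env_tensor[OF Y L]]
      left_module_abelian_group[OF left_module_env_tensor[OF P L]]]
    interpret W: left_module A "env_tensor P L" by (rule left_module_env_tensor[OF P L])
    have "env_map P L j (env_map X L r w) = w"
      using SUM[OF w(1)] w(2) z hom_closed[OF J rc[OF w(1)]] by simp
    then show "\<exists>v\<in>carrier (env_tensor X L). env_map P L j v = w" using rc[OF w(1)] by blast
  next
    fix w assume w: "w \<in> carrier (env_tensor Y L)"
    then show "\<exists>v\<in>carrier (env_tensor P L). env_map Y L \<pi> v = w" using PS[OF w] sc[OF w] by blast
  qed
qed

end

section \<open>The bimodule \<open>A\<close> and its projective resolution tensored with a
  module\<close>

context fd_algebra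
begin

lemma central_regular_bimodule: "central_bimodule K A A (regular_bimodule A)"
proof (rule central_bimodule.intro)
  show "left_module A (regular_bimodule A)"
    by (rule left_module_cong[OF left_module_regular[OF A.ring_axioms]]) (simp_all add: regular_bimodule_def)
  show "left_module (opposite A) (right_part (regular_bimodule A))"
    by (rule left_module_cong[OF left_module_regular[OF ring_opposite]]) (simp_all add: regular_bimodule_def)
qed (simp_all add: regular_bimodule_def A.m_assoc smult_mult_left smult_mult_right)

abbreviation "env_self \<equiv> enveloping_module (regular_bimodule A)"

lemma env_self_smult:
  "a \<in> carrier A \<Longrightarrow> b \<in> carrier A \<Longrightarrow> x \<in> carrier A \<Longrightarrow> env a b \<odot>\<^bsub>env_self\<^esub> x = (a \<otimes>\<^bsub>A\<^esub> x) \<otimes>\<^bsub>A\<^esub> b"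
  using enveloping_module_smult(2)[OF central_regular_bimodule, of x a b] by (simp add: regular_bimodule_def)

lemma regular_bimodule_simps:
  "carrier (regular_bimodule A) = carrier A" "zero (regular_bimodule A) = zero A"
  "add (regular_bimodule A) = add A"
  by (simp_all add: regular_bimodule_def)

lemma right_projective_self:
  assumes E: "ring E"
  shows "projective_module (opposite A) (right_part (env_bimodule env_self))"
proof -
  note T = left_module_right_env[OF left_module_enveloping[OF central_regular_bimodule E]]
  have "(\<lambda>x. x) \<in> module_homs (opposite A) (right_part (env_bimodule env_self)) (regular_module (opposite A))"
    "(\<lambda>x. x) \<in> module_homs (opposite A) (regular_module (opposite A)) (right_part (env_bimodule env_self))"
    by (auto intro!: module_homsI simp: regular_bimodule_simps env_self_smult)
  from add_map_retract[OF T this] show ?thesis by simp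
qed

lemma env_tensor_self_iso:
  assumes E: "ring E" and L: "left_module A L"
  shows "module_iso A (env_tensor env_self L) L"
proof -
  interpret L: left_module A L by fact
  note T = left_module_enveloping[OF central_regular_bimodule E]
  interpret T: tensor_mod A A "env_bimodule env_self" L by (rule env_tensor_mod[OF T L])
  have "T.T.balanced L (\<lambda>x l. x \<odot>\<^bsub>L\<^esub> l)"
    by (intro T.T.balancedI)
      (simp_all add: regular_bimodule_simps env_self_smult L.smult_closed L.smult_l_distr L.smult_r_distr L.smult_assoc)
  moreover have "(a \<odot>\<^bsub>env_bimodule env_self\<^esub> x) \<odot>\<^bsub>L\<^esub> l = a \<odot>\<^bsub>L\<^esub> (x \<odot>\<^bsub>L\<^esub> l)"
    if "a \<in> carrier A" "x \<in> carrier (env_bimodule env_self)" "l \<in> carrier L" for a x l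
    using that by (simp add: regular_bimodule_simps env_self_smult L.smult_assoc)
  ultimately obtain h where h: "h \<in> module_homs A (env_tensor env_self L) L"
    "\<And>x l. x \<in> carrier (env_bimodule env_self) \<Longrightarrow> l \<in> carrier L \<Longrightarrow> h (T.T.pure_tensor x l) = x \<odot>\<^bsub>L\<^esub> l"
    using T.lift_hom[OF L] by blast
  have one: "\<one>\<^bsub>A\<^esub> \<in> carrier (env_bimodule env_self)" by (simp add: regular_bimodule_simps)
  have i: "(\<lambda>l. T.T.pure_tensor \<one>\<^bsub>A\<^esub> l) \<in> module_homs A L (env_tensor env_self L)"
  proof (rule module_homsI)
    fix a l assume m: "a \<in> carrier A" "l \<in> carrier L"
    have e: "rsmult (env_bimodule env_self) \<one>\<^bsub>A\<^esub> a = a \<odot>\<^bsub>env_bimodule env_self\<^esub> \<one>\<^bsub>A\<^esub>"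
      using m by (simp add: env_self_smult)
    show "T.T.pure_tensor \<one>\<^bsub>A\<^esub> (a \<odot>\<^bsub>L\<^esub> l) = a \<odot>\<^bsub>env_tensor env_self L\<^esub> T.T.pure_tensor \<one>\<^bsub>A\<^esub> l"
      unfolding T.T.pure_balanced[OF one m, symmetric] T.smult_tensor(2)[OF m(1) one m(2)] e ..
  qed (use one T.T.pure_closed T.T.pure_add_right in auto)
  show ?thesis
  proof (rule module_isoI[OF h(1) i])
    fix w assume w: "w \<in> carrier (env_tensor env_self L)"
    show "T.T.pure_tensor \<one>\<^bsub>A\<^esub> (h w) = w"
    proof (rule T.T.additive_map_eqI[OF hom_additive[OF hom_comp[OF h(1) i]] additive_map_id T.T.abelian_group_W w])
      fix x l assume m: "x \<in> carrier (env_bimodule env_self)" "l \<in> carrier L"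
      then have x: "x \<in> carrier A" by (simp add: regular_bimodule_simps)
      have e: "rsmult (env_bimodule env_self) \<one>\<^bsub>A\<^esub> x = x" using x by (simp add: env_self_smult)
      show "T.T.pure_tensor \<one>\<^bsub>A\<^esub> (h (T.T.pure_tensor x l)) = T.T.pure_tensor x l"
        unfolding h(2)[OF m] using T.T.pure_balanced[OF one x m(2)] unfolding e by simp
    qed
  next
    fix l assume "l \<in> carrier L"
    then show "h (T.T.pure_tensor \<one>\<^bsub>A\<^esub> l) = l" using h(2)[OF one] by (simp add: L.smult_one)
  qed
qed

lemma env_tensor_iso:
  assumes X: "left_module E X" and T: "left_module E T" and i: "module_iso E X T" and L: "left_module A L"
  shows "module_iso A (env_tensor X L) (env_tensor T L)"
proof -
  obtain f g where fg: "f \<in> module_homs E X T" "g \<in> module_homs E T X"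
    "\<And>x. x \<in> carrier X \<Longrightarrow> g (f x) = x" "\<And>y. y \<in> carrier T \<Longrightarrow> f (g y) = y"
    using module_isoE[OF i X T] by metis
  note r = env_bimodule_homs(2)
  have half: "env_map X L g (env_map T L f w) = w"
    if X: "left_module E X" and T: "left_module E T" and f: "f \<in> module_homs E X T" and g: "g \<in> module_homs E T X"
      and gf: "\<And>x. x \<in> carrier X \<Longrightarrow> g (f x) = x" and w: "w \<in> carrier (env_tensor X L)"
    for f g w and X :: "(('a \<times> 'a \<Rightarrow>\<^sub>0 int) set, 'x, 'y) module_scheme"
      and T :: "(('a \<times> 'a \<Rightarrow>\<^sub>0 int) set, 't, 'u) module_scheme"
  proof -
    note tX = env_tensor_mod[OF X L]
    show ?thesis
      using env_map_comp[OF X T X L r[OF f] r[OF g] w] tensor_map_id[OF tX w] gf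
        tensor_map_cong[OF tX tX hom_comp[OF r[OF f] r[OF g]] hom_id hom_id hom_id w] by simp
  qed
  show ?thesis
    by (rule module_isoI[OF env_map_hom[OF X T L fg(1)] env_map_hom[OF T X L fg(2)]
      half[OF X T fg(1,2,3)] half[OF T X fg(2,1,4)]])
qed

text \<open>Right projectivity of \<open>X\<close> is carried along in the induction because the
  next short exact sequence stays exact after tensoring only if it splits on the right.\<close>

lemma env_tensor_nth_syzygy:
  fixes L :: "('k, 'a) small_module" and X :: "('k, ('a \<times> 'a \<Rightarrow>\<^sub>0 int) set) small_module"
  assumes T: "left_module E T" and L: "fg_module A L"
    and pT: "projective_module (opposite A) (right_part (env_bimodule T))"
    and s: "is_nth_syzygy E n T X"
  shows "projective_module (opposite A) (right_part (env_bimodule X)) \<and>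
    (\<exists>W :: ('k, 'a) small_module. is_nth_syzygy A n (env_tensor T L) W \<and> module_iso A W (env_tensor X L))"
  using s
proof (induction n arbitrary: X)
  case 0
  then have X: "fg_module E X" "module_iso E X T" by auto
  note lX = fg_module_left[OF X(1)] and lL = fg_module_left[OF L]
  obtain f g where fg: "f \<in> module_homs E X T" "g \<in> module_homs E T X" "\<And>x. x \<in> carrier X \<Longrightarrow> g (f x) = x"
    using module_isoE[OF X(2) lX T] by metis
  note r = left_module_right_env
  have 1: "projective_module (opposite A) (right_part (env_bimodule X))"
    by (rule add_map_cong[OF add_map_comp_left[OF add_map_comp_right[OF pT env_bimodule_homs(2)[OF fg(1)]]
      r[OF lX] r[OF T] r[OF lX] env_bimodule_homs(2)[OF fg(2)]]]) (use fg(3) in simp)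
  note fT = tensor_mod.fg_module_tensor[OF env_tensor_mod[OF lX lL] fg_env_bimodule[OF X(1)] L]
  obtain W :: "('k, 'a) small_module" where W: "fg_module A W" "module_iso A (env_tensor X L) W"
    using fg_module_in_universe[OF fd_algebra_axioms fT] by blast
  note W' = module_iso_sym[OF W(2) fg_module_left[OF fT] fg_module_left[OF W(1)]]
  have "module_iso A W (env_tensor T L)"
    by (rule module_iso_trans[OF W' env_tensor_iso[OF lX T X(2) lL]])
  then show ?case using 1 W W' by (intro conjI exI[of _ W]) simp_all
next
  case (Suc n)
  then obtain Y where Y: "is_nth_syzygy E n T Y" "is_syzygy E Y X" by auto
  obtain V :: "('k, 'a) small_module" where V: "is_nth_syzygy A n (env_tensor T L) V"
    "module_iso A V (env_tensor Y L)" and pY: "projective_module (opposite A) (right_part (env_bimodule Y))"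
    using Suc.IH[OF Y(1)] by blast
  obtain P :: "('k, ('a \<times> 'a \<Rightarrow>\<^sub>0 int) set) small_module" and j \<pi> where
    P: "fg_projective E P" "short_exact E X P Y j \<pi>" and fX: "fg_module E X"
    using Y(2) by (auto simp: is_syzygy_def)
  have fP: "fg_module E P" using P(1) by (simp add: fg_projective_def)
  note fY = is_nth_syzygy_fg[OF Y(1)] and fV = is_nth_syzygy_fg[OF V(1)]
  note l = fg_module_left[OF fX] fg_module_left[OF fP] fg_module_left[OF fY] and lL = fg_module_left[OF L]
  note pP = right_projective[OF l(2) fg_projective_add_map[OF P(1)]]
  note ex = env_tensor_short_exact[OF l lL P(2) pY pP]
  note lT = left_module_env_tensor[OF _ lL]
  have fT: "fg_module A (env_tensor X L)" "fg_module A (env_tensor P L)"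
    using tensor_mod.fg_module_tensor[OF env_tensor_mod[OF _ lL] fg_env_bimodule L] l fX fP by blast+
  obtain W :: "('k, 'a) small_module" where W: "fg_module A W" "module_iso A (env_tensor X L) W"
    using fg_module_in_universe[OF fd_algebra_axioms fT(1)] by blast
  obtain Q :: "('k, 'a) small_module" where Q: "fg_module A Q" "module_iso A (env_tensor P L) Q"
    using fg_module_in_universe[OF fd_algebra_axioms fT(2)] by blast
  note lWQ = fg_module_left[OF W(1)] fg_module_left[OF Q(1)] fg_module_left[OF fV]
  have "\<exists>j' \<pi>'. short_exact A W Q V j' \<pi>'"
    by (rule short_exact_iso[OF ex(1) lT[OF l(1)] lT[OF l(2)] lT[OF l(3)] lWQ W(2) Q(2)
      module_iso_sym[OF V(2) lWQ(3) lT[OF l(3)]]])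
  moreover have "fg_projective A Q"
    by (rule fg_projectiveI[OF fd_algebra_axioms lWQ(2) add_map_id_iso[OF env_tensor_projective[OF
      l(2) fg_projective_add_map[OF P(1)] L] Q(2) lT[OF l(2)] lWQ(2)]])
  ultimately have "is_syzygy A V W" using W(1) unfolding is_syzygy_def by blast
  then show ?case
    using V(1) module_iso_sym[OF W(2) lT[OF l(1)] lWQ(1)] ex(2) by (intro conjI exI[of _ W]) auto
qed

end


section \<open>Tensor products of bimodules\<close>

locale bimodule_pair = M: lr_bimodule A B M + N: lr_bimodule B C N
  for A :: "('k, 'a) module" and B :: "('k, 'b) module" and C :: "('k, 'c) module"
    and M :: "('a, 'b, 'm) bimodule" and N :: "('b, 'c, 'n) bimodule"
begin

sublocale T: tensor_mod A B M N
  by (intro tensor_modI M.lr_bimodule_axioms N.left)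

sublocale TB: tensor_product M N B "rsmult M" "smult N" "tensor_bimodule B M N"
  by (intro tensor_product.intro T.T.M T.T.N M.rsmult_closed N.M.smult_closed)
    (simp_all add: tensor_bimodule_def Let_def)

lemma tensor_bimodule_eq:
  "carrier (tensor_bimodule B M N) = carrier (tensor_module B M N)"
  "zero (tensor_bimodule B M N) = zero (tensor_module B M N)"
  "add (tensor_bimodule B M N) = add (tensor_module B M N)"
  "smult (tensor_bimodule B M N) = smult (tensor_module B M N)"
  by (simp_all add: tensor_bimodule_def tensor_module_def Let_def)

lemma left_smult:
  "\<lbrakk>a \<in> carrier A; x \<in> carrier M; y \<in> carrier N\<rbrakk> \<Longrightarrow>
    a \<odot>\<^bsub>tensor_bimodule B M N\<^esub> TB.pure_tensor x y = TB.pure_tensor (a \<odot>\<^bsub>M\<^esub> x) y"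
  using T.smult_tensor(2)[of a x y] by (simp add: tensor_bimodule_eq)

lemma right_smult:
  assumes c: "c \<in> carrier C"
  shows "additive_map (tensor_bimodule B M N) (tensor_bimodule B M N) (\<lambda>w. rsmult (tensor_bimodule B M N) w c)"
    "\<And>x y. x \<in> carrier M \<Longrightarrow> y \<in> carrier N \<Longrightarrow>
      rsmult (tensor_bimodule B M N) (TB.pure_tensor x y) c = TB.pure_tensor x (rsmult N y c)"
proof -
  let ?\<gamma> = "\<lambda>(x, y). frag_of (x, rsmult N y c)"
  have b: "TB.balanced (tensor_bimodule B M N) (\<lambda>x y. TB.cl (?\<gamma> (x, y)))"
    using c by (intro TB.balancedI)
      (simp_all add: TB.pure_closed N.rsmult_closed TB.pure_add_left TB.pure_add_right
        N.rsmult_l_distr N.assoc TB.pure_balanced)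
  have k: "Poly_Mapping.keys (?\<gamma> (x, y)) \<subseteq> carrier M \<times> carrier N"
    if "x \<in> carrier M" "y \<in> carrier N" for x y
    using c that by (simp add: N.rsmult_closed)
  note r = tensor_product_rep_map[OF TB.tensor_product_axioms TB.tensor_product_axioms k b]
  show "additive_map (tensor_bimodule B M N) (tensor_bimodule B M N) (\<lambda>w. rsmult (tensor_bimodule B M N) w c)"
    using r(1) by (simp add: tensor_bimodule_def Let_def additive_map_def)
  show "rsmult (tensor_bimodule B M N) (TB.pure_tensor x y) c = TB.pure_tensor x (rsmult N y c)"
    if "x \<in> carrier M" "y \<in> carrier N" for x y
    using r(2)[of "frag_of (x, y)"] that by (simp add: tensor_bimodule_def Let_def)
qed

lemma left_module_tensor_bimodule: "left_module A (tensor_bimodule B M N)"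
  by (rule left_module_cong[OF T.left_module_tensor]) (simp_all add: tensor_bimodule_eq)

lemma left_smult_additive:
  assumes "a \<in> carrier A"
  shows "additive_map (tensor_bimodule B M N) (tensor_bimodule B M N) (\<lambda>w. a \<odot>\<^bsub>tensor_bimodule B M N\<^esub> w)"
proof -
  interpret W: left_module A "tensor_bimodule B M N" by (rule left_module_tensor_bimodule)
  show ?thesis using assms by (simp add: additive_map_def W.smult_closed W.smult_r_distr)
qed

lemma right_module_tensor_bimodule: "left_module (opposite C) (right_part (tensor_bimodule B M N))"
proof -
  let ?T = "tensor_bimodule B M N"
  note s = right_smult and W = TB.abelian_group_W
  note eq = TB.additive_map_eqI[OF _ _ W]
  have ag: "abelian_group (right_part ?T)"
  proof (rule abelian_groupI)
    fix x assume "x \<in> carrier (right_part ?T)"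
    then show "\<exists>y\<in>carrier (right_part ?T). y \<oplus>\<^bsub>right_part ?T\<^esub> x = \<zero>\<^bsub>right_part ?T\<^esub>"
      by (intro bexI[of _ "\<ominus>\<^bsub>?T\<^esub> x"]) (simp_all add: TB.W.l_neg)
  qed (simp_all add: TB.W.a_ac)
  have 1: "rsmult ?T w c \<in> carrier ?T" if "c \<in> carrier C" "w \<in> carrier ?T" for c w
    using additive_map_closed[OF s(1)] that by simp
  have 2: "rsmult ?T (w \<oplus>\<^bsub>?T\<^esub> v) c = rsmult ?T w c \<oplus>\<^bsub>?T\<^esub> rsmult ?T v c"
    if "c \<in> carrier C" "w \<in> carrier ?T" "v \<in> carrier ?T" for c w v
    using additive_map_add[OF s(1)] that by simp
  have 3: "rsmult ?T w (b \<oplus>\<^bsub>C\<^esub> c) = rsmult ?T w b \<oplus>\<^bsub>?T\<^esub> rsmult ?T w c"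
    if m: "b \<in> carrier C" "c \<in> carrier C" and w: "w \<in> carrier ?T" for b c w
    using m N.rM.R.add.m_closed[of b c]
    by (intro eq[where f = "\<lambda>w. rsmult ?T w (b \<oplus>\<^bsub>C\<^esub> c)", OF s(1) additive_map_plus[OF s(1) s(1) W] w])
      (simp_all add: s(2) N.rsmult_r_distr TB.pure_add_right N.rsmult_closed)
  have 4: "rsmult ?T w (b \<otimes>\<^bsub>C\<^esub> c) = rsmult ?T (rsmult ?T w b) c"
    if m: "b \<in> carrier C" "c \<in> carrier C" and w: "w \<in> carrier ?T" for b c w
    using m N.rM.R.m_closed[of c b]
    by (intro eq[where f = "\<lambda>w. rsmult ?T w (b \<otimes>\<^bsub>C\<^esub> c)", OF s(1) additive_map_comp[OF s(1) s(1)] w])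
      (simp_all add: s(2) N.rsmult_mult N.rsmult_closed)
  have 5: "rsmult ?T w \<one>\<^bsub>C\<^esub> = w" if w: "w \<in> carrier ?T" for w
    using N.rM.R.one_closed
    by (intro eq[where f = "\<lambda>w. rsmult ?T w \<one>\<^bsub>C\<^esub>", OF s(1) additive_map_id w])
      (simp_all add: s(2) N.rsmult_one)
  show ?thesis
    by (intro left_module.intro left_module_axioms.intro ag N.rM.R.ring_axioms) (simp_all add: 1 2 3 4 5)
qed

lemma lr_tensor_bimodule: "lr_bimodule A C (tensor_bimodule B M N)"
proof (rule lr_bimodule.intro[OF left_module_tensor_bimodule right_module_tensor_bimodule])
  let ?T = "tensor_bimodule B M N"
  fix a w c assume m: "a \<in> carrier A" "w \<in> carrier ?T" "c \<in> carrier C"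
  show "rsmult ?T (a \<odot>\<^bsub>?T\<^esub> w) c = a \<odot>\<^bsub>?T\<^esub> rsmult ?T w c"
    by (rule TB.additive_map_eqI[OF additive_map_comp[OF left_smult_additive[OF m(1)] right_smult(1)[OF m(3)]]
      additive_map_comp[OF right_smult(1)[OF m(3)] left_smult_additive[OF m(1)]] TB.abelian_group_W m(2)])
      (use m in \<open>simp_all add: left_smult right_smult(2) M.M.smult_closed N.rsmult_closed\<close>)
qed

end

text \<open>A scalar passes from the left of \<open>M\<close> to its right, across the tensor sign
  to the left of \<open>N\<close>, and on to its right.\<close>

lemma central_tensor_bimodule:
  fixes A :: "('k, 'a) module" and B :: "('k, 'b) module" and C :: "('k, 'c) module"
  assumes A: "fd_algebra K A" and B: "fd_algebra K B" and C: "fd_algebra K C"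
    and M: "central_bimodule K A B M" and N: "central_bimodule K B C N"
  shows "central_bimodule K A C (tensor_bimodule B M N)"
proof -
  interpret P: bimodule_pair A B C M N
    by (intro bimodule_pair.intro central_bimodule_lr[OF M] central_bimodule_lr[OF N])
  interpret A: fd_algebra K A by fact
  interpret B: fd_algebra K B by fact
  interpret C: fd_algebra K C by fact
  note l = P.lr_tensor_bimodule
  show ?thesis
  proof (rule central_bimodule.intro[OF lr_bimodule.left[OF l] lr_bimodule.right[OF l] lr_bimodule.assoc[OF l]])
    fix c w assume c: "c \<in> carrier K" and w: "w \<in> carrier (tensor_bimodule B M N)"
    have sc: "c \<odot>\<^bsub>A\<^esub> \<one>\<^bsub>A\<^esub> \<in> carrier A" "c \<odot>\<^bsub>B\<^esub> \<one>\<^bsub>B\<^esub> \<in> carrier B" "c \<odot>\<^bsub>C\<^esub> \<one>\<^bsub>C\<^esub> \<in> carrier C"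
      using c by (simp_all add: A.smult_closed B.smult_closed C.smult_closed)
    show "(c \<odot>\<^bsub>A\<^esub> \<one>\<^bsub>A\<^esub>) \<odot>\<^bsub>tensor_bimodule B M N\<^esub> w = rsmult (tensor_bimodule B M N) w (c \<odot>\<^bsub>C\<^esub> \<one>\<^bsub>C\<^esub>)"
      by (rule P.TB.additive_map_eqI[OF P.left_smult_additive[OF sc(1)] P.right_smult(1)[OF sc(3)]
        P.TB.abelian_group_W w])
        (use c sc in \<open>simp_all add: P.left_smult P.right_smult(2) central_bimodule.central[OF M c]
          central_bimodule.central[OF N c, symmetric] P.TB.pure_balanced\<close>)
  qed
qed

text \<open>Associativity, with the left-hand side formed by way of the enveloping algebra. Each of
  the two inverse maps uses the universal property twice: one variable is held fixed for the inner
  tensor product, and the resulting family is shown to be balanced in the remaining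
  variable.\<close>

lemma (in fd_algebra) tensor_assoc:
  fixes B :: "('k, 'b) module" and L :: "('a, 'l, 'e) module_scheme"
  assumes B: "fd_algebra K B" and M: "central_bimodule K A B M" and N: "central_bimodule K B A N"
    and E: "ring E" and L: "left_module A L"
  shows "module_iso A (env_tensor (enveloping_module (tensor_bimodule B M N)) L)
    (tensor_module B M (tensor_module A N L))"
proof -
  interpret P: bimodule_pair A B A M N
    by (intro bimodule_pair.intro central_bimodule_lr[OF M] central_bimodule_lr[OF N])
  let ?TB = "tensor_bimodule B M N"
  let ?EM = "enveloping_module ?TB"
  note C = central_tensor_bimodule[OF fd_algebra_axioms B fd_algebra_axioms M N]
  note lE = left_module_enveloping[OF C E]
  interpret L: left_module A L by fact
  interpret F: tensor_mod B A N L by (rule tensor_modI[OF central_bimodule_lr[OF N] L])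
  let ?F = "tensor_module A N L"
  interpret G: tensor_mod A B M ?F by (rule tensor_modI[OF central_bimodule_lr[OF M] F.left_module_tensor])
  let ?G = "tensor_module B M ?F"
  interpret H: tensor_mod A A "env_bimodule ?EM" L by (rule env_tensor_mod[OF lE L])
  let ?H = "env_tensor ?EM L"
  interpret TBl: lr_bimodule A A ?TB by (rule P.lr_tensor_bimodule)
  have cE: "carrier (env_bimodule ?EM) = carrier ?TB" "add (env_bimodule ?EM) = add ?TB" by simp_all
  \<comment> \<open>The passage through \<open>enveloping_module\<close> and
    \<open>env_bimodule\<close> returns the original two actions, since
    \<open>(a \<otimes> 1) t = a t\<close> and \<open>(1 \<otimes> a) t = t a\<close>.\<close>
  have sE: "a \<odot>\<^bsub>env_bimodule ?EM\<^esub> t = a \<odot>\<^bsub>?TB\<^esub> t" "rsmult (env_bimodule ?EM) t a = rsmult ?TB t a"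
    if "a \<in> carrier A" "t \<in> carrier ?TB" for a t
    using that enveloping_module_smult(2)[OF C, of t]
    by (simp_all add: TBl.rsmult_one TBl.M.smult_one TBl.M.smult_closed)
  have tc: "P.TB.pure_tensor x y \<in> carrier ?TB" if "x \<in> carrier M" "y \<in> carrier N" for x y
    using P.TB.pure_closed that by blast
  note Gag = G.T.abelian_group_W and Hag = H.T.abelian_group_W
  have "\<exists>f. additive_map ?TB ?G f \<and>
      (\<forall>x\<in>carrier M. \<forall>y\<in>carrier N. f (P.TB.pure_tensor x y) = G.T.pure_tensor x (F.T.pure_tensor y l))"
    if l: "l \<in> carrier L" for l
  proof -
    have "P.TB.balanced ?G (\<lambda>x y. G.T.pure_tensor x (F.T.pure_tensor y l))"
      using l by (intro P.TB.balancedI)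
        (simp_all add: F.T.pure_closed G.T.pure_closed G.T.pure_add_left F.T.pure_add_left G.T.pure_add_right
          G.T.pure_balanced F.smult_tensor(2))
    from P.TB.lift[OF Gag this] show ?thesis by metis
  qed
  then obtain f where f: "\<And>l. l \<in> carrier L \<Longrightarrow> additive_map ?TB ?G (f l)"
    "\<And>l x y. l \<in> carrier L \<Longrightarrow> x \<in> carrier M \<Longrightarrow> y \<in> carrier N \<Longrightarrow>
      f l (P.TB.pure_tensor x y) = G.T.pure_tensor x (F.T.pure_tensor y l)"
    by metis
  note eqT = P.TB.additive_map_eqI
  have b1: "H.T.balanced ?G (\<lambda>t l. f l t)"
  proof (rule H.T.balancedI)
    fix t l l' assume m: "t \<in> carrier (env_bimodule ?EM)" "l \<in> carrier L" "l' \<in> carrier L"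
    show "f (l \<oplus>\<^bsub>L\<^esub> l') t = f l t \<oplus>\<^bsub>?G\<^esub> f l' t"
      by (rule eqT[where f = "f (l \<oplus>\<^bsub>L\<^esub> l')", OF f(1) additive_map_plus[OF f(1) f(1) Gag] Gag])
        (use m in \<open>simp_all add: f(2) F.T.pure_add_right G.T.pure_add_right F.T.pure_closed\<close>)
  next
    fix t a l assume m: "t \<in> carrier (env_bimodule ?EM)" "a \<in> carrier A" "l \<in> carrier L"
    have "f l (rsmult ?TB t a) = f (a \<odot>\<^bsub>L\<^esub> l) t"
      by (rule eqT[OF additive_map_comp[OF P.right_smult(1)[OF m(2)] f(1)] f(1) Gag])
        (use m in \<open>simp_all add: f(2) P.right_smult(2) P.N.rsmult_closed F.T.pure_balanced L.smult_closed\<close>)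
    then show "f l (rsmult (env_bimodule ?EM) t a) = f (a \<odot>\<^bsub>L\<^esub> l) t"
      using sE(2)[OF m(2)] m(1) cE by simp
  qed (use additive_map_closed[OF f(1)] additive_map_add[OF f(1)] in simp_all)
  have b2: "f l (a \<odot>\<^bsub>env_bimodule ?EM\<^esub> t) = a \<odot>\<^bsub>?G\<^esub> f l t"
    if m: "a \<in> carrier A" "t \<in> carrier (env_bimodule ?EM)" "l \<in> carrier L" for a t l
  proof -
    have "f l (a \<odot>\<^bsub>?TB\<^esub> t) = a \<odot>\<^bsub>?G\<^esub> f l t"
      by (rule eqT[OF additive_map_comp[OF P.left_smult_additive[OF m(1)] f(1)]
        additive_map_comp[OF f(1) G.smult_tensor(1)[OF m(1)]] Gag])
        (use m in \<open>simp_all add: f(2) P.left_smult P.M.M.smult_closed G.smult_tensor(2) F.T.pure_closed\<close>)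
    then show ?thesis using sE(1)[OF m(1)] m(2) cE by simp
  qed
  obtain \<phi> where \<phi>: "\<phi> \<in> module_homs A ?H ?G"
    "\<And>t l. t \<in> carrier (env_bimodule ?EM) \<Longrightarrow> l \<in> carrier L \<Longrightarrow> \<phi> (H.T.pure_tensor t l) = f l t"
    using H.lift_hom[OF G.left_module_tensor b1 b2] by metis
  have "\<exists>g. additive_map ?F ?H g \<and>
      (\<forall>y\<in>carrier N. \<forall>l\<in>carrier L. g (F.T.pure_tensor y l) = H.T.pure_tensor (P.TB.pure_tensor x y) l)"
    if x: "x \<in> carrier M" for x
  proof -
    have "F.T.balanced ?H (\<lambda>y l. H.T.pure_tensor (P.TB.pure_tensor x y) l)"
    proof (rule F.T.balancedI)
      fix y y' l assume m: "y \<in> carrier N" "y' \<in> carrier N" "l \<in> carrier L"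
      show "H.T.pure_tensor (P.TB.pure_tensor x (y \<oplus>\<^bsub>N\<^esub> y')) l
          = H.T.pure_tensor (P.TB.pure_tensor x y) l \<oplus>\<^bsub>?H\<^esub> H.T.pure_tensor (P.TB.pure_tensor x y') l"
        using H.T.pure_add_left[of "P.TB.pure_tensor x y" "P.TB.pure_tensor x y'" l] tc x m
        by (simp add: P.TB.pure_add_right cE del: env_bimodule_simps)
    next
      fix y a l assume m: "y \<in> carrier N" "a \<in> carrier A" "l \<in> carrier L"
      show "H.T.pure_tensor (P.TB.pure_tensor x (rsmult N y a)) l = H.T.pure_tensor (P.TB.pure_tensor x y) (a \<odot>\<^bsub>L\<^esub> l)"
        using H.T.pure_balanced[of "P.TB.pure_tensor x y" a l] sE(2)[OF m(2) tc[OF x m(1)]] tc[OF x m(1)] m x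
        by (simp add: P.right_smult(2) cE del: env_bimodule_simps)
    qed (use tc x H.T.pure_closed H.T.pure_add_right in \<open>simp_all add: cE del: env_bimodule_simps\<close>)
    from F.T.lift[OF Hag this] show ?thesis by metis
  qed
  then obtain g where g: "\<And>x. x \<in> carrier M \<Longrightarrow> additive_map ?F ?H (g x)"
    "\<And>x y l. x \<in> carrier M \<Longrightarrow> y \<in> carrier N \<Longrightarrow> l \<in> carrier L \<Longrightarrow>
      g x (F.T.pure_tensor y l) = H.T.pure_tensor (P.TB.pure_tensor x y) l"
    by metis
  note eqF = F.T.additive_map_eqI
  have b3: "G.T.balanced ?H g"
  proof (rule G.T.balancedI)
    fix x x' w assume m: "x \<in> carrier M" "x' \<in> carrier M" "w \<in> carrier ?F"
    show "g (x \<oplus>\<^bsub>M\<^esub> x') w = g x w \<oplus>\<^bsub>?H\<^esub> g x' w"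
    proof (rule eqF[where f = "g (x \<oplus>\<^bsub>M\<^esub> x')", OF g(1) additive_map_plus[OF g(1) g(1) Hag] Hag m(3)])
      fix y l assume n: "y \<in> carrier N" "l \<in> carrier L"
      show "g (x \<oplus>\<^bsub>M\<^esub> x') (F.T.pure_tensor y l) = g x (F.T.pure_tensor y l) \<oplus>\<^bsub>?H\<^esub> g x' (F.T.pure_tensor y l)"
        using H.T.pure_add_left[of "P.TB.pure_tensor x y" "P.TB.pure_tensor x' y" l] tc m n
        by (simp add: g(2) P.TB.pure_add_left cE del: env_bimodule_simps)
    qed (use m in simp_all)
  next
    fix x b w assume m: "x \<in> carrier M" "b \<in> carrier B" "w \<in> carrier ?F"
    show "g (rsmult M x b) w = g x (b \<odot>\<^bsub>?F\<^esub> w)"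
      by (rule eqF[OF g(1) additive_map_comp[OF F.smult_tensor(1)[OF m(2)] g(1)] Hag m(3)])
        (use m in \<open>simp_all add: g(2) P.M.rsmult_closed F.smult_tensor(2) P.N.M.smult_closed P.TB.pure_balanced
          del: env_bimodule_simps\<close>)
  qed (use additive_map_closed[OF g(1)] additive_map_add[OF g(1)] in simp_all)
  have b4: "g (a \<odot>\<^bsub>M\<^esub> x) w = a \<odot>\<^bsub>?H\<^esub> g x w"
    if m: "a \<in> carrier A" "x \<in> carrier M" "w \<in> carrier ?F" for a x w
  proof (rule eqF[where f = "g (a \<odot>\<^bsub>M\<^esub> x)", OF g(1) additive_map_comp[OF g(1) H.smult_tensor(1)[OF m(1)]] Hag m(3)])
    fix y l assume n: "y \<in> carrier N" "l \<in> carrier L"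
    show "g (a \<odot>\<^bsub>M\<^esub> x) (F.T.pure_tensor y l) = a \<odot>\<^bsub>?H\<^esub> g x (F.T.pure_tensor y l)"
      using H.smult_tensor(2)[of a "P.TB.pure_tensor x y" l] sE(1)[OF m(1) tc[OF m(2) n(1)]] tc m n
      by (simp add: g(2) P.left_smult P.M.M.smult_closed cE del: env_bimodule_simps)
  qed (use m in \<open>simp_all add: P.M.M.smult_closed\<close>)
  obtain \<psi> where \<psi>: "\<psi> \<in> module_homs A ?G ?H"
    "\<And>x w. x \<in> carrier M \<Longrightarrow> w \<in> carrier ?F \<Longrightarrow> \<psi> (G.T.pure_tensor x w) = g x w"
    using G.lift_hom[OF H.left_module_tensor b3 b4] by metis
  show ?thesis
  proof (rule module_isoI[OF \<phi>(1) \<psi>(1)])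
    fix w assume w: "w \<in> carrier ?H"
    show "\<psi> (\<phi> w) = w"
    proof (rule H.T.additive_map_eqI[OF hom_additive[OF hom_comp[OF \<phi>(1) \<psi>(1)]] additive_map_id Hag w])
      fix t l assume t: "t \<in> carrier (env_bimodule ?EM)" and l: "l \<in> carrier L"
      have p: "additive_map ?TB ?H (\<lambda>t. H.T.pure_tensor t l)"
        using H.T.pure_closed H.T.pure_add_left l by (simp add: additive_map_def cE del: env_bimodule_simps)
      have "\<psi> (f l t) = H.T.pure_tensor t l"
        by (rule eqT[OF additive_map_comp[OF f(1)[OF l] hom_additive[OF \<psi>(1)]] p Hag])
          (use t l in \<open>simp_all add: f(2) \<psi>(2) g(2) F.T.pure_closed cE del: env_bimodule_simps\<close>)
      then show "\<psi> (\<phi> (H.T.pure_tensor t l)) = H.T.pure_tensor t l" using \<phi>(2)[OF t l] by simp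
    qed
  next
    fix w assume w: "w \<in> carrier ?G"
    show "\<phi> (\<psi> w) = w"
    proof (rule G.T.additive_map_eqI[OF hom_additive[OF hom_comp[OF \<psi>(1) \<phi>(1)]] additive_map_id Gag w])
      fix x u assume x: "x \<in> carrier M" and u: "u \<in> carrier ?F"
      have p: "additive_map ?F ?G (\<lambda>u. G.T.pure_tensor x u)"
        using G.T.pure_closed G.T.pure_add_right x by (simp add: additive_map_def)
      have "\<phi> (g x u) = G.T.pure_tensor x u"
      proof (rule eqF[OF additive_map_comp[OF g(1)[OF x] hom_additive[OF \<phi>(1)]] p Gag u])
        fix y l assume n: "y \<in> carrier N" "l \<in> carrier L"
        show "\<phi> (g x (F.T.pure_tensor y l)) = G.T.pure_tensor x (F.T.pure_tensor y l)"
          unfolding g(2)[OF x n] using \<phi>(2)[of "P.TB.pure_tensor x y" l] tc[OF x n(1)] n f(2)[OF n(2) x n(1)]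
          by (simp add: cE del: env_bimodule_simps)
      qed
      then show "\<phi> (\<psi> (G.T.pure_tensor x u)) = G.T.pure_tensor x u" using \<psi>(2)[OF x u] by simp
    qed
  qed
qed

text \<open>The only place where condition (2) of the equivalence is used. The chain is
  \<open>M \<otimes> (N \<otimes> L)\<close>, then \<open>(M \<otimes> N) \<otimes> L\<close>,
  stably \<open>X \<otimes> L\<close>, then a small copy \<open>V\<close>. This \<open>V\<close> is
  an \<open>n\<close>-th syzygy of \<open>A \<otimes> L\<close> and so of \<open>L\<close>, hence
  stably the given \<open>W\<close>.\<close>

lemma tensor_tensor_stable_syzygy:
  fixes A :: "('k, 'a) module" and B :: "('k, 'b) module"
    and L W :: "('k, 'a) small_module" and X :: "('k, ('a \<times> 'a \<Rightarrow>\<^sub>0 int) set) small_module"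
  assumes A: "fd_algebra K A" and B: "fd_algebra K B"
    and M: "central_bimodule K A B M" and N: "central_bimodule K B A N"
    and X: "is_nth_syzygy (enveloping K A) n (enveloping_module (regular_bimodule A)) X"
    and MN: "stably_isomorphic (enveloping K A) (enveloping_module (tensor_bimodule B M N)) X"
    and L: "fg_module A L" and W: "is_nth_syzygy A n L W"
  shows "stable_iso A (tensor_module B M (tensor_module A N L)) W"
proof -
  interpret fd_algebra K A by fact
  note fX = is_nth_syzygy_fg[OF X] and fW = is_nth_syzygy_fg[OF W]
  note lX = fg_module_left[OF fX] and lW = fg_module_left[OF fW] and lL = fg_module_left[OF L]
  note E = left_module_ring[OF lX]
  note lT = left_module_enveloping[OF central_tensor_bimodule[OF A B A M N] E]
  note lS = left_module_enveloping[OF central_regular_bimodule E]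
  obtain V :: "('k, 'a) small_module" where V: "is_nth_syzygy A n (env_tensor env_self L) V"
    "module_iso A V (env_tensor X L)"
    using env_tensor_nth_syzygy[OF lS L right_projective_self[OF E] X] by blast
  note lV = fg_module_left[OF is_nth_syzygy_fg[OF V(1)]]
  note l = left_module_env_tensor[OF lX lL] left_module_env_tensor[OF lT lL]
  have lG: "left_module A (tensor_module B M (tensor_module A N L))"
    by (intro left_module_tensor_module central_bimodule_lr[OF M] central_bimodule_lr[OF N] lL)
  have "is_nth_syzygy A n L V"
    by (rule is_nth_syzygy_iso_base[OF V(1) env_tensor_self_iso[OF E lL]])
  then have 1: "stable_iso A V W"
    by (rule is_nth_syzygy_stable_iso[OF _ W module_iso_stable_iso[OF module_iso_refl lL lL] lL lL])
  have 2: "stable_iso A (env_tensor X L) V"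
    by (rule stable_iso_sym[OF module_iso_stable_iso[OF V(2) lV l(1)]])
  have 3: "stable_iso A (env_tensor (enveloping_module (tensor_bimodule B M N)) L) (env_tensor X L)"
    by (rule env_stable_iso[OF stably_isomorphic_stable_iso[OF MN lT lX] lT lX L])
  have 4: "stable_iso A (tensor_module B M (tensor_module A N L))
      (env_tensor (enveloping_module (tensor_bimodule B M N)) L)"
    by (rule stable_iso_sym[OF module_iso_stable_iso[OF tensor_assoc[OF B M N E lL] l(2) lG]])
  show ?thesis
    by (rule stable_iso_trans[OF stable_iso_trans[OF stable_iso_trans[OF 4 3 lG l(2,1)] 2 lG l(1) lV] 1 lG lV lW])
qed

section \<open>Transfer of syzygy-finiteness\<close>

text \<open>
  Nothing is assumed about \<open>Z\<close>: the finite set in \<open>representation_finite\<close> may contain records that are not modules.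
\<close>

lemma module_iso_common:
  assumes f: "module_iso R X Z" and g: "module_iso R Y Z" and X: "left_module R X" and Y: "left_module R Y"
  shows "module_iso R X Y"
proof -
  interpret X: left_module R X by fact
  interpret Y: left_module R Y by fact
  obtain f where f: "f \<in> module_homs R X Z" "bij_betw f (carrier X) (carrier Z)"
    using f by (auto simp: module_iso_def)
  obtain g where g: "g \<in> module_homs R Y Z" "bij_betw g (carrier Y) (carrier Z)"
    using g by (auto simp: module_iso_def)
  let ?h = "\<lambda>x. inv_into (carrier Y) g (f x)"
  have gh: "g (?h x) = f x" and hc: "?h x \<in> carrier Y" if "x \<in> carrier X" for x
    using bij_betw_inv_into_right[OF g(2)] hom_closed[OF f(1) that] bij_betw_apply[OF bij_betw_inv_into[OF g(2)]]
    by auto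
  note inj = inj_onD[OF bij_betw_imp_inj_on[OF g(2)]]
  have "?h \<in> module_homs R X Y"
  proof (rule module_homsI)
    show "?h x \<in> carrier Y" if "x \<in> carrier X" for x by (rule hc[OF that])
    show "?h (x \<oplus>\<^bsub>X\<^esub> y) = ?h x \<oplus>\<^bsub>Y\<^esub> ?h y" if xy: "x \<in> carrier X" "y \<in> carrier X" for x y
    proof (rule inj)
      have "g (?h (x \<oplus>\<^bsub>X\<^esub> y)) = f (x \<oplus>\<^bsub>X\<^esub> y)" using xy by (intro gh) simp
      also have "\<dots> = g (?h x \<oplus>\<^bsub>Y\<^esub> ?h y)"
        using xy gh hc by (simp add: hom_add[OF f(1)] hom_add[OF g(1)])
      finally show "g (?h (x \<oplus>\<^bsub>X\<^esub> y)) = g (?h x \<oplus>\<^bsub>Y\<^esub> ?h y)" .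
      show "?h (x \<oplus>\<^bsub>X\<^esub> y) \<in> carrier Y" using xy by (intro hc) simp
      show "?h x \<oplus>\<^bsub>Y\<^esub> ?h y \<in> carrier Y" using xy hc by simp
    qed
    show "?h (a \<odot>\<^bsub>X\<^esub> x) = a \<odot>\<^bsub>Y\<^esub> ?h x" if ax: "a \<in> carrier R" "x \<in> carrier X" for a x
    proof (rule inj)
      have "g (?h (a \<odot>\<^bsub>X\<^esub> x)) = f (a \<odot>\<^bsub>X\<^esub> x)" using ax by (intro gh X.smult_closed)
      also have "\<dots> = g (a \<odot>\<^bsub>Y\<^esub> ?h x)"
        using ax gh hc by (simp add: hom_smult[OF f(1)] hom_smult[OF g(1)])
      finally show "g (?h (a \<odot>\<^bsub>X\<^esub> x)) = g (a \<odot>\<^bsub>Y\<^esub> ?h x)" .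
      show "?h (a \<odot>\<^bsub>X\<^esub> x) \<in> carrier Y" using ax by (intro hc X.smult_closed)
      show "a \<odot>\<^bsub>Y\<^esub> ?h x \<in> carrier Y" using ax hc by (simp add: Y.smult_closed)
    qed
  qed
  moreover have "bij_betw ?h (carrier X) (carrier Y)"
    using bij_betw_trans[OF f(2) bij_betw_inv_into[OF g(2)]] by (simp add: comp_def)
  ultimately show ?thesis by (auto simp: module_iso_def)
qed

lemma finite_indecomposable_retracts_fg:
  fixes A :: "('k, 'a) module"
  assumes A: "fd_algebra K A" and U: "fg_module A U"
  shows "\<exists>S :: ('k, 'a) small_module set. finite S \<and> (\<forall>X :: ('k, 'a) small_module.
    fg_module A X \<longrightarrow> indecomposable A X \<longrightarrow> retract A X U \<longrightarrow> (\<exists>Z\<in>S. module_iso A X Z))"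
proof -
  obtain U' :: "('k, 'a) small_module" where U': "fg_module A U'" "module_iso A U U'"
    using fg_module_in_universe[OF A U] by blast
  note r = module_iso_retract(1)[OF U'(2) fg_module_left[OF U] fg_module_left[OF U'(1)]]
  obtain S :: "('k, 'a) small_module set" where "finite S" "\<forall>X :: ('k, 'a) small_module.
    fg_module A X \<longrightarrow> indecomposable A X \<longrightarrow> retract A X U' \<longrightarrow> (\<exists>Z\<in>S. module_iso A X Z)"
    using finite_indecomposable_retracts[OF A U'(1)] by blast
  then show ?thesis using retract_trans[OF _ r] by (intro exI[of _ S]) blast
qed

text \<open>The tensor functor is additive, so a decomposition of \<open>Y\<close> induces one of
  \<open>M \<otimes> Y\<close>, and \<open>X\<close> is a retract of one of the terms. The clause
  that \<open>Z\<close> is a retract of \<open>Y\<close> is kept because finiteness over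
  \<open>B\<close> is known only for summands of syzygies.\<close>

lemma retract_tensor_indecomposable:
  fixes A :: "('k, 'a) module" and B :: "('k, 'b) module"
    and X :: "('k, 'a) small_module" and Y :: "('k, 'b) small_module"
  assumes B: "fd_algebra K B" and Y: "fg_module B Y"
    and A: "fd_algebra K A" and M: "lr_bimodule A B M"
    and X: "fg_module A X" "indecomposable A X" and r: "retract A X (tensor_module B M Y)"
  shows "\<exists>Z :: ('k, 'b) small_module. fg_module B Z \<and> indecomposable B Z \<and> retract B Z Y \<and>
    retract A X (tensor_module B M Z)"
  using B Y r
proof (induction rule: decomposition_induct)
  case (zero Y)
  note lX = fg_module_left[OF X(1)] and lY = fg_module_left[OF zero(1)]
  note lT = left_module_tensor_module[OF M lY]
  obtain f g where fg: "f \<in> module_homs A X (tensor_module B M Y)" "g \<in> module_homs A (tensor_module B M Y) X"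
    "\<And>x. x \<in> carrier X \<Longrightarrow> g (f x) = x"
    using zero(3) by (auto simp: retract_def)
  obtain x where x: "x \<in> carrier X" "x \<noteq> \<zero>\<^bsub>X\<^esub>" using indecomposable_nonzero[OF X(2)] .
  note fx = hom_closed[OF fg(1) x(1)]
  note t = tensor_modI[OF M lY]
  have "tensor_fun B M Y (\<lambda>y. y) (f x) = \<zero>\<^bsub>tensor_module B M Y\<^esub>"
    by (rule tensor_map_zero[OF t t hom_id hom_id fx]) (use zero(2) in auto)
  then have "f x = \<zero>\<^bsub>tensor_module B M Y\<^esub>" using tensor_map_id[OF t fx] by simp
  then show ?case using fg(3)[OF x(1)] hom_zero[OF fg(2) lT lX] x(2) by simp
next
  case (indecomposable Y)
  then show ?case
    using module_iso_retract(1)[OF module_iso_refl fg_module_left fg_module_left] by blast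
next
  case (sum Y Y1 Y2)
  note lX = fg_module_left[OF X(1)] and lY = fg_module_left[OF sum(1)]
    and l1 = fg_module_left[OF sum(2)] and l2 = fg_module_left[OF sum(3)]
  interpret Y1: left_module B Y1 by fact
  interpret Y2: left_module B Y2 by fact
  note lD = left_module_direct_sum[OF l1 l2]
  let ?D = "direct_sum Y1 Y2"
  have "retract A X (tensor_module B M ?D)"
    by (rule retract_trans[OF sum.prems tensor_retract[OF M lY lD module_iso_retract(1)[OF sum(4) lY lD]]])
  then obtain f g where fg: "f \<in> module_homs A X (tensor_module B M ?D)" "g \<in> module_homs A (tensor_module B M ?D) X"
    "\<And>x. x \<in> carrier X \<Longrightarrow> g (f x) = x"
    by (auto simp: retract_def)
  have i1: "(\<lambda>y. (y, \<zero>\<^bsub>Y2\<^esub>)) \<in> module_homs B Y1 ?D" and i2: "(\<lambda>y. (\<zero>\<^bsub>Y1\<^esub>, y)) \<in> module_homs B Y2 ?D"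
    by (intro hom_pair hom_id hom_zero_map l1 l2)+
  have e1: "(\<lambda>d. (fst d, \<zero>\<^bsub>Y2\<^esub>)) \<in> module_homs B ?D ?D" and e2: "(\<lambda>d. (\<zero>\<^bsub>Y1\<^esub>, snd d)) \<in> module_homs B ?D ?D"
    by (intro hom_pair hom_fst hom_snd hom_zero_map l1 l2)+
  note lT = left_module_tensor_module[OF M lD]
  interpret T: left_module A "tensor_module B M ?D" by (rule lT)
  note t = tensor_modI[OF M lD]
  have m1: "add_map B Y1 ?D ?D (\<lambda>d. (fst d, \<zero>\<^bsub>Y2\<^esub>))"
    by (rule add_map_single[OF lD hom_fst i1])
  have m2: "add_map B Y2 ?D ?D (\<lambda>d. (\<zero>\<^bsub>Y1\<^esub>, snd d))"
    by (rule add_map_single[OF lD hom_snd i2])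
  have "retract A X (tensor_module B M Y1) \<or> retract A X (tensor_module B M Y2)"
  proof (rule indecomposable_add_map_sum[OF A X])
    show "add_map A (tensor_module B M Y1) X X (\<lambda>x. g (tensor_fun B M ?D (\<lambda>d. (fst d, \<zero>\<^bsub>Y2\<^esub>)) (f x)))"
      by (rule add_map_comp_left[OF add_map_comp_right[OF tensor_add_map[OF M m1 l1 lD lD] fg(1)] lX lT lX fg(2)])
    show "add_map A (tensor_module B M Y2) X X (\<lambda>x. g (tensor_fun B M ?D (\<lambda>d. (\<zero>\<^bsub>Y1\<^esub>, snd d)) (f x)))"
      by (rule add_map_comp_left[OF add_map_comp_right[OF tensor_add_map[OF M m2 l2 lD lD] fg(1)] lX lT lX fg(2)])
    fix x assume x: "x \<in> carrier X"
    note fx = hom_closed[OF fg(1) x]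
    let ?u = "tensor_fun B M ?D (\<lambda>d. (fst d, \<zero>\<^bsub>Y2\<^esub>)) (f x)" and ?v = "tensor_fun B M ?D (\<lambda>d. (\<zero>\<^bsub>Y1\<^esub>, snd d)) (f x)"
    have c: "?u \<in> carrier (tensor_module B M ?D)" "?v \<in> carrier (tensor_module B M ?D)"
      using hom_closed[OF tensor_fun_hom[OF M lD lD e1] fx] hom_closed[OF tensor_fun_hom[OF M lD lD e2] fx] by auto
    have "tensor_fun B M ?D (\<lambda>d. d) (f x) = ?u \<oplus>\<^bsub>tensor_module B M ?D\<^esub> ?v"
      by (rule tensor_map_plus_right[OF t t hom_id e1 e2 hom_id fx]) auto
    then have "f x = ?u \<oplus>\<^bsub>tensor_module B M ?D\<^esub> ?v" using tensor_map_id[OF t fx] by simp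
    then have "g (f x) = g ?u \<oplus>\<^bsub>X\<^esub> g ?v" using hom_add[OF fg(2) c] by simp
    then show "g ?u \<oplus>\<^bsub>X\<^esub> g ?v = x" using fg(3)[OF x] by simp
  qed
  then obtain Z :: "('k, 'b) small_module" where Z: "fg_module B Z" "indecomposable B Z"
    "retract B Z Y1 \<or> retract B Z Y2" "retract A X (tensor_module B M Z)"
    using sum.IH by blast
  note rs = module_iso_retract(2)[OF sum(4) lY lD]
  have "retract B Y1 Y" "retract B Y2 Y"
    by (rule retract_trans[OF retract_summands(1)[OF l1 l2] rs], rule retract_trans[OF retract_summands(2)[OF l1 l2] rs])
  then have "retract B Z Y" using Z(3) retract_trans by blast
  then show ?case using Z by blast
qed

text \<open>Finiteness survives because each of the finitely many indecomposables \<open>Z\<close>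
  over \<open>B\<close> contributes only finitely many indecomposable retracts of
  \<open>M \<otimes> Z\<close>, and the projective error term adds those of
  \<open>A\<close>.\<close>

lemma syzygy_finite_transfer:
  fixes A :: "('k, 'a) module" and B :: "('k, 'b) module"
  assumes A: "fd_algebra K A" and B: "fd_algebra K B"
    and M: "lr_bimodule A B M" and N: "lr_bimodule B A N"
    and pM: "fg_projective A M" and pN: "fg_projective B N"
    and rN: "projective_module (opposite A) (right_part N)"
    and st: "\<And>(L :: ('k, 'a) small_module) (W :: ('k, 'a) small_module). fg_module A L \<Longrightarrow> is_nth_syzygy A n L W
      \<Longrightarrow> stable_iso A (tensor_module B M (tensor_module A N L)) W"
    and sf: "syzygy_finite B"
  shows "syzygy_finite A"
proof -
  let ?small = "\<lambda>m. {Y :: ('k, 'b) small_module. \<exists>i (L :: ('k, 'b) small_module). int i > m \<and> fg_module B L \<and>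
    is_nth_syzygy B i L Y}"
  have fM: "fg_module A M" and fN: "fg_module B N" using pM pN by (simp_all add: fg_projective_def)
  obtain s :: int and S :: "('k, 'b) small_module set" where S: "finite S"
    "\<forall>Y\<in>?small s. \<forall>Z :: ('k, 'b) small_module. fg_module B Z \<and> indecomposable B Z \<and> direct_summand B Z Y
      \<longrightarrow> (\<exists>Z'\<in>S. module_iso B Z Z')"
    using sf unfolding syzygy_finite_def representation_finite_def by blast
  have "\<exists>F :: ('k, 'a) small_module set. finite F \<and>
      (\<forall>(Z :: ('k, 'b) small_module) (X :: ('k, 'a) small_module). fg_module B Z \<longrightarrow> module_iso B Z Z' \<longrightarrow>
        fg_module A X \<longrightarrow> indecomposable A X \<longrightarrow> retract A X (tensor_module B M Z) \<longrightarrow> (\<exists>Y\<in>F. module_iso A X Y))"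
    for Z' :: "('k, 'b) small_module"
  \<comment> \<open>A listed \<open>Z'\<close> contributes only if some module is isomorphic to it.
    Then every such \<open>Z\<close> is isomorphic to the single module \<open>Z0\<close>, and the
    retracts of \<open>M \<otimes> Z0\<close> serve for all of them.\<close>
  proof (cases "\<exists>Z0 :: ('k, 'b) small_module. fg_module B Z0 \<and> module_iso B Z0 Z'")
    case True
    then obtain Z0 :: "('k, 'b) small_module" where Z0: "fg_module B Z0" "module_iso B Z0 Z'" by blast
    note l0 = fg_module_left[OF Z0(1)]
    obtain F :: "('k, 'a) small_module set" where F: "finite F" "\<forall>X :: ('k, 'a) small_module.
      fg_module A X \<longrightarrow> indecomposable A X \<longrightarrow> retract A X (tensor_module B M Z0) \<longrightarrow> (\<exists>Z\<in>F. module_iso A X Z)"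
      using finite_indecomposable_retracts_fg[OF A
        tensor_mod.fg_module_tensor[OF tensor_modI[OF M l0] fM Z0(1)]] by blast
    have "retract A (tensor_module B M Z) (tensor_module B M Z0)"
      if "fg_module B Z" "module_iso B Z Z'" for Z :: "('k, 'b) small_module"
      using fg_module_left[OF that(1)]
      by (intro tensor_retract[OF M _ l0] module_iso_retract(1)[OF module_iso_common[OF that(2) Z0(2)]] l0)
    then show ?thesis using F by (intro exI[of _ F]) (meson retract_trans)
  next
    case False
    then show ?thesis by (intro exI[of _ "{}"]) blast
  qed
  then obtain F :: "('k, 'b) small_module \<Rightarrow> ('k, 'a) small_module set" where F: "\<And>Z'. finite (F Z')"
    "\<And>Z' (Z :: ('k, 'b) small_module) (X :: ('k, 'a) small_module). fg_module B Z \<Longrightarrow> module_iso B Z Z' \<Longrightarrow>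
      fg_module A X \<Longrightarrow> indecomposable A X \<Longrightarrow> retract A X (tensor_module B M Z) \<Longrightarrow> \<exists>Y\<in>F Z'. module_iso A X Y"
    by metis
  obtain FR :: "('k, 'a) small_module set" where FR: "finite FR" "\<forall>X :: ('k, 'a) small_module.
    fg_module A X \<longrightarrow> indecomposable A X \<longrightarrow> retract A X (regular_module A) \<longrightarrow> (\<exists>Z\<in>FR. module_iso A X Z)"
    using finite_indecomposable_retracts_fg[OF A fg_module_regular[OF fd_algebra_ring[OF A]]] by blast
  let ?S = "(\<Union>Z\<in>S. F Z) \<union> FR"
  have main: "\<exists>Z\<in>?S. module_iso A X Z"
    if i: "int i > int n + max s 0" and L: "fg_module A L" and W: "is_nth_syzygy A i L W"
      and X: "fg_module A X" "indecomposable A X" "direct_summand A X W"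
    for i and L W X :: "('k, 'a) small_module"
  proof -
    \<comment> \<open>The bound \<open>n + max s 0\<close> makes this subtraction of naturals exact
      even for negative \<open>s\<close>, and leaves \<open>m > s\<close>.\<close>
    define m where "m = i - n"
    have m: "i = n + m" "int m > s" using i by (auto simp: m_def)
    obtain L' :: "('k, 'a) small_module" where L': "is_nth_syzygy A m L L'" "is_nth_syzygy A n L' W"
      using is_nth_syzygy_add[of A n m L W] W m(1) by blast
    note fL' = is_nth_syzygy_fg[OF L'(1)] and fW = is_nth_syzygy_fg[OF W]
    note lL = fg_module_left[OF L] and lL' = fg_module_left[OF fL'] and lW = fg_module_left[OF fW]
      and lX = fg_module_left[OF X(1)]
    let ?FL = "tensor_module A N L" and ?FL' = "tensor_module A N L'"
    have lF: "left_module B ?FL" "left_module B ?FL'"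
      using left_module_tensor_module[OF N] lL lL' by auto
    let ?G = "tensor_module B M ?FL'"
    interpret W: left_module A W by (rule lW)
    obtain \<phi> \<psi> where \<phi>\<psi>: "\<phi> \<in> module_homs A ?G W" "\<psi> \<in> module_homs A W ?G"
      "add_map A (regular_module A) W W (\<lambda>y. y \<ominus>\<^bsub>W\<^esub> \<phi> (\<psi> y))"
      using st[OF fL' L'(2)] by (auto simp: stable_iso_def)
    obtain f g where fg: "f \<in> module_homs A X W" "g \<in> module_homs A W X" "\<And>x. x \<in> carrier X \<Longrightarrow> g (f x) = x"
      using direct_summand_retract[OF X(3) lX lW] by blast
    \<comment> \<open>The identity of \<open>X\<close> is split as
      \<open>g \<phi> \<psi> f + g (1 - \<phi> \<psi>) f\<close>: the first term passes through
      \<open>M \<otimes> (N \<otimes> L')\<close>, the second through copies of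
      \<open>A\<close>.\<close>
    have "retract A X ?G \<or> retract A X (regular_module A)"
    proof (rule indecomposable_add_map_sum[OF A X(1,2)])
      show "add_map A ?G X X (\<lambda>x. g (\<phi> (\<psi> (f x))))"
        by (rule add_map_single[OF lX hom_comp[OF fg(1) \<phi>\<psi>(2)] hom_comp[OF \<phi>\<psi>(1) fg(2)]])
      show "add_map A (regular_module A) X X (\<lambda>x. g (f x \<ominus>\<^bsub>W\<^esub> \<phi> (\<psi> (f x))))"
        by (rule add_map_comp_left[OF add_map_comp_right[OF \<phi>\<psi>(3) fg(1)] lX lW lX fg(2)])
      fix x assume x: "x \<in> carrier X"
      have c: "f x \<in> carrier W" "\<phi> (\<psi> (f x)) \<in> carrier W"
        using hom_closed[OF fg(1) x] hom_closed[OF \<phi>\<psi>(1) hom_closed[OF \<phi>\<psi>(2)]] by auto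
      have "f x = \<phi> (\<psi> (f x)) \<oplus>\<^bsub>W\<^esub> (f x \<ominus>\<^bsub>W\<^esub> \<phi> (\<psi> (f x)))"
        using W.M.minus_plus_cancel[OF c] c by (simp add: W.M.a_comm)
      then show "g (\<phi> (\<psi> (f x))) \<oplus>\<^bsub>X\<^esub> g (f x \<ominus>\<^bsub>W\<^esub> \<phi> (\<psi> (f x))) = x"
        using fg(3)[OF x] hom_add[OF fg(2) c(2), of "f x \<ominus>\<^bsub>W\<^esub> \<phi> (\<psi> (f x))"] c by simp
    qed
    then show ?thesis
    proof
      assume "retract A X (regular_module A)"
      then show ?thesis using FR X(1,2) by blast
    next
      assume r: "retract A X ?G"
      have fF: "fg_module B ?FL"
        by (rule tensor_mod.fg_module_tensor[OF tensor_modI[OF N lL] fN L])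
      obtain L0 :: "('k, 'b) small_module" where L0: "fg_module B L0" "module_iso B ?FL L0"
        using fg_module_in_universe[OF B fF] by blast
      obtain Y :: "('k, 'b) small_module" where Y: "is_nth_syzygy B m ?FL Y" "module_iso B Y ?FL'"
        using tensor_nth_syzygy[OF B N rN pN L L'(1)] by blast
      note fY = is_nth_syzygy_fg[OF Y(1)]
      note lY = fg_module_left[OF fY]
      \<comment> \<open>\<open>Y\<close> is a syzygy of \<open>N \<otimes> L\<close>, which is not
        on the required type; its small copy \<open>L0\<close> has the same syzygies.\<close>
      have Ys: "Y \<in> ?small s"
        using is_nth_syzygy_iso_base[OF Y(1) L0(2)] L0(1) m(2) by blast
      have "retract A X (tensor_module B M Y)"
        by (rule retract_trans[OF r tensor_retract[OF M lF(2) lY module_iso_retract(2)[OF Y(2) lY lF(2)]]])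
      from retract_tensor_indecomposable[OF B fY A M X(1,2) this]
      obtain Z :: "('k, 'b) small_module" where Z: "fg_module B Z" "indecomposable B Z" "retract B Z Y"
        "retract A X (tensor_module B M Z)" by blast
      have "direct_summand B Z Y"
        using direct_summand_iff_retract[OF B fY fg_module_left[OF Z(1)]] Z(3) by simp
      then obtain Z' where "Z' \<in> S" "module_iso B Z Z'" using S(2) Ys Z(1,2) by blast
      then show ?thesis using F(2)[OF Z(1) _ X(1,2) Z(4)] by blast
    qed
  qed
  have "finite ?S" using S(1) F(1) FR(1) by auto
  then show ?thesis
    unfolding syzygy_finite_def representation_finite_def
    by (intro exI[of _ "int n + max s 0"] exI[of _ ?S] conjI) (use main in blast)+
qed


section \<open>Transfer of the Igusa-Todorov property\<close>

text \<open>Write \<open>1 - \<psi> \<phi> = v u\<close> with \<open>u\<close> and \<open>v\<close>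
  passing through a projective \<open>P\<close>. Then the map given by \<open>\<psi>\<close> and
  \<open>v\<close> on \<open>U \<oplus> P\<close> has the section \<open>(\<phi>, u)\<close>, so it
  is onto and its kernel is a summand.\<close>

lemma stable_iso_exact:
  fixes A :: "('k, 'a) module"
  assumes A: "fd_algebra K A" and st: "stable_iso A U W" and U: "left_module A U" and W: "left_module A W"
  obtains P :: "('k, 'a) small_module" and v \<psi> where "fg_projective A P"
    "\<psi> \<in> module_homs A U W" "v \<in> module_homs A P W"
    "(\<lambda>(y, p). \<psi> y \<oplus>\<^bsub>W\<^esub> v p) ` carrier (direct_sum U P) = carrier W"
    "projective_module A ((direct_sum U P)\<lparr>carrier := a_kernel (direct_sum U P) W (\<lambda>(y, p). \<psi> y \<oplus>\<^bsub>W\<^esub> v p)\<rparr>)"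
proof -
  interpret U: left_module A U by fact
  interpret W: left_module A W by fact
  obtain \<psi> \<phi> where \<phi>\<psi>: "\<psi> \<in> module_homs A U W" "\<phi> \<in> module_homs A W U"
    "add_map A (regular_module A) U U (\<lambda>y. y \<ominus>\<^bsub>U\<^esub> \<phi> (\<psi> y))"
    "add_map A (regular_module A) W W (\<lambda>y. y \<ominus>\<^bsub>W\<^esub> \<psi> (\<phi> y))"
    using st by (auto simp: stable_iso_def)
  obtain P :: "('k, 'a) small_module" and u v where P: "fg_projective A P"
    and u: "u \<in> module_homs A W P" and v: "v \<in> module_homs A P W"
    and vu: "\<And>w. w \<in> carrier W \<Longrightarrow> w \<ominus>\<^bsub>W\<^esub> \<psi> (\<phi> w) = v (u w)"
    using add_map_free[OF A \<phi>\<psi>(4) W W] by metis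
  have lP: "left_module A P" using P by (simp add: fg_projective_def fg_module_def)
  interpret P: left_module A P by fact
  let ?D = "direct_sum U P"
  note lD = left_module_direct_sum[OF U lP]
  interpret D: left_module A ?D by fact
  let ?q = "\<lambda>(y, p). \<psi> y \<oplus>\<^bsub>W\<^esub> v p"
  note q = hom_copair[OF W \<phi>\<psi>(1) v]
  have sec: "?q (\<phi> w, u w) = w" if w: "w \<in> carrier W" for w
    using vu[OF w] w W.M.minus_plus_cancel[of w "\<psi> (\<phi> w)"]
      hom_closed[OF \<phi>\<psi>(1) hom_closed[OF \<phi>\<psi>(2) w]] hom_closed[OF v hom_closed[OF u w]]
    by (simp add: W.M.a_comm)
  have surj: "?q ` carrier ?D = carrier W"
  proof
    show "?q ` carrier ?D \<subseteq> carrier W" using hom_closed[OF q] by blast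
    show "carrier W \<subseteq> ?q ` carrier ?D"
    proof
      fix w assume w: "w \<in> carrier W"
      have "(\<phi> w, u w) \<in> carrier ?D" using hom_closed[OF \<phi>\<psi>(2) w] hom_closed[OF u w] by simp
      from imageI[OF this, of ?q] show "w \<in> ?q ` carrier ?D" by (simp only: sec[OF w])
    qed
  qed
  let ?H = "a_kernel ?D W ?q"
  let ?Z = "?D\<lparr>carrier := ?H\<rparr>"
  note sH = submodule_kernel[OF lD W q]
  note HD = D.submoduleD[OF sH]
  have lZ: "left_module A ?Z" by (rule D.left_module_submodule[OF sH])
  note incl = hom_incl[OF HD(1)]
  have "(\<lambda>w. (\<phi> w, u w)) \<in> module_homs A W ?D" by (rule hom_pair[OF \<phi>\<psi>(2) u])
  note e = hom_minus[OF lD lD hom_id hom_comp[OF q this]]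
  let ?e = "\<lambda>z. z \<ominus>\<^bsub>?D\<^esub> (\<phi> (?q z), u (?q z))"
  have eH: "?e z \<in> ?H" if z: "z \<in> carrier ?D" for z
  proof -
    note qz = hom_closed[OF q z]
    have pz: "(\<phi> (?q z), u (?q z)) \<in> carrier ?D" using hom_closed[OF \<phi>\<psi>(2) qz] hom_closed[OF u qz] by simp
    have "?q (?e z) = ?q z \<ominus>\<^bsub>W\<^esub> ?q (\<phi> (?q z), u (?q z))" by (rule hom_diff[OF q lD W z pz])
    also have "\<dots> = \<zero>\<^bsub>W\<^esub>" unfolding sec[OF qz] by (rule W.M.minus_self[OF qz])
    finally show ?thesis using hom_closed[OF e z] by (simp add: mem_a_kernel)
  qed
  have eZ: "?e \<in> module_homs A ?D ?Z" by (rule hom_corestrict[OF e eH])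
  have ez: "?e z = z" if z: "z \<in> ?H" for z
  proof -
    have z0: "?q z = \<zero>\<^bsub>W\<^esub>" and zD: "z \<in> carrier ?D" using z by (simp_all add: mem_a_kernel)
    have "(\<phi> (?q z), u (?q z)) = \<zero>\<^bsub>?D\<^esub>"
      unfolding z0 by (simp add: hom_zero[OF \<phi>\<psi>(2) W U] hom_zero[OF u W lP])
    then have "?e z = z \<ominus>\<^bsub>?D\<^esub> \<zero>\<^bsub>?D\<^esub>" by (simp only:)
    then show ?thesis
      using D.M.plus_minus_cancel[OF zD D.M.zero_closed] by (simp only: D.M.r_zero[OF zD])
  qed
  have i1: "(\<lambda>y. (y, \<zero>\<^bsub>P\<^esub>)) \<in> module_homs A U ?D" by (intro hom_pair hom_id hom_zero_map lP)
  have n\<phi>: "(\<lambda>p. \<zero>\<^bsub>U\<^esub> \<ominus>\<^bsub>U\<^esub> \<phi> (v p)) \<in> module_homs A P U"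
    by (rule hom_minus[OF lP U hom_zero_map[OF U] hom_comp[OF v \<phi>\<psi>(2)]])
  have i2: "(\<lambda>p. (\<zero>\<^bsub>U\<^esub> \<ominus>\<^bsub>U\<^esub> \<phi> (v p), p)) \<in> module_homs A P ?D" by (rule hom_pair[OF n\<phi> hom_id])
  note z1 = hom_comp[OF incl hom_fst] and z2 = hom_comp[OF incl hom_snd]
  \<comment> \<open>On the kernel \<open>\<psi> y + v p = 0\<close>, so
    \<open>(y, p) = (y - \<phi> \<psi> y, 0) + (-\<phi> v p, p)\<close>. The first part factors
    through projectives by stability, the second through \<open>P\<close>; the kernel is therefore
    projective.\<close>
  have "add_map A (regular_module A) ?Z ?D
      (\<lambda>z. (fst z \<ominus>\<^bsub>U\<^esub> \<phi> (\<psi> (fst z)), \<zero>\<^bsub>P\<^esub>) \<oplus>\<^bsub>?D\<^esub> (\<zero>\<^bsub>U\<^esub> \<ominus>\<^bsub>U\<^esub> \<phi> (v (snd z)), snd z))"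
    by (rule add_map_plus[OF add_map_comp_left[OF add_map_comp_right[OF \<phi>\<psi>(3) z1] lZ U lD i1]
      add_map_comp_left[OF add_map_comp_right[OF fg_projective_add_map[OF P] z2] lZ lP lD i2] lZ lD])
  then have "add_map A (regular_module A) ?Z ?D (\<lambda>z. z)"
  proof (rule add_map_cong)
    fix z assume "z \<in> carrier ?Z"
    then obtain y p where z: "z = (y, p)" "y \<in> carrier U" "p \<in> carrier P" "\<psi> y \<oplus>\<^bsub>W\<^esub> v p = \<zero>\<^bsub>W\<^esub>"
      by (auto simp: mem_a_kernel)
    have cy: "\<psi> y \<in> carrier W" "v p \<in> carrier W" using z hom_closed[OF \<phi>\<psi>(1)] hom_closed[OF v] by auto
    have cf: "\<phi> (\<psi> y) \<in> carrier U" "\<phi> (v p) \<in> carrier U" using cy hom_closed[OF \<phi>\<psi>(2)] by auto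
    have s: "\<phi> (\<psi> y) \<oplus>\<^bsub>U\<^esub> \<phi> (v p) = \<zero>\<^bsub>U\<^esub>"
      using hom_add[OF \<phi>\<psi>(2) cy] z(4) hom_zero[OF \<phi>\<psi>(2) W U] by simp
    have "y \<ominus>\<^bsub>U\<^esub> \<phi> (\<psi> y) \<oplus>\<^bsub>U\<^esub> (\<zero>\<^bsub>U\<^esub> \<ominus>\<^bsub>U\<^esub> \<phi> (v p)) = y \<ominus>\<^bsub>U\<^esub> (\<phi> (\<psi> y) \<oplus>\<^bsub>U\<^esub> \<phi> (v p))"
      using z cf by (simp add: a_minus_def U.M.minus_add U.M.a_ac)
    also have "\<dots> = y" using z(2) unfolding s by (simp add: a_minus_def)
    finally show "(fst z \<ominus>\<^bsub>U\<^esub> \<phi> (\<psi> (fst z)), \<zero>\<^bsub>P\<^esub>) \<oplus>\<^bsub>?D\<^esub> (\<zero>\<^bsub>U\<^esub> \<ominus>\<^bsub>U\<^esub> \<phi> (v (snd z)), snd z) = z"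
      using z by simp
  qed
  from add_map_comp_left[OF this lZ lD lZ eZ]
  have "projective_module A ?Z"
    by (rule add_map_cong) (use ez in simp)
  with that P \<phi>\<psi>(1) v surj show thesis by blast
qed

text \<open>
  A stable isomorphism gives an exact sequence \<open>0 \<rightarrow> Z \<rightarrow> U \<oplus> P \<rightarrow> W \<rightarrow> 0\<close> with \<open>Z\<close> and \<open>P\<close> projective.
  The kernel of \<open>V0 \<oplus> P \<rightarrow> U \<oplus> P \<rightarrow> W\<close> is an extension of \<open>Z\<close> by \<open>V1\<close>, hence \<open>V1 \<oplus> Z\<close>.
\<close>

lemma stable_iso_add_resolution:
  fixes A :: "('k, 'a) module"
  assumes A: "fd_algebra K A" and st: "stable_iso A U W" and W: "left_module A W" and U: "left_module A U"
    and ex: "short_exact A V1 V0 U j \<pi>"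
    and l1: "left_module A V1" and l0: "left_module A V0" and V: "left_module A V"
    and a1: "mem_add A V V1" and a0: "mem_add A V V0"
    and aR: "mem_add A V (regular_module A)"
  obtains P :: "('k, 'a) small_module" and H f g where
    "short_exact A ((direct_sum V0 P)\<lparr>carrier := H\<rparr>) (direct_sum V0 P) W f g"
    "left_module A P" "submodule H A (direct_sum V0 P)"
    "mem_add A V ((direct_sum V0 P)\<lparr>carrier := H\<rparr>)"
    "mem_add A V (direct_sum V0 P)"
proof -
  obtain P :: "('k, 'a) small_module" and v \<psi> where P: "fg_projective A P"
    and \<psi>: "\<psi> \<in> module_homs A U W" and v: "v \<in> module_homs A P W"
    and surj: "(\<lambda>(y, p). \<psi> y \<oplus>\<^bsub>W\<^esub> v p) ` carrier (direct_sum U P) = carrier W"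
    and aZ: "projective_module A ((direct_sum U P)\<lparr>carrier := a_kernel (direct_sum U P) W (\<lambda>(y, p). \<psi> y \<oplus>\<^bsub>W\<^esub> v p)\<rparr>)"
    using stable_iso_exact[OF A st U W] by metis
  have lP: "left_module A P" using P by (simp add: fg_projective_def fg_module_def)
  have lR: "left_module A (regular_module A)" by (rule left_module_regular[OF fd_algebra_ring[OF A]])
  note E = short_exactD[OF ex]
  let ?D = "direct_sum U P" and ?Q = "direct_sum V0 P"
  let ?q = "\<lambda>(y, p). \<psi> y \<oplus>\<^bsub>W\<^esub> v p"
  note lD = left_module_direct_sum[OF U lP] and lQ = left_module_direct_sum[OF l0 lP]
  interpret D: left_module A ?D by fact
  interpret Q: left_module A ?Q by fact
  interpret V0: left_module A V0 by fact
  interpret P: left_module A P by fact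
  interpret U: left_module A U by fact
  interpret W: left_module A W by fact
  note q = hom_copair[OF W \<psi> v]
  let ?Z = "?D\<lparr>carrier := a_kernel ?D W ?q\<rparr>"
  note sZ = submodule_kernel[OF lD W q]
  have lZ: "left_module A ?Z" by (rule D.left_module_submodule[OF sZ])
  note iZ = hom_incl[OF D.submoduleD(1)[OF sZ]]
  let ?p = "\<lambda>z. (\<pi> (fst z), snd z)"
  have p: "?p \<in> module_homs A ?Q ?D" by (rule hom_pair[OF hom_comp[OF hom_fst E(2)] hom_snd])
  have psurj: "?p ` carrier ?Q = carrier ?D"
  proof
    show "?p ` carrier ?Q \<subseteq> carrier ?D" using hom_closed[OF p] by blast
    show "carrier ?D \<subseteq> ?p ` carrier ?Q"
    proof
      fix d assume "d \<in> carrier ?D"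
      then obtain y r where d: "d = (y, r)" "y \<in> carrier U" "r \<in> carrier P" by auto
      obtain x where "x \<in> carrier V0" "\<pi> x = y" using E(6) d(2) by (metis imageE)
      then show "d \<in> ?p ` carrier ?Q" using d by (intro image_eqI[of _ _ "(x, r)"]) auto
    qed
  qed
  note qp = hom_comp[OF p q]
  let ?H = "a_kernel ?Q W (\<lambda>z. ?q (?p z))"
  let ?K = "?Q\<lparr>carrier := ?H\<rparr>"
  note sH = submodule_kernel[OF lQ W qp]
  note HD = Q.submoduleD[OF sH]
  have lK: "left_module A ?K" by (rule Q.left_module_submodule[OF sH])
  note iK = hom_incl[OF HD(1)]
  have exK: "short_exact A ?K ?Q W (\<lambda>x. x) (\<lambda>z. ?q (?p z))"
  proof (rule short_exactI[OF iK qp])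
    show "\<exists>x\<in>carrier ?Q. ?q (?p x) = w" if "w \<in> carrier W" for w
    proof -
      have "w \<in> ?q ` carrier ?D" using that by (simp only: surj)
      then obtain d where d: "w = ?q d" "d \<in> carrier ?D" by (rule imageE) (rule that)
      have "d \<in> ?p ` carrier ?Q" using d(2) by (simp only: psurj)
      then obtain z where z: "d = ?p z" "z \<in> carrier ?Q" by (rule imageE) (rule that)
      show ?thesis by (rule bexI[OF _ z(2)]) (simp only: d(1) z(1))
    qed
  qed (simp_all add: mem_a_kernel)
  \<comment> \<open>Projectivity of \<open>Z\<close> lifts its inclusion along
    \<open>\<pi> \<oplus> 1\<close>; this is the splitting of the extension.\<close>
  obtain \<sigma> where \<sigma>: "\<sigma> \<in> module_homs A ?Z ?Q" "\<And>z. z \<in> carrier ?Z \<Longrightarrow> ?p (\<sigma> z) = z"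
    using projective_lift[OF aZ lZ lD lQ p psurj iZ] by metis
  have \<sigma>H: "\<sigma> z \<in> ?H" if "z \<in> carrier ?Z" for z
  proof -
    have "?q z = \<zero>\<^bsub>W\<^esub>" using that by (simp add: mem_a_kernel)
    then have "?q (?p (\<sigma> z)) = \<zero>\<^bsub>W\<^esub>" by (simp only: \<sigma>(2)[OF that])
    then show ?thesis using hom_closed[OF \<sigma>(1) that] by (simp only: mem_a_kernel)
  qed
  note \<sigma>K = hom_corestrict[OF \<sigma>(1) \<sigma>H]
  have pK: "?p \<in> module_homs A ?K ?Z"
  proof (rule hom_corestrict[OF hom_comp[OF iK p]])
    fix k assume "k \<in> carrier ?K"
    then show "?p k \<in> a_kernel ?D W ?q" using hom_closed[OF p, of k] by (simp add: mem_a_kernel)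
  qed
  \<comment> \<open>Being killed by \<open>\<pi> \<oplus> 1\<close>, its values have second
    component zero and first component in the image of \<open>V1\<close>.\<close>
  let ?e = "\<lambda>k. k \<ominus>\<^bsub>?Q\<^esub> \<sigma> (?p k)"
  have e: "?e \<in> module_homs A ?K ?Q"
    by (rule hom_minus[OF lK lQ iK hom_comp[OF pK \<sigma>(1)]])
  have pe: "?p (?e k) = \<zero>\<^bsub>?D\<^esub>" if k: "k \<in> carrier ?K" for k
  proof -
    have kQ: "k \<in> carrier ?Q" using k HD(1) by auto
    note pk = hom_closed[OF pK k]
    have "?p (?e k) = ?p k \<ominus>\<^bsub>?D\<^esub> ?p (\<sigma> (?p k))"
      by (rule hom_diff[OF p lQ lD kQ hom_closed[OF \<sigma>(1) pk]])
    also have "\<dots> = \<zero>\<^bsub>?D\<^esub>"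
      unfolding \<sigma>(2)[OF pk] by (rule D.M.minus_self[OF hom_closed[OF p kQ]])
    finally show ?thesis .
  qed
  have \<pi>e: "\<pi> (fst (?e k)) = \<zero>\<^bsub>U\<^esub>" if "k \<in> carrier ?K" for k
    using pe[OF that] by simp
  obtain \<kappa> where \<kappa>: "\<kappa> \<in> module_homs A ?K V1" "\<And>k. k \<in> carrier ?K \<Longrightarrow> j (\<kappa> k) = fst (?e k)"
    by (rule short_exact_kernel_lift[OF ex l1 l0 lK hom_comp[OF e hom_fst] \<pi>e]) (assumption, rule that, assumption, simp only:)
  have jK: "(\<lambda>x. (j x, \<zero>\<^bsub>P\<^esub>)) \<in> module_homs A V1 ?K"
  proof (rule hom_corestrict[OF hom_pair[OF E(1) hom_zero_map[OF lP]]])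
    fix x assume "x \<in> carrier V1"
    then show "(j x, \<zero>\<^bsub>P\<^esub>) \<in> ?H"
      using hom_closed[OF E(1)] E(4) hom_zero[OF \<psi> U W] hom_zero[OF v lP W] by (simp add: mem_a_kernel)
  qed
  have aZV: "mem_add A V ?Z" by (rule add_map_trans[OF aZ aR lZ lZ lR])
  \<comment> \<open>The kernel is decomposed as \<open>V1 \<oplus> Z\<close>; both terms lie in the
    additive closure of \<open>V\<close>, the second one through \<open>A\<close>.\<close>
  have "add_map A V ?K ?K (\<lambda>k. (j (\<kappa> k), \<zero>\<^bsub>P\<^esub>) \<oplus>\<^bsub>?K\<^esub> \<sigma> (?p k))"
    by (rule add_map_plus[OF add_map_comp_left[OF add_map_comp_right[OF a1 \<kappa>(1)] lK l1 lK jK]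
      add_map_comp_left[OF add_map_comp_right[OF aZV pK] lK lZ lK \<sigma>K] lK lK])
  then have aK: "mem_add A V ?K"
  proof (rule add_map_cong)
    fix k assume k: "k \<in> carrier ?K"
    have kQ: "k \<in> carrier ?Q" using k HD(1) by auto
    have "snd (?e k) = \<zero>\<^bsub>P\<^esub>" using pe[OF k] by simp
    then have "(j (\<kappa> k), \<zero>\<^bsub>P\<^esub>) = ?e k" using \<kappa>(2)[OF k] by (simp add: prod_eq_iff)
    then show "(j (\<kappa> k), \<zero>\<^bsub>P\<^esub>) \<oplus>\<^bsub>?K\<^esub> \<sigma> (?p k) = k"
      using Q.M.minus_plus_cancel[OF kQ hom_closed[OF \<sigma>(1) hom_closed[OF pK k]]] by simp
  qed
  have i1: "(\<lambda>y. (y, \<zero>\<^bsub>P\<^esub>)) \<in> module_homs A V0 ?Q" by (intro hom_pair hom_id hom_zero_map lP)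
  have i2: "(\<lambda>y. (\<zero>\<^bsub>V0\<^esub>, y)) \<in> module_homs A P ?Q" by (intro hom_pair hom_id hom_zero_map l0)
  have aP: "mem_add A V P" by (rule add_map_trans[OF fg_projective_add_map[OF P] aR lP lP lR])
  have "add_map A V ?Q ?Q (\<lambda>z. (fst z, \<zero>\<^bsub>P\<^esub>) \<oplus>\<^bsub>?Q\<^esub> (\<zero>\<^bsub>V0\<^esub>, snd z))"
    by (rule add_map_plus[OF add_map_comp_left[OF add_map_comp_right[OF a0 hom_fst] lQ l0 lQ i1]
      add_map_comp_left[OF add_map_comp_right[OF aP hom_snd] lQ lP lQ i2] lQ lQ])
  then have aQ: "mem_add A V ?Q"
    by (rule add_map_cong) auto
  show thesis by (rule that[OF exK lP sH aK aQ])
qed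

text \<open>The sequence for \<open>N \<otimes> L'\<close> over \<open>B\<close> is tensored with
  \<open>M\<close> and gives one for \<open>M \<otimes> (N \<otimes> L')\<close>. As this is only
  stably isomorphic to \<open>W\<close>, the terms have to be enlarged by projectives before the
  sequence ends in \<open>W\<close> itself.\<close>

lemma igusa_todorov_transfer:
  fixes A :: "('k, 'a) module" and B :: "('k, 'b) module"
  assumes A: "fd_algebra K A" and B: "fd_algebra K B"
    and M: "lr_bimodule A B M" and N: "lr_bimodule B A N"
    and pM: "fg_projective A M" and pN: "fg_projective B N"
    and rM: "projective_module (opposite B) (right_part M)"
    and rN: "projective_module (opposite A) (right_part N)"
    and st: "\<And>(L :: ('k, 'a) small_module) (W :: ('k, 'a) small_module). fg_module A L \<Longrightarrow> is_nth_syzygy A n L W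
      \<Longrightarrow> stable_iso A (tensor_module B M (tensor_module A N L)) W"
    and it: "igusa_todorov B"
  shows "igusa_todorov A"
proof -
  have fM: "fg_module A M" and fN: "fg_module B N" using pM pN by (simp_all add: fg_projective_def)
  obtain V :: "('k, 'b) small_module" and m where V: "fg_module B V"
    and seq: "\<forall>(L :: ('k, 'b) small_module) Y. fg_module B L \<and> is_nth_syzygy B m L Y \<longrightarrow>
        (\<exists>(V1 :: ('k, 'b) small_module) (V0 :: ('k, 'b) small_module) f g.
          in_add B V V1 \<and> in_add B V V0 \<and> short_exact B V1 V0 Y f g)"
    using it unfolding igusa_todorov_def by blast
  note lV = fg_module_left[OF V]
  let ?GV = "tensor_module B M V" and ?R = "regular_module A"
  have fGV: "fg_module A ?GV" by (rule tensor_mod.fg_module_tensor[OF tensor_modI[OF M lV] fM V])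
  note fR = fg_module_regular[OF fd_algebra_ring[OF A]]
  note lGV = fg_module_left[OF fGV] and lR = fg_module_left[OF fR]
  note fD = fg_module_direct_sum[OF fGV fR]
  \<comment> \<open>The test module is a small copy of \<open>(M \<otimes> V) \<oplus> A\<close>;
    the summand \<open>A\<close> accounts for the projectives that enter with the stable
    isomorphism.\<close>
  obtain V' :: "('k, 'a) small_module" where V': "fg_module A V'" "module_iso A (direct_sum ?GV ?R) V'"
    using fg_module_in_universe[OF A fD] by blast
  note lV' = fg_module_left[OF V'(1)]
  note rV' = module_iso_retract(1)[OF V'(2) fg_module_left[OF fD] lV']
  have ret: "mem_add A V' X" if "retract A X (direct_sum ?GV ?R)" "left_module A X"
    for X :: "('a, 'x, 'y) module_scheme"
    using retract_trans[OF that(1) rV'] add_map_retract[OF that(2)]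
    unfolding retract_def by blast
  note aGV = ret[OF retract_summands(1)[OF lGV lR] lGV] and aR = ret[OF retract_summands(2)[OF lGV lR] lR]
  have main: "\<exists>(V1 :: ('k, 'a) small_module) (V0 :: ('k, 'a) small_module) f g.
      in_add A V' V1 \<and> in_add A V' V0 \<and> short_exact A V1 V0 W f g"
    if L: "fg_module A L" and W: "is_nth_syzygy A (n + m) L W" for L W :: "('k, 'a) small_module"
  proof -
    obtain L' :: "('k, 'a) small_module" where L': "is_nth_syzygy A m L L'" "is_nth_syzygy A n L' W"
      using is_nth_syzygy_add[OF W] by blast
    note fL' = is_nth_syzygy_fg[OF L'(1)] and fW = is_nth_syzygy_fg[OF W]
    note lL = fg_module_left[OF L] and lL' = fg_module_left[OF fL'] and lW = fg_module_left[OF fW]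
    let ?FL = "tensor_module A N L" and ?FL' = "tensor_module A N L'"
    have lF: "left_module B ?FL" "left_module B ?FL'"
      using left_module_tensor_module[OF N] lL lL' by auto
    have fF: "fg_module B ?FL"
      by (rule tensor_mod.fg_module_tensor[OF tensor_modI[OF N lL] fN L])
    obtain L0 :: "('k, 'b) small_module" where L0: "fg_module B L0" "module_iso B ?FL L0"
      using fg_module_in_universe[OF B fF] by blast
    obtain Y :: "('k, 'b) small_module" where Y: "is_nth_syzygy B m ?FL Y" "module_iso B Y ?FL'"
      using tensor_nth_syzygy[OF B N rN pN L L'(1)] by blast
    note lY = fg_module_left[OF is_nth_syzygy_fg[OF Y(1)]]
    obtain V1 V0 :: "('k, 'b) small_module" and f g where VV: "in_add B V V1" "in_add B V V0"
      "short_exact B V1 V0 Y f g"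
      using seq L0(1) is_nth_syzygy_iso_base[OF Y(1) L0(2)] by blast
    have l: "left_module B V1" "left_module B V0" using VV(1,2) by (simp_all add: in_add_def fg_module_def)
    let ?G1 = "tensor_module B M V1" and ?G0 = "tensor_module B M V0" and ?GY = "tensor_module B M Y"
    note lT = left_module_tensor_module[OF M]
    note ex = tensor_short_exact[OF M rM l lY VV(3)]
    have a: "mem_add A V' (tensor_module B M X)"
      if "in_add B V X" "left_module B X" for X :: "('k, 'b) small_module"
      by (rule add_map_trans[OF tensor_add_map_id[OF M in_add_add_map[OF that(1) lV] lV that(2)] aGV
        lT[OF that(2)] lT[OF that(2)] lGV])
    have "stable_iso A ?GY W"
      by (rule stable_iso_trans[OF module_iso_stable_iso[OF tensor_iso[OF M lY lF(2) Y(2)] lT[OF lY] lT[OF lF(2)]]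
        st[OF fL' L'(2)] lT[OF lY] lT[OF lF(2)] lW])
    then obtain P :: "('k, 'a) small_module" and H f' g' where
      ex': "short_exact A ((direct_sum ?G0 P)\<lparr>carrier := H\<rparr>) (direct_sum ?G0 P) W f' g'"
      and lP: "left_module A P" and sH: "submodule H A (direct_sum ?G0 P)"
      and aK: "mem_add A V' ((direct_sum ?G0 P)\<lparr>carrier := H\<rparr>)"
      and aQ: "mem_add A V' (direct_sum ?G0 P)"
      by (rule stable_iso_add_resolution[OF A _ lW lT[OF lY] ex lT[OF l(1)] lT[OF l(2)] lV'
        a[OF VV(1) l(1)] a[OF VV(2) l(2)] aR]) (rule that)
    let ?Q = "direct_sum ?G0 P"
    let ?K = "?Q\<lparr>carrier := H\<rparr>"
    have lQ: "left_module A ?Q" by (rule left_module_direct_sum[OF lT[OF l(2)] lP])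
    have lK: "left_module A ?K" by (rule left_module.left_module_submodule[OF lQ sH])
    note fK = add_map_fg_module[OF aK lK V'(1)] and fQ = add_map_fg_module[OF aQ lQ V'(1)]
    obtain K' :: "('k, 'a) small_module" where K': "fg_module A K'" "module_iso A ?K K'"
      using fg_module_in_universe[OF A fK] by blast
    obtain Q' :: "('k, 'a) small_module" where Q': "fg_module A Q'" "module_iso A ?Q Q'"
      using fg_module_in_universe[OF A fQ] by blast
    note lK' = fg_module_left[OF K'(1)] and lQ' = fg_module_left[OF Q'(1)]
    have "\<exists>j \<pi>. short_exact A K' Q' W j \<pi>"
      by (rule short_exact_iso[OF ex' lK lQ lW lK' lQ' lW K'(2) Q'(2) module_iso_refl])
    moreover have "in_add A V' K'"
      by (rule in_addI[OF A V'(1) lK' add_map_id_iso[OF aK K'(2) lK lK']])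
    moreover have "in_add A V' Q'"
      by (rule in_addI[OF A V'(1) lQ' add_map_id_iso[OF aQ Q'(2) lQ lQ']])
    ultimately show ?thesis by blast
  qed
  show ?thesis
    unfolding igusa_todorov_def
  proof (rule exI[of _ V'], rule exI[of _ "n + m"], rule conjI[OF V'(1)], intro allI impI)
    fix L W :: "('k, 'a) small_module"
    assume "fg_module A L \<and> is_nth_syzygy A (n + m) L W"
    then show "\<exists>(V1 :: ('k, 'a) small_module) (V0 :: ('k, 'a) small_module) f g.
        in_add A V' V1 \<and> in_add A V' V0 \<and> short_exact A V1 V0 W f g"
      using main by blast
  qed
qed

theorem proposition5p1:
  fixes K :: "'k ring" and A :: "('k, 'a) module" and B :: "('k, 'b) module"
  assumes "field K" and "fd_algebra K A" and "fd_algebra K B"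
    and "singularly_equivalent_morita_level K A B"
  shows "(syzygy_finite A \<longleftrightarrow> syzygy_finite B) \<and> (igusa_todorov A \<longleftrightarrow> igusa_todorov B)"
proof -
  note A = assms(2) and B = assms(3)
  obtain M :: "('a, 'b, nat \<Rightarrow> 'k) bimodule" and N :: "('b, 'a, nat \<Rightarrow> 'k) bimodule" and n X Y where
    M: "central_bimodule K A B M" and N: "central_bimodule K B A N"
    and pM: "fg_projective A M" "fg_projective (opposite B) (right_part M)"
    and pN: "fg_projective B N" "fg_projective (opposite A) (right_part N)"
    and X: "is_nth_syzygy (enveloping K A) n (enveloping_module (regular_bimodule A)) X"
      "stably_isomorphic (enveloping K A) (enveloping_module (tensor_bimodule B M N)) X"
    and Y: "is_nth_syzygy (enveloping K B) n (enveloping_module (regular_bimodule B)) Y"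
      "stably_isomorphic (enveloping K B) (enveloping_module (tensor_bimodule A N M)) Y"
    using assms(4) unfolding singularly_equivalent_morita_level_def by blast
  note bM = central_bimodule_lr[OF M] and bN = central_bimodule_lr[OF N]
  note rM = fg_projective_add_map[OF pM(2)] and rN = fg_projective_add_map[OF pN(2)]
  \<comment> \<open>The condition on \<open>M \<otimes> N\<close> governs modules over
    \<open>A\<close> and so carries finiteness from \<open>B\<close> to \<open>A\<close>; the one on
    \<open>N \<otimes> M\<close> carries it back.\<close>
  note stA = tensor_tensor_stable_syzygy[OF A B M N X] and stB = tensor_tensor_stable_syzygy[OF B A N M Y]
  show ?thesis
    using syzygy_finite_transfer[OF A B bM bN pM(1) pN(1) rN stA]
      syzygy_finite_transfer[OF B A bN bM pN(1) pM(1) rM stB]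
      igusa_todorov_transfer[OF A B bM bN pM(1) pN(1) rM rN stA]
      igusa_todorov_transfer[OF B A bN bM pN(1) pM(1) rN rM stB]
    by blast
qed

end
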